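(* Let $(x_*(\cdot),u_*(\cdot))$ be a strong local minimum of the finite-horizon state-constrained problem (ES) (see context), where the data satisfy the regularity assumption stated in the context along $x_*(\cdot)$. Then there exist a number $\lambda_0\ge0$, a vector function $p(\cdot):[t_0,t_1]\to\mathbb{R}^n$, vectors $l_0\in\mathbb{R}^{s_0}$, $l_1\in\mathbb{R}^{s_1}$, and nonnegative regular Borel measures $\mu_j$ on $[t_0,t_1]$ of finite total variation, $\mu_j$ concentrated on $$T_j=\{t\in[t_0,t_1]:g_j(t,x_*(t))=0\},\qquad j=1,\dots,l,$$ (all these quantities not vanishing simultaneously) such that: (a) $p(\cdot)$ is of bounded variation, satisfies for $t\in[t_0,t_1]$ $$p(t)=-{h_1'}^T(x_*(t_1))\,l_1+\int_t^{t_1}H_x(s,x_*(s),u_*(s),p(s),\lambda_0)\,ds-\sum_{j=1}^l\int_{[t,t_1]}g_{jx}(s,x_*(s))\,d\mu_j(s),$$ and $p(t_0)={h_0'}^T(x_*(t_0))\,l_0$; (b) for almost every $t\in[t_0,t_1]$ $$H(t,x_*(t),u_*(t),p(t),\lambda_0)=\max_{u\in U}H(t,x_*(t),u,p(t),\lambda_0).$$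
   Context: Problem (ES), on a compact interval $[t_0,t_1]$, $t_0<t_1$: $$J(x(\cdot),u(\cdot))=\int_{t_0}^{t_1}f(t,x(t),u(t))\,dt\to\inf,\quad \dot x(t)=\varphi(t,x(t),u(t)),\quad h_0(x(t_0))=0,\quad h_1(x(t_1))=0,$$ $$u(t)\in U,\qquad g_j(t,x(t))\le0\ \text{ for all }t\in[t_0,t_1],\ j=1,\dots,l,$$ with $\emptyset\ne U\subseteq\mathbb{R}^m$, $f$ real-valued and $\varphi$ $\mathbb{R}^n$-valued functions of $(t,x,u)\in[t_0,t_1]\times\mathbb{R}^n\times\mathbb{R}^m$, $g_j:[t_0,t_1]\times\mathbb{R}^n\to\mathbb{R}$, $h_0:\mathbb{R}^n\to\mathbb{R}^{s_0}$, $h_1:\mathbb{R}^n\to\mathbb{R}^{s_1}$. A process $(x(\cdot),u(\cdot))\in W^1_\infty([t_0,t_1],\mathbb{R}^n)\times L_\infty([t_0,t_1],U)$ ($x$ absolutely continuous with essentially bounded derivative, $u$ essentially bounded, measurable, $U$-valued) is admissible if it satisfies the differential equation (in the sense of Carathéodory), the boundary conditions and the state constraints, and the integral $J$ is finite. An admissible $(x_*(\cdot),u_*(\cdot))$ is a strong local minimum if there is $\varepsilon>0$ with $J(x(\cdot),u(\cdot))\ge J(x_*(\cdot),u_*(\cdot))$ for all admissible $(x(\cdot),u(\cdot))$ with $\|x(\cdot)-x_*(\cdot)\|_\infty\le\varepsilon$. Regularity assumption: for every compact $U_1\subseteq\mathbb{R}^m$ there is $\gamma>0$ such that on $V_\gamma\times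 U_1$, $V_\gamma=\{(t,x)\in[t_0,t_1]\times\mathbb{R}^n:\|x-x_*(t)\|\le\gamma\}$, the maps $f(t,x,u)$, $\varphi(t,x,u)$, $g_j(t,x)$, $h_0(x)$, $h_1(x)$ are uniformly continuous and differentiable in $x$ with uniformly continuous $x$-derivatives. Pontryagin function: $H(t,x,u,p,\lambda_0)=\langle p,\varphi(t,x,u)\rangle-\lambda_0 f(t,x,u)$, with $x$-gradient $H_x$. *)

theory Defs
  imports "HOL-Analysis.Analysis"
begin

section \<open>Function spaces on a compact interval\<close>

text \<open>Functions on the interval are total functions on the reals; their values outside the
  interval are irrelevant in all definitions below. In the next two definitions \<open>d\<close> ranges over the
  finite families of nonoverlapping compact intervals.\<close>

definition absolutely_continuous_on :: "real set \<Rightarrow> (real \<Rightarrow> 'b::real_normed_vector) \<Rightarrow> bool" where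
  "absolutely_continuous_on S x \<longleftrightarrow>
     (\<forall>\<epsilon>>0. \<exists>\<delta>>0. \<forall>d A. d division_of A \<and> A \<subseteq> S \<and> (\<Sum>k\<in>d. Sup k - Inf k) < \<delta> \<longrightarrow>
        (\<Sum>k\<in>d. norm (x (Sup k) - x (Inf k))) < \<epsilon>)"

definition bounded_variation_on :: "real set \<Rightarrow> (real \<Rightarrow> 'b::real_normed_vector) \<Rightarrow> bool" where
  "bounded_variation_on S p \<longleftrightarrow>
     (\<exists>C. \<forall>d A. d division_of A \<and> A \<subseteq> S \<longrightarrow> (\<Sum>k\<in>d. norm (p (Sup k) - p (Inf k))) \<le> C)"

definition W1_inf :: "real \<Rightarrow> real \<Rightarrow> (real \<Rightarrow> 'b::real_normed_vector) \<Rightarrow> bool" where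
  "W1_inf t0 t1 x \<longleftrightarrow>
     absolutely_continuous_on {t0..t1} x \<and>
     (\<exists>C. AE t in lebesgue_on {t0..t1}.
        \<exists>v. (x has_vector_derivative v) (at t within {t0..t1}) \<and> norm v \<le> C)"

text \<open>Elements of \<open>L\<^sub>\<infinity>\<close> are only determined up to null sets, so the condition \<open>u(t) \<in> U\<close> is
  required almost everywhere.\<close>

definition L_inf :: "real \<Rightarrow> real \<Rightarrow> 'b::euclidean_space set \<Rightarrow> (real \<Rightarrow> 'b) \<Rightarrow> bool" where
  "L_inf t0 t1 U u \<longleftrightarrow>
     u \<in> borel_measurable (lebesgue_on {t0..t1}) \<and>
     (AE t in lebesgue_on {t0..t1}. u t \<in> U) \<and>
     (\<exists>C. AE t in lebesgue_on {t0..t1}. norm (u t) \<le> C)"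

section \<open>The optimal control problem\<close>

text \<open>The maps \<open>h\<^sub>0\<close>, \<open>h\<^sub>1\<close> with values in \<open>\<real>\<^sup>s\<close> are given by their components, indexed by \<open>{1..s}\<close>,
  and elements of \<open>\<real>\<^sup>s\<close> by functions on the naturals restricted to \<open>{1..s}\<close>. In this way \<open>s = 0\<close>
  (a free endpoint) is included, which an index type would exclude.\<close>

definition cost ::
  "real \<Rightarrow> real \<Rightarrow> (real \<Rightarrow> real^'n \<Rightarrow> real^'m \<Rightarrow> real) \<Rightarrow>
   (real \<Rightarrow> real^'n) \<Rightarrow> (real \<Rightarrow> real^'m) \<Rightarrow> real" where
  "cost t0 t1 f x u = (LINT t:{t0..t1}|lebesgue. f t (x t) (u t))"

definition admissible ::
  "real \<Rightarrow> real \<Rightarrow> (real \<Rightarrow> real^'n \<Rightarrow> real^'m \<Rightarrow> real) \<Rightarrow>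
   (real \<Rightarrow> real^'n \<Rightarrow> real^'m \<Rightarrow> real^'n) \<Rightarrow>
   nat \<Rightarrow> (nat \<Rightarrow> real^'n \<Rightarrow> real) \<Rightarrow> nat \<Rightarrow> (nat \<Rightarrow> real^'n \<Rightarrow> real) \<Rightarrow>
   (real^'m) set \<Rightarrow> nat \<Rightarrow> (nat \<Rightarrow> real \<Rightarrow> real^'n \<Rightarrow> real) \<Rightarrow>
   (real \<Rightarrow> real^'n) \<Rightarrow> (real \<Rightarrow> real^'m) \<Rightarrow> bool" where
  "admissible t0 t1 f \<phi> s0 h0 s1 h1 U l g x u \<longleftrightarrow>
     W1_inf t0 t1 x \<and> L_inf t0 t1 U u \<and>
     (AE t in lebesgue_on {t0..t1}.
        (x has_vector_derivative \<phi> t (x t) (u t)) (at t within {t0..t1})) \<and>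
     (\<forall>i\<in>{1..s0}. h0 i (x t0) = 0) \<and>
     (\<forall>i\<in>{1..s1}. h1 i (x t1) = 0) \<and>
     (\<forall>j\<in>{1..l}. \<forall>t\<in>{t0..t1}. g j t (x t) \<le> 0) \<and>
     set_integrable lebesgue {t0..t1} (\<lambda>t. f t (x t) (u t))"

definition strong_local_min ::
  "real \<Rightarrow> real \<Rightarrow> (real \<Rightarrow> real^'n \<Rightarrow> real^'m \<Rightarrow> real) \<Rightarrow>
   (real \<Rightarrow> real^'n \<Rightarrow> real^'m \<Rightarrow> real^'n) \<Rightarrow>
   nat \<Rightarrow> (nat \<Rightarrow> real^'n \<Rightarrow> real) \<Rightarrow> nat \<Rightarrow> (nat \<Rightarrow> real^'n \<Rightarrow> real) \<Rightarrow>
   (real^'m) set \<Rightarrow> nat \<Rightarrow> (nat \<Rightarrow> real \<Rightarrow> real^'n \<Rightarrow> real) \<Rightarrow>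
   (real \<Rightarrow> real^'n) \<Rightarrow> (real \<Rightarrow> real^'m) \<Rightarrow> bool" where
  "strong_local_min t0 t1 f \<phi> s0 h0 s1 h1 U l g xs us \<longleftrightarrow>
     admissible t0 t1 f \<phi> s0 h0 s1 h1 U l g xs us \<and>
     (\<exists>\<epsilon>>0. \<forall>x u. admissible t0 t1 f \<phi> s0 h0 s1 h1 U l g x u \<and>
        (\<forall>t\<in>{t0..t1}. norm (x t - xs t) \<le> \<epsilon>) \<longrightarrow> cost t0 t1 f x u \<ge> cost t0 t1 f xs us)"

section \<open>Regularity of the data\<close>

text \<open>\<open>F s x\<close> is uniformly continuous in \<open>(s, x) \<in> S\<close> and differentiable in \<open>x\<close>, with uniformly
  continuous \<open>x\<close>-derivative.\<close>

definition uniformly_C1_on ::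
  "('s::metric_space \<times> 'a::real_normed_vector) set \<Rightarrow> ('s \<Rightarrow> 'a \<Rightarrow> 'b::real_normed_vector) \<Rightarrow> bool" where
  "uniformly_C1_on S F \<longleftrightarrow>
     uniformly_continuous_on S (\<lambda>(s, x). F s x) \<and>
     (\<exists>F' :: 's \<times> 'a \<Rightarrow> 'a \<Rightarrow>\<^sub>L 'b.
        (\<forall>(s, x)\<in>S. (F s has_derivative blinfun_apply (F' (s, x))) (at x)) \<and>
        uniformly_continuous_on S F')"

text \<open>The variables \<open>(t, x, u)\<close> are regrouped as \<open>((t, u), x)\<close>; the set is \<open>V\<^sub>\<gamma> \<times> U\<^sub>1\<close>.\<close>

definition tube ::
  "real \<Rightarrow> real \<Rightarrow> (real \<Rightarrow> real^'n) \<Rightarrow> real \<Rightarrow> (real^'m) set \<Rightarrow> ((real \<times> (real^'m)) \<times> (real^'n)) set" where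
  "tube t0 t1 xs \<gamma> U1 = {((t, u), x) | t u x. t \<in> {t0..t1} \<and> norm (x - xs t) \<le> \<gamma> \<and> u \<in> U1}"

definition regular_data ::
  "real \<Rightarrow> real \<Rightarrow> (real \<Rightarrow> real^'n \<Rightarrow> real^'m \<Rightarrow> real) \<Rightarrow>
   (real \<Rightarrow> real^'n \<Rightarrow> real^'m \<Rightarrow> real^'n) \<Rightarrow>
   nat \<Rightarrow> (nat \<Rightarrow> real^'n \<Rightarrow> real) \<Rightarrow> nat \<Rightarrow> (nat \<Rightarrow> real^'n \<Rightarrow> real) \<Rightarrow>
   nat \<Rightarrow> (nat \<Rightarrow> real \<Rightarrow> real^'n \<Rightarrow> real) \<Rightarrow> (real \<Rightarrow> real^'n) \<Rightarrow> bool" where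
  "regular_data t0 t1 f \<phi> s0 h0 s1 h1 l g xs \<longleftrightarrow>
     (\<forall>U1 :: (real^'m) set. compact U1 \<longrightarrow>
        (\<exists>\<gamma>>0.
           uniformly_C1_on (tube t0 t1 xs \<gamma> U1) (\<lambda>(t, u) x. f t x u) \<and>
           uniformly_C1_on (tube t0 t1 xs \<gamma> U1) (\<lambda>(t, u) x. \<phi> t x u) \<and>
           (\<forall>j\<in>{1..l}. uniformly_C1_on (tube t0 t1 xs \<gamma> U1) (\<lambda>(t, u) x. g j t x)) \<and>
           (\<forall>i\<in>{1..s0}. uniformly_C1_on (tube t0 t1 xs \<gamma> U1) (\<lambda>(t, u) x. h0 i x)) \<and>
           (\<forall>i\<in>{1..s1}. uniformly_C1_on (tube t0 t1 xs \<gamma> U1) (\<lambda>(t, u) x. h1 i x))))"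

section \<open>Multipliers\<close>

definition grad :: "('a::real_inner \<Rightarrow> real) \<Rightarrow> 'a \<Rightarrow> 'a" where
  "grad F x = (THE D. GDERIV F x :> D)"

text \<open>\<open>h'(x)\<^sup>T c\<close>: the rows of the Jacobian matrix \<open>h'(x)\<close> are the gradients of the components.\<close>

definition jacobian_transpose_mult ::
  "nat \<Rightarrow> (nat \<Rightarrow> real^'n \<Rightarrow> real) \<Rightarrow> real^'n \<Rightarrow> (nat \<Rightarrow> real) \<Rightarrow> real^'n" where
  "jacobian_transpose_mult s h x c = (\<Sum>i\<in>{1..s}. c i *\<^sub>R grad (h i) x)"

definition pontryagin ::
  "(real \<Rightarrow> real^'n \<Rightarrow> real^'m \<Rightarrow> real) \<Rightarrow> (real \<Rightarrow> real^'n \<Rightarrow> real^'m \<Rightarrow> real^'n) \<Rightarrow>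
   real \<Rightarrow> real^'n \<Rightarrow> real^'m \<Rightarrow> real^'n \<Rightarrow> real \<Rightarrow> real" where
  "pontryagin f \<phi> t x u p lam0 = p \<bullet> \<phi> t x u - lam0 * f t x u"

definition pontryagin_x ::
  "(real \<Rightarrow> real^'n \<Rightarrow> real^'m \<Rightarrow> real) \<Rightarrow> (real \<Rightarrow> real^'n \<Rightarrow> real^'m \<Rightarrow> real^'n) \<Rightarrow>
   real \<Rightarrow> real^'n \<Rightarrow> real^'m \<Rightarrow> real^'n \<Rightarrow> real \<Rightarrow> real^'n" where
  "pontryagin_x f \<phi> t x u p lam0 = grad (\<lambda>y. pontryagin f \<phi> t y u p lam0) x"

definition finite_regular_borel_measure_on :: "'a::topological_space set \<Rightarrow> 'a measure \<Rightarrow> bool" where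
  "finite_regular_borel_measure_on S \<mu> \<longleftrightarrow>
     sets \<mu> = sets (restrict_space borel S) \<and> finite_measure \<mu> \<and>
     (\<forall>B\<in>sets \<mu>.
        emeasure \<mu> B = (SUP K\<in>{K. compact K \<and> K \<subseteq> B}. emeasure \<mu> K) \<and>
        emeasure \<mu> B = (INF W\<in>{W. openin (top_of_set S) W \<and> B \<subseteq> W}. emeasure \<mu> W))"

end

theory Submission
  imports Defs "HOL-Probability.Helly_Selection"
begin

text \<open>Controls are truncated to a ball and the data are extended by projection to a neighbourhood of the
  optimal trajectory. For \<open>\<epsilon> > 0\<close> the maximum of \<open>J - J\<^sub>* + \<epsilon>\<close>, of the
  endpoint constraints \<open>\<plusminus>h\<close> and of all values \<open>g\<^sub>j(t, x(t))\<close> is positive near the optimal process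
  and equals \<open>\<epsilon>\<close> at that process, so Ekeland's principle, for the distance
  \<open>|\<xi> - \<xi>'| + meas {u \<noteq> u'}\<close>, gives a nearby process that almost minimises it. This
  maximum is smoothed by \<open>ln \<Sum> exp\<close>, whose gradient is a family of weights of total mass \<open>1\<close>: numbers for the
  endpoint constraints and densities for the state constraints. Replacing the control by a constant on many
  short intervals spread over a fixed interval (so that the trajectory hardly moves, while the first variation
  is proportional to the measure of change) yields the maximum condition in integrated form, up to a small error. As the
  error tends to \<open>0\<close> and the ball exhausts the control space, Helly's theorem turns the densities into
  measures, and the adjoint equations pass to the limit outside the atoms.\<close>

section \<open>Bounded measurable functions on an interval\<close>

text \<open>Regularity gives a tube radius and bounds only for controls in a fixed compact set, and
  both may deteriorate as the ball grows. The limit survives because the linearisation is taken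
  along \<open>xs\<close> and the optimal control, not along the perturbed process: the adjoint
  equations for all radii share the coefficient \<open>D\<close>, and the multipliers always have
  total mass 1. The price is an error where the perturbed control differs from the optimal one, a
  set that Ekeland's distance keeps small. The smoothing parameter \<beta> must be chosen after the
  violation at Ekeland's point is known, so a second, approximate minimisation follows; its error
  \<sigma> has to be small even against the length \<open>h\<close> of a single change of control.
  Each such change affects one interval of length at most \<open>h\<close>, and the inequalities of
  consecutive intervals are added, so that the total error does not depend on \<open>h\<close>.
  Finally, the weights of \<open>h \<le> 0\<close> and \<open>- h \<le> 0\<close> could cancel in
  \<open>l0\<close> or \<open>l1\<close> and leave all multipliers zero; one of each pair is shown
  to vanish, because two opposite constraints are never violated by the same process.\<close>

definition bmeas :: "real \<Rightarrow> real \<Rightarrow> (real \<Rightarrow> 'a::euclidean_space) \<Rightarrow> bool" where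
  "bmeas a b f \<longleftrightarrow> f \<in> borel_measurable (lebesgue_on {a..b}) \<and> (\<exists>B. \<forall>t\<in>{a..b}. norm (f t) \<le> B)"

lemma bmeasI:
  "f \<in> borel_measurable (lebesgue_on {a..b}) \<Longrightarrow> (\<And>t. t \<in> {a..b} \<Longrightarrow> norm (f t) \<le> B) \<Longrightarrow> bmeas a b f"
  unfolding bmeas_def by blast

lemma bmeas_measurable: "bmeas a b f \<Longrightarrow> f \<in> borel_measurable (lebesgue_on {a..b})"
  unfolding bmeas_def by blast

lemma bmeas_bound:
  assumes "bmeas a b f"
  obtains B where "B > 0" "\<And>t. t \<in> {a..b} \<Longrightarrow> norm (f t) \<le> B"
proof -
  obtain B where "\<forall>t\<in>{a..b}. norm (f t) \<le> B"
    using assms unfolding bmeas_def by blast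
  then show ?thesis using that[of "max B 1"] by force
qed

lemma bmeas_absolutely_integrable:
  assumes "bmeas a b f" "{c..d} \<subseteq> {a..b}"
  shows "f absolutely_integrable_on {c..d}"
proof -
  obtain B where B: "\<And>t. t \<in> {a..b} \<Longrightarrow> norm (f t) \<le> B"
    using bmeas_bound[OF assms(1)] by metis
  have "f absolutely_integrable_on {a..b}"
    by (rule measurable_bounded_by_integrable_imp_absolutely_integrable[where g = "\<lambda>_. B"])
      (use assms B in \<open>auto simp: bmeas_def\<close>)
  then show ?thesis
    using assms(2) set_integrable_subset by fastforce
qed

lemma bmeas_integrable: "bmeas a b f \<Longrightarrow> {c..d} \<subseteq> {a..b} \<Longrightarrow> f integrable_on {c..d}"
  using bmeas_absolutely_integrable set_lebesgue_integral_eq_integral(1) by blast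

lemma bmeas_subinterval:
  assumes "bmeas a b f" "{c..d} \<subseteq> {a..b}"
  shows "bmeas c d f"
proof -
  have "f \<in> borel_measurable (lebesgue_on {c..d})"
    using bmeas_absolutely_integrable[OF assms] absolutely_integrable_measurable[of "{c..d}" f] by auto
  then show ?thesis
    using assms unfolding bmeas_def by (meson subset_iff)
qed

lemma bmeas_cong: "bmeas a b f \<Longrightarrow> (\<And>t. t \<in> {a..b} \<Longrightarrow> f t = g t) \<Longrightarrow> bmeas a b g"
  unfolding bmeas_def using measurable_cong[of "lebesgue_on {a..b}" f g borel] by auto

lemma bmeas_continuous:
  assumes "continuous_on {a..b} f"
  shows "bmeas a b f"
proof -
  have "f \<in> borel_measurable (lebesgue_on {a..b})"
    using assms by (intro continuous_imp_measurable_on_sets_lebesgue) auto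
  moreover have "bounded (f ` {a..b})"
    using assms by (intro compact_imp_bounded compact_continuous_image) auto
  ultimately show ?thesis
    unfolding bmeas_def bounded_iff by auto
qed

lemma bmeas_const: "bmeas a b (\<lambda>_. c)"
  by (intro bmeas_continuous continuous_intros)

lemma bmeas_compose:
  assumes "bmeas a b f" "continuous_on UNIV h"
  shows "bmeas a b (\<lambda>t. h (f t))"
proof -
  obtain B where B: "\<And>t. t \<in> {a..b} \<Longrightarrow> norm (f t) \<le> B"
    using bmeas_bound[OF assms(1)] by metis
  have "compact (h ` cball 0 B)"
    using assms(2) by (intro compact_continuous_image) (auto intro: continuous_on_subset)
  then obtain C where C: "\<And>x. x \<in> cball 0 B \<Longrightarrow> norm (h x) \<le> C"
    by (meson compact_imp_bounded bounded_iff imageI)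
  show ?thesis
  proof (rule bmeasI)
    show "(\<lambda>t. h (f t)) \<in> borel_measurable (lebesgue_on {a..b})"
      using assms borel_measurable_continuous_onI measurable_compose bmeas_def by blast
    show "norm (h (f t)) \<le> C" if "t \<in> {a..b}" for t
      using C[of "f t"] B[OF that] by simp
  qed
qed

lemma bmeas_pair:
  assumes "bmeas a b f" "bmeas a b g"
  shows "bmeas a b (\<lambda>t. (f t, g t))"
proof -
  obtain B where B: "\<And>t. t \<in> {a..b} \<Longrightarrow> norm (f t) \<le> B"
    using bmeas_bound[OF assms(1)] by metis
  obtain C where C: "\<And>t. t \<in> {a..b} \<Longrightarrow> norm (g t) \<le> C"
    using bmeas_bound[OF assms(2)] by metis
  show ?thesis
  proof (rule bmeasI)
    show "(\<lambda>t. (f t, g t)) \<in> borel_measurable (lebesgue_on {a..b})"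
      using assms by (intro borel_measurable_Pair) (auto simp: bmeas_def)
    show "norm (f t, g t) \<le> B + C" if "t \<in> {a..b}" for t
      using norm_Pair_le[of "f t" "g t"] B[OF that] C[OF that] by linarith
  qed
qed

lemma bmeas_compose2:
  assumes "bmeas a b f" "bmeas a b g" "continuous_on UNIV (\<lambda>(x, y). h x y)"
  shows "bmeas a b (\<lambda>t. h (f t) (g t))"
  using bmeas_compose[OF bmeas_pair[OF assms(1,2)] assms(3)] by simp

lemma bmeas_add: "bmeas a b f \<Longrightarrow> bmeas a b g \<Longrightarrow> bmeas a b (\<lambda>t. f t + g t)"
  by (erule (1) bmeas_compose2) (auto simp: case_prod_unfold intro!: continuous_intros)

lemma bmeas_diff: "bmeas a b f \<Longrightarrow> bmeas a b g \<Longrightarrow> bmeas a b (\<lambda>t. f t - g t)"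
  by (erule (1) bmeas_compose2) (auto simp: case_prod_unfold intro!: continuous_intros)

lemma bmeas_scaleR: "bmeas a b f \<Longrightarrow> bmeas a b g \<Longrightarrow> bmeas a b (\<lambda>t. f t *\<^sub>R g t)"
  by (erule (1) bmeas_compose2) (auto simp: case_prod_unfold intro!: continuous_intros)

lemma bmeas_mult: "bmeas a b f \<Longrightarrow> bmeas a b g \<Longrightarrow> bmeas a b (\<lambda>t. f t * g t :: real)"
  by (erule (1) bmeas_compose2) (auto simp: case_prod_unfold intro!: continuous_intros)

lemma bmeas_inner: "bmeas a b f \<Longrightarrow> bmeas a b g \<Longrightarrow> bmeas a b (\<lambda>t. f t \<bullet> g t)"
  by (erule (1) bmeas_compose2) (auto simp: case_prod_unfold intro!: continuous_intros)

lemma bmeas_norm: "bmeas a b f \<Longrightarrow> bmeas a b (\<lambda>t. norm (f t))"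
  by (erule bmeas_compose) (auto intro!: continuous_intros)

lemma bmeas_uminus: "bmeas a b f \<Longrightarrow> bmeas a b (\<lambda>t. - f t)"
  by (erule bmeas_compose) (auto intro!: continuous_intros)

lemma bmeas_fst: "bmeas a b f \<Longrightarrow> bmeas a b (\<lambda>t. fst (f t))"
  by (erule bmeas_compose) (auto intro!: continuous_intros)

lemma bmeas_snd: "bmeas a b f \<Longrightarrow> bmeas a b (\<lambda>t. snd (f t))"
  by (erule bmeas_compose) (auto intro!: continuous_intros)

lemma bmeas_sum: "(\<And>i. i \<in> I \<Longrightarrow> bmeas a b (f i)) \<Longrightarrow> bmeas a b (\<lambda>t. \<Sum>i\<in>I. f i t)"
  by (induction I rule: infinite_finite_induct) (auto intro: bmeas_const bmeas_add)

lemma bmeas_if: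
  assumes "bmeas a b f" "bmeas a b g" "{t \<in> {a..b}. P t} \<in> sets lebesgue"
  shows "bmeas a b (\<lambda>t. if P t then f t else g t)"
proof -
  obtain B where B: "\<And>t. t \<in> {a..b} \<Longrightarrow> norm (f t) \<le> B"
    using bmeas_bound[OF assms(1)] by metis
  obtain C where C: "\<And>t. t \<in> {a..b} \<Longrightarrow> norm (g t) \<le> C"
    using bmeas_bound[OF assms(2)] by metis
  show ?thesis
  proof (rule bmeasI)
    show "(\<lambda>t. if P t then f t else g t) \<in> borel_measurable (lebesgue_on {a..b})"
    proof (rule measurable_If)
      show "{x \<in> space (lebesgue_on {a..b}). P x} \<in> sets (lebesgue_on {a..b})"
        using assms(3) by (auto simp: sets_restrict_space_iff)
    qed (use assms in \<open>auto simp: bmeas_def\<close>)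
    show "norm (if P t then f t else g t) \<le> max B C" if "t \<in> {a..b}" for t
      using B[OF that] C[OF that] by auto
  qed
qed

lemma bmeas_reflect:
  fixes f :: "real \<Rightarrow> 'a::euclidean_space"
  assumes "bmeas a b f"
  shows "bmeas (-b) (-a) (\<lambda>t. f (- t))"
proof -
  obtain B where B: "\<And>t. t \<in> {a..b} \<Longrightarrow> norm (f t) \<le> B"
    using bmeas_bound[OF assms(1)] by metis
  have "(\<lambda>t. f (- t)) absolutely_integrable_on {-b..-a}"
    using bmeas_absolutely_integrable[OF assms] by simp
  then have "(\<lambda>t. f (- t)) \<in> borel_measurable (lebesgue_on {-b..-a})"
    using absolutely_integrable_measurable[of "{-b..-a}" "\<lambda>t. f (- t)"] by auto
  then show ?thesis
    by (rule bmeasI[where B = B]) (use B in auto)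
qed

lemmas bmeas_intros = bmeas_const bmeas_add bmeas_diff bmeas_scaleR bmeas_mult bmeas_inner bmeas_norm
  bmeas_uminus bmeas_fst bmeas_snd bmeas_sum bmeas_pair

section \<open>Estimates for integrals of bounded measurable functions\<close>

lemma bmeas_integral_le:
  fixes f g :: "real \<Rightarrow> real"
  assumes "bmeas a b f" "bmeas a b g" "{c..d} \<subseteq> {a..b}" "\<And>t. t \<in> {c..d} \<Longrightarrow> f t \<le> g t"
  shows "integral {c..d} f \<le> integral {c..d} g"
  using assms by (intro integral_le bmeas_integrable[of a b]) auto

lemma bmeas_norm_integral_le:
  fixes f :: "real \<Rightarrow> 'a::euclidean_space"
  assumes "bmeas a b f" "bmeas a b g" "{c..d} \<subseteq> {a..b}" "\<And>t. t \<in> {c..d} \<Longrightarrow> norm (f t) \<le> g t"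
  shows "norm (integral {c..d} f) \<le> integral {c..d} g"
  using assms
  by (intro Henstock_Kurzweil_Integration.integral_norm_bound_integral bmeas_integrable[of a b]) auto

lemma bmeas_norm_integral_le_const:
  fixes f :: "real \<Rightarrow> 'a::euclidean_space"
  assumes "bmeas a b f" "{c..d} \<subseteq> {a..b}" "\<And>t. t \<in> {c..d} \<Longrightarrow> norm (f t) \<le> B" "c \<le> d"
  shows "norm (integral {c..d} f) \<le> B * (d - c)"
  using bmeas_norm_integral_le[OF assms(1) bmeas_const[of a b B] assms(2,3)] assms(4)
  by (simp add: mult.commute)

lemma bmeas_integral_combine:
  fixes f :: "real \<Rightarrow> 'a::euclidean_space"
  assumes "bmeas a b f" "a \<le> c" "c \<le> d" "d \<le> e" "e \<le> b"
  shows "integral {c..d} f + integral {d..e} f = integral {c..e} f"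
  by (rule Henstock_Kurzweil_Integration.integral_combine) (use assms in \<open>auto intro: bmeas_integrable\<close>)

lemma bmeas_integral_Lipschitz:
  fixes f :: "real \<Rightarrow> 'a::euclidean_space"
  assumes "bmeas a b f" "\<And>t. t \<in> {a..b} \<Longrightarrow> norm (f t) \<le> B" "s \<in> {a..b}" "t \<in> {a..b}"
  shows "norm (integral {a..t} f - integral {a..s} f) \<le> B * \<bar>t - s\<bar>"
proof -
  have *: "norm (integral {a..t} f - integral {a..s} f) \<le> B * \<bar>t - s\<bar>" if "s \<le> t" "s \<in> {a..b}" "t \<in> {a..b}" for s t
  proof -
    have "integral {a..t} f - integral {a..s} f = integral {s..t} f"
      using bmeas_integral_combine[OF assms(1), of a s t] that by (simp add: algebra_simps)
    then show ?thesis
      using bmeas_norm_integral_le_const[OF assms(1), of s t B] that assms(2) by auto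
  qed
  show ?thesis
    using *[of s t] *[of t s] assms(3,4) by (cases "s \<le> t") (auto simp: norm_minus_commute)
qed

lemma AE_lebesgue_on_iff_negligible:
  assumes "S \<in> sets lebesgue"
  shows "(AE t in lebesgue_on S. P t) \<longleftrightarrow> (\<exists>N. negligible N \<and> (\<forall>t\<in>S - N. P t))"
proof -
  have "(AE t in lebesgue_on S. P t) \<longleftrightarrow> (AE t in lebesgue. t \<in> S \<longrightarrow> P t)"
    using assms by (intro AE_restrict_space_iff) auto
  also have "\<dots> \<longleftrightarrow> (\<exists>N. negligible N \<and> (\<forall>t\<in>S - N. P t))"
  proof
    assume "AE t in lebesgue. t \<in> S \<longrightarrow> P t"
    then obtain N where "\<And>t. t \<in> space lebesgue - N \<Longrightarrow> t \<in> S \<longrightarrow> P t" "N \<in> null_sets lebesgue"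
      using AE_E3 by blast
    then show "\<exists>N. negligible N \<and> (\<forall>t\<in>S - N. P t)"
      by (intro exI[of _ N]) (auto simp: negligible_iff_null_sets)
  next
    assume "\<exists>N. negligible N \<and> (\<forall>t\<in>S - N. P t)"
    then obtain N where "N \<in> null_sets lebesgue" "\<forall>t\<in>S - N. P t"
      by (auto simp: negligible_iff_null_sets)
    then show "AE t in lebesgue. t \<in> S \<longrightarrow> P t"
      by (intro AE_I'[of N]) auto
  qed
  finally show ?thesis .
qed

section \<open>The fundamental theorem of calculus for absolutely continuous functions\<close>

text \<open>A gauge argument. At a tag outside \<open>N\<close>, differentiability makes the
  increment of \<open>x\<close> nearly \<open>v t\<close> times the length of the interval. At a tag
  in \<open>N\<close>, the gauge forces the interval into an open set of measure below \<delta>, and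
  absolute continuity bounds the sum of these increments.\<close>

lemma absolutely_continuous_has_integral:
  fixes x :: "real \<Rightarrow> 'a::euclidean_space"
  assumes ac: "absolutely_continuous_on {a..b} x" and "a \<le> b" and N: "negligible N"
    and d: "\<And>t. t \<in> {a..b} - N \<Longrightarrow> (x has_vector_derivative v t) (at t within {a..b})"
  shows "(v has_integral (x b - x a)) {a..b}"
proof -
  define v' where "v' t = (if t \<in> N then 0 else v t)" for t
  have "(v' has_integral (x b - x a)) {a..b}"
    unfolding has_integral_real
  proof (intro allI impI)
    fix e :: real assume "e > 0"
    \<comment> \<open>The added 1 keeps the quotient meaningful when \<open>a = b\<close>.\<close>
    define e1 where "e1 = e / (2 * (b - a + 1))"
    have e1: "e1 > 0" using \<open>e > 0\<close> \<open>a \<le> b\<close> by (simp add: e1_def)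
    obtain \<delta> where "\<delta> > 0" and \<delta>: "\<And>D A. D division_of A \<Longrightarrow> A \<subseteq> {a..b} \<Longrightarrow> (\<Sum>k\<in>D. Sup k - Inf k) < \<delta> \<Longrightarrow>
        (\<Sum>k\<in>D. norm (x (Sup k) - x (Inf k))) < e / 2"
      using ac\<open>e > 0\<close>
      unfolding absolutely_continuous_on_def by (meson half_gt_zero)
    obtain O' where O': "open O'" "N \<subseteq> O'" "O' \<in> lmeasurable" "measure lebesgue O' < \<delta>"
    proof -
      have "N \<in> sets lebesgue" using N negligible_imp_sets by blast
      then obtain T where T: "open T" "N \<subseteq> T" "T - N \<in> lmeasurable" "emeasure lebesgue (T - N) < ennreal \<delta>"
        using sets_lebesgue_outer_open[of N \<delta>] \<open>\<delta> > 0\<close> by auto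
      have Nl: "N \<in> lmeasurable" "measure lebesgue N = 0"
        using N negligible_imp_measurable negligible_imp_measure0 by auto
      have eq: "T = (T - N) \<union> N" using T by auto
      have "T \<in> lmeasurable" by (subst eq) (intro fmeasurable.Un T Nl)
      moreover have "measure lebesgue T \<le> measure lebesgue (T - N) + measure lebesgue N"
        by (subst eq) (intro measure_Un_le; use T Nl in auto)
      moreover have "measure lebesgue (T - N) < \<delta>"
        using T(3,4) \<open>\<delta> > 0\<close> by (metis emeasure_eq_measure2 ennreal_less_iff measure_nonneg)
      ultimately show ?thesis using that T Nl by auto
    qed
    have "\<exists>r>0. (t \<in> N \<longrightarrow> ball t r \<subseteq> O') \<and> (t \<in> {a..b} - N \<longrightarrow>
       (\<forall>s\<in>{a..b}. norm (s - t) < r \<longrightarrow> norm (x s - x t - (s - t) *\<^sub>R v t) \<le> e1 * norm (s - t)))" for t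
    proof (cases "t \<in> N")
      case True
      then show ?thesis using O' by (meson DiffD2 openE subsetD)
    next
      case False
      show ?thesis
      proof (cases "t \<in> {a..b}")
        case True
        then have "(x has_derivative (\<lambda>h. h *\<^sub>R v t)) (at t within {a..b})"
          using d[of t] False by (simp add: has_vector_derivative_def)
        then show ?thesis
          using e1 False by (auto simp: has_derivative_within_alt)
      qed (use False in \<open>auto intro: exI[of _ 1]\<close>)
    qed
    then obtain r where r: "\<And>t. r t > 0" "\<And>t. t \<in> N \<Longrightarrow> ball t (r t) \<subseteq> O'"
      "\<And>t s. t \<in> {a..b} - N \<Longrightarrow> s \<in> {a..b} \<Longrightarrow> norm (s - t) < r t \<Longrightarrow>
         norm (x s - x t - (s - t) *\<^sub>R v t) \<le> e1 * norm (s - t)"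
      by metis
    define \<gamma> where "\<gamma> t = ball t (r t)" for t
    show "\<exists>\<gamma>. gauge \<gamma> \<and> (\<forall>D. D tagged_division_of {a..b} \<and> \<gamma> fine D \<longrightarrow>
            norm ((\<Sum>(t, k)\<in>D. measure lborel k *\<^sub>R v' t) - (x b - x a)) < e)"
    proof (intro exI conjI allI impI)
      show "gauge \<gamma>" unfolding \<gamma>_def gauge_def using r by auto
      fix D assume "D tagged_division_of {a..b} \<and> \<gamma> fine D"
      then have D: "D tagged_division_of {a..b}" "\<gamma> fine D" by auto
      have fin: "finite D" using D by auto
      define DN where "DN = {p \<in> D. fst p \<in> N}"
      have iv: "\<exists>c d. k = {c..d} \<and> c \<le> d \<and> t \<in> k \<and> k \<subseteq> {a..b}" if "(t, k) \<in> D" for t k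
      proof -
        have "t \<in> k" "k \<subseteq> {a..b}" "\<exists>c d. k = cbox c d"
          using that D tagged_division_ofD(2-4) by blast+
        then show ?thesis by auto
      qed
      have sub: "(\<Sum>(t,k)\<in>D. x (Sup k) - x (Inf k)) = x b - x a"
        using additive_tagged_division_1[OF \<open>a \<le> b\<close>, of D x] D by simp
      have len: "(\<Sum>(t,k)\<in>D. Sup k - Inf k) = b - a"
        using additive_tagged_division_1[OF \<open>a \<le> b\<close>, of D "\<lambda>t. t"] D by simp
      have "norm ((\<Sum>(t, k)\<in>D. measure lborel k *\<^sub>R v' t) - (x b - x a))
          = norm (\<Sum>(t, k)\<in>D. measure lborel k *\<^sub>R v' t - (x (Sup k) - x (Inf k)))"
        unfolding sub[symmetric] by (simp add: sum_subtractf case_prod_unfold)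
      also have "\<dots> \<le> (\<Sum>(t,k)\<in>D. e1 * (Sup k - Inf k) + (if t \<in> N then norm (x (Sup k) - x (Inf k)) else 0))"
        unfolding case_prod_unfold
      proof (rule sum_norm_le)
        fix p assume "p \<in> D"
        obtain t k where p: "p = (t, k)" by force
        obtain c d where k: "k = {c..d}" "c \<le> d" "t \<in> k" "k \<subseteq> {a..b}"
          using iv[of t k] \<open>p \<in> D\<close> p by auto
        have SI: "Sup k = d" "Inf k = c" "measure lborel k = d - c" using k by auto
        have kg: "k \<subseteq> ball t (r t)"
          using D(2) \<open>p \<in> D\<close> p unfolding fine_def \<gamma>_def by auto
        show "norm (measure lborel (snd p) *\<^sub>R v' (fst p) - (x (Sup (snd p)) - x (Inf (snd p))))
          \<le> e1 * (Sup (snd p) - Inf (snd p)) + (if fst p \<in> N then norm (x (Sup (snd p)) - x (Inf (snd p))) else 0)"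
        proof (cases "t \<in> N")
          case True
          then show ?thesis using e1 k SI p by (simp add: v'_def norm_minus_commute)
        next
          case False
          have cd: "c \<in> k" "d \<in> k" using k by auto
          then have "dist t c < r t" "dist t d < r t" using kg by auto
          then have 1: "norm (x c - x t - (c - t) *\<^sub>R v t) \<le> e1 * norm (c - t)"
            "norm (x d - x t - (d - t) *\<^sub>R v t) \<le> e1 * norm (d - t)"
            using r(3)[of t c] r(3)[of t d] False k cd by (auto simp: dist_norm norm_minus_commute)
          have eq: "(d - c) *\<^sub>R v t - (x d - x c) = (x c - x t - (c - t) *\<^sub>R v t) - (x d - x t - (d - t) *\<^sub>R v t)"
            by (simp add: algebra_simps)
          have "norm ((d - c) *\<^sub>R v t - (x d - x c)) \<le> e1 * norm (c - t) + e1 * norm (d - t)"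
            unfolding eq using 1 norm_triangle_ineq4[of "x c - x t - (c - t) *\<^sub>R v t" "x d - x t - (d - t) *\<^sub>R v t"] by linarith
          also have "\<dots> = e1 * (d - c)" using k by (simp add: algebra_simps)
          finally show ?thesis using False SI p by (simp add: v'_def)
        qed
      qed
      also have "\<dots> = e1 * (b - a) + (\<Sum>(t,k)\<in>D. if t \<in> N then norm (x (Sup k) - x (Inf k)) else 0)"
        unfolding len[symmetric] by (simp add: sum.distrib case_prod_unfold sum_distrib_left)
      also have "(\<Sum>(t,k)\<in>D. if t \<in> N then norm (x (Sup k) - x (Inf k)) else 0)
          = (\<Sum>(t,k)\<in>DN. norm (x (Sup k) - x (Inf k)))"
        unfolding DN_def case_prod_unfold using fin by (subst sum.inter_filter) auto
      also have "\<dots> < e / 2"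
      proof -
        have "DN tagged_partial_division_of {a..b}"
          using D(1) tagged_partial_division_subset[of D "{a..b}" DN]
          unfolding DN_def tagged_division_of_def by auto
        then have tp: "DN tagged_division_of \<Union>(snd ` DN)"
          using tagged_partial_division_of_Union_self by blast
        have dv: "(snd ` DN) division_of \<Union>(snd ` DN)"
          using division_of_tagged_division tp by blast
        have ne: "k \<noteq> {}" if "(t, k) \<in> DN" for t k
          using iv[of t k] that unfolding DN_def by auto
        \<comment> \<open>Summing over the intervals instead of the tagged pairs requires the value
          0 on degenerate intervals. \<open>Sup\<close> and \<open>Inf\<close> of the empty set are
          unspecified, so that case is set to 0 by hand.\<close>
        have "(\<Sum>(t,k)\<in>DN. norm (x (Sup k) - x (Inf k)))
            = (\<Sum>(t,k)\<in>DN. if k = {} then 0 else norm (x (Sup k) - x (Inf k)))"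
          using ne by (intro sum.cong) auto
        also have "\<dots> = (\<Sum>k\<in>snd ` DN. if k = {} then 0 else norm (x (Sup k) - x (Inf k)))"
          by (rule sum.over_tagged_division_lemma[OF tp]) (auto simp: box_eq_empty(1) not_less dest: order_antisym)
        also have "\<dots> = (\<Sum>k\<in>snd ` DN. norm (x (Sup k) - x (Inf k)))"
          using ne by (intro sum.cong) auto
        also have "\<dots> < e / 2"
        proof (rule \<delta>[OF dv])
          show "\<Union>(snd ` DN) \<subseteq> {a..b}" using iv unfolding DN_def by fastforce
          have "(\<Sum>k\<in>snd ` DN. Sup k - Inf k) = (\<Sum>k\<in>snd ` DN. measure lebesgue k)"
          proof (rule sum.cong)
            fix k assume "k \<in> snd ` DN"
            then show "Sup k - Inf k = measure lebesgue k" using iv unfolding DN_def by fastforce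
          qed auto
          also have "\<dots> = measure lebesgue (\<Union>(snd ` DN))"
            using content_division[OF dv] by simp
          also have "\<dots> \<le> measure lebesgue O'"
          proof (rule measure_mono_fmeasurable)
            show "\<Union>(snd ` DN) \<subseteq> O'"
            proof safe
              fix s t k assume "(t, k) \<in> DN" "s \<in> snd (t, k)"
              then have "s \<in> ball t (r t)" "t \<in> N"
                using D(2) unfolding fine_def \<gamma>_def DN_def by fastforce+
              then show "s \<in> O'" using r(2) by blast
            qed
          qed (use O' lmeasurable_division[OF dv] in auto)
          finally show "(\<Sum>k\<in>snd ` DN. Sup k - Inf k) < \<delta>" using O' by linarith
        qed
        finally show ?thesis .
      qed
      also have "e1 * (b - a) + e / 2 \<le> e"
        using \<open>e > 0\<close> \<open>a \<le> b\<close> by (simp add: e1_def field_simps)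
      finally show "norm ((\<Sum>(t, k)\<in>D. measure lborel k *\<^sub>R v' t) - (x b - x a)) < e" by simp
    qed
  qed
  then show ?thesis
    by (rule has_integral_spike[OF N, rotated]) (auto simp: v'_def)
qed

lemma Lipschitz_absolutely_continuous_on:
  fixes x :: "real \<Rightarrow> 'a::real_normed_vector"
  assumes "\<And>s t. s \<in> S \<Longrightarrow> t \<in> S \<Longrightarrow> norm (x t - x s) \<le> C * \<bar>t - s\<bar>"
  shows "absolutely_continuous_on S x"
  unfolding absolutely_continuous_on_def
proof (intro allI impI)
  fix e :: real assume "e > 0"
  define \<delta> where "\<delta> = e / (\<bar>C\<bar> + 1)"
  have "\<delta> > 0" using \<open>e > 0\<close> by (simp add: \<delta>_def add_nonneg_pos)
  moreover have "(\<Sum>k\<in>D. norm (x (Sup k) - x (Inf k))) < e"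
    if "D division_of A" "A \<subseteq> S" "(\<Sum>k\<in>D. Sup k - Inf k) < \<delta>" for D A
  proof -
    have iv: "\<exists>c d. k = {c..d} \<and> c \<le> d \<and> k \<subseteq> S" if "k \<in> D" for k
      using division_ofD(2-4)[OF \<open>D division_of A\<close>] that \<open>A \<subseteq> S\<close>
      by (metis atLeastatMost_empty_iff box_real(2) order_trans)
    have "(\<Sum>k\<in>D. norm (x (Sup k) - x (Inf k))) \<le> (\<Sum>k\<in>D. (\<bar>C\<bar> + 1) * (Sup k - Inf k))"
    proof (rule sum_mono)
      fix k assume "k \<in> D"
      then obtain c d where k: "k = {c..d}" "c \<le> d" "k \<subseteq> S" using iv by blast
      then have "norm (x d - x c) \<le> C * \<bar>d - c\<bar>"
        using assms[of c d] by (metis atLeastAtMost_iff order_refl subsetD)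
      also have "\<dots> \<le> (\<bar>C\<bar> + 1) * (d - c)" using k by (intro mult_mono) auto
      finally show "norm (x (Sup k) - x (Inf k)) \<le> (\<bar>C\<bar> + 1) * (Sup k - Inf k)" using k by simp
    qed
    also have "\<dots> < (\<bar>C\<bar> + 1) * \<delta>"
      unfolding sum_distrib_left[symmetric] using that(3) by (intro mult_strict_left_mono) auto
    also have "\<dots> = e" by (simp add: \<delta>_def add_nonneg_pos)
    finally show ?thesis .
  qed
  ultimately show "\<exists>\<delta>>0. \<forall>D A. D division_of A \<and> A \<subseteq> S \<and> (\<Sum>k\<in>D. Sup k - Inf k) < \<delta> \<longrightarrow>
      (\<Sum>k\<in>D. norm (x (Sup k) - x (Inf k))) < e" by blast
qed

lemma integral_has_vector_derivative_AE:
  fixes f :: "real \<Rightarrow> 'a::euclidean_space"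
  assumes f: "bmeas a b f"
  shows "\<exists>N. negligible N \<and> (\<forall>t\<in>{a..b} - N.
           ((\<lambda>s. integral {a..s} f) has_vector_derivative f t) (at t within {a..b}))"
proof -
  define F where "F t = (if t \<in> {a..b} then f t else 0)" for t
  have FU: "F integrable_on UNIV"
    unfolding F_def integrable_restrict_UNIV using bmeas_integrable[OF f] by blast
  have Fi: "F integrable_on cbox c d" for c d
    using integrable_on_subcbox[OF FU] by blast
  have Gi: "(\<lambda>t. F (- t)) integrable_on cbox c d" for c d
    using Fi[of "-d" "-c"] integrable_reflect[where f = F and a = "-d" and b = "-c"] by simp
  obtain N1 where N1: "negligible N1" "\<And>x e. x \<notin> N1 \<Longrightarrow> 0 < e \<Longrightarrow>
      \<exists>d>0. \<forall>h. 0 < h \<and> h < d \<longrightarrow> norm (integral (cbox x (x + h *\<^sub>R One)) F /\<^sub>R h ^ DIM(real) - F x) < e"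
    using integrable_ccontinuous_explicit[of F] Fi by blast
  obtain N2 where N2: "negligible N2" "\<And>x e. x \<notin> N2 \<Longrightarrow> 0 < e \<Longrightarrow>
      \<exists>d>0. \<forall>h. 0 < h \<and> h < d \<longrightarrow> norm (integral (cbox x (x + h *\<^sub>R One)) (\<lambda>t. F (-t)) /\<^sub>R h ^ DIM(real) - F (-x)) < e"
    using integrable_ccontinuous_explicit[of "\<lambda>t. F (-t)"] Gi by blast
  have N: "negligible (N1 \<union> uminus ` N2)"
    using N1 N2 by (intro negligible_Un negligible_differentiable_image_negligible)
      (auto intro!: derivative_intros simp: differentiable_on_def)
  have comb: "integral {a..s} f - integral {a..t} f = integral {t..s} F"
    if "s \<in> {a..b}" "t \<in> {a..b}" "t \<le> s" for s t
  proof -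
    have "integral {t..s} F = integral {t..s} f"
      by (rule Henstock_Kurzweil_Integration.integral_cong) (use that in \<open>auto simp: F_def\<close>)
    then show ?thesis
      using bmeas_integral_combine[OF f, of a t s] that by (simp add: algebra_simps)
  qed
  have "((\<lambda>s. integral {a..s} f) has_vector_derivative f t) (at t within {a..b})"
    if t: "t \<in> {a..b} - (N1 \<union> uminus ` N2)" for t
    unfolding has_vector_derivative_def has_derivative_within_alt
  proof (intro conjI allI impI)
    show "bounded_linear (\<lambda>x. x *\<^sub>R f t)" by (rule bounded_linear_scaleR_left)
    fix e :: real assume "e > 0"
    obtain d1 where d1: "d1 > 0" "\<And>h. 0 < h \<Longrightarrow> h < d1 \<Longrightarrow> norm (integral {t..t+h} F /\<^sub>R h - F t) < e"
      using N1(2)[of t e] t \<open>e > 0\<close> by auto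
    have "- t \<notin> N2" using t by force
    then obtain d2 where d2: "d2 > 0" "\<And>h. 0 < h \<Longrightarrow> h < d2 \<Longrightarrow> norm (integral {-t..-t+h} (\<lambda>t. F (-t)) /\<^sub>R h - F t) < e"
      using N2(2)[of "-t" e] \<open>e > 0\<close> by auto
    have refl: "integral {-t..-t+h} (\<lambda>t. F (-t)) = integral {t-h..t} F" for h
      using Henstock_Kurzweil_Integration.integral_reflect_real[of t "t - h" F] by simp
    have Ft: "F t = f t" using t by (simp add: F_def)
    show "\<exists>d>0. \<forall>s\<in>{a..b}. norm (s - t) < d \<longrightarrow>
       norm (integral {a..s} f - integral {a..t} f - (s - t) *\<^sub>R f t) \<le> e * norm (s - t)"
    proof (intro exI[of _ "min d1 d2"] conjI ballI impI)
      fix s assume s: "s \<in> {a..b}" "norm (s - t) < min d1 d2"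
      consider "s = t" | "t < s" | "s < t" by linarith
      then show "norm (integral {a..s} f - integral {a..t} f - (s - t) *\<^sub>R f t) \<le> e * norm (s - t)"
      proof cases
        case 2
        let ?h = "s - t"
        have "norm (integral {t..s} F /\<^sub>R ?h - F t) < e"
          using d1(2)[of ?h] 2 s by simp
        moreover have "integral {t..s} F - ?h *\<^sub>R f t = ?h *\<^sub>R (integral {t..s} F /\<^sub>R ?h - F t)"
          using 2 by (simp add: Ft scaleR_diff_right)
        ultimately have "norm (integral {t..s} F - ?h *\<^sub>R f t) \<le> ?h * e"
          using 2 by simp
        then show ?thesis using comb[of s t] s t 2 by (simp add: mult.commute)
      next
        case 3
        let ?h = "t - s"
        have "norm (integral {s..t} F /\<^sub>R ?h - F t) < e"
          using d2(2)[of ?h] 3 s refl[of ?h] by simp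
        moreover have "integral {s..t} F - ?h *\<^sub>R f t = ?h *\<^sub>R (integral {s..t} F /\<^sub>R ?h - F t)"
          using 3 by (simp add: Ft scaleR_diff_right)
        ultimately have *: "norm (integral {s..t} F - ?h *\<^sub>R f t) \<le> ?h * e"
          using 3 by simp
        have "integral {a..s} f - integral {a..t} f - (s - t) *\<^sub>R f t = - (integral {s..t} F - ?h *\<^sub>R f t)"
          using comb[of t s] s t 3 by (simp add: algebra_simps)
        then show ?thesis using * 3 by (metis abs_minus_commute abs_of_pos diff_gt_0_iff_gt mult.commute norm_minus_cancel real_norm_def)
      qed auto
    qed (use d1 d2 in auto)
  qed
  then show ?thesis using N by blast
qed

section \<open>Volterra equations\<close>

text \<open>The weight of a Bielecki norm: with exponent 2L its integral up to \<open>t\<close> is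
  below 1/(2L) times its value at \<open>t\<close>, so an integral operator with Lipschitz constant
  \<open>L\<close> halves weighted distances on an interval of any length.\<close>

lemma integral_exp_weight:
  fixes L a t :: real
  assumes "L > 0" "a \<le> t"
  shows "((\<lambda>s. exp (2 * L * (s - a))) has_integral (exp (2 * L * (t - a)) - 1) / (2 * L)) {a..t}"
proof -
  have "((\<lambda>s. exp (2 * L * (s - a))) has_integral
      (exp (2 * L * (t - a)) / (2 * L) - exp (2 * L * (a - a)) / (2 * L))) {a..t}"
    by (rule fundamental_theorem_of_calculus)
      (use assms in \<open>auto intro!: derivative_eq_intros simp: has_real_derivative_iff_has_vector_derivative[symmetric]\<close>)
  then show ?thesis by (simp add: diff_divide_distrib)
qed

text \<open>At the point \<open>m\<close> where \<open>y\<close> divided by the exponential weight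
  is maximal, the integral term is at most half of \<open>y m\<close>; absorbing it on the left
  produces the factor 2.\<close>

lemma gronwall:
  fixes y :: "real \<Rightarrow> real"
  assumes y: "continuous_on {a..b} y" and "L > 0" "c \<ge> 0"
    and le: "\<And>t. t \<in> {a..b} \<Longrightarrow> y t \<le> c + L * integral {a..t} y" and t: "t \<in> {a..b}"
  shows "y t \<le> 2 * c * exp (2 * L * (b - a))"
proof -
  define q where "q s = exp (- (2 * L * (s - a))) * y s" for s
  have "continuous_on {a..b} q" unfolding q_def by (intro continuous_intros y)
  then obtain m where m: "m \<in> {a..b}" "\<And>s. s \<in> {a..b} \<Longrightarrow> q s \<le> q m"
    using continuous_attains_sup[of "{a..b}" q] t by auto
  have ys: "y s = exp (2 * L * (s - a)) * q s" for s
    unfolding q_def by (simp add: exp_minus)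
  show ?thesis
  proof (cases "q m \<le> 0")
    case True
    then have "y t \<le> 0" using m(2)[OF t] unfolding ys[of t] by (simp add: mult_nonneg_nonpos)
    then show ?thesis using \<open>c \<ge> 0\<close> by (smt (verit) exp_ge_zero mult_nonneg_nonneg)
  next
    case False
    have W: "((\<lambda>s. exp (2 * L * (s - a))) has_integral (exp (2 * L * (m - a)) - 1) / (2 * L)) {a..m}"
      using integral_exp_weight[of L a m] \<open>L > 0\<close> m by auto
    have "integral {a..m} y \<le> integral {a..m} (\<lambda>s. q m * exp (2 * L * (s - a)))"
    proof (rule integral_le)
      show "y integrable_on {a..m}"
        using m by (intro integrable_continuous_interval continuous_on_subset[OF y]) auto
      show "(\<lambda>s. q m * exp (2 * L * (s - a))) integrable_on {a..m}"
        by (intro integrable_continuous_interval continuous_intros)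
      show "y s \<le> q m * exp (2 * L * (s - a))" if "s \<in> {a..m}" for s
        unfolding ys[of s] using m(2)[of s] m(1) that by (simp add: mult.commute)
    qed
    also have "\<dots> = q m * ((exp (2 * L * (m - a)) - 1) / (2 * L))"
      using has_integral_mult_right[OF W, of "q m"] by (rule integral_unique)
    also have "\<dots> \<le> q m * (exp (2 * L * (m - a)) / (2 * L))"
      using False \<open>L > 0\<close> by (intro mult_left_mono divide_right_mono) auto
    finally have "y m \<le> c + L * (q m * (exp (2 * L * (m - a)) / (2 * L)))"
      using le[OF m(1)] \<open>L > 0\<close> by (smt (verit) mult_left_mono)
    then have "exp (2 * L * (m - a)) * q m \<le> c + exp (2 * L * (m - a)) * q m / 2"
      using \<open>L > 0\<close> unfolding ys[of m] by (simp add: field_simps)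
    then have "exp (2 * L * (m - a)) * q m \<le> 2 * c" by simp
    moreover have "q m \<le> exp (2 * L * (m - a)) * q m"
      using False \<open>L > 0\<close> m(1) by simp
    ultimately have "q t \<le> 2 * c" using m(2)[OF t] by linarith
    then have "y t \<le> exp (2 * L * (t - a)) * (2 * c)"
      unfolding ys[of t] by simp
    also have "\<dots> \<le> exp (2 * L * (b - a)) * (2 * c)"
      using t \<open>L > 0\<close> \<open>c \<ge> 0\<close> by (intro mult_right_mono) auto
    finally show ?thesis by (simp add: mult.commute)
  qed
qed

lemma gronwall_backward:
  fixes y :: "real \<Rightarrow> real"
  assumes y: "continuous_on {a..b} y" and "L > 0" "c \<ge> 0"
    and le: "\<And>t. t \<in> {a..b} \<Longrightarrow> y t \<le> c + L * integral {t..b} y" and t: "t \<in> {a..b}"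
  shows "y t \<le> 2 * c * exp (2 * L * (b - a))"
proof -
  have "y (- (- t)) \<le> 2 * c * exp (2 * L * ((- a) - (- b)))"
  proof (rule gronwall[where y = "\<lambda>t. y (- t)" and a = "-b" and b = "-a" and L = L])
    show "continuous_on {- b..- a} (\<lambda>t. y (- t))"
      by (rule continuous_on_compose2[OF y]) (auto intro!: continuous_intros)
    show "y (- s) \<le> c + L * integral {- b..s} (\<lambda>t. y (- t))" if "s \<in> {- b..- a}" for s
      using le[of "-s"] that Henstock_Kurzweil_Integration.integral_reflect_real[of b "-s" y] by simp
  qed (use t assms in auto)
  then show ?thesis by simp
qed

text \<open>Banach's fixed point theorem for bounded continuous functions on the line. The unknown
  is the solution divided by the exponential weight \<omega>, which yields the contraction factor
  1/2 without shortening the interval; the clamp \<open>cl\<close> extends functions from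
  \<open>{a..b}\<close> to the line.\<close>

lemma volterra_exists:
  fixes K :: "real \<Rightarrow> 'a::euclidean_space \<Rightarrow> 'a"
  assumes "a \<le> b" "L > 0"
    and meas: "\<And>x. continuous_on {a..b} x \<Longrightarrow> bmeas a b (\<lambda>t. K t (x t))"
    and lip: "\<And>t x y. t \<in> {a..b} \<Longrightarrow> norm (K t x - K t y) \<le> L * norm (x - y)"
  shows "\<exists>x. continuous_on {a..b} x \<and> (\<forall>t\<in>{a..b}. x t = x0 + integral {a..t} (\<lambda>s. K s (x s)))"
proof -
  define cl where "cl t = max a (min b t)" for t
  define \<omega> where "\<omega> t = exp (2 * L * (t - a))" for t
  have cl: "cl t \<in> {a..b}" "t \<in> {a..b} \<Longrightarrow> cl t = t" for t
    using \<open>a \<le> b\<close> by (auto simp: cl_def)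
  have clc: "continuous_on UNIV cl"
    unfolding cl_def by (intro continuous_intros)
  have \<omega>: "\<omega> t > 0" "continuous_on A \<omega>" for t A
    unfolding \<omega>_def by (auto intro!: continuous_intros)
  define T where "T y t = (x0 + integral {a..cl t} (\<lambda>s. K s (\<omega> s *\<^sub>R apply_bcontfun y s))) /\<^sub>R \<omega> (cl t)"
    for y :: "real \<Rightarrow>\<^sub>C 'a" and t
  have Km: "bmeas a b (\<lambda>s. K s (\<omega> s *\<^sub>R apply_bcontfun y s))" for y :: "real \<Rightarrow>\<^sub>C 'a"
    by (intro meas continuous_intros \<omega>) (auto intro!: continuous_on_apply_bcontfun)
  have Tb: "T y \<in> bcontfun" for y :: "real \<Rightarrow>\<^sub>C 'a"
  proof -
    define S where "S t = (x0 + integral {a..t} (\<lambda>s. K s (\<omega> s *\<^sub>R apply_bcontfun y s))) /\<^sub>R \<omega> t" for t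
    have Sc: "continuous_on {a..b} S"
      unfolding S_def
      by (intro continuous_intros \<omega> indefinite_integral_continuous_1 bmeas_integrable[OF Km])
        (use \<omega> in \<open>auto simp: less_imp_neq[symmetric]\<close>)
    have eq: "T y = S \<circ> cl" by (auto simp: T_def S_def)
    have "continuous_on UNIV (T y)"
      unfolding eq using cl by (intro continuous_on_compose clc continuous_on_subset[OF Sc]) auto
    moreover have "bounded (range (T y))"
    proof (rule bounded_subset)
      show "bounded (S ` {a..b})"
        by (intro compact_imp_bounded compact_continuous_image Sc) auto
      show "range (T y) \<subseteq> S ` {a..b}" unfolding eq using cl by auto
    qed
    ultimately show ?thesis by (auto simp: bcontfun_def)
  qed
  have "\<exists>!y. Bcontfun (T y) = y"
  proof (rule banach_fix_type[where c = "1/2"])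
    show "\<forall>x y. dist (Bcontfun (T x)) (Bcontfun (T y)) \<le> 1 / 2 * dist x y"
    proof (intro allI dist_bound)
      fix x y :: "real \<Rightarrow>\<^sub>C 'a" and t
      define s where "s = cl t"
      have s: "s \<in> {a..b}" using cl by (simp add: s_def)
      have W: "((\<lambda>s. exp (2 * L * (s - a))) has_integral (exp (2 * L * (s - a)) - 1) / (2 * L)) {a..s}"
        using integral_exp_weight[of L a s] \<open>L > 0\<close> s by auto
      have sub: "{a..s} \<subseteq> {a..b}" using s by auto
      have "norm (integral {a..s} (\<lambda>r. K r (\<omega> r *\<^sub>R x r)) - integral {a..s} (\<lambda>r. K r (\<omega> r *\<^sub>R y r)))
        = norm (integral {a..s} (\<lambda>r. K r (\<omega> r *\<^sub>R x r) - K r (\<omega> r *\<^sub>R y r)))"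
        using sub by (subst Henstock_Kurzweil_Integration.integral_diff) (auto intro: bmeas_integrable[OF Km])
      also have "\<dots> \<le> integral {a..s} (\<lambda>r. (L * dist x y) * \<omega> r)"
      proof (rule bmeas_norm_integral_le[of a b])
        show "norm (K r (\<omega> r *\<^sub>R x r) - K r (\<omega> r *\<^sub>R y r)) \<le> L * dist x y * \<omega> r" if "r \<in> {a..s}" for r
        proof -
          have "norm (K r (\<omega> r *\<^sub>R x r) - K r (\<omega> r *\<^sub>R y r)) \<le> L * norm (\<omega> r *\<^sub>R x r - \<omega> r *\<^sub>R y r)"
            using lip that s by auto
          also have "\<dots> = L * (\<omega> r * dist (x r) (y r))"
            using \<omega>(1)[of r] by (simp add: dist_norm scaleR_diff_right[symmetric])
          also have "\<dots> \<le> L * (\<omega> r * dist x y)"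
            using \<omega>(1)[of r] \<open>L > 0\<close> dist_bounded[of x r y] by (intro mult_left_mono) auto
          finally show ?thesis by (simp add: mult.commute mult.left_commute)
        qed
      qed (use sub in \<open>auto intro!: bmeas_diff Km bmeas_mult bmeas_const bmeas_continuous[OF \<omega>(2)]\<close>)
      also have "\<dots> = (L * dist x y) * ((\<omega> s - 1) / (2 * L))"
        using integral_unique[OF has_integral_mult_right[OF W, of "L * dist x y"]] by (simp add: \<omega>_def)
      also have "\<dots> \<le> dist x y / 2 * \<omega> s"
        using \<open>L > 0\<close> by (simp add: field_simps)
      finally have *: "norm (integral {a..s} (\<lambda>r. K r (\<omega> r *\<^sub>R x r)) - integral {a..s} (\<lambda>r. K r (\<omega> r *\<^sub>R y r)))
         \<le> dist x y / 2 * \<omega> s" .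
      have "dist (T x t) (T y t) = norm (integral {a..s} (\<lambda>r. K r (\<omega> r *\<^sub>R x r)) - integral {a..s} (\<lambda>r. K r (\<omega> r *\<^sub>R y r))) / \<omega> s"
        unfolding dist_norm T_def s_def[symmetric] scaleR_diff_right[symmetric]
        using \<omega>(1)[of s] by (simp add: divide_inverse)
      also have "\<dots> \<le> dist x y / 2"
        using * \<omega>(1)[of s] by (simp add: pos_divide_le_eq)
      finally show "dist (Bcontfun (T x) t) (Bcontfun (T y) t) \<le> 1 / 2 * dist x y"
        by (simp add: Bcontfun_inverse[OF Tb])
    qed
  qed auto
  then obtain y where y: "Bcontfun (T y) = y" by blast
  have yT: "apply_bcontfun y t = T y t" for t
    using y Bcontfun_inverse[OF Tb] by metis
  define x where "x t = \<omega> t *\<^sub>R apply_bcontfun y t" for t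
  have "continuous_on {a..b} x"
    unfolding x_def by (intro continuous_intros \<omega>) (auto intro!: continuous_on_apply_bcontfun)
  moreover have "x t = x0 + integral {a..t} (\<lambda>s. K s (x s))" if "t \<in> {a..b}" for t
    unfolding x_def yT[of t] using \<omega>(1)[of t] by (simp add: T_def cl(2)[OF that])
  ultimately show ?thesis by blast
qed

lemma volterra_exists_backward:
  fixes K :: "real \<Rightarrow> 'a::euclidean_space \<Rightarrow> 'a"
  assumes "a \<le> b" "L > 0"
    and meas: "\<And>x. continuous_on {a..b} x \<Longrightarrow> bmeas a b (\<lambda>t. K t (x t))"
    and lip: "\<And>t x y. t \<in> {a..b} \<Longrightarrow> norm (K t x - K t y) \<le> L * norm (x - y)"
  shows "\<exists>x. continuous_on {a..b} x \<and> (\<forall>t\<in>{a..b}. x t = x0 + integral {t..b} (\<lambda>s. K s (x s)))"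
proof -
  have "\<exists>x. continuous_on {-b..-a} x \<and> (\<forall>t\<in>{-b..-a}. x t = x0 + integral {-b..t} (\<lambda>s. K (-s) (x s)))"
  proof (rule volterra_exists[where L = L])
    fix x :: "real \<Rightarrow> 'a" assume x: "continuous_on {-b..-a} x"
    have "continuous_on {a..b} (\<lambda>t. x (- t))"
      by (rule continuous_on_compose2[OF x]) (auto intro!: continuous_intros)
    from bmeas_reflect[OF meas[OF this]] show "bmeas (-b) (-a) (\<lambda>t. K (-t) (x t))" by simp
  qed (use assms in auto)
  then obtain x where x: "continuous_on {-b..-a} x"
    "\<And>t. t \<in> {-b..-a} \<Longrightarrow> x t = x0 + integral {-b..t} (\<lambda>s. K (-s) (x s))" by blast
  have "continuous_on {a..b} (\<lambda>t. x (- t))"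
    by (rule continuous_on_compose2[OF x(1)]) (auto intro!: continuous_intros)
  moreover have "x (- t) = x0 + integral {t..b} (\<lambda>s. K s (x (- s)))" if "t \<in> {a..b}" for t
    using x(2)[of "-t"] that Henstock_Kurzweil_Integration.integral_reflect_real[of b t "\<lambda>s. K s (x (- s))"] by simp
  ultimately show ?thesis by (intro exI[of _ "\<lambda>t. x (- t)"]) auto
qed

section \<open>Smoothed maxima\<close>

text \<open>For negative arguments \<open>x = - y\<close> this rests on (1 - y + y^2) (1 + y) = 1 +
  y^3 \<ge> 1 and 1 + y \<le> exp y.\<close>

lemma exp_le_quadratic:
  fixes x :: real
  assumes "\<bar>x\<bar> \<le> 1"
  shows "exp x \<le> 1 + x + x\<^sup>2"
proof (cases "x \<ge> 0")
  case True
  then show ?thesis using assms exp_bound[of x] by simp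
next
  case False
  define y where "y = - x"
  have y: "y > 0" "y \<le> 1" using False assms by (auto simp: y_def)
  have "1 \<le> (1 - y + y\<^sup>2) * (1 + y)"
    using y by (simp add: algebra_simps power2_eq_square)
  also have "\<dots> \<le> (1 - y + y\<^sup>2) * exp y"
    using y by (intro mult_left_mono exp_ge_add_one_self) auto
  finally have "exp (- y) \<le> 1 - y + y\<^sup>2"
    by (simp add: exp_minus field_simps)
  then show ?thesis by (simp add: y_def)
qed

text \<open>The logarithm of \<open>exp_total\<close>, divided by \<open>\<beta>\<close>, is a smooth approximation of the maximum of finitely
  many numbers \<open>y i\<close> and functions \<open>h j\<close>; its gradient consists of weights of total mass \<open>1\<close>.\<close>

definition exp_total :: "'i set \<Rightarrow> nat \<Rightarrow> real \<Rightarrow> real \<Rightarrow> real \<Rightarrow> ('i \<Rightarrow> real) \<Rightarrow> (nat \<Rightarrow> real \<Rightarrow> real) \<Rightarrow> real" where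
  "exp_total I l a b \<beta> y h =
     (\<Sum>i\<in>I. exp (\<beta> * y i)) + (\<Sum>j\<in>{1..l}. integral {a..b} (\<lambda>t. exp (\<beta> * h j t)))"

context
  fixes I :: "'i set" and l :: nat and a b \<beta> :: real and y :: "'i \<Rightarrow> real" and h :: "nat \<Rightarrow> real \<Rightarrow> real"
  assumes I: "finite I" "I \<noteq> {}" and ab: "a < b" and \<beta>: "\<beta> > 0"
    and h: "\<And>j. j \<in> {1..l} \<Longrightarrow> continuous_on {a..b} (h j)"
begin

lemma exp_total_integrable: "j \<in> {1..l} \<Longrightarrow> (\<lambda>t. exp (\<beta> * h j t)) integrable_on {a..b}"
  by (intro integrable_continuous_interval continuous_intros h) auto

lemma exp_total_ge:
  shows exp_total_ge_point: "i \<in> I \<Longrightarrow> exp (\<beta> * y i) \<le> exp_total I l a b \<beta> y h"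
    and exp_total_ge_integral: "j \<in> {1..l} \<Longrightarrow> integral {a..b} (\<lambda>t. exp (\<beta> * h j t)) \<le> exp_total I l a b \<beta> y h"
proof -
  have nn: "0 \<le> integral {a..b} (\<lambda>t. exp (\<beta> * h j t))" if "j \<in> {1..l}" for j
    by (intro integral_nonneg exp_total_integrable that) auto
  show "exp (\<beta> * y i) \<le> exp_total I l a b \<beta> y h" if "i \<in> I"
  proof -
    have "exp (\<beta> * y i) \<le> (\<Sum>i\<in>I. exp (\<beta> * y i))"
      using that I by (intro member_le_sum) auto
    moreover have "0 \<le> (\<Sum>j\<in>{1..l}. integral {a..b} (\<lambda>t. exp (\<beta> * h j t)))"
      by (intro sum_nonneg nn)
    ultimately show ?thesis unfolding exp_total_def by linarith
  qed
  show "integral {a..b} (\<lambda>t. exp (\<beta> * h j t)) \<le> exp_total I l a b \<beta> y h" if "j \<in> {1..l}"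
  proof -
    have "integral {a..b} (\<lambda>t. exp (\<beta> * h j t)) \<le> (\<Sum>j\<in>{1..l}. integral {a..b} (\<lambda>t. exp (\<beta> * h j t)))"
      using that by (intro member_le_sum nn) auto
    moreover have "0 \<le> (\<Sum>i\<in>I. exp (\<beta> * y i))" by (intro sum_nonneg) auto
    ultimately show ?thesis unfolding exp_total_def by linarith
  qed
qed

lemma exp_total_pos: "0 < exp_total I l a b \<beta> y h"
  using I exp_total_ge_point by (metis equals0I exp_gt_zero order_less_le_trans)

text \<open>All terms are at most \<open>exp (\<beta> * M)\<close> times a mass that does not depend
  on \<beta>, so the excess over the maximum decays like 1/\<beta>.\<close>

lemma ln_exp_total_le:
  assumes "\<And>i. i \<in> I \<Longrightarrow> y i \<le> M" "\<And>j t. j \<in> {1..l} \<Longrightarrow> t \<in> {a..b} \<Longrightarrow> h j t \<le> M"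
  shows "ln (exp_total I l a b \<beta> y h) / \<beta> \<le> M + ln (card I + l * (b - a)) / \<beta>"
proof -
  have "exp_total I l a b \<beta> y h \<le> (\<Sum>i\<in>I. exp (\<beta> * M)) + (\<Sum>j\<in>{1..l}. exp (\<beta> * M) * (b - a))"
    unfolding exp_total_def
  proof (intro add_mono sum_mono)
    show "exp (\<beta> * y i) \<le> exp (\<beta> * M)" if "i \<in> I" for i using assms that \<beta> by auto
    fix j assume j: "j \<in> {1..l}"
    have "integral {a..b} (\<lambda>t. exp (\<beta> * h j t)) \<le> integral {a..b} (\<lambda>t. exp (\<beta> * M))"
      using assms(2)[OF j] \<beta> by (intro integral_le exp_total_integrable j) auto
    then show "integral {a..b} (\<lambda>t. exp (\<beta> * h j t)) \<le> exp (\<beta> * M) * (b - a)"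
      using ab by (simp add: mult.commute)
  qed
  also have "\<dots> = exp (\<beta> * M) * (card I + l * (b - a))"
    by (simp add: algebra_simps)
  finally have le: "exp_total I l a b \<beta> y h \<le> exp (\<beta> * M) * (card I + l * (b - a))" .
  have pos: "0 < card I + l * (b - a)"
    using I ab by (simp add: card_gt_0_iff add_pos_nonneg)
  have "ln (exp_total I l a b \<beta> y h) \<le> ln (exp (\<beta> * M) * (card I + l * (b - a)))"
    using le exp_total_pos by (subst ln_le_cancel_iff) (auto intro: order_less_le_trans)
  also have "\<dots> = \<beta> * M + ln (card I + l * (b - a))"
    using pos by (simp add: ln_mult)
  finally show ?thesis using \<beta> by (simp add: field_simps)
qed

lemma ln_exp_total_ge_point:
  assumes "i \<in> I"
  shows "y i \<le> ln (exp_total I l a b \<beta> y h) / \<beta>"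
proof -
  have "\<beta> * y i \<le> ln (exp_total I l a b \<beta> y h)"
    using exp_total_ge_point[OF assms] exp_total_pos by (simp add: ln_ge_iff)
  then show ?thesis using \<beta> by (simp add: field_simps)
qed

text \<open>An integral of exponentials notices a large value only if the value persists on an
  interval; persistence for the length \<delta> costs \<open>ln \<delta> / \<beta>\<close>. This is
  where equicontinuity of the state constraints will be needed.\<close>

lemma ln_exp_total_ge_integral:
  assumes j: "j \<in> {1..l}" and s: "s \<in> {a..b}" and \<delta>: "0 < \<delta>" "\<delta> \<le> (b - a) / 2"
    and close: "\<And>t. t \<in> {a..b} \<Longrightarrow> \<bar>t - s\<bar> \<le> \<delta> \<Longrightarrow> h j t \<ge> m"
  shows "m + ln \<delta> / \<beta> \<le> ln (exp_total I l a b \<beta> y h) / \<beta>"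
proof -
  \<comment> \<open>The interval of length \<delta> lies to the right of \<open>s\<close> or,
    failing that, to the left; \<delta> \<le> (b - a) / 2 leaves room on one side.\<close>
  obtain c where c: "{c..c+\<delta>} \<subseteq> {a..b}" "\<And>t. t \<in> {c..c+\<delta>} \<Longrightarrow> \<bar>t - s\<bar> \<le> \<delta>"
  proof (cases "s + \<delta> \<le> b")
    case True then show ?thesis using that[of s] s by auto
  next
    case False then show ?thesis using that[of "s - \<delta>"] s \<delta> by auto
  qed
  have "exp (\<beta> * m) * \<delta> = integral {c..c+\<delta>} (\<lambda>t. exp (\<beta> * m))"
    using \<delta> by simp
  also have "\<dots> \<le> integral {c..c+\<delta>} (\<lambda>t. exp (\<beta> * h j t))"
    using close c \<beta> by (intro integral_le integrable_subinterval_real[OF exp_total_integrable[OF j]]) auto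
  also have "\<dots> \<le> integral {a..b} (\<lambda>t. exp (\<beta> * h j t))"
    using c by (intro integral_subset_le integrable_subinterval_real[OF exp_total_integrable[OF j]]) auto
  also have "\<dots> \<le> exp_total I l a b \<beta> y h" by (rule exp_total_ge_integral[OF j])
  finally have "ln (exp (\<beta> * m) * \<delta>) \<le> ln (exp_total I l a b \<beta> y h)"
    using \<delta> exp_total_pos by (subst ln_le_cancel_iff) auto
  then have "(\<beta> * m + ln \<delta>) / \<beta> \<le> ln (exp_total I l a b \<beta> y h) / \<beta>"
    using \<delta> \<beta> by (intro divide_right_mono) (simp_all add: ln_mult)
  then show ?thesis using \<beta> by (simp add: add_divide_distrib)
qed

lemma exp_total_weights:
  "(\<Sum>i\<in>I. exp (\<beta> * y i) / exp_total I l a b \<beta> y h)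
    + (\<Sum>j\<in>{1..l}. integral {a..b} (\<lambda>t. exp (\<beta> * h j t) / exp_total I l a b \<beta> y h)) = 1"
proof -
  have "(\<Sum>i\<in>I. exp (\<beta> * y i) / exp_total I l a b \<beta> y h)
    + (\<Sum>j\<in>{1..l}. integral {a..b} (\<lambda>t. exp (\<beta> * h j t) / exp_total I l a b \<beta> y h))
    = exp_total I l a b \<beta> y h / exp_total I l a b \<beta> y h"
    by (subst (2) exp_total_def) (simp add: sum_divide_distrib add_divide_distrib integral_divide)
  then show ?thesis using exp_total_pos by simp
qed

text \<open>First-order expansion from above: ln z \<le> z - 1 for the logarithm and exp x \<le> 1 +
  x + x^2 for the exponentials, whence the remainder \<open>\<beta> * \<rho>\<^sup>2\<close>. Upper
  bounds \<open>dy\<close> and \<open>dh\<close> of the increments suffice because the weights are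
  positive; the result is later compared with a lower bound that comes from minimality.\<close>

lemma ln_exp_total_diff_le:
  assumes h': "\<And>j. j \<in> {1..l} \<Longrightarrow> continuous_on {a..b} (h' j)"
    and y\<rho>: "\<And>i. i \<in> I \<Longrightarrow> \<bar>y' i - y i\<bar> \<le> \<rho>"
    and h\<rho>: "\<And>j t. j \<in> {1..l} \<Longrightarrow> t \<in> {a..b} \<Longrightarrow> \<bar>h' j t - h j t\<bar> \<le> \<rho>"
    and \<rho>: "\<beta> * \<rho> \<le> 1"
    and yd: "\<And>i. i \<in> I \<Longrightarrow> y' i - y i \<le> dy i"
    and hd: "\<And>j t. j \<in> {1..l} \<Longrightarrow> t \<in> {a..b} \<Longrightarrow> h' j t - h j t \<le> dh j t"
    and dh: "\<And>j. j \<in> {1..l} \<Longrightarrow> continuous_on {a..b} (dh j)"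
  shows "ln (exp_total I l a b \<beta> y' h') / \<beta> - ln (exp_total I l a b \<beta> y h) / \<beta>
    \<le> (\<Sum>i\<in>I. exp (\<beta> * y i) / exp_total I l a b \<beta> y h * dy i)
      + (\<Sum>j\<in>{1..l}. integral {a..b} (\<lambda>t. exp (\<beta> * h j t) / exp_total I l a b \<beta> y h * dh j t))
      + \<beta> * \<rho>\<^sup>2"
proof -
  define E where "E = exp_total I l a b \<beta> y h"
  define E' where "E' = exp_total I l a b \<beta> y' h'"
  have E: "E > 0" unfolding E_def by (rule exp_total_pos)
  have step: "exp (\<beta> * v') \<le> exp (\<beta> * v) * (1 + \<beta> * d + \<beta>\<^sup>2 * \<rho>\<^sup>2)" if "\<bar>v' - v\<bar> \<le> \<rho>" "v' - v \<le> d" for v v' d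
  proof -
    have r: "\<bar>\<beta> * (v' - v)\<bar> \<le> \<beta> * \<rho>"
      using that \<beta> by (simp add: abs_mult)
    have "exp (\<beta> * v') = exp (\<beta> * v) * exp (\<beta> * (v' - v))"
      by (simp add: exp_add[symmetric] algebra_simps)
    also have "exp (\<beta> * (v' - v)) \<le> 1 + \<beta> * (v' - v) + (\<beta> * (v' - v))\<^sup>2"
      using r \<rho> by (intro exp_le_quadratic) linarith
    also have "(\<beta> * (v' - v))\<^sup>2 \<le> (\<beta> * \<rho>)\<^sup>2"
      using r by (metis abs_ge_zero abs_le_square_iff abs_of_nonneg order_trans)
    also have "\<beta> * (v' - v) \<le> \<beta> * d" using that \<beta> by simp
    finally show ?thesis by (simp add: power_mult_distrib)
  qed
  have "E' \<le> (\<Sum>i\<in>I. exp (\<beta> * y i) * (1 + \<beta> * dy i + \<beta>\<^sup>2 * \<rho>\<^sup>2))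
     + (\<Sum>j\<in>{1..l}. integral {a..b} (\<lambda>t. exp (\<beta> * h j t) * (1 + \<beta> * dh j t + \<beta>\<^sup>2 * \<rho>\<^sup>2)))"
    unfolding E'_def exp_total_def
  proof (intro add_mono sum_mono)
    show "exp (\<beta> * y' i) \<le> exp (\<beta> * y i) * (1 + \<beta> * dy i + \<beta>\<^sup>2 * \<rho>\<^sup>2)" if "i \<in> I" for i
      using that by (intro step y\<rho> yd)
    fix j assume j: "j \<in> {1..l}"
    show "integral {a..b} (\<lambda>t. exp (\<beta> * h' j t))
        \<le> integral {a..b} (\<lambda>t. exp (\<beta> * h j t) * (1 + \<beta> * dh j t + \<beta>\<^sup>2 * \<rho>\<^sup>2))"
    proof (rule integral_le)
      show "exp (\<beta> * h' j t) \<le> exp (\<beta> * h j t) * (1 + \<beta> * dh j t + \<beta>\<^sup>2 * \<rho>\<^sup>2)" if "t \<in> {a..b}" for t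
        using that j by (intro step h\<rho> hd)
    qed (use j in \<open>auto intro!: integrable_continuous_interval continuous_intros h h' dh\<close>)
  qed
  also have "\<dots> = E * (1 + \<beta>\<^sup>2 * \<rho>\<^sup>2) + \<beta> * ((\<Sum>i\<in>I. exp (\<beta> * y i) * dy i)
      + (\<Sum>j\<in>{1..l}. integral {a..b} (\<lambda>t. exp (\<beta> * h j t) * dh j t)))"
  proof -
    have "integral {a..b} (\<lambda>t. exp (\<beta> * h j t) * (1 + \<beta> * dh j t + \<beta>\<^sup>2 * \<rho>\<^sup>2))
      = integral {a..b} (\<lambda>t. exp (\<beta> * h j t)) * (1 + \<beta>\<^sup>2 * \<rho>\<^sup>2) + \<beta> * integral {a..b} (\<lambda>t. exp (\<beta> * h j t) * dh j t)"
      if j: "j \<in> {1..l}" for j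
    proof -
      have "integral {a..b} (\<lambda>t. exp (\<beta> * h j t) * (1 + \<beta> * dh j t + \<beta>\<^sup>2 * \<rho>\<^sup>2))
        = integral {a..b} (\<lambda>t. exp (\<beta> * h j t) * (1 + \<beta>\<^sup>2 * \<rho>\<^sup>2) + \<beta> * (exp (\<beta> * h j t) * dh j t))"
        by (simp add: algebra_simps)
      also have "\<dots> = integral {a..b} (\<lambda>t. exp (\<beta> * h j t) * (1 + \<beta>\<^sup>2 * \<rho>\<^sup>2)) + integral {a..b} (\<lambda>t. \<beta> * (exp (\<beta> * h j t) * dh j t))"
        using j by (intro Henstock_Kurzweil_Integration.integral_add integrable_continuous_interval continuous_intros h dh)
      finally show ?thesis by simp
    qed
    then show ?thesis
      unfolding E_def exp_total_def
      by (simp add: sum.distrib sum_distrib_left sum_distrib_right algebra_simps)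
  qed
  finally have le: "E' \<le> E * (1 + \<beta>\<^sup>2 * \<rho>\<^sup>2) + \<beta> * ((\<Sum>i\<in>I. exp (\<beta> * y i) * dy i)
      + (\<Sum>j\<in>{1..l}. integral {a..b} (\<lambda>t. exp (\<beta> * h j t) * dh j t)))" .
  define R where "R = (\<Sum>i\<in>I. exp (\<beta> * y i) / E * dy i)
      + (\<Sum>j\<in>{1..l}. integral {a..b} (\<lambda>t. exp (\<beta> * h j t) / E * dh j t))"
  have R: "E * R = (\<Sum>i\<in>I. exp (\<beta> * y i) * dy i) + (\<Sum>j\<in>{1..l}. integral {a..b} (\<lambda>t. exp (\<beta> * h j t) * dh j t))"
  proof -
    have 1: "E * (exp (\<beta> * y i) / E * dy i) = exp (\<beta> * y i) * dy i" for i using E by simp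
    have 2: "E * integral {a..b} (\<lambda>t. exp (\<beta> * h j t) / E * dh j t) = integral {a..b} (\<lambda>t. exp (\<beta> * h j t) * dh j t)" for j
      using E by (subst integral_mult_right[symmetric]) simp
    show ?thesis unfolding R_def distrib_left sum_distrib_left 1 2 ..
  qed
  have E'pos: "E' > 0"
  proof -
    obtain i where "i \<in> I" using I by auto
    have "0 \<le> (\<Sum>j\<in>{1..l}. integral {a..b} (\<lambda>t. exp (\<beta> * h' j t)))"
      by (intro sum_nonneg integral_nonneg integrable_continuous_interval continuous_intros h') auto
    moreover have "0 < (\<Sum>i\<in>I. exp (\<beta> * y' i))" using I by (intro sum_pos) auto
    ultimately show ?thesis unfolding E'_def exp_total_def by linarith
  qed
  have "E' / E \<le> (E * (1 + \<beta>\<^sup>2 * \<rho>\<^sup>2 + \<beta> * R)) / E"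
    using le E unfolding R[symmetric] by (intro divide_right_mono) (auto simp: algebra_simps)
  then have q: "E' / E \<le> 1 + \<beta>\<^sup>2 * \<rho>\<^sup>2 + \<beta> * R" using E by simp
  have "ln E' - ln E = ln (E' / E)" using E E'pos by (simp add: ln_div)
  also have "\<dots> \<le> E' / E - 1" using E E'pos by (intro ln_le_minus_one) auto
  also have "\<dots> \<le> \<beta> * (R + \<beta> * \<rho>\<^sup>2)" using q by (simp add: algebra_simps power2_eq_square)
  finally have "(ln E' - ln E) / \<beta> \<le> R + \<beta> * \<rho>\<^sup>2"
    using \<beta> by (simp add: field_simps)
  then show ?thesis
    unfolding R_def E_def E'_def by (simp add: diff_divide_distrib)
qed

end

section \<open>A weak form of Ekeland's principle\<close>

text \<open>The proof descends geometrically: if no point qualified, the values along a Cauchy sequence would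
  tend to \<open>0\<close>, whereas \<open>F\<close> is positive at its limit.\<close>

lemma ekeland_weak:
  fixes F :: "'x \<Rightarrow> real" and d :: "'x \<Rightarrow> 'x \<Rightarrow> real"
  assumes x0: "x0 \<in> X" "d x0 x0 = 0" and \<kappa>: "\<kappa> > 0" and \<theta>: "0 < \<theta>" "\<theta> < 1"
    and d0: "\<And>x y. d x y \<ge> 0"
    and tri: "\<And>x y z. x \<in> X \<Longrightarrow> y \<in> X \<Longrightarrow> z \<in> X \<Longrightarrow> d x z \<le> d x y + d y z"
    and pos: "\<And>x. x \<in> X \<Longrightarrow> F x > 0"
    and complete: "\<And>s. (\<And>n. s n \<in> X) \<Longrightarrow> summable (\<lambda>n. d (s n) (s (Suc n)))
       \<Longrightarrow> \<exists>y\<in>X. (\<lambda>n. F (s n)) \<longlonglongrightarrow> F y"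
  shows "\<exists>x\<in>X. \<kappa> * d x0 x \<le> F x0 \<and> F x \<le> F x0 \<and> (\<forall>y\<in>X. F y \<ge> (1 - \<theta>) * F x - \<kappa> * d x y)"
proof (rule ccontr)
  assume neg: "\<not> ?thesis"
  \<comment> \<open>The invariant pays for the distance from \<open>x0\<close> by the decrease of
    \<open>F\<close>. A point that violates the last conclusion at \<open>x\<close> inherits it, so
    the descent can continue.\<close>
  define Q where "Q x \<longleftrightarrow> x \<in> X \<and> \<kappa> * d x0 x \<le> F x0 - F x" for x
  have step: "\<exists>y. Q y \<and> F y < (1 - \<theta>) * F x - \<kappa> * d x y" if "Q x" for x
  proof -
    have x: "x \<in> X" "\<kappa> * d x0 x \<le> F x0 - F x" using that by (auto simp: Q_def)
    have "0 \<le> \<kappa> * d x0 x" using \<kappa> d0 by simp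
    then have "\<kappa> * d x0 x \<le> F x0" "F x \<le> F x0" using x pos[OF x(1)] by linarith+
    then obtain y where y: "y \<in> X" "F y < (1 - \<theta>) * F x - \<kappa> * d x y"
      using neg x by (meson not_le)
    have "\<kappa> * d x0 y \<le> \<kappa> * d x0 x + \<kappa> * d x y"
      using tri[OF x0(1) x(1) y(1)] \<kappa> by (simp add: distrib_left[symmetric])
    moreover have "(1 - \<theta>) * F x \<le> F x" using \<theta> pos[OF x(1)] by (simp add: algebra_simps)
    ultimately have "Q y" using x y unfolding Q_def by linarith
    then show ?thesis using y by blast
  qed
  have Q0: "Q x0" using x0 by (simp add: Q_def)
  obtain s where s: "s 0 = x0" "\<And>n. Q (s n) \<and> F (s (Suc n)) < (1 - \<theta>) * F (s n) - \<kappa> * d (s n) (s (Suc n))"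
    using dependent_nat_choice[of "\<lambda>n x. Q x \<and> (n = 0 \<longrightarrow> x = x0)"
        "\<lambda>n x y. F y < (1 - \<theta>) * F x - \<kappa> * d x y"] Q0 step by (metis nat.distinct(1))
  have sX: "s n \<in> X" for n using s(2) by (auto simp: Q_def)
  have geo: "F (s n) \<le> (1 - \<theta>) ^ n * F x0" for n
  proof (induction n)
    case (Suc n)
    have "F (s (Suc n)) \<le> (1 - \<theta>) * F (s n)"
      using s(2)[of n] \<kappa> d0[of "s n" "s (Suc n)"] by (smt (verit) mult_nonneg_nonneg)
    also have "\<dots> \<le> (1 - \<theta>) * ((1 - \<theta>) ^ n * F x0)"
      using Suc \<theta> by (intro mult_left_mono) auto
    finally show ?case by simp
  qed (simp add: s)
  have dle: "d (s n) (s (Suc n)) \<le> F x0 / \<kappa> * (1 - \<theta>) ^ n" for n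
  proof -
    have "\<kappa> * d (s n) (s (Suc n)) \<le> (1 - \<theta>) * F (s n)"
      using s(2)[of n] pos[OF sX[of "Suc n"]] by linarith
    also have "\<dots> \<le> F (s n)" using \<theta> pos[OF sX[of n]] by (simp add: algebra_simps)
    also have "\<dots> \<le> (1 - \<theta>) ^ n * F x0" by (rule geo)
    finally show ?thesis using \<kappa> by (simp add: field_simps)
  qed
  have "summable (\<lambda>n. d (s n) (s (Suc n)))"
    by (rule summable_comparison_test'[where g = "\<lambda>n. F x0 / \<kappa> * (1 - \<theta>) ^ n" and N = 0])
      (use dle d0 \<theta> in \<open>auto intro!: summable_mult summable_geometric\<close>)
  then obtain z where z: "z \<in> X" "(\<lambda>n. F (s n)) \<longlonglongrightarrow> F z"
    using complete[of s] sX by blast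
  have "(\<lambda>n. (1 - \<theta>) ^ n * F x0) \<longlonglongrightarrow> 0 * F x0"
    using \<theta> by (intro tendsto_mult LIMSEQ_realpow_zero tendsto_const) auto
  then have "F z \<le> 0"
    using z(2) geo by (intro LIMSEQ_le[of "\<lambda>n. F (s n)" _ "\<lambda>n. (1 - \<theta>) ^ n * F x0"]) auto
  then show False using pos[OF z(1)] by linarith
qed

section \<open>Controlled trajectories\<close>

lemma norm_fst_le_norm: "norm (fst p) \<le> norm p" and norm_snd_le_norm: "norm (snd p) \<le> norm p"
  using norm_fst_le[of "fst p" "snd p"] norm_snd_le[of "snd p" "fst p"] by auto

text \<open>The first component of \<open>\<Phi>\<close> is the dynamics, the second the running
  cost. \<open>D\<close> stands for the derivative of \<open>\<Phi>\<close> in the state along the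
  reference process; this link is imposed only in \<open>constrained_system\<close>, since
  trajectories and adjoint equations merely use that \<open>D\<close> is linear, bounded and
  measurable. The single constant \<open>B \<ge> 1\<close> serves all bounds.\<close>

locale control_system =
  fixes t0 t1 :: real
    and xs :: "real \<Rightarrow> 'a::euclidean_space" and us :: "real \<Rightarrow> 'u::euclidean_space"
    and V :: "'u set"
    and \<Phi> :: "real \<Rightarrow> 'a \<Rightarrow> 'u \<Rightarrow> 'a \<times> real"
    and D :: "real \<Rightarrow> 'a \<Rightarrow> 'a \<times> real"
    and B :: real
  assumes t01: "t0 < t1" and B: "B \<ge> 1"
    and us_measurable: "us \<in> borel_measurable (lebesgue_on {t0..t1})"
    and us_V: "\<And>t. t \<in> {t0..t1} \<Longrightarrow> us t \<in> V"
    and xs_continuous: "continuous_on {t0..t1} xs"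
    and xs_eq: "\<And>t. t \<in> {t0..t1} \<Longrightarrow> xs t = xs t0 + integral {t0..t} (\<lambda>s. fst (\<Phi> s (xs s) (us s)))"
    and \<Phi>_bound: "\<And>t x u. t \<in> {t0..t1} \<Longrightarrow> u \<in> V \<Longrightarrow> norm (\<Phi> t x u) \<le> B"
    and \<Phi>_Lipschitz: "\<And>t x y u. t \<in> {t0..t1} \<Longrightarrow> u \<in> V \<Longrightarrow> norm (\<Phi> t x u - \<Phi> t y u) \<le> B * norm (x - y)"
    and \<Phi>_measurable: "\<And>x u. continuous_on {t0..t1} x \<Longrightarrow> u \<in> borel_measurable (lebesgue_on {t0..t1}) \<Longrightarrow>
      (\<And>t. t \<in> {t0..t1} \<Longrightarrow> u t \<in> V) \<Longrightarrow> (\<lambda>t. \<Phi> t (x t) (u t)) \<in> borel_measurable (lebesgue_on {t0..t1})"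
    and D_linear: "\<And>t. t \<in> {t0..t1} \<Longrightarrow> linear (D t)"
    and D_bound: "\<And>t v. t \<in> {t0..t1} \<Longrightarrow> norm (D t v) \<le> B * norm v"
    and D_measurable: "\<And>v. (\<lambda>t. D t v) \<in> borel_measurable (lebesgue_on {t0..t1})"
begin

definition control :: "(real \<Rightarrow> 'u) \<Rightarrow> bool" where
  "control u \<longleftrightarrow> u \<in> borel_measurable (lebesgue_on {t0..t1}) \<and> (\<forall>t\<in>{t0..t1}. u t \<in> V)"

definition solution :: "'a \<Rightarrow> (real \<Rightarrow> 'u) \<Rightarrow> (real \<Rightarrow> 'a) \<Rightarrow> bool" where
  "solution \<xi> u x \<longleftrightarrow> continuous_on {t0..t1} x \<and>
     (\<forall>t\<in>{t0..t1}. x t = \<xi> + integral {t0..t} (\<lambda>s. fst (\<Phi> s (x s) (u s))))"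

definition traj :: "'a \<Rightarrow> (real \<Rightarrow> 'u) \<Rightarrow> real \<Rightarrow> 'a" where
  "traj \<xi> u = (SOME x. solution \<xi> u x)"

definition endpoints :: "'a \<Rightarrow> (real \<Rightarrow> 'u) \<Rightarrow> 'a \<times> 'a \<times> real" where
  "endpoints \<xi> u = (\<xi>, traj \<xi> u t1, integral {t0..t1} (\<lambda>s. snd (\<Phi> s (traj \<xi> u s) (u s))))"

definition control_dist :: "(real \<Rightarrow> 'u) \<Rightarrow> (real \<Rightarrow> 'u) \<Rightarrow> real" where
  "control_dist u v = integral {t0..t1} (\<lambda>t. if u t = v t then 0 else 1)"

definition process_dist :: "'a \<times> (real \<Rightarrow> 'u) \<Rightarrow> 'a \<times> (real \<Rightarrow> 'u) \<Rightarrow> real" where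
  "process_dist p q = norm (fst p - fst q) + control_dist (snd p) (snd q)"

text \<open>The transpose of the linear map \<open>D t\<close> in coordinates. At
  \<open>(p, - lam)\<close> it will turn out to be the state gradient of the Pontryagin
  function.\<close>

definition adj :: "real \<Rightarrow> 'a \<times> real \<Rightarrow> 'a" where
  "adj t P = (\<Sum>i\<in>Basis. (D t i \<bullet> P) *\<^sub>R i)"

lemma control_us: "control us"
  using us_measurable us_V by (simp add: control_def)

lemma bmeas_\<Phi>:
  assumes "continuous_on {t0..t1} x" "control u"
  shows "bmeas t0 t1 (\<lambda>t. \<Phi> t (x t) (u t))"
  using assms \<Phi>_measurable[of x u] \<Phi>_bound unfolding control_def by (intro bmeasI[where B = B]) auto

lemma bmeas_D_const: "bmeas t0 t1 (\<lambda>t. D t v)"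
  using D_bound D_measurable by (intro bmeasI[where B = "B * norm v"]) auto

lemma adj_inner: "t \<in> {t0..t1} \<Longrightarrow> adj t P \<bullet> v = D t v \<bullet> P"
proof -
  assume t: "t \<in> {t0..t1}"
  have "D t v = D t (\<Sum>i\<in>Basis. (v \<bullet> i) *\<^sub>R i)" by (simp add: euclidean_representation)
  also have "\<dots> = (\<Sum>i\<in>Basis. (v \<bullet> i) *\<^sub>R D t i)"
    using D_linear[OF t] by (simp add: linear_sum linear_cmul)
  finally show ?thesis
    unfolding adj_def by (simp add: inner_sum_left inner_sum_right inner_commute mult.commute)
qed

lemma adj_bound: "t \<in> {t0..t1} \<Longrightarrow> norm (adj t P) \<le> B * norm P"
proof -
  assume t: "t \<in> {t0..t1}"
  have "norm (adj t P) * norm (adj t P) = D t (adj t P) \<bullet> P"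
    using adj_inner[OF t, of P "adj t P"] by (simp add: dot_square_norm power2_eq_square)
  also have "\<dots> \<le> norm (D t (adj t P)) * norm P" by (rule norm_cauchy_schwarz)
  also have "\<dots> \<le> (B * norm (adj t P)) * norm P" using D_bound[OF t] by (intro mult_right_mono) auto
  finally have "norm (adj t P) * norm (adj t P) \<le> (B * norm P) * norm (adj t P)" by (simp add: ac_simps)
  then show ?thesis using B by (cases "adj t P = 0") auto
qed

lemma adj_diff: "adj t P - adj t Q = adj t (P - Q)"
  unfolding adj_def by (simp add: sum_subtractf[symmetric] scaleR_diff_left[symmetric] inner_diff_right)

lemma bmeas_adj: "bmeas t0 t1 P \<Longrightarrow> bmeas t0 t1 (\<lambda>t. adj t (P t))"
  unfolding adj_def by (intro bmeas_intros bmeas_D_const) auto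

section \<open>Distances between controls and between processes\<close>

lemma control_diff_set:
  assumes "control u" "control v"
  shows "{t \<in> {t0..t1}. u t = v t} \<in> sets lebesgue"
proof -
  have "{t \<in> space (lebesgue_on {t0..t1}). u t = v t} \<in> sets (lebesgue_on {t0..t1})"
    using assms unfolding control_def by (intro measurable_equality_set) auto
  then show ?thesis by (auto simp: sets_restrict_space_iff)
qed

lemma bmeas_control_diff:
  assumes "control u" "control v"
  shows "bmeas t0 t1 (\<lambda>t. if u t = v t then 0 else 1 :: real)"
  using control_diff_set[OF assms] by (intro bmeas_if bmeas_const)

lemma control_dist_nonneg: "control_dist u v \<ge> 0"
  unfolding control_dist_def
  by (cases "(\<lambda>t. if u t = v t then 0 else 1 :: real) integrable_on {t0..t1}")
    (auto intro: integral_nonneg simp: not_integrable_integral)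

lemma control_dist_self [simp]: "control_dist u u = 0"
  by (simp add: control_dist_def)

lemma control_dist_commute: "control_dist u v = control_dist v u"
  unfolding control_dist_def by (rule arg_cong[where f = "integral _"]) auto

lemma control_dist_triangle:
  assumes "control u" "control v" "control w"
  shows "control_dist u w \<le> control_dist u v + control_dist v w"
  unfolding control_dist_def
proof (subst Henstock_Kurzweil_Integration.integral_add[symmetric])
  show "integral {t0..t1} (\<lambda>t. if u t = w t then 0 else 1 :: real)
      \<le> integral {t0..t1} (\<lambda>t. (if u t = v t then 0 else 1) + (if v t = w t then 0 else 1))"
    using assms by (intro bmeas_integral_le[of t0 t1] bmeas_control_diff bmeas_add) auto
qed (use assms in \<open>auto intro: bmeas_integrable[OF bmeas_control_diff]\<close>)

lemma process_dist_nonneg: "process_dist p q \<ge> 0"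
  by (simp add: process_dist_def control_dist_nonneg)

lemma process_dist_self [simp]: "process_dist p p = 0"
  by (simp add: process_dist_def)

lemma process_dist_commute: "process_dist p q = process_dist q p"
  by (simp add: process_dist_def control_dist_commute norm_minus_commute)

lemma process_dist_triangle:
  assumes "control (snd p)" "control (snd q)" "control (snd r)"
  shows "process_dist p r \<le> process_dist p q + process_dist q r"
  using control_dist_triangle[OF assms] norm_triangle_ineq[of "fst p - fst q" "fst q - fst r"]
  by (simp add: process_dist_def)

section \<open>Trajectories and their dependence on the process\<close>

lemma solution_exists:
  assumes "control u"
  shows "\<exists>x. solution \<xi> u x"
  unfolding solution_def
proof (rule volterra_exists[where L = B])
  show "bmeas t0 t1 (\<lambda>t. fst (\<Phi> t (x t) (u t)))" if "continuous_on {t0..t1} x" for x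
    using that assms by (intro bmeas_intros bmeas_\<Phi>)
  show "norm (fst (\<Phi> t x (u t)) - fst (\<Phi> t y (u t))) \<le> B * norm (x - y)" if "t \<in> {t0..t1}" for t x y
    using \<Phi>_Lipschitz[of t "u t" x y] that assms norm_fst_le_norm[of "\<Phi> t x (u t) - \<Phi> t y (u t)"]
    unfolding control_def by auto
qed (use t01 B in auto)

lemma solution_traj: "control u \<Longrightarrow> solution \<xi> u (traj \<xi> u)"
  unfolding traj_def using solution_exists by (rule someI_ex)

lemma solution_start: "solution \<xi> u x \<Longrightarrow> x t0 = \<xi>"
  unfolding solution_def using t01 by auto

lemma solution_continuous: "solution \<xi> u x \<Longrightarrow> continuous_on {t0..t1} x"
  by (simp add: solution_def)

lemma bmeas_solution: "solution \<xi> u x \<Longrightarrow> bmeas t0 t1 x"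
  by (intro bmeas_continuous solution_continuous)

lemma solution_Lipschitz:
  assumes "solution \<xi> u x" "control u" "s \<in> {t0..t1}" "t \<in> {t0..t1}"
  shows "norm (x t - x s) \<le> B * \<bar>t - s\<bar>"
proof -
  have f: "bmeas t0 t1 (\<lambda>t. fst (\<Phi> t (x t) (u t)))"
    using assms by (intro bmeas_intros bmeas_\<Phi> solution_continuous)
  have "norm (integral {t0..t} (\<lambda>s. fst (\<Phi> s (x s) (u s))) - integral {t0..s} (\<lambda>s. fst (\<Phi> s (x s) (u s)))) \<le> B * \<bar>t - s\<bar>"
  proof (rule bmeas_integral_Lipschitz[OF f])
    show "norm (fst (\<Phi> r (x r) (u r))) \<le> B" if "r \<in> {t0..t1}" for r
      using \<Phi>_bound[OF that, of "u r" "x r"] norm_fst_le_norm[of "\<Phi> r (x r) (u r)"] assms(2) that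
      unfolding control_def by force
  qed (use assms in auto)
  then show ?thesis using assms unfolding solution_def by auto
qed

lemma \<Phi>_diff_bound:
  assumes "control u" "control v" "t \<in> {t0..t1}"
  shows "norm (\<Phi> t x (u t) - \<Phi> t y (v t)) \<le> B * norm (x - y) + 2 * B * (if u t = v t then 0 else 1)"
proof (cases "u t = v t")
  case True
  then show ?thesis using \<Phi>_Lipschitz[of t "u t" x y] assms by (auto simp: control_def)
next
  case False
  have "norm (\<Phi> t x (u t)) \<le> B" "norm (\<Phi> t y (v t)) \<le> B"
    using assms \<Phi>_bound by (auto simp: control_def)
  then have "norm (\<Phi> t x (u t) - \<Phi> t y (v t)) \<le> 2 * B"
    using norm_triangle_ineq4[of "\<Phi> t x (u t)" "\<Phi> t y (v t)"] by linarith
  moreover have "0 \<le> B * norm (x - y)" using B by simp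
  ultimately show ?thesis using False by simp
qed

text \<open>Gronwall's factor 2 times the weight \<open>2 * B\<close> that
  \<open>\<Phi>_diff_bound\<close> puts on a change of control, times the exponential.\<close>

definition C1 :: real where "C1 = 4 * B * exp (2 * B * (t1 - t0))"

lemma C1: "C1 \<ge> 1"
proof -
  have "1 \<le> exp (2 * B * (t1 - t0))" using B t01 by simp
  then have "1 * 1 \<le> (4 * B) * exp (2 * B * (t1 - t0))" using B by (intro mult_mono) auto
  then show ?thesis by (simp add: C1_def)
qed

text \<open>Where the controls agree the right-hand side is Lipschitz in the state; where they
  differ it is only bounded, and this enters through the measure of that set. Gronwall's inequality
  does the rest.\<close>

lemma solution_diff:
  assumes x: "solution \<xi> u x" "control u" and y: "solution \<xi>' v y" "control v" and t: "t \<in> {t0..t1}"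
  shows "norm (x t - y t) \<le> C1 * process_dist (\<xi>, u) (\<xi>', v)"
proof -
  have bx: "bmeas t0 t1 (\<lambda>t. \<Phi> t (x t) (u t))" and by': "bmeas t0 t1 (\<lambda>t. \<Phi> t (y t) (v t))"
    using assms by (auto intro!: bmeas_\<Phi> solution_continuous)
  have c: "continuous_on {t0..t1} (\<lambda>t. norm (x t - y t))"
    using x y by (intro continuous_intros solution_continuous)
  define c where "c = norm (\<xi> - \<xi>') + 2 * B * control_dist u v"
  have "norm (x t - y t) \<le> 2 * c * exp (2 * B * (t1 - t0))"
  proof (rule gronwall[OF c])
    fix t assume t: "t \<in> {t0..t1}"
    have sub: "{t0..t} \<subseteq> {t0..t1}" using t by auto
    have "x t - y t = (\<xi> - \<xi>') + (integral {t0..t} (\<lambda>s. fst (\<Phi> s (x s) (u s))) - integral {t0..t} (\<lambda>s. fst (\<Phi> s (y s) (v s))))"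
      using x y t by (auto simp: solution_def)
    also have "integral {t0..t} (\<lambda>s. fst (\<Phi> s (x s) (u s))) - integral {t0..t} (\<lambda>s. fst (\<Phi> s (y s) (v s)))
       = integral {t0..t} (\<lambda>s. fst (\<Phi> s (x s) (u s) - \<Phi> s (y s) (v s)))"
      using bmeas_integrable[OF bmeas_fst[OF bx] sub] bmeas_integrable[OF bmeas_fst[OF by'] sub]
      by (simp add: Henstock_Kurzweil_Integration.integral_diff)
    finally have "norm (x t - y t) \<le> norm (\<xi> - \<xi>') + norm (integral {t0..t} (\<lambda>s. fst (\<Phi> s (x s) (u s) - \<Phi> s (y s) (v s))))"
      by (simp add: norm_triangle_ineq)
    also have "norm (integral {t0..t} (\<lambda>s. fst (\<Phi> s (x s) (u s) - \<Phi> s (y s) (v s))))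
       \<le> integral {t0..t} (\<lambda>s. B * norm (x s - y s) + 2 * B * (if u s = v s then 0 else 1))"
    proof (rule bmeas_norm_integral_le[of t0 t1, OF _ _ sub])
      show "norm (fst (\<Phi> s (x s) (u s) - \<Phi> s (y s) (v s))) \<le> B * norm (x s - y s) + 2 * B * (if u s = v s then 0 else 1)"
        if "s \<in> {t0..t}" for s
        using \<Phi>_diff_bound[OF x(2) y(2), of s "x s" "y s"] that t
          norm_fst_le_norm[of "\<Phi> s (x s) (u s) - \<Phi> s (y s) (v s)"] by auto
    qed (intro bmeas_intros bmeas_control_diff x(2) y(2) bmeas_solution[OF x(1)] bmeas_solution[OF y(1)] bx by')+
    also have "\<dots> = B * integral {t0..t} (\<lambda>s. norm (x s - y s)) + 2 * B * integral {t0..t} (\<lambda>s. if u s = v s then 0 else 1)"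
    proof (subst Henstock_Kurzweil_Integration.integral_add)
      show "(\<lambda>s. B * norm (x s - y s)) integrable_on {t0..t}"
        by (rule bmeas_integrable[OF _ sub]) (intro bmeas_intros bmeas_solution[OF x(1)] bmeas_solution[OF y(1)])
      show "(\<lambda>s. 2 * B * (if u s = v s then 0 else 1)) integrable_on {t0..t}"
        by (rule bmeas_integrable[OF _ sub]) (intro bmeas_intros bmeas_control_diff x(2) y(2))
    qed simp
    also have "integral {t0..t} (\<lambda>s. if u s = v s then 0 else 1) \<le> control_dist u v"
      unfolding control_dist_def
      using sub bmeas_integrable[OF bmeas_control_diff[OF x(2) y(2)]] by (intro integral_subset_le) auto
    finally show "norm (x t - y t) \<le> c + B * integral {t0..t} (\<lambda>s. norm (x s - y s))"
      using B by (simp add: c_def)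
  qed (use B t control_dist_nonneg[of u v] in \<open>auto simp: c_def\<close>)
  also have "\<dots> \<le> 2 * (2 * B * process_dist (\<xi>, u) (\<xi>', v)) * exp (2 * B * (t1 - t0))"
  proof -
    have "1 * norm (\<xi> - \<xi>') \<le> (2 * B) * norm (\<xi> - \<xi>')" using B by (intro mult_right_mono) auto
    then have "c \<le> 2 * B * process_dist (\<xi>, u) (\<xi>', v)"
      unfolding c_def process_dist_def by (simp add: algebra_simps)
    then show ?thesis by (intro mult_right_mono mult_left_mono) auto
  qed
  finally show ?thesis by (simp add: C1_def algebra_simps)
qed

lemma solution_unique:
  assumes "solution \<xi> u x" "control u" "t \<in> {t0..t1}"
  shows "traj \<xi> u t = x t"
  using solution_diff[OF solution_traj[OF assms(2)] assms(2) assms(1,2,3), of \<xi>] by simp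

lemma solution_xs: "solution (xs t0) us xs"
  unfolding solution_def using xs_continuous xs_eq by blast

lemma traj_xs: "t \<in> {t0..t1} \<Longrightarrow> traj (xs t0) us t = xs t"
  by (rule solution_unique[OF solution_xs control_us])

lemma traj_diff:
  assumes "control u" "control v" "t \<in> {t0..t1}"
  shows "norm (traj \<xi> u t - traj \<xi>' v t) \<le> C1 * process_dist (\<xi>, u) (\<xi>', v)"
  using assms by (intro solution_diff solution_traj)

lemma traj_start: "control u \<Longrightarrow> traj \<xi> u t0 = \<xi>"
  by (rule solution_start[OF solution_traj])

lemma bmeas_traj: "control u \<Longrightarrow> bmeas t0 t1 (traj \<xi> u)"
  by (rule bmeas_solution[OF solution_traj])

lemma traj_continuous: "control u \<Longrightarrow> continuous_on {t0..t1} (traj \<xi> u)"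
  by (rule solution_continuous[OF solution_traj])

lemma bmeas_\<Phi>_traj: "control u \<Longrightarrow> bmeas t0 t1 (\<lambda>t. \<Phi> t (traj \<xi> u t) (u t))"
  by (intro bmeas_\<Phi> traj_continuous)

text \<open>The summands belong to the starting point, the final point and the cost integral; the
  cost contributes a Lipschitz part and \<open>2 * B\<close> for the change of control.\<close>

definition C2 :: real where "C2 = 1 + C1 + B * C1 * (t1 - t0) + 2 * B"

lemma C2: "C2 \<ge> 1" "C2 \<ge> C1"
proof -
  have "0 \<le> B * C1 * (t1 - t0)" using B C1 t01 by (intro mult_nonneg_nonneg) auto
  then show "C2 \<ge> 1" "C2 \<ge> C1" using C1 B by (auto simp: C2_def)
qed

lemma endpoints_diff:
  assumes u: "control u" and v: "control v"
  shows "norm (endpoints \<xi> u - endpoints \<xi>' v) \<le> C2 * process_dist (\<xi>, u) (\<xi>', v)"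
proof -
  let ?d = "process_dist (\<xi>, u) (\<xi>', v)"
  let ?J = "\<lambda>\<xi> u. integral {t0..t1} (\<lambda>s. snd (\<Phi> s (traj \<xi> u s) (u s)))"
  have "?J \<xi> u - ?J \<xi>' v = integral {t0..t1} (\<lambda>s. snd (\<Phi> s (traj \<xi> u s) (u s) - \<Phi> s (traj \<xi>' v s) (v s)))"
    using u v by (simp add: Henstock_Kurzweil_Integration.integral_diff bmeas_integrable[OF bmeas_snd[OF bmeas_\<Phi>_traj]])
  then have "norm (?J \<xi> u - ?J \<xi>' v) = norm (integral {t0..t1} (\<lambda>s. snd (\<Phi> s (traj \<xi> u s) (u s) - \<Phi> s (traj \<xi>' v s) (v s))))"
    by (rule arg_cong)
  also have "\<dots> \<le> integral {t0..t1} (\<lambda>s. B * (C1 * ?d) + 2 * B * (if u s = v s then 0 else 1))"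
  proof (rule bmeas_norm_integral_le[of t0 t1])
    fix s assume s: "s \<in> {t0..t1}"
    have "norm (snd (\<Phi> s (traj \<xi> u s) (u s) - \<Phi> s (traj \<xi>' v s) (v s)))
      \<le> norm (\<Phi> s (traj \<xi> u s) (u s) - \<Phi> s (traj \<xi>' v s) (v s))"
      by (rule norm_snd_le_norm)
    also have "\<dots> \<le> B * norm (traj \<xi> u s - traj \<xi>' v s) + 2 * B * (if u s = v s then 0 else 1)"
      by (rule \<Phi>_diff_bound[OF u v s])
    also have "\<dots> \<le> B * (C1 * ?d) + 2 * B * (if u s = v s then 0 else 1)"
      using traj_diff[OF u v s] B by (intro add_right_mono mult_left_mono) auto
    finally show "norm (snd (\<Phi> s (traj \<xi> u s) (u s) - \<Phi> s (traj \<xi>' v s) (v s)))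
      \<le> B * (C1 * ?d) + 2 * B * (if u s = v s then 0 else 1)" .
  qed (intro subset_refl bmeas_intros bmeas_control_diff bmeas_\<Phi>_traj u v)+
  also have "\<dots> = B * (C1 * ?d) * (t1 - t0) + 2 * B * control_dist u v"
    using t01 bmeas_integrable[OF bmeas_control_diff[OF u v]]
    by (subst Henstock_Kurzweil_Integration.integral_add)
      (auto simp: control_dist_def intro!: bmeas_integrable[of t0 t1] bmeas_intros bmeas_control_diff u v)
  also have "\<dots> \<le> (B * C1 * (t1 - t0) + 2 * B) * ?d"
    using B by (simp add: process_dist_def algebra_simps)
  finally have J: "norm (?J \<xi> u - ?J \<xi>' v) \<le> (B * C1 * (t1 - t0) + 2 * B) * ?d" .
  have "norm (endpoints \<xi> u - endpoints \<xi>' v)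
     \<le> norm (\<xi> - \<xi>') + (norm (traj \<xi> u t1 - traj \<xi>' v t1) + norm (?J \<xi> u - ?J \<xi>' v))"
    unfolding endpoints_def diff_Pair by (meson add_left_mono norm_Pair_le order_trans)
  also have "\<dots> \<le> ?d + (C1 * ?d + (B * C1 * (t1 - t0) + 2 * B) * ?d)"
    using J traj_diff[OF u v, of t1] t01 control_dist_nonneg[of u v]
    by (intro add_mono) (auto simp: process_dist_def)
  finally show ?thesis by (simp add: C2_def algebra_simps)
qed

end

lemma bmeas_integrable_lebesgue_on: "bmeas a b f \<Longrightarrow> integrable (lebesgue_on {a..b}) f"
  by (rule absolutely_integrable_imp_integrable[OF bmeas_absolutely_integrable]) auto

lemma bmeas_integral_eq: "bmeas a b f \<Longrightarrow> integral\<^sup>L (lebesgue_on {a..b}) f = integral {a..b} f"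
  by (rule lebesgue_integral_eq_integral[OF bmeas_integrable_lebesgue_on]) auto

lemma bmeas_dominated_convergence:
  fixes f :: "nat \<Rightarrow> real \<Rightarrow> 'a::euclidean_space"
  assumes f: "\<And>k. bmeas a b (f k)" and g: "bmeas a b g"
    and bound: "\<And>k t. t \<in> {a..b} \<Longrightarrow> norm (f k t) \<le> C" and N: "negligible N"
    and lim: "\<And>t. t \<in> {a..b} - N \<Longrightarrow> (\<lambda>k. f k t) \<longlonglongrightarrow> g t"
  shows "(\<lambda>k. integral {a..b} (f k)) \<longlonglongrightarrow> integral {a..b} g"
proof -
  have "(\<lambda>k. integral\<^sup>L (lebesgue_on {a..b}) (f k)) \<longlonglongrightarrow> integral\<^sup>L (lebesgue_on {a..b}) g"
  proof (rule integral_dominated_convergence[where w = "\<lambda>_. C"])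
    show "integrable (lebesgue_on {a..b}) (\<lambda>_. C)"
      by (rule bmeas_integrable_lebesgue_on[OF bmeas_const])
    show "AE t in lebesgue_on {a..b}. (\<lambda>k. f k t) \<longlonglongrightarrow> g t"
      using N lim by (subst AE_lebesgue_on_iff_negligible) auto
    show "AE t in lebesgue_on {a..b}. norm (f k t) \<le> C" for k
      using bound by (intro AE_I2) auto
  qed (use f g in \<open>auto simp: bmeas_def\<close>)
  then show ?thesis by (simp add: bmeas_integral_eq f g)
qed

section \<open>Completeness of the space of controls\<close>

context control_system
begin

lemma control_dist_measure:
  assumes "control u" "control v"
  shows "control_dist u v = measure (lebesgue_on {t0..t1}) {t \<in> {t0..t1}. u t \<noteq> v t}"
proof -
  have eq: "(\<lambda>t. if u t = v t then 0 else 1 :: real) = indicator {t. u t \<noteq> v t}"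
    by (auto simp: indicator_def)
  have "control_dist u v = integral\<^sup>L (lebesgue_on {t0..t1}) (\<lambda>t. if u t = v t then 0 else 1)"
    unfolding control_dist_def using bmeas_integral_eq[OF bmeas_control_diff[OF assms]] by simp
  also have "\<dots> = measure (lebesgue_on {t0..t1}) ({t. u t \<noteq> v t} \<inter> space (lebesgue_on {t0..t1}))"
    unfolding eq by simp
  also have "{t. u t \<noteq> v t} \<inter> space (lebesgue_on {t0..t1}) = {t \<in> {t0..t1}. u t \<noteq> v t}" by auto
  finally show ?thesis .
qed

text \<open>Borel-Cantelli: when the distances are summable, almost every \<open>t\<close> lies in
  only finitely many of the sets where consecutive controls differ, so the sequence is eventually
  constant at \<open>t\<close>. The limit therefore takes values in \<open>V\<close> although
  \<open>V\<close> need not be closed.\<close>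

lemma control_complete:
  assumes s: "\<And>n. control (s n)" and sum: "summable (\<lambda>n. control_dist (s n) (s (Suc n)))"
  shows "\<exists>u. control u \<and> (\<lambda>n. control_dist (s n) u) \<longlonglongrightarrow> 0"
proof -
  let ?M = "lebesgue_on {t0..t1}"
  define A where "A n = {t \<in> {t0..t1}. s n t \<noteq> s (Suc n) t}" for n
  have A: "A n \<in> sets ?M" for n
  proof -
    have "{t \<in> {t0..t1}. s n t = s (Suc n) t} \<in> sets ?M"
      using control_diff_set[OF s s, of n "Suc n"] by (auto simp: sets_restrict_space_iff)
    then have "space ?M - {t \<in> {t0..t1}. s n t = s (Suc n) t} \<in> sets ?M" by (rule sets.compl_sets)
    also have "space ?M - {t \<in> {t0..t1}. s n t = s (Suc n) t} = A n" by (auto simp: A_def)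
    finally show ?thesis .
  qed
  have fin: "finite_measure ?M" by (rule finite_measure_lebesgue_on) auto
  have AE1: "AE t in ?M. eventually (\<lambda>n. t \<in> space ?M - A n) sequentially"
  proof (rule borel_cantelli_AE1[OF A])
    show "emeasure ?M (A n) < \<infinity>" for n
      using finite_measure.emeasure_finite[OF fin] by (simp add: less_top)
    show "summable (\<lambda>n. measure ?M (A n))"
      using sum unfolding A_def by (simp add: control_dist_measure s)
  qed
  define G where "G = {t \<in> space ?M. eventually (\<lambda>n. t \<in> space ?M - A n) sequentially}"
  have G: "G \<in> sets ?M"
    unfolding G_def
  proof (rule sets_Collect_eventually_sequentially)
    have "{t \<in> space ?M. t \<in> space ?M - A n} = space ?M - A n" for n by auto
    then show "{t \<in> space ?M. t \<in> space ?M - A n} \<in> sets ?M" for n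
      using sets.compl_sets[OF A[of n]] by metis
  qed
  define u where "u t = (if t \<in> G then lim (\<lambda>n. s n t) else us t)" for t
  have ev: "\<exists>n. \<forall>m\<ge>n. s m t = u t" if t: "t \<in> G" for t
  proof -
    obtain n where n: "\<And>m. m \<ge> n \<Longrightarrow> t \<in> {t0..t1} - A m"
      using t unfolding G_def eventually_sequentially by auto
    have const: "s m t = s n t" if "m \<ge> n" for m
      using that
    proof (induction m rule: dec_induct)
      case (step m)
      then show ?case using n[of m] by (auto simp: A_def)
    qed auto
    have "(\<lambda>m. s m t) \<longlonglongrightarrow> s n t"
      by (rule tendsto_eventually, rule eventually_sequentiallyI[of n], rule const)
    then have "u t = s n t" using t by (simp add: u_def limI)
    then show ?thesis using const by metis
  qed
  \<comment> \<open>Off \<open>G\<close> the sequence is frozen at \<open>us\<close>, so that it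
    converges at every point and the limit is measurable.\<close>
  define v where "v n t = (if t \<in> G then s n t else us t)" for n t
  have vlim: "(\<lambda>n. v n t) \<longlonglongrightarrow> u t" for t
  proof (cases "t \<in> G")
    case True
    then show ?thesis using ev[OF True]
      by (intro tendsto_eventually) (auto simp: v_def eventually_sequentially)
  qed (simp add: v_def u_def)
  have "u \<in> borel_measurable ?M"
  proof (rule borel_measurable_LIMSEQ_metric)
    show "v n \<in> borel_measurable ?M" for n
      unfolding v_def
    proof (rule measurable_If)
      have "{t \<in> space ?M. t \<in> G} = G" by (auto simp: G_def)
      then show "{t \<in> space ?M. t \<in> G} \<in> sets ?M" using G by simp
    qed (use s control_us in \<open>auto simp: control_def\<close>)
  qed (rule vlim)
  moreover have "u t \<in> V" if "t \<in> {t0..t1}" for t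
  proof (cases "t \<in> G")
    case True
    then obtain n where "s n t = u t" using ev by blast
    then show ?thesis using s[of n] that unfolding control_def by metis
  qed (use us_V that in \<open>simp add: u_def\<close>)
  ultimately have u: "control u" by (simp add: control_def)
  obtain N where N: "negligible N" "\<And>t. t \<in> {t0..t1} - N \<Longrightarrow> t \<in> G"
    using AE1 unfolding G_def by (subst (asm) AE_lebesgue_on_iff_negligible) auto
  have "(\<lambda>n. control_dist (s n) u) \<longlonglongrightarrow> integral {t0..t1} (\<lambda>t. 0 :: real)"
    unfolding control_dist_def
  proof (rule bmeas_dominated_convergence[where C = 1, OF _ _ _ N(1)])
    show "(\<lambda>k. if s k t = u t then 0 else 1 :: real) \<longlonglongrightarrow> 0" if "t \<in> {t0..t1} - N" for t
      using ev[OF N(2)[OF that]] by (intro tendsto_eventually) (auto simp: eventually_sequentially)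
  qed (use s u in \<open>auto intro: bmeas_control_diff bmeas_const\<close>)
  then show ?thesis using u by auto
qed

section \<open>Replacing the control on one interval\<close>

lemma control_needle:
  assumes u: "control u" and w: "w \<in> V"
  shows "control (\<lambda>t. if t \<in> {c..<d} then w else u t)"
proof -
  have "(\<lambda>t. if t \<in> {c..<d} then w else u t) \<in> borel_measurable (lebesgue_on {t0..t1})"
  proof (rule measurable_If)
    show "{x \<in> space (lebesgue_on {t0..t1}). x \<in> {c..<d}} \<in> sets (lebesgue_on {t0..t1})"
    proof -
      have eq: "{x \<in> space (lebesgue_on {t0..t1}). x \<in> {c..<d}} = {t0..t1} \<inter> {c..<d}" by auto
      show ?thesis unfolding eq by (intro sets_restrict_space_iff[THEN iffD2]) auto
    qed
  qed (use u in \<open>auto simp: control_def\<close>)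
  then show ?thesis using u w by (auto simp: control_def)
qed

lemma control_dist_needle:
  assumes u: "control u" and w: "w \<in> V" and cd: "t0 \<le> c" "c \<le> d" "d \<le> t1"
  shows "control_dist u (\<lambda>t. if t \<in> {c..<d} then w else u t) \<le> d - c"
proof -
  have "((\<lambda>t. if t \<in> {c..d} then 1 else 0 :: real) has_integral (d - c)) {t0..t1}"
    using has_integral_const_real[of "1::real" c d] cd by (subst has_integral_restrict) auto
  then have i: "integral {t0..t1} (\<lambda>t. if t \<in> {c..d} then 1 else 0 :: real) = d - c"
    "(\<lambda>t. if t \<in> {c..d} then 1 else 0 :: real) integrable_on {t0..t1}"
    by (auto simp: integral_unique integrable_on_def)
  show ?thesis
    unfolding control_dist_def i(1)[symmetric]
    using bmeas_integrable[OF bmeas_control_diff[OF u control_needle[OF u w]]]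
    by (intro integral_le i(2)) auto
qed

text \<open>The adjoint function \<open>p\<close> may jump with the tail \<open>M\<close> of the
  state multipliers. The unknown \<open>q = p + M\<close> is continuous, as the fixed point argument
  requires.\<close>

lemma adjoint_exists:
  assumes M: "bmeas t0 t1 M"
  shows "\<exists>q. continuous_on {t0..t1} q \<and> (\<forall>t\<in>{t0..t1}.
     q t = q1 + integral {t..t1} (\<lambda>s. adj s (q s - M s, - lam)))"
proof (rule volterra_exists_backward[where L = B])
  show "bmeas t0 t1 (\<lambda>t. adj t (x t - M t, - lam))" if "continuous_on {t0..t1} x" for x
    by (intro bmeas_adj bmeas_intros bmeas_continuous that M)
  show "norm (adj t (x - M t, - lam) - adj t (y - M t, - lam)) \<le> B * norm (x - y)" if "t \<in> {t0..t1}" for t x y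
    using adj_bound[OF that, of "(x - y, 0)"] by (simp add: adj_diff norm_Pair)
qed (use t01 B in auto)

lemma D_representation: "t \<in> {t0..t1} \<Longrightarrow> (\<Sum>i\<in>Basis. (v \<bullet> i) *\<^sub>R D t i) = D t v"
proof -
  assume t: "t \<in> {t0..t1}"
  have "D t v = D t (\<Sum>i\<in>Basis. (v \<bullet> i) *\<^sub>R i)" by (simp add: euclidean_representation)
  also have "\<dots> = (\<Sum>i\<in>Basis. (v \<bullet> i) *\<^sub>R D t i)"
    using D_linear[OF t] by (simp add: linear_sum linear_cmul)
  finally show ?thesis ..
qed

lemma bmeas_D:
  assumes "bmeas t0 t1 z"
  shows "bmeas t0 t1 (\<lambda>s. D s (z s))"
proof (rule bmeas_cong)
  show "bmeas t0 t1 (\<lambda>s. \<Sum>i\<in>Basis. (z s \<bullet> i) *\<^sub>R D s i)"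
    by (intro bmeas_intros assms bmeas_D_const)
qed (rule D_representation)

text \<open>Integration by parts. The adjoint equation cancels the linear part
  \<open>D s (x s - y s)\<close>, so the effect of two different processes on endpoints, cost and
  state constraints reduces to the starting points and an integral of the increment of
  \<open>\<Phi>\<close> minus its linearisation. The identity is exact; no smallness enters.\<close>

lemma duality:
  fixes p m :: "real \<Rightarrow> 'a" and \<xi> \<xi>' q1 :: 'a and lam :: real
  assumes u: "control u" and v: "control v" and m: "bmeas t0 t1 m"
    and p: "\<And>t. t \<in> {t0..t1} \<Longrightarrow> p t = - q1 + integral {t..t1} (\<lambda>s. adj s (p s, - lam)) - integral {t..t1} m"
    and pc: "bmeas t0 t1 p"
  defines "x \<equiv> traj \<xi> u" and "y \<equiv> traj \<xi>' v"
  defines "\<Delta> \<equiv> \<lambda>s. \<Phi> s (x s) (u s) - \<Phi> s (y s) (v s)"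
  shows "q1 \<bullet> (x t1 - y t1) + lam * integral {t0..t1} (\<lambda>s. snd (\<Delta> s)) + integral {t0..t1} (\<lambda>s. m s \<bullet> (x s - y s))
    = - (p t0 \<bullet> (\<xi> - \<xi>')) - integral {t0..t1} (\<lambda>s. (p s, - lam) \<bullet> (\<Delta> s - D s (x s - y s)))"
proof -
  have \<Delta>: "bmeas t0 t1 \<Delta>"
    unfolding \<Delta>_def x_def y_def by (intro bmeas_diff bmeas_\<Phi>_traj u v)
  have xy: "bmeas t0 t1 x" "bmeas t0 t1 y"
    unfolding x_def y_def by (intro bmeas_traj u v)+
  define k where "k s = adj s (p s, - lam) - m s" for s
  have k: "bmeas t0 t1 k" unfolding k_def by (intro bmeas_intros bmeas_adj pc m)
  have pk: "p t = p t0 - integral {t0..t} k" if t: "t \<in> {t0..t1}" for t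
  proof -
    have *: "p r = - q1 + integral {r..t1} k" if "r \<in> {t0..t1}" for r
      unfolding k_def using p[OF that] that
      by (subst Henstock_Kurzweil_Integration.integral_diff)
        (auto intro!: bmeas_integrable[of t0 t1] bmeas_adj bmeas_intros pc m)
    have "p t0 = - q1 + (integral {t0..t} k + integral {t..t1} k)"
      using *[of t0] bmeas_integral_combine[OF k, of t0 t t1] t t01 by simp
    then show ?thesis using *[OF t] by simp
  qed
  \<comment> \<open>The first component is \<open>x t - y t\<close> (see \<open>fstZ\<close>), the
    second accumulates the difference of the costs.\<close>
  define Z where "Z t = (\<xi> - \<xi>', 0) + integral {t0..t} \<Delta>" for t
  have fstZ: "fst (Z t) = x t - y t" if t: "t \<in> {t0..t1}" for t
  proof -
    have sub: "{t0..t} \<subseteq> {t0..t1}" using t by auto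
    have "fst (integral {t0..t} \<Delta>) = integral {t0..t} (\<lambda>s. fst (\<Delta> s))"
      using integral_linear[OF bmeas_integrable[OF \<Delta> sub] bounded_linear_fst] by (simp add: o_def)
    also have "\<dots> = integral {t0..t} (\<lambda>s. fst (\<Phi> s (x s) (u s))) - integral {t0..t} (\<lambda>s. fst (\<Phi> s (y s) (v s)))"
      unfolding \<Delta>_def x_def y_def
      by (subst Henstock_Kurzweil_Integration.integral_diff[symmetric])
        (auto intro!: bmeas_integrable[OF bmeas_fst[OF bmeas_\<Phi>_traj] sub] u v)
    finally show ?thesis
      using solution_traj[OF u, of \<xi>] solution_traj[OF v, of \<xi>'] t
      unfolding Z_def solution_def x_def y_def by (auto simp: algebra_simps)
  qed
  have sndZ: "snd (Z t1) = integral {t0..t1} (\<lambda>s. snd (\<Delta> s))"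
    using integral_linear[OF bmeas_integrable[OF \<Delta>, of t0 t1] bounded_linear_snd] by (simp add: o_def Z_def)
  define W where "W t = (p t, - lam) \<bullet> Z t" for t
  define w where "w s = (p s, - lam) \<bullet> (\<Delta> s - D s (x s - y s)) + m s \<bullet> (x s - y s)" for s
  obtain N1 where N1: "negligible N1" "\<And>t. t \<in> {t0..t1} - N1 \<Longrightarrow>
      ((\<lambda>s. integral {t0..s} k) has_vector_derivative k t) (at t within {t0..t1})"
    using integral_has_vector_derivative_AE[OF k] by blast
  obtain N2 where N2: "negligible N2" "\<And>t. t \<in> {t0..t1} - N2 \<Longrightarrow>
      ((\<lambda>s. integral {t0..s} \<Delta>) has_vector_derivative \<Delta> t) (at t within {t0..t1})"
    using integral_has_vector_derivative_AE[OF \<Delta>] by blast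
  obtain Bk where Bk: "Bk > 0" "\<And>t. t \<in> {t0..t1} \<Longrightarrow> norm (k t) \<le> Bk" using bmeas_bound[OF k] by blast
  obtain Bd where Bd: "Bd > 0" "\<And>t. t \<in> {t0..t1} \<Longrightarrow> norm (\<Delta> t) \<le> Bd" using bmeas_bound[OF \<Delta>] by blast
  have Zc: "continuous_on {t0..t1} Z"
    unfolding Z_def by (intro continuous_intros indefinite_integral_continuous_1 bmeas_integrable[OF \<Delta>]) auto
  obtain BZ where BZ: "BZ > 0" "\<And>t. t \<in> {t0..t1} \<Longrightarrow> norm (Z t) \<le> BZ"
    using bmeas_bound[OF bmeas_continuous[OF Zc]] by blast
  have Pb: "bmeas t0 t1 (\<lambda>t. (p t, - lam))" by (intro bmeas_intros pc)
  obtain BP where BP: "BP > 0" "\<And>t. t \<in> {t0..t1} \<Longrightarrow> norm (p t, - lam) \<le> BP"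
    using bmeas_bound[OF Pb] by blast
  \<comment> \<open>Both factors of \<open>W\<close> are primitives of bounded functions up to
    constants, so \<open>W\<close> is Lipschitz and the fundamental theorem applies to its almost
    everywhere derivative \<open>w\<close>.\<close>
  have "absolutely_continuous_on {t0..t1} W"
  proof (rule Lipschitz_absolutely_continuous_on)
    fix s t assume st: "s \<in> {t0..t1}" "t \<in> {t0..t1}"
    have "W t - W s = ((p t, - lam) - (p s, - lam)) \<bullet> Z t + (p s, - lam) \<bullet> (Z t - Z s)"
      unfolding W_def by (simp only: inner_diff_left inner_diff_right)
    also have "norm \<dots> \<le> norm ((p t, - lam) - (p s, - lam)) * norm (Z t) + norm (p s, - lam) * norm (Z t - Z s)"
      by (intro order_trans[OF norm_triangle_ineq] add_mono) (simp_all only: real_norm_def Cauchy_Schwarz_ineq2)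
    also have "\<dots> \<le> (Bk * \<bar>t - s\<bar>) * BZ + BP * (Bd * \<bar>t - s\<bar>)"
    proof (intro add_mono mult_mono)
      have "norm ((p t, - lam) - (p s, - lam)) = norm (integral {t0..t} k - integral {t0..s} k)"
        using pk[OF st(1)] pk[OF st(2)] by (simp add: norm_Pair norm_minus_commute)
      then show "norm ((p t, - lam) - (p s, - lam)) \<le> Bk * \<bar>t - s\<bar>"
        using bmeas_integral_Lipschitz[OF k Bk(2) st] by simp
      show "norm (Z t - Z s) \<le> Bd * \<bar>t - s\<bar>"
        using bmeas_integral_Lipschitz[OF \<Delta> Bd(2) st] by (simp add: Z_def)
    qed (use st BZ BP Bk in auto)
    finally show "norm (W t - W s) \<le> (Bk * BZ + BP * Bd) * \<bar>t - s\<bar>" by (simp add: algebra_simps)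
  qed
  then have "(w has_integral (W t1 - W t0)) {t0..t1}"
  proof (rule absolutely_continuous_has_integral[where N = "N1 \<union> N2"])
    fix t assume t: "t \<in> {t0..t1} - (N1 \<union> N2)"
    have "((\<lambda>r. p t0 - integral {t0..r} k) has_vector_derivative (- k t)) (at t within {t0..t1})"
      using has_vector_derivative_diff[OF has_vector_derivative_const N1(2), of t "p t0"] t by simp
    from has_vector_derivative_transform[OF _ pk this]
    have dp: "(p has_vector_derivative (- k t)) (at t within {t0..t1})" using t by blast
    have dP: "((\<lambda>r. (p r, - lam)) has_vector_derivative (- k t, 0)) (at t within {t0..t1})"
      by (intro has_vector_derivative_Pair dp has_vector_derivative_const)
    have dZ: "(Z has_vector_derivative \<Delta> t) (at t within {t0..t1})"
      unfolding Z_def using t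
      by (subst add_0_left[of "\<Delta> t", symmetric], intro has_vector_derivative_add has_vector_derivative_const N2) auto
    have "(W has_vector_derivative ((p t, - lam) \<bullet> \<Delta> t + (- k t, 0) \<bullet> Z t)) (at t within {t0..t1})"
      unfolding W_def by (rule bounded_bilinear.has_vector_derivative[OF bounded_bilinear_inner dP dZ])
    also have "(- k t, 0) \<bullet> Z t = - (k t \<bullet> (x t - y t))"
      using fstZ[of t] t by (simp add: inner_prod_def)
    also have "k t \<bullet> (x t - y t) = D t (x t - y t) \<bullet> (p t, - lam) - m t \<bullet> (x t - y t)"
      using adj_inner[of t] t by (simp add: k_def inner_diff_left)
    finally show "(W has_vector_derivative w t) (at t within {t0..t1})"
      by (simp add: w_def inner_diff_right inner_commute algebra_simps)
  qed (use t01 N1 N2 in auto)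
  then have "integral {t0..t1} w = W t1 - W t0" by (rule integral_unique)
  moreover have "integral {t0..t1} w = integral {t0..t1} (\<lambda>s. (p s, - lam) \<bullet> (\<Delta> s - D s (x s - y s)))
      + integral {t0..t1} (\<lambda>s. m s \<bullet> (x s - y s))"
  proof -
    have Dz: "bmeas t0 t1 (\<lambda>s. D s (x s - y s))"
      by (intro bmeas_D bmeas_diff xy)
    show ?thesis
      unfolding w_def
      by (intro Henstock_Kurzweil_Integration.integral_add bmeas_integrable[of t0 t1] bmeas_intros pc \<Delta> Dz m xy) auto
  qed
  moreover have "W t1 = - (q1 \<bullet> (x t1 - y t1)) - lam * integral {t0..t1} (\<lambda>s. snd (\<Delta> s))"
    using p[of t1] t01 fstZ[of t1] sndZ by (simp add: W_def inner_prod_def)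
  moreover have "W t0 = p t0 \<bullet> (\<xi> - \<xi>')"
    using t01 by (simp add: W_def Z_def inner_prod_def)
  ultimately show ?thesis by linarith
qed

text \<open>Three kinds of times. If both controls equal \<open>us\<close>, differentiability along
  \<open>xs\<close> gives the small factor \<eta>. If they agree with each other but not with
  \<open>us\<close>, only Lipschitz bounds are available, on a set of measure
  \<open>control_dist u us\<close>. If they differ, the increment of \<open>\<Phi>\<close> is
  compared with the one taken at \<open>xs\<close>, which costs \<open>B * r\<close> for each
  trajectory and \<open>2 * B * r\<close> for the linear part.\<close>

lemma residual_bound:
  fixes P :: "real \<Rightarrow> 'a \<times> real"
  assumes u: "control u" and v: "control v" and P: "bmeas t0 t1 P" "\<And>s. s \<in> {t0..t1} \<Longrightarrow> norm (P s) \<le> CP"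
    and near: "\<And>t x y. t \<in> {t0..t1} \<Longrightarrow> norm (x - xs t) \<le> r \<Longrightarrow> norm (y - xs t) \<le> r \<Longrightarrow>
       norm (\<Phi> t x (us t) - \<Phi> t y (us t) - D t (x - y)) \<le> \<eta> * norm (x - y)"
    and xr: "\<And>s. s \<in> {t0..t1} \<Longrightarrow> norm (traj \<xi> v s - xs s) \<le> r"
    and yr: "\<And>s. s \<in> {t0..t1} \<Longrightarrow> norm (traj \<xi>' u s - xs s) \<le> r"
    and z: "\<And>s. s \<in> {t0..t1} \<Longrightarrow> norm (traj \<xi> v s - traj \<xi>' u s) \<le> z" and \<eta>: "\<eta> \<ge> 0"
  shows "\<bar>integral {t0..t1} (\<lambda>s. P s \<bullet> (\<Phi> s (traj \<xi> v s) (v s) - \<Phi> s (traj \<xi>' u s) (u s)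
             - D s (traj \<xi> v s - traj \<xi>' u s)))
      - integral {t0..t1} (\<lambda>s. P s \<bullet> (\<Phi> s (xs s) (v s) - \<Phi> s (xs s) (u s)))\<bar>
    \<le> CP * (\<eta> * z * (t1 - t0) + 2 * B * z * control_dist u us + 4 * B * r * control_dist u v)"
proof -
  let ?x = "traj \<xi> v" and ?y = "traj \<xi>' u"
  define R where "R s = \<Phi> s (?x s) (v s) - \<Phi> s (?y s) (u s) - D s (?x s - ?y s) - (\<Phi> s (xs s) (v s) - \<Phi> s (xs s) (u s))" for s
  have CP0: "CP \<ge> 0" using order_trans[OF norm_ge_zero P(2)[of t0]] t01 by simp
  have r0: "r \<ge> 0" using order_trans[OF norm_ge_zero xr[of t0]] t01 by simp
  have z0: "z \<ge> 0" using order_trans[OF norm_ge_zero z[of t0]] t01 by simp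
  have b1: "bmeas t0 t1 (\<lambda>s. \<Phi> s (?x s) (v s) - \<Phi> s (?y s) (u s) - D s (?x s - ?y s))"
    by (intro bmeas_diff bmeas_D bmeas_\<Phi>_traj bmeas_traj u v)
  have b2: "bmeas t0 t1 (\<lambda>s. \<Phi> s (xs s) (v s) - \<Phi> s (xs s) (u s))"
    by (intro bmeas_diff bmeas_\<Phi> xs_continuous u v)
  have Rb: "bmeas t0 t1 R" unfolding R_def by (intro bmeas_diff[OF b1 b2])
  have pt: "norm (R s) \<le> \<eta> * z + 2 * B * z * (if u s = us s then 0 else 1) + 4 * B * r * (if u s = v s then 0 else 1)"
    if s: "s \<in> {t0..t1}" for s
  proof (cases "u s = v s")
    case uv: True
    then have Req: "R s = \<Phi> s (?x s) (u s) - \<Phi> s (?y s) (u s) - D s (?x s - ?y s)" by (simp add: R_def)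
    show ?thesis
    proof (cases "u s = us s")
      case True
      have "norm (R s) \<le> \<eta> * norm (?x s - ?y s)"
        unfolding Req True using near[OF s xr[OF s] yr[OF s]] by simp
      also have "\<dots> \<le> \<eta> * z" using z[OF s] \<eta> by (intro mult_left_mono) auto
      finally show ?thesis using uv True by simp
    next
      case False
      have uV: "u s \<in> V" using u s by (auto simp: control_def)
      have "norm (R s) \<le> norm (\<Phi> s (?x s) (u s) - \<Phi> s (?y s) (u s)) + norm (D s (?x s - ?y s))"
        unfolding Req by (rule norm_triangle_ineq4)
      also have "\<dots> \<le> B * norm (?x s - ?y s) + B * norm (?x s - ?y s)"
        using \<Phi>_Lipschitz[OF s uV] D_bound[OF s] by (intro add_mono) auto
      also have "\<dots> \<le> B * z + B * z" using z[OF s] B by (intro add_mono mult_left_mono) auto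
      finally have "norm (R s) \<le> 2 * B * z" by simp
      moreover have "0 \<le> \<eta> * z" using \<eta> z0 by simp
      ultimately show ?thesis using uv False by simp
    qed
  next
    case False
    have uV: "u s \<in> V" "v s \<in> V" using u v s by (auto simp: control_def)
    have Req: "R s = (\<Phi> s (?x s) (v s) - \<Phi> s (xs s) (v s)) - (\<Phi> s (?y s) (u s) - \<Phi> s (xs s) (u s)) - D s (?x s - ?y s)"
      by (simp add: R_def)
    have "norm (R s) \<le> norm (\<Phi> s (?x s) (v s) - \<Phi> s (xs s) (v s)) + norm (\<Phi> s (?y s) (u s) - \<Phi> s (xs s) (u s)) + norm (D s (?x s - ?y s))"
      unfolding Req by (rule order_trans[OF norm_triangle_ineq4 add_right_mono[OF norm_triangle_ineq4]])
    also have "\<dots> \<le> B * r + B * r + B * (2 * r)"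
    proof (intro add_mono)
      show "norm (\<Phi> s (?x s) (v s) - \<Phi> s (xs s) (v s)) \<le> B * r"
        using \<Phi>_Lipschitz[OF s uV(2), of "?x s" "xs s"] mult_left_mono[OF xr[OF s], of B] B by linarith
      show "norm (\<Phi> s (?y s) (u s) - \<Phi> s (xs s) (u s)) \<le> B * r"
        using \<Phi>_Lipschitz[OF s uV(1), of "?y s" "xs s"] mult_left_mono[OF yr[OF s], of B] B by linarith
      have "norm (?x s - ?y s) \<le> norm (?x s - xs s) + norm (?y s - xs s)"
        using norm_triangle_ineq4[of "?x s - xs s" "?y s - xs s"] by simp
      then have "norm (?x s - ?y s) \<le> 2 * r" using xr[OF s] yr[OF s] by linarith
      then show "norm (D s (?x s - ?y s)) \<le> B * (2 * r)"
        using D_bound[OF s, of "?x s - ?y s"] B by (meson mult_left_mono order_trans zero_le_one)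
    qed
    finally have "norm (R s) \<le> 4 * B * r" by simp
    moreover have "0 \<le> \<eta> * z" "0 \<le> 2 * B * z" using \<eta> z0 B by auto
    ultimately show ?thesis using False by auto
  qed
  have cd1: "bmeas t0 t1 (\<lambda>s. if u s = us s then 0 else 1 :: real)" by (intro bmeas_control_diff u control_us)
  have cd2: "bmeas t0 t1 (\<lambda>s. if u s = v s then 0 else 1 :: real)" by (intro bmeas_control_diff u v)
  have eq: "integral {t0..t1} (\<lambda>s. P s \<bullet> (\<Phi> s (?x s) (v s) - \<Phi> s (?y s) (u s) - D s (?x s - ?y s)))
      - integral {t0..t1} (\<lambda>s. P s \<bullet> (\<Phi> s (xs s) (v s) - \<Phi> s (xs s) (u s)))
    = integral {t0..t1} (\<lambda>s. P s \<bullet> R s)"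
    unfolding R_def
    by (subst Henstock_Kurzweil_Integration.integral_diff[symmetric])
      (auto intro!: bmeas_integrable[OF bmeas_inner[OF P(1) b1]] bmeas_integrable[OF bmeas_inner[OF P(1) b2]]
        simp: inner_diff_right[symmetric])
  have "\<bar>integral {t0..t1} (\<lambda>s. P s \<bullet> R s)\<bar> \<le> integral {t0..t1} (\<lambda>s. CP * (\<eta> * z + 2 * B * z * (if u s = us s then 0 else 1)
      + 4 * B * r * (if u s = v s then 0 else 1)))"
    unfolding real_norm_def[symmetric]
  proof (rule bmeas_norm_integral_le[of t0 t1])
    show "norm (P s \<bullet> R s) \<le> CP * (\<eta> * z + 2 * B * z * (if u s = us s then 0 else 1)
      + 4 * B * r * (if u s = v s then 0 else 1))" if s: "s \<in> {t0..t1}" for s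
    proof -
      have "norm (P s \<bullet> R s) \<le> norm (P s) * norm (R s)" by (simp add: Cauchy_Schwarz_ineq2)
      also have "\<dots> \<le> CP * (\<eta> * z + 2 * B * z * (if u s = us s then 0 else 1)
      + 4 * B * r * (if u s = v s then 0 else 1))"
        using pt[OF s] P(2)[OF s] CP0 by (intro mult_mono) auto
      finally show ?thesis .
    qed
  qed (intro subset_refl bmeas_intros P Rb cd1 cd2)+
  also have "\<dots> = CP * (\<eta> * z * (t1 - t0) + 2 * B * z * control_dist u us + 4 * B * r * control_dist u v)"
  proof -
    have i1: "(\<lambda>s. 2 * B * z * (if u s = us s then 0 else 1)) integrable_on {t0..t1}"
      "(\<lambda>s. 4 * B * r * (if u s = v s then 0 else 1)) integrable_on {t0..t1}"
      "(\<lambda>s. \<eta> * z + 2 * B * z * (if u s = us s then 0 else 1)) integrable_on {t0..t1}"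
      by (intro bmeas_integrable[of t0 t1] bmeas_intros cd1 cd2 subset_refl)+
    have "integral {t0..t1} (\<lambda>s. \<eta> * z + 2 * B * z * (if u s = us s then 0 else 1))
        = \<eta> * z * (t1 - t0) + 2 * B * z * control_dist u us"
      using t01 i1 by (subst Henstock_Kurzweil_Integration.integral_add) (auto simp: control_dist_def)
    then show ?thesis
      using i1 by (simp add: control_dist_def Henstock_Kurzweil_Integration.integral_add integral_mult_right)
  qed
  finally show ?thesis unfolding eq .
qed

end

text \<open>Since \<open>e\<close> need not be continuous, Gronwall's inequality is applied to its
  tail integral, which is; one use of the hypothesis then returns to \<open>e\<close> with the
  pointwise error \<open>r t\<close>.\<close>

lemma gronwall_bmeas:
  fixes e r :: "real \<Rightarrow> real"
  assumes e: "bmeas a b e" and r: "bmeas a b r" "\<And>t. t \<in> {a..b} \<Longrightarrow> 0 \<le> r t" and "L > 0"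
    and le: "\<And>t. t \<in> {a..b} \<Longrightarrow> e t \<le> r t + L * integral {t..b} e" and t: "t \<in> {a..b}"
  shows "e t \<le> r t + L * (2 * integral {a..b} r * exp (2 * L * (b - a)))"
proof -
  have ei: "e integrable_on {a..b}" by (rule bmeas_integrable[OF e]) auto
  have yc: "continuous_on {a..b} (\<lambda>t. integral {t..b} e)"
    by (rule indefinite_integral_continuous_1'[OF ei])
  have "integral {t..b} e \<le> 2 * integral {a..b} r * exp (2 * L * (b - a))"
  proof (rule gronwall_backward[OF yc \<open>L > 0\<close> _ _ t])
    show "0 \<le> integral {a..b} r" by (intro integral_nonneg bmeas_integrable[OF r(1)] r(2)) auto
    fix t assume t: "t \<in> {a..b}"
    have "integral {t..b} e \<le> integral {t..b} (\<lambda>s. r s + L * integral {s..b} e)"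
      using t le by (intro bmeas_integral_le[of a b] bmeas_intros bmeas_continuous[OF yc] e r) auto
    also have "\<dots> = integral {t..b} r + L * integral {t..b} (\<lambda>s. integral {s..b} e)"
    proof (subst Henstock_Kurzweil_Integration.integral_add)
      show "r integrable_on {t..b}" using t by (intro bmeas_integrable[OF r(1)]) auto
      show "(\<lambda>s. L * integral {s..b} e) integrable_on {t..b}"
        using t by (intro bmeas_integrable[of a b] bmeas_intros bmeas_continuous[OF yc]) auto
    qed simp
    also have "integral {t..b} r \<le> integral {a..b} r"
      using t r(2) by (intro integral_subset_le bmeas_integrable[OF r(1)]) auto
    finally show "integral {t..b} e \<le> integral {a..b} r + L * integral {t..b} (\<lambda>s. integral {s..b} e)" by simp
  qed
  then have "L * integral {t..b} e \<le> L * (2 * integral {a..b} r * exp (2 * L * (b - a)))"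
    using \<open>L > 0\<close> by (intro mult_left_mono) auto
  then show ?thesis using le[OF t] by linarith
qed

lemma sigma_minimizer:
  fixes H :: "'x \<Rightarrow> real"
  assumes "X \<noteq> {}" "\<And>x. x \<in> X \<Longrightarrow> m \<le> H x" "\<sigma> > 0"
  shows "\<exists>x\<in>X. \<forall>y\<in>X. H x \<le> H y + \<sigma>"
proof -
  have bdd: "bdd_below (H ` X)" using assms(2) by (auto simp: bdd_below_def)
  have "Inf (H ` X) < Inf (H ` X) + \<sigma>" using assms by simp
  then obtain x where x: "x \<in> X" "H x < Inf (H ` X) + \<sigma>"
    using assms(1) cInf_lessD[of "H ` X" "Inf (H ` X) + \<sigma>"] by auto
  have "H x \<le> H y + \<sigma>" if "y \<in> X" for y
    using cInf_lower[OF imageI[OF that, of H] bdd] x(2) by linarith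
  then show ?thesis using x(1) by blast
qed

context control_system
begin

text \<open>The bound depends on the multipliers only through \<open>c1\<close>, \<open>c2\<close>
  and \<open>c3\<close>. Total mass 1 bounds these, so the estimate is uniform over all
  approximations.\<close>

lemma adjoint_bound:
  assumes pb: "bmeas t0 t1 p" and M: "\<And>t. t \<in> {t0..t1} \<Longrightarrow> norm (M t) \<le> c2" and c: "norm q1 \<le> c1" "\<bar>lam\<bar> \<le> c3"
    and p: "\<And>t. t \<in> {t0..t1} \<Longrightarrow> p t = - q1 + integral {t..t1} (\<lambda>s. adj s (p s, - lam)) - M t"
    and t: "t \<in> {t0..t1}"
  defines "k \<equiv> c1 + c2 + B * c3 * (t1 - t0)"
  shows "norm (p t, - lam) \<le> k + B * (2 * (k * (t1 - t0)) * exp (2 * B * (t1 - t0))) + c3"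
proof -
  have c0: "c1 \<ge> 0" "c2 \<ge> 0" "c3 \<ge> 0"
    using c M[of t] t by (auto intro: order_trans[OF norm_ge_zero] order_trans[OF abs_ge_zero])
  have k0: "k \<ge> 0" unfolding k_def using c0 B t01 by (intro add_nonneg_nonneg mult_nonneg_nonneg) auto
  have "norm (p t) \<le> k + B * (2 * integral {t0..t1} (\<lambda>_. k) * exp (2 * B * (t1 - t0)))"
  proof (rule gronwall_bmeas[OF bmeas_norm[OF pb] bmeas_const])
    fix t assume t: "t \<in> {t0..t1}"
    have sub: "{t..t1} \<subseteq> {t0..t1}" using t by auto
    have "norm (integral {t..t1} (\<lambda>s. adj s (p s, - lam))) \<le> integral {t..t1} (\<lambda>s. B * norm (p s) + B * c3)"
    proof (rule bmeas_norm_integral_le[OF _ _ sub])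
      show "bmeas t0 t1 (\<lambda>s. adj s (p s, - lam))" by (intro bmeas_adj bmeas_intros pb)
      show "bmeas t0 t1 (\<lambda>s. B * norm (p s) + B * c3)" by (intro bmeas_intros pb)
      show "norm (adj s (p s, - lam)) \<le> B * norm (p s) + B * c3" if "s \<in> {t..t1}" for s
      proof -
        have "norm (adj s (p s, - lam)) \<le> B * norm (p s, - lam)" using adj_bound that t by auto
        also have "\<dots> \<le> B * (norm (p s) + \<bar>lam\<bar>)"
          using norm_Pair_le[of "p s" "- lam"] B by (intro mult_left_mono) auto
        also have "\<dots> \<le> B * (norm (p s) + c3)" using c B by (intro mult_left_mono) auto
        finally show ?thesis by (simp add: distrib_left)
      qed
    qed
    also have "\<dots> = B * integral {t..t1} (\<lambda>s. norm (p s)) + B * c3 * (t1 - t)"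
    proof (subst Henstock_Kurzweil_Integration.integral_add)
      show "(\<lambda>s. B * norm (p s)) integrable_on {t..t1}"
        by (rule bmeas_integrable[OF _ sub]) (intro bmeas_intros pb)
    qed (use t in auto)
    also have "B * c3 * (t1 - t) \<le> B * c3 * (t1 - t0)"
      using t B c0 by (intro mult_left_mono) auto
    finally have "norm (integral {t..t1} (\<lambda>s. adj s (p s, - lam))) \<le> B * integral {t..t1} (\<lambda>s. norm (p s)) + B * c3 * (t1 - t0)"
      by simp
    moreover have "norm (p t) \<le> norm q1 + norm (integral {t..t1} (\<lambda>s. adj s (p s, - lam))) + norm (M t)"
      unfolding p[OF t] using norm_triangle_ineq4[of "- q1 + integral {t..t1} (\<lambda>s. adj s (p s, - lam))" "M t"]
        norm_triangle_ineq[of "- q1" "integral {t..t1} (\<lambda>s. adj s (p s, - lam))"] by simp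
    ultimately show "norm (p t) \<le> k + B * integral {t..t1} (\<lambda>s. norm (p s))"
      using c(1) M[OF t] by (simp add: k_def)
  qed (use k0 B t in auto)
  moreover have "norm (p t, - lam) \<le> norm (p t) + \<bar>lam\<bar>" using norm_Pair_le[of "p t" "- lam"] by simp
  ultimately show ?thesis using c t01 by (simp add: mult.commute)
qed

end

section \<open>Approximate multipliers\<close>

text \<open>The constraints are \<open>\<psi> i \<le> 0\<close> at the endpoints and
  \<open>g j \<le> 0\<close> along the trajectory; \<open>b i\<close> is the share of the shift
  \<open>s\<close> that constraint \<open>i\<close> receives, and in the application it is 1 exactly
  for the decrease of the cost. Minimality enters only through \<open>infeasible\<close>: after a
  positive shift no nearby process satisfies all constraints.\<close>

locale constrained_system = control_system t0 t1 xs us V \<Phi> D B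
  for t0 t1 :: real and xs :: "real \<Rightarrow> 'a::euclidean_space" and us :: "real \<Rightarrow> 'u::euclidean_space"
    and V :: "'u set" and \<Phi> :: "real \<Rightarrow> 'a \<Rightarrow> 'u \<Rightarrow> 'a \<times> real" and D :: "real \<Rightarrow> 'a \<Rightarrow> 'a \<times> real" and B :: real +
  fixes I :: "'i set" and \<psi> :: "'i \<Rightarrow> 'a \<times> 'a \<times> real \<Rightarrow> real" and a :: "'i \<Rightarrow> 'a \<times> 'a \<times> real"
    and b :: "'i \<Rightarrow> real" and l :: nat and g :: "nat \<Rightarrow> real \<Rightarrow> 'a \<Rightarrow> real" and G :: "nat \<Rightarrow> real \<Rightarrow> 'a"
    and \<rho> :: real
  assumes I: "finite I" "I \<noteq> {}"
    and b: "\<And>i. i \<in> I \<Longrightarrow> 0 \<le> b i \<and> b i \<le> 1"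
    and \<psi>_Lipschitz: "\<And>i e e'. i \<in> I \<Longrightarrow> \<bar>\<psi> i e - \<psi> i e'\<bar> \<le> B * norm (e - e')"
    and \<psi>_start: "\<And>i. i \<in> I \<Longrightarrow> \<psi> i (endpoints (xs t0) us) \<le> 0"
    and a_bound: "\<And>i. i \<in> I \<Longrightarrow> norm (a i) \<le> B"
    and g_Lipschitz: "\<And>j t x y. j \<in> {1..l} \<Longrightarrow> t \<in> {t0..t1} \<Longrightarrow> \<bar>g j t x - g j t y\<bar> \<le> B * norm (x - y)"
    and g_uniform: "\<And>\<eta>. \<eta> > 0 \<Longrightarrow> \<exists>\<delta>>0. \<forall>j\<in>{1..l}. \<forall>s\<in>{t0..t1}. \<forall>t\<in>{t0..t1}. \<forall>x.
        \<bar>s - t\<bar> \<le> \<delta> \<longrightarrow> \<bar>g j s x - g j t x\<bar> \<le> \<eta>"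
    and g_start: "\<And>j t. j \<in> {1..l} \<Longrightarrow> t \<in> {t0..t1} \<Longrightarrow> g j t (xs t) \<le> 0"
    and g_bound: "\<And>j t. j \<in> {1..l} \<Longrightarrow> t \<in> {t0..t1} \<Longrightarrow> \<bar>g j t (xs t)\<bar> \<le> B"
    and G_continuous: "\<And>j. j \<in> {1..l} \<Longrightarrow> continuous_on {t0..t1} (G j)"
    and G_bound: "\<And>j t. j \<in> {1..l} \<Longrightarrow> t \<in> {t0..t1} \<Longrightarrow> norm (G j t) \<le> B"
    and differentiable: "\<And>\<eta>. \<eta> > 0 \<Longrightarrow> \<exists>\<delta>>0.
        (\<forall>t\<in>{t0..t1}. \<forall>x y. norm (x - xs t) \<le> \<delta> \<longrightarrow> norm (y - xs t) \<le> \<delta> \<longrightarrow>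
            norm (\<Phi> t x (us t) - \<Phi> t y (us t) - D t (x - y)) \<le> \<eta> * norm (x - y)) \<and>
        (\<forall>i\<in>I. \<forall>e e'. norm (e - endpoints (xs t0) us) \<le> \<delta> \<longrightarrow> norm (e' - endpoints (xs t0) us) \<le> \<delta> \<longrightarrow>
            \<bar>\<psi> i e - \<psi> i e' - a i \<bullet> (e - e')\<bar> \<le> \<eta> * norm (e - e')) \<and>
        (\<forall>j\<in>{1..l}. \<forall>t\<in>{t0..t1}. \<forall>x y. norm (x - xs t) \<le> \<delta> \<longrightarrow> norm (y - xs t) \<le> \<delta> \<longrightarrow>
            \<bar>g j t x - g j t y - G j t \<bullet> (x - y)\<bar> \<le> \<eta> * norm (x - y))"
    and \<rho>: "\<rho> > 0"
    and infeasible: "\<And>s \<xi> u. s > 0 \<Longrightarrow> control u \<Longrightarrow> process_dist (xs t0, us) (\<xi>, u) \<le> \<rho> \<Longrightarrow>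
        (\<exists>i\<in>I. \<psi> i (endpoints \<xi> u) + s * b i > 0) \<or> (\<exists>j\<in>{1..l}. \<exists>t\<in>{t0..t1}. g j t (traj \<xi> u t) > 0)"
begin

section \<open>Constraint values, their maximum and its smoothing\<close>

definition val :: "real \<Rightarrow> 'i \<Rightarrow> 'a \<times> (real \<Rightarrow> 'u) \<Rightarrow> real" where
  "val s i p = \<psi> i (endpoints (fst p) (snd p)) + s * b i"

definition gval :: "nat \<Rightarrow> 'a \<times> (real \<Rightarrow> 'u) \<Rightarrow> real \<Rightarrow> real" where
  "gval j p t = g j t (traj (fst p) (snd p) t)"

definition vals :: "real \<Rightarrow> 'a \<times> (real \<Rightarrow> 'u) \<Rightarrow> real set" where
  "vals s p = (\<lambda>i. val s i p) ` I \<union> (\<Union>j\<in>{1..l}. gval j p ` {t0..t1})"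

definition violation :: "real \<Rightarrow> 'a \<times> (real \<Rightarrow> 'u) \<Rightarrow> real" where
  "violation s p = Sup (vals s p)"

definition weight_total :: "real \<Rightarrow> real \<Rightarrow> 'a \<times> (real \<Rightarrow> 'u) \<Rightarrow> real" where
  "weight_total s \<beta> p = exp_total I l t0 t1 \<beta> (\<lambda>i. val s i p) (\<lambda>j. gval j p)"

definition smooth_violation :: "real \<Rightarrow> real \<Rightarrow> 'a \<times> (real \<Rightarrow> 'u) \<Rightarrow> real" where
  "smooth_violation s \<beta> p = ln (weight_total s \<beta> p) / \<beta>"

text \<open>A Lipschitz constant, with respect to \<open>process_dist\<close>, common to all
  constraint values.\<close>

definition C3 :: real where "C3 = B * C2"

lemma C3: "C3 \<ge> 1" "C3 \<ge> B * C1"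
proof -
  have "1 * 1 \<le> B * C2" using B C2 by (intro mult_mono) auto
  then show "C3 \<ge> 1" by (simp add: C3_def)
  show "C3 \<ge> B * C1" unfolding C3_def using B C2 by (intro mult_left_mono) auto
qed

text \<open>All trajectories have the Lipschitz constant \<open>B\<close> in time, so \<delta> can
  be chosen independently of the process. That is what makes the smoothing parameter below
  uniform.\<close>

lemma gval_equicontinuous:
  assumes "\<eta> > 0"
  shows "\<exists>\<delta>>0. \<forall>j\<in>{1..l}. \<forall>p. control (snd p) \<longrightarrow> (\<forall>s\<in>{t0..t1}. \<forall>t\<in>{t0..t1}.
     \<bar>s - t\<bar> \<le> \<delta> \<longrightarrow> \<bar>gval j p s - gval j p t\<bar> \<le> \<eta>)"
proof -
  obtain \<delta> where \<delta>: "\<delta> > 0" "\<And>j s t x. j \<in> {1..l} \<Longrightarrow> s \<in> {t0..t1} \<Longrightarrow> t \<in> {t0..t1} \<Longrightarrow> \<bar>s - t\<bar> \<le> \<delta> \<Longrightarrow>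
      \<bar>g j s x - g j t x\<bar> \<le> \<eta> / 2"
    using g_uniform[of "\<eta> / 2"] assms by auto
  define \<delta>' where "\<delta>' = min \<delta> (\<eta> / (2 * B * B))"
  have "\<delta>' > 0" using \<delta> assms B by (simp add: \<delta>'_def)
  moreover have "\<bar>gval j p s - gval j p t\<bar> \<le> \<eta>"
    if j: "j \<in> {1..l}" and p: "control (snd p)" and st: "s \<in> {t0..t1}" "t \<in> {t0..t1}" "\<bar>s - t\<bar> \<le> \<delta>'" for j p s t
  proof -
    let ?x = "traj (fst p) (snd p)"
    have "\<bar>g j s (?x s) - g j s (?x t)\<bar> \<le> B * norm (?x s - ?x t)"
      by (rule g_Lipschitz[OF j st(1)])
    also have "\<dots> \<le> B * (B * \<bar>s - t\<bar>)"
      using solution_Lipschitz[OF solution_traj[OF p] p st(2,1)] B by (intro mult_left_mono) auto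
    also have "\<dots> \<le> B * (B * (\<eta> / (2 * B * B)))"
      using st B by (intro mult_left_mono) (auto simp: \<delta>'_def)
    also have "\<dots> = \<eta> / 2" using B by simp
    finally have "\<bar>g j s (?x s) - g j s (?x t)\<bar> \<le> \<eta> / 2" .
    moreover have "\<bar>g j s (?x t) - g j t (?x t)\<bar> \<le> \<eta> / 2"
      using st by (intro \<delta> j) (auto simp: \<delta>'_def)
    ultimately show ?thesis unfolding gval_def by linarith
  qed
  ultimately show ?thesis by blast
qed

lemma gval_continuous:
  assumes "j \<in> {1..l}" "control (snd p)"
  shows "continuous_on {t0..t1} (gval j p)"
  unfolding continuous_on_iff
proof (intro ballI allI impI)
  fix t e :: real assume t: "t \<in> {t0..t1}" and "e > 0"
  obtain \<delta> where "\<delta> > 0" "\<forall>j\<in>{1..l}. \<forall>p. control (snd p) \<longrightarrow> (\<forall>s\<in>{t0..t1}. \<forall>t\<in>{t0..t1}.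
     \<bar>s - t\<bar> \<le> \<delta> \<longrightarrow> \<bar>gval j p s - gval j p t\<bar> \<le> e / 2)"
    using gval_equicontinuous[of "e / 2"] \<open>e > 0\<close> by auto
  then have "\<bar>gval j p s - gval j p t\<bar> \<le> e / 2" if "s \<in> {t0..t1}" "\<bar>s - t\<bar> \<le> \<delta>" for s
    using that t assms by blast
  then show "\<exists>d>0. \<forall>s\<in>{t0..t1}. dist s t < d \<longrightarrow> dist (gval j p s) (gval j p t) < e"
    using \<open>\<delta> > 0\<close> \<open>e > 0\<close> by (intro exI[of _ \<delta>]) (auto simp: dist_real_def, fastforce)
qed

lemma val_diff:
  assumes "i \<in> I" "control (snd p)" "control (snd q)"
  shows "\<bar>val s i p - val s i q\<bar> \<le> C3 * process_dist p q"
proof -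
  have "\<bar>val s i p - val s i q\<bar> \<le> B * norm (endpoints (fst p) (snd p) - endpoints (fst q) (snd q))"
    using \<psi>_Lipschitz[OF assms(1)] by (simp add: val_def)
  also have "\<dots> \<le> B * (C2 * process_dist p q)"
    using endpoints_diff[OF assms(2,3), of "fst p" "fst q"] B by (intro mult_left_mono) auto
  finally show ?thesis by (simp add: C3_def)
qed

lemma gval_diff:
  assumes "j \<in> {1..l}" "t \<in> {t0..t1}" "control (snd p)" "control (snd q)"
  shows "\<bar>gval j p t - gval j q t\<bar> \<le> C3 * process_dist p q"
proof -
  have "\<bar>gval j p t - gval j q t\<bar> \<le> B * norm (traj (fst p) (snd p) t - traj (fst q) (snd q) t)"
    using g_Lipschitz[OF assms(1,2)] by (simp add: gval_def)
  also have "\<dots> \<le> B * (C1 * process_dist p q)"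
    using traj_diff[OF assms(3,4,2), of "fst p" "fst q"] B by (intro mult_left_mono) auto
  also have "\<dots> \<le> C3 * process_dist p q"
    unfolding mult.assoc[symmetric] using C3(2) process_dist_nonneg by (intro mult_right_mono) auto
  finally show ?thesis .
qed

lemma vals_nonempty: "vals s p \<noteq> {}"
  using I by (auto simp: vals_def)

lemma vals_bdd:
  assumes "control (snd p)"
  shows "bdd_above (vals s p)"
proof -
  have "bdd_above (gval j p ` {t0..t1})" if "j \<in> {1..l}" for j
    using compact_continuous_image[OF gval_continuous[OF that assms]]
    by (intro bounded_imp_bdd_above compact_imp_bounded) auto
  then show ?thesis using I unfolding vals_def by (auto simp: bdd_above_UN)
qed

lemma violation_le_iff:
  assumes "control (snd p)"
  shows "violation s p \<le> r \<longleftrightarrow> (\<forall>i\<in>I. val s i p \<le> r) \<and> (\<forall>j\<in>{1..l}. \<forall>t\<in>{t0..t1}. gval j p t \<le> r)"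
  unfolding violation_def cSup_le_iff[OF vals_nonempty vals_bdd[OF assms]] by (auto simp: vals_def)

lemma violation_diff:
  assumes "control (snd p)" "control (snd q)"
  shows "\<bar>violation s p - violation s q\<bar> \<le> C3 * process_dist p q"
proof -
  have *: "violation s p \<le> violation s q + C3 * process_dist p q" if "control (snd p)" "control (snd q)" for p q
  proof -
    have v: "val s i q \<le> violation s q" if "i \<in> I" for i
      using violation_le_iff[OF \<open>control (snd q)\<close>, of s "violation s q"] that by auto
    have gv: "gval j q t \<le> violation s q" if "j \<in> {1..l}" "t \<in> {t0..t1}" for j t
      using violation_le_iff[OF \<open>control (snd q)\<close>, of s "violation s q"] that by auto
    show ?thesis
      unfolding violation_le_iff[OF that(1)]
    proof (intro conjI ballI)
      show "val s i p \<le> violation s q + C3 * process_dist p q" if "i \<in> I" for i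
        using v[OF that] val_diff[OF that \<open>control (snd p)\<close> \<open>control (snd q)\<close>, of s] by linarith
      show "gval j p t \<le> violation s q + C3 * process_dist p q" if "j \<in> {1..l}" "t \<in> {t0..t1}" for j t
        using gv[OF that] gval_diff[OF that \<open>control (snd p)\<close> \<open>control (snd q)\<close>] by linarith
    qed
  qed
  show ?thesis using *[OF assms] *[OF assms(2,1)] by (simp add: process_dist_commute abs_le_iff)
qed

lemma weight_total_pos: "\<beta> > 0 \<Longrightarrow> control (snd p) \<Longrightarrow> weight_total s \<beta> p > 0"
  unfolding weight_total_def by (intro exp_total_pos I t01 gval_continuous)

text \<open>The upper estimate loses only the logarithm of the total mass. For the lower one, a
  value close to the supremum persists for a time \<delta> by equicontinuity, so its integral of
  exponentials is nearly as large.\<close>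

lemma smooth_violation_close:
  assumes "\<eta> > 0"
  shows "\<exists>\<beta>0>0. \<forall>\<beta>\<ge>\<beta>0. \<forall>s p. control (snd p) \<longrightarrow> \<bar>smooth_violation s \<beta> p - violation s p\<bar> \<le> \<eta>"
proof -
  obtain \<delta>1 where \<delta>1: "\<delta>1 > 0" "\<And>j p s t. j \<in> {1..l} \<Longrightarrow> control (snd p) \<Longrightarrow> s \<in> {t0..t1} \<Longrightarrow> t \<in> {t0..t1} \<Longrightarrow>
     \<bar>s - t\<bar> \<le> \<delta>1 \<Longrightarrow> \<bar>gval j p s - gval j p t\<bar> \<le> \<eta> / 2"
    using gval_equicontinuous[of "\<eta> / 2"] assms by (metis half_gt_zero)
  define \<delta> where "\<delta> = min \<delta>1 ((t1 - t0) / 2)"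
  have \<delta>: "0 < \<delta>" "\<delta> \<le> (t1 - t0) / 2" "\<delta> \<le> \<delta>1"
    unfolding \<delta>_def using \<delta>1(1) t01 by (simp_all only: min.cobounded1 min.cobounded2) simp
  define K1 where "K1 = ln (card I + l * (t1 - t0))"
  \<comment> \<open>The lower estimate splits \<eta> into 1/4 for approaching the supremum, 1/2 for
    the oscillation within \<delta> and 1/4 for \<open>ln \<delta> / \<beta>\<close>; this explains
    the factor 4.\<close>
  define \<beta>0 where "\<beta>0 = 1 + (\<bar>K1\<bar> + 4 * \<bar>ln \<delta>\<bar>) / \<eta>"
  have "\<bar>smooth_violation s \<beta> p - violation s p\<bar> \<le> \<eta>" if "\<beta> \<ge> \<beta>0" and p: "control (snd p)" for \<beta> s p
  proof -
    have q0: "0 \<le> (\<bar>K1\<bar> + 4 * \<bar>ln \<delta>\<bar>) / \<eta>" using assms by simp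
    then have \<beta>: "\<beta> > 0" and \<beta>2: "\<beta> \<ge> (\<bar>K1\<bar> + 4 * \<bar>ln \<delta>\<bar>) / \<eta>" using that by (auto simp: \<beta>0_def)
    have *: "\<bar>K1\<bar> + 4 * \<bar>ln \<delta>\<bar> \<le> \<eta> * \<beta>" using \<beta>2 assms by (simp add: pos_divide_le_eq mult.commute)
    have K1: "K1 / \<beta> \<le> \<eta>" using * \<beta> by (simp add: pos_divide_le_eq)
    have K2: "- (\<eta> / 4) \<le> ln \<delta> / \<beta>" using * \<beta> by (simp add: pos_le_divide_eq)
    have gc: "\<And>j. j \<in> {1..l} \<Longrightarrow> continuous_on {t0..t1} (gval j p)" using gval_continuous p by blast
    have v: "\<And>i. i \<in> I \<Longrightarrow> val s i p \<le> violation s p"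
      and gv: "\<And>j t. j \<in> {1..l} \<Longrightarrow> t \<in> {t0..t1} \<Longrightarrow> gval j p t \<le> violation s p"
      using violation_le_iff[OF p, of s "violation s p"] by auto
    have up: "smooth_violation s \<beta> p \<le> violation s p + K1 / \<beta>"
      unfolding smooth_violation_def weight_total_def K1_def
      by (rule ln_exp_total_le[OF I t01 \<beta> gc v gv])
    have "violation s p - \<eta> / 4 < violation s p" using assms by simp
    then obtain r where r: "r \<in> vals s p" "violation s p - \<eta> / 4 < r"
      unfolding violation_def less_cSup_iff[OF vals_nonempty vals_bdd[OF p]] by blast
    have "violation s p - \<eta> \<le> smooth_violation s \<beta> p"
    proof -
      consider i where "i \<in> I" "r = val s i p" | j t where "j \<in> {1..l}" "t \<in> {t0..t1}" "r = gval j p t"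
        using r(1) by (auto simp: vals_def)
      then show ?thesis
      proof cases
        case 1
        have "val s i p \<le> smooth_violation s \<beta> p"
          unfolding smooth_violation_def weight_total_def
          by (rule ln_exp_total_ge_point[OF I t01 \<beta> gc 1(1)])
        then show ?thesis using r 1 assms by linarith
      next
        case 2
        have "(r - \<eta> / 2) + ln \<delta> / \<beta> \<le> smooth_violation s \<beta> p"
          unfolding smooth_violation_def weight_total_def
        proof (rule ln_exp_total_ge_integral[OF I t01 \<beta> gc 2(1,2) \<delta>(1,2)])
          fix t' assume "t' \<in> {t0..t1}" "\<bar>t' - t\<bar> \<le> \<delta>"
          then have "\<bar>gval j p t' - gval j p t\<bar> \<le> \<eta> / 2" using \<delta>(3) by (intro \<delta>1(2) 2 p) auto
          then show "r - \<eta> / 2 \<le> gval j p t'" using 2 by linarith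
        qed
        then show ?thesis using r K2 by linarith
      qed
    qed
    then show ?thesis using up K1 by linarith
  qed
  moreover have "\<beta>0 > 0" unfolding \<beta>0_def using assms by (simp add: add_pos_nonneg)
  ultimately show ?thesis by blast
qed

section \<open>First variation of the smoothed maximum\<close>

definition near :: "real \<Rightarrow> real \<Rightarrow> bool" where
  "near \<eta> \<delta> \<longleftrightarrow>
        (\<forall>t\<in>{t0..t1}. \<forall>x y. norm (x - xs t) \<le> \<delta> \<longrightarrow> norm (y - xs t) \<le> \<delta> \<longrightarrow>
            norm (\<Phi> t x (us t) - \<Phi> t y (us t) - D t (x - y)) \<le> \<eta> * norm (x - y)) \<and>
        (\<forall>i\<in>I. \<forall>e e'. norm (e - endpoints (xs t0) us) \<le> \<delta> \<longrightarrow> norm (e' - endpoints (xs t0) us) \<le> \<delta> \<longrightarrow>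
            \<bar>\<psi> i e - \<psi> i e' - a i \<bullet> (e - e')\<bar> \<le> \<eta> * norm (e - e')) \<and>
        (\<forall>j\<in>{1..l}. \<forall>t\<in>{t0..t1}. \<forall>x y. norm (x - xs t) \<le> \<delta> \<longrightarrow> norm (y - xs t) \<le> \<delta> \<longrightarrow>
            \<bar>g j t x - g j t y - G j t \<bullet> (x - y)\<bar> \<le> \<eta> * norm (x - y))"

text \<open>The chain rule for a change from \<open>P\<close> to \<open>Q\<close>. With
  \<open>p\<close> solving the adjoint equation driven by the smoothing weights, the difference of
  the trajectories disappears from the leading terms; a starting-point term and an increment of the
  Pontryagin function along \<open>xs\<close> remain, with errors that are small multiples of the
  distance once \<eta>, \<open>r\<close> and \<open>control_dist (snd P) us\<close> are
  small.\<close>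

lemma variation:
  fixes p :: "real \<Rightarrow> 'a" and P Q :: "'a \<times> (real \<Rightarrow> 'u)"
  assumes \<beta>: "\<beta> > 0" and P: "control (snd P)" and Q: "control (snd Q)" and near: "near \<eta> \<delta>" and \<eta>: "\<eta> \<ge> 0"
    and Pr: "process_dist (xs t0, us) P \<le> r" and Qr: "process_dist (xs t0, us) Q \<le> r" and r: "C2 * r \<le> \<delta>"
    and d: "\<beta> * (C3 * process_dist P Q) \<le> 1"
    and w: "\<And>i. i \<in> I \<Longrightarrow> w i = exp (\<beta> * val s i P) / weight_total s \<beta> P"
    and \<omega>: "\<And>j t. j \<in> {1..l} \<Longrightarrow> t \<in> {t0..t1} \<Longrightarrow> \<omega> j t = exp (\<beta> * gval j P t) / weight_total s \<beta> P"
    and \<alpha>: "\<alpha> = (\<Sum>i\<in>I. w i *\<^sub>R a i)"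
    and pb: "bmeas t0 t1 p"
    and p: "\<And>t. t \<in> {t0..t1} \<Longrightarrow> p t = - fst (snd \<alpha>) + integral {t..t1} (\<lambda>s. adj s (p s, - snd (snd \<alpha>)))
          - integral {t..t1} (\<lambda>s. \<Sum>j\<in>{1..l}. \<omega> j s *\<^sub>R G j s)"
    and CP: "\<And>t. t \<in> {t0..t1} \<Longrightarrow> norm (p t, - snd (snd \<alpha>)) \<le> CP"
  shows "smooth_violation s \<beta> Q - smooth_violation s \<beta> P
     \<le> (fst \<alpha> - p t0) \<bullet> (fst Q - fst P)
      - integral {t0..t1} (\<lambda>s. (p s, - snd (snd \<alpha>)) \<bullet> (\<Phi> s (xs s) (snd Q s) - \<Phi> s (xs s) (snd P s)))
      + \<eta> * (C2 * process_dist P Q) + \<beta> * (C3 * process_dist P Q)\<^sup>2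
      + CP * (\<eta> * (C1 * process_dist P Q) * (t1 - t0)
          + 2 * B * (C1 * process_dist P Q) * control_dist (snd P) us
          + 4 * B * (C1 * r) * control_dist (snd P) (snd Q))"
proof -
  let ?d = "process_dist P Q"
  define x where "x = traj (fst Q) (snd Q)"
  define y where "y = traj (fst P) (snd P)"
  define eQ where "eQ = endpoints (fst Q) (snd Q)"
  define eP where "eP = endpoints (fst P) (snd P)"
  define lam where "lam = snd (snd \<alpha>)"
  define m where "m = (\<lambda>s. \<Sum>j\<in>{1..l}. \<omega> j s *\<^sub>R G j s)"
  have d0: "?d \<ge> 0" by (rule process_dist_nonneg)
  have r0: "r \<ge> 0" using Pr process_dist_nonneg order_trans by blast
  have C1r: "C1 * r \<le> C2 * r" using C2 r0 by (intro mult_right_mono) auto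
  have C1d: "C1 * ?d \<le> C2 * ?d" using C2 d0 by (intro mult_right_mono) auto
  have gc: "\<And>j. j \<in> {1..l} \<Longrightarrow> continuous_on {t0..t1} (gval j P)" using gval_continuous P by blast
  have gcQ: "\<And>j. j \<in> {1..l} \<Longrightarrow> continuous_on {t0..t1} (gval j Q)" using gval_continuous Q by blast
  have tot: "weight_total s \<beta> P > 0" by (rule weight_total_pos[OF \<beta> P])
  have \<omega>c: "continuous_on {t0..t1} (\<omega> j)" if j: "j \<in> {1..l}" for j
  proof (rule continuous_on_eq)
    show "continuous_on {t0..t1} (\<lambda>t. exp (\<beta> * gval j P t) / weight_total s \<beta> P)"
      using tot by (intro continuous_intros gc j) auto
  qed (use \<omega> j in auto)
  have \<omega>b: "bmeas t0 t1 (\<omega> j)" if "j \<in> {1..l}" for j by (rule bmeas_continuous[OF \<omega>c[OF that]])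
  have Gb: "bmeas t0 t1 (G j)" if "j \<in> {1..l}" for j by (rule bmeas_continuous[OF G_continuous[OF that]])
  have mb: "bmeas t0 t1 m" unfolding m_def by (intro bmeas_sum bmeas_scaleR \<omega>b Gb)
  have xr: "norm (x t - xs t) \<le> C1 * r" if t: "t \<in> {t0..t1}" for t
  proof -
    have "norm (x t - xs t) \<le> C1 * process_dist Q (xs t0, us)"
      using traj_diff[OF Q control_us t, of "fst Q" "xs t0"] traj_xs[OF t] by (simp add: x_def)
    also have "\<dots> \<le> C1 * r" using Qr C1 by (intro mult_left_mono) (auto simp: process_dist_commute)
    finally show ?thesis .
  qed
  have yr: "norm (y t - xs t) \<le> C1 * r" if t: "t \<in> {t0..t1}" for t
  proof -
    have "norm (y t - xs t) \<le> C1 * process_dist P (xs t0, us)"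
      using traj_diff[OF P control_us t, of "fst P" "xs t0"] traj_xs[OF t] by (simp add: y_def)
    also have "\<dots> \<le> C1 * r" using Pr C1 by (intro mult_left_mono) (auto simp: process_dist_commute)
    finally show ?thesis .
  qed
  have z: "norm (x t - y t) \<le> C1 * ?d" if t: "t \<in> {t0..t1}" for t
    using traj_diff[OF Q P t, of "fst Q" "fst P"] by (simp add: x_def y_def process_dist_commute)
  have eQr: "norm (eQ - endpoints (xs t0) us) \<le> \<delta>"
  proof -
    have "norm (eQ - endpoints (xs t0) us) \<le> C2 * process_dist Q (xs t0, us)"
      using endpoints_diff[OF Q control_us, of "fst Q" "xs t0"] by (simp add: eQ_def)
    also have "\<dots> \<le> C2 * r" using Qr C2 by (intro mult_left_mono) (auto simp: process_dist_commute)
    finally show ?thesis using r by simp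
  qed
  have ePr: "norm (eP - endpoints (xs t0) us) \<le> \<delta>"
  proof -
    have "norm (eP - endpoints (xs t0) us) \<le> C2 * process_dist P (xs t0, us)"
      using endpoints_diff[OF P control_us, of "fst P" "xs t0"] by (simp add: eP_def)
    also have "\<dots> \<le> C2 * r" using Pr C2 by (intro mult_left_mono) (auto simp: process_dist_commute)
    finally show ?thesis using r by simp
  qed
  have ed: "norm (eQ - eP) \<le> C2 * ?d"
    using endpoints_diff[OF Q P, of "fst Q" "fst P"] by (simp add: eQ_def eP_def process_dist_commute)
  have "smooth_violation s \<beta> Q - smooth_violation s \<beta> P
    \<le> (\<Sum>i\<in>I. w i * (a i \<bullet> (eQ - eP) + \<eta> * (C2 * ?d)))
      + (\<Sum>j\<in>{1..l}. integral {t0..t1} (\<lambda>t. \<omega> j t * (G j t \<bullet> (x t - y t) + \<eta> * (C2 * ?d)))) + \<beta> * (C3 * ?d)\<^sup>2"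
  proof -
    have "smooth_violation s \<beta> Q - smooth_violation s \<beta> P
    \<le> (\<Sum>i\<in>I. exp (\<beta> * val s i P) / weight_total s \<beta> P * (a i \<bullet> (eQ - eP) + \<eta> * (C2 * ?d)))
      + (\<Sum>j\<in>{1..l}. integral {t0..t1} (\<lambda>t. exp (\<beta> * gval j P t) / weight_total s \<beta> P * (G j t \<bullet> (x t - y t) + \<eta> * (C2 * ?d)))) + \<beta> * (C3 * ?d)\<^sup>2"
      unfolding smooth_violation_def weight_total_def
    proof (rule ln_exp_total_diff_le[OF I t01 \<beta> gc gcQ])
      show "\<bar>val s i Q - val s i P\<bar> \<le> C3 * ?d" if "i \<in> I" for i
        using val_diff[OF that P Q, of s] by (simp add: abs_minus_commute)
      show "\<bar>gval j Q t - gval j P t\<bar> \<le> C3 * ?d" if "j \<in> {1..l}" "t \<in> {t0..t1}" for j t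
        using gval_diff[OF that P Q] by (simp add: abs_minus_commute)
      show "val s i Q - val s i P \<le> a i \<bullet> (eQ - eP) + \<eta> * (C2 * ?d)" if "i \<in> I" for i
      proof -
        have "\<bar>\<psi> i eQ - \<psi> i eP - a i \<bullet> (eQ - eP)\<bar> \<le> \<eta> * norm (eQ - eP)"
          using near that eQr ePr unfolding near_def by blast
        also have "\<dots> \<le> \<eta> * (C2 * ?d)" using ed \<eta> by (intro mult_left_mono)
        finally show ?thesis by (simp add: val_def eQ_def eP_def)
      qed
      show "gval j Q t - gval j P t \<le> G j t \<bullet> (x t - y t) + \<eta> * (C2 * ?d)" if "j \<in> {1..l}" "t \<in> {t0..t1}" for j t
      proof -
        have "norm (x t - xs t) \<le> \<delta>" "norm (y t - xs t) \<le> \<delta>" using xr yr that C1r r by fastforce+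
        then have "\<bar>g j t (x t) - g j t (y t) - G j t \<bullet> (x t - y t)\<bar> \<le> \<eta> * norm (x t - y t)"
          using near that unfolding near_def by blast
        also have "\<dots> \<le> \<eta> * (C2 * ?d)" using z[OF that(2)] C1d \<eta> by (intro mult_left_mono) auto
        finally show ?thesis by (simp add: gval_def x_def y_def)
      qed
      show "continuous_on {t0..t1} (\<lambda>t. G j t \<bullet> (x t - y t) + \<eta> * (C2 * ?d))" if "j \<in> {1..l}" for j
        unfolding x_def y_def by (intro continuous_intros G_continuous that traj_continuous P Q)
    qed (use d in auto)
    also have "(\<Sum>j\<in>{1..l}. integral {t0..t1} (\<lambda>t. exp (\<beta> * gval j P t) / weight_total s \<beta> P * (G j t \<bullet> (x t - y t) + \<eta> * (C2 * ?d))))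
      = (\<Sum>j\<in>{1..l}. integral {t0..t1} (\<lambda>t. \<omega> j t * (G j t \<bullet> (x t - y t) + \<eta> * (C2 * ?d))))"
      by (intro sum.cong refl Henstock_Kurzweil_Integration.integral_cong) (simp add: \<omega>)
    finally show ?thesis by (simp add: w)
  qed
  also have "(\<Sum>i\<in>I. w i * (a i \<bullet> (eQ - eP) + \<eta> * (C2 * ?d)))
      + (\<Sum>j\<in>{1..l}. integral {t0..t1} (\<lambda>t. \<omega> j t * (G j t \<bullet> (x t - y t) + \<eta> * (C2 * ?d))))
      = \<alpha> \<bullet> (eQ - eP) + integral {t0..t1} (\<lambda>t. m t \<bullet> (x t - y t)) + \<eta> * (C2 * ?d)"
  proof -
    have xyb: "bmeas t0 t1 (\<lambda>t. x t - y t)"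
      unfolding x_def y_def by (intro bmeas_diff bmeas_traj P Q)
    have 1: "(\<Sum>i\<in>I. w i * (a i \<bullet> (eQ - eP) + \<eta> * (C2 * ?d))) = \<alpha> \<bullet> (eQ - eP) + (\<Sum>i\<in>I. w i) * (\<eta> * (C2 * ?d))"
      by (simp add: \<alpha> inner_sum_left distrib_left sum.distrib sum_distrib_right)
    have 2: "integral {t0..t1} (\<lambda>t. \<omega> j t * (G j t \<bullet> (x t - y t) + \<eta> * (C2 * ?d)))
       = integral {t0..t1} (\<lambda>t. \<omega> j t * (G j t \<bullet> (x t - y t))) + integral {t0..t1} (\<omega> j) * (\<eta> * (C2 * ?d))"
      if j: "j \<in> {1..l}" for j
    proof -
      have "integral {t0..t1} (\<lambda>t. \<omega> j t * (G j t \<bullet> (x t - y t) + \<eta> * (C2 * ?d)))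
         = integral {t0..t1} (\<lambda>t. \<omega> j t * (G j t \<bullet> (x t - y t)) + \<omega> j t * (\<eta> * (C2 * ?d)))"
        by (simp add: distrib_left)
      also have "\<dots> = integral {t0..t1} (\<lambda>t. \<omega> j t * (G j t \<bullet> (x t - y t))) + integral {t0..t1} (\<lambda>t. \<omega> j t * (\<eta> * (C2 * ?d)))"
        by (intro Henstock_Kurzweil_Integration.integral_add bmeas_integrable[of t0 t1] bmeas_mult bmeas_inner
            bmeas_const \<omega>b Gb xyb j subset_refl)
      finally show ?thesis by simp
    qed
    have 3: "integral {t0..t1} (\<lambda>t. m t \<bullet> (x t - y t)) = (\<Sum>j\<in>{1..l}. integral {t0..t1} (\<lambda>t. \<omega> j t * (G j t \<bullet> (x t - y t))))"
      unfolding m_def inner_sum_left inner_scaleR_left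
      by (intro Henstock_Kurzweil_Integration.integral_sum bmeas_integrable[of t0 t1] bmeas_mult bmeas_inner \<omega>b Gb xyb) auto
    \<comment> \<open>The weights have total mass 1, so the linearisation errors of all constraints
      add up to a single \<open>\<eta> * (C2 * ?d)\<close>.\<close>
    have 4: "(\<Sum>i\<in>I. w i) + (\<Sum>j\<in>{1..l}. integral {t0..t1} (\<omega> j)) = 1"
    proof -
      have "integral {t0..t1} (\<omega> j) = integral {t0..t1} (\<lambda>t. exp (\<beta> * gval j P t) / weight_total s \<beta> P)" if "j \<in> {1..l}" for j
        by (rule Henstock_Kurzweil_Integration.integral_cong, rule \<omega>[OF that])
      then show ?thesis
        using exp_total_weights[OF I t01 \<beta> gc, where y = "\<lambda>i. val s i P"] by (simp add: w weight_total_def)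
    qed
    have "(\<Sum>j\<in>{1..l}. integral {t0..t1} (\<lambda>t. \<omega> j t * (G j t \<bullet> (x t - y t) + \<eta> * (C2 * ?d))))
       = integral {t0..t1} (\<lambda>t. m t \<bullet> (x t - y t)) + (\<Sum>j\<in>{1..l}. integral {t0..t1} (\<omega> j)) * (\<eta> * (C2 * ?d))"
      unfolding 3 by (simp add: 2 sum.distrib sum_distrib_right)
    then show ?thesis
      unfolding 1 using arg_cong[OF 4, of "\<lambda>q. q * (\<eta> * (C2 * ?d))"] by (simp add: distrib_right)
  qed
  \<comment> \<open>Duality exchanges the terms at the final time, the cost and the state
    constraints for an integral of \<open>\<Phi>\<close>; its nonlinear remainder is estimated
    afterwards.\<close>
  also have "\<alpha> \<bullet> (eQ - eP) + integral {t0..t1} (\<lambda>t. m t \<bullet> (x t - y t))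
     = (fst \<alpha> - p t0) \<bullet> (fst Q - fst P)
       - integral {t0..t1} (\<lambda>s. (p s, - lam) \<bullet> (\<Phi> s (x s) (snd Q s) - \<Phi> s (y s) (snd P s) - D s (x s - y s)))"
  proof -
    have J: "snd (snd (eQ - eP)) = integral {t0..t1} (\<lambda>s. snd (\<Phi> s (x s) (snd Q s) - \<Phi> s (y s) (snd P s)))"
      unfolding eQ_def eP_def endpoints_def x_def y_def
      by (simp add: Henstock_Kurzweil_Integration.integral_diff bmeas_integrable[OF bmeas_snd[OF bmeas_\<Phi>_traj]] P Q)
    have "\<alpha> \<bullet> (eQ - eP) = fst \<alpha> \<bullet> (fst Q - fst P) + (fst (snd \<alpha>) \<bullet> (x t1 - y t1) + lam * snd (snd (eQ - eP)))"
      by (simp add: inner_prod_def eQ_def eP_def endpoints_def x_def y_def lam_def)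
    moreover have "fst (snd \<alpha>) \<bullet> (x t1 - y t1) + lam * snd (snd (eQ - eP)) + integral {t0..t1} (\<lambda>s. m s \<bullet> (x s - y s))
      = - (p t0 \<bullet> (fst Q - fst P)) - integral {t0..t1} (\<lambda>s. (p s, - lam) \<bullet> (\<Phi> s (x s) (snd Q s) - \<Phi> s (y s) (snd P s) - D s (x s - y s)))"
      unfolding J unfolding x_def y_def
      by (rule duality[OF Q P mb _ pb]) (simp only: lam_def m_def p)
    ultimately show ?thesis by (simp add: inner_diff_left)
  qed
  finally have main: "smooth_violation s \<beta> Q - smooth_violation s \<beta> P \<le> (fst \<alpha> - p t0) \<bullet> (fst Q - fst P)
       - integral {t0..t1} (\<lambda>s. (p s, - lam) \<bullet> (\<Phi> s (x s) (snd Q s) - \<Phi> s (y s) (snd P s) - D s (x s - y s)))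
       + \<eta> * (C2 * ?d) + \<beta> * (C3 * ?d)\<^sup>2" .
  have "- integral {t0..t1} (\<lambda>s. (p s, - lam) \<bullet> (\<Phi> s (x s) (snd Q s) - \<Phi> s (y s) (snd P s) - D s (x s - y s)))
     \<le> - integral {t0..t1} (\<lambda>s. (p s, - lam) \<bullet> (\<Phi> s (xs s) (snd Q s) - \<Phi> s (xs s) (snd P s)))
       + CP * (\<eta> * (C1 * ?d) * (t1 - t0) + 2 * B * (C1 * ?d) * control_dist (snd P) us + 4 * B * (C1 * r) * control_dist (snd P) (snd Q))"
  proof -
    have nearC1: "norm (\<Phi> t x (us t) - \<Phi> t y (us t) - D t (x - y)) \<le> \<eta> * norm (x - y)"
      if "t \<in> {t0..t1}" "norm (x - xs t) \<le> C1 * r" "norm (y - xs t) \<le> C1 * r" for t x y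
    proof -
      have "norm (x - xs t) \<le> \<delta>" "norm (y - xs t) \<le> \<delta>" using that C1r r by linarith+
      then show ?thesis using near that(1) unfolding near_def by blast
    qed
    have "bmeas t0 t1 (\<lambda>s. (p s, - lam))" by (intro bmeas_pair pb bmeas_const)
    then have "\<bar>integral {t0..t1} (\<lambda>s. (p s, - lam) \<bullet> (\<Phi> s (x s) (snd Q s) - \<Phi> s (y s) (snd P s) - D s (x s - y s)))
      - integral {t0..t1} (\<lambda>s. (p s, - lam) \<bullet> (\<Phi> s (xs s) (snd Q s) - \<Phi> s (xs s) (snd P s)))\<bar>
      \<le> CP * (\<eta> * (C1 * ?d) * (t1 - t0) + 2 * B * (C1 * ?d) * control_dist (snd P) us + 4 * B * (C1 * r) * control_dist (snd P) (snd Q))"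
      unfolding x_def y_def
      by (rule residual_bound[OF P Q _ _ nearC1 xr[unfolded x_def] yr[unfolded y_def] z[unfolded x_def y_def] \<eta>])
        (use CP in \<open>auto simp: lam_def\<close>)
    then show ?thesis by linarith
  qed
  then show ?thesis using main unfolding lam_def by linarith
qed

section \<open>Almost minimal processes\<close>

text \<open>With shift \<open>\<kappa>\<^sup>2\<close> the reference process has violation at most
  \<open>\<kappa>\<^sup>2\<close>; with slope \<kappa> in Ekeland's principle the point found
  therefore lies within \<kappa>. The factor 7/8 is \<open>1 - \<theta>\<close> for
  \<open>\<theta> = 1/8\<close>. Completeness combines the completeness of the controls with the
  telescoping series of the starting points.\<close>

lemma ekeland_violation:
  assumes \<kappa>: "\<kappa> > 0" "3 * \<kappa> \<le> \<rho>"
  defines "X \<equiv> {p. control (snd p) \<and> process_dist (xs t0, us) p \<le> \<rho>}" and "s \<equiv> \<kappa>\<^sup>2"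
  shows "\<exists>P. control (snd P) \<and> process_dist (xs t0, us) P \<le> \<kappa> \<and> 0 < violation s P \<and> violation s P \<le> \<kappa>\<^sup>2 \<and>
     (\<forall>Q\<in>X. violation s Q \<ge> (7/8) * violation s P - \<kappa> * process_dist P Q)"
proof -
  let ?x0 = "(xs t0, us)"
  have s: "s > 0" using \<kappa> by (simp add: s_def)
  have start: "violation s ?x0 \<le> \<kappa>\<^sup>2"
  proof -
    have "val s i ?x0 \<le> \<kappa>\<^sup>2" if "i \<in> I" for i
    proof -
      have "s * b i \<le> s * 1" using b[OF that] s by (intro mult_left_mono) auto
      then show ?thesis using \<psi>_start[OF that] by (simp add: val_def s_def)
    qed
    moreover have "gval j ?x0 t \<le> \<kappa>\<^sup>2" if "j \<in> {1..l}" "t \<in> {t0..t1}" for j t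
      using g_start[OF that] traj_xs[OF that(2)] by (simp add: gval_def) (meson order_trans zero_le_power2)
    ultimately show ?thesis by (subst violation_le_iff) (auto simp: control_us)
  qed
  have pos: "violation s p > 0" if "p \<in> X" for p
  proof -
    have "(\<exists>i\<in>I. val s i p > 0) \<or> (\<exists>j\<in>{1..l}. \<exists>t\<in>{t0..t1}. gval j p t > 0)"
      using infeasible[OF s, of "snd p" "fst p"] that by (auto simp: X_def val_def gval_def)
    then have "\<not> violation s p \<le> 0"
      using that by (subst violation_le_iff) (auto simp: X_def not_le)
    then show ?thesis by simp
  qed
  have "\<exists>P\<in>X. \<kappa> * process_dist ?x0 P \<le> violation s ?x0 \<and> violation s P \<le> violation s ?x0 \<and>
     (\<forall>Q\<in>X. violation s Q \<ge> (1 - 1/8) * violation s P - \<kappa> * process_dist P Q)"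
  proof (rule ekeland_weak[where F = "violation s"])
    show "?x0 \<in> X" using \<rho> by (simp add: X_def control_us)
    show "process_dist x z \<le> process_dist x y + process_dist y z" if "x \<in> X" "y \<in> X" "z \<in> X" for x y z
      using that by (intro process_dist_triangle) (auto simp: X_def)
    fix q :: "nat \<Rightarrow> 'a \<times> (real \<Rightarrow> 'u)"
    assume qX: "\<And>n. q n \<in> X" and sum: "summable (\<lambda>n. process_dist (q n) (q (Suc n)))"
    have qc: "control (snd (q n))" for n using qX by (simp add: X_def)
    have "summable (\<lambda>n. control_dist (snd (q n)) (snd (q (Suc n))))"
      by (rule summable_comparison_test'[OF sum, of 0]) (auto simp: process_dist_def control_dist_nonneg)
    then obtain u where u: "control u" "(\<lambda>n. control_dist (snd (q n)) u) \<longlonglongrightarrow> 0"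
      using control_complete[of "\<lambda>n. snd (q n)"] qc by blast
    have "summable (\<lambda>n. norm (fst (q (Suc n)) - fst (q n)))"
      by (rule summable_comparison_test'[OF sum, of 0]) (auto simp: process_dist_def control_dist_nonneg norm_minus_commute)
    then have "convergent (\<lambda>n. \<Sum>k<n. fst (q (Suc k)) - fst (q k))"
      by (rule summable_iff_convergent[THEN iffD1, OF summable_norm_cancel])
    then have "convergent (\<lambda>n. fst (q n) - fst (q 0))"
      by (simp only: sum_lessThan_telescope[of "\<lambda>n. fst (q n)"])
    then obtain c where "(\<lambda>n. fst (q n) - fst (q 0)) \<longlonglongrightarrow> c" unfolding convergent_def by blast
    then have "(\<lambda>n. fst (q n) - fst (q 0) + fst (q 0)) \<longlonglongrightarrow> c + fst (q 0)" by (intro tendsto_intros)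
    then have \<xi>: "(\<lambda>n. fst (q n)) \<longlonglongrightarrow> c + fst (q 0)" by simp
    define y where "y = (c + fst (q 0), u)"
    have "(\<lambda>n. norm (fst (q n) - fst y) + control_dist (snd (q n)) (snd y)) \<longlonglongrightarrow> norm (fst y - fst y) + 0"
      by (intro tendsto_add tendsto_norm tendsto_diff tendsto_const) (use \<xi> u(2) in \<open>simp_all add: y_def\<close>)
    then have dl: "(\<lambda>n. process_dist (q n) y) \<longlonglongrightarrow> 0" by (simp add: process_dist_def)
    have yc: "control (snd y)" using u by (simp add: y_def)
    have "process_dist ?x0 y \<le> \<rho>"
    proof (rule LIMSEQ_le_const)
      show "(\<lambda>n. \<rho> + process_dist (q n) y) \<longlonglongrightarrow> \<rho>" using tendsto_add[OF tendsto_const dl] by simp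
      have "process_dist ?x0 y \<le> \<rho> + process_dist (q n) y" for n
        using process_dist_triangle[of ?x0 "q n" y] qX[of n] yc control_us by (simp add: X_def)
      then show "\<exists>N. \<forall>n\<ge>N. process_dist ?x0 y \<le> \<rho> + process_dist (q n) y" by blast
    qed
    then have "y \<in> X" using yc by (simp add: X_def)
    moreover have "(\<lambda>n. violation s (q n)) \<longlonglongrightarrow> violation s y"
    proof (rule LIM_zero_cancel, rule Lim_null_comparison)
      show "\<forall>\<^sub>F n in sequentially. norm (violation s (q n) - violation s y) \<le> C3 * process_dist (q n) y"
        using violation_diff[OF qc yc] by simp
      show "(\<lambda>n. C3 * process_dist (q n) y) \<longlonglongrightarrow> 0" using tendsto_mult_right_zero[OF dl] by simp
    qed
    ultimately show "\<exists>y\<in>X. (\<lambda>n. violation s (q n)) \<longlonglongrightarrow> violation s y" by blast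
  qed (use \<kappa> pos process_dist_nonneg in auto)
  then obtain P where P: "P \<in> X" "\<kappa> * process_dist ?x0 P \<le> violation s ?x0" "violation s P \<le> violation s ?x0"
    "\<And>Q. Q \<in> X \<Longrightarrow> violation s Q \<ge> (7/8) * violation s P - \<kappa> * process_dist P Q" by auto
  have "\<kappa> * process_dist ?x0 P \<le> \<kappa> * \<kappa>" using P(2) start by (simp add: power2_eq_square)
  then have "process_dist ?x0 P \<le> \<kappa>" using \<kappa> by simp
  then show ?thesis using P pos[OF P(1)] start by (intro exI[of _ P]) (auto simp: X_def)
qed

text \<open>Replacing the maximum of the constraint values by its smooth approximation keeps the minimality
  property up to an arbitrarily small error, because \<open>\<beta>\<close> may depend on the violation at the point found
  by Ekeland's principle.\<close>

lemma smooth_minimizer: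
  assumes \<kappa>: "\<kappa> > 0" "3 * \<kappa> \<le> \<rho>"
  shows "\<exists>c>0. \<exists>\<beta>0>0. \<forall>\<beta>\<ge>\<beta>0. \<forall>\<sigma>>0. \<sigma> \<le> c / 16 \<longrightarrow> (\<exists>P. control (snd P) \<and> process_dist (xs t0, us) P \<le> 2 * \<kappa> \<and>
     c / 2 \<le> smooth_violation (\<kappa>\<^sup>2) \<beta> P \<and>
     (\<forall>Q. control (snd Q) \<longrightarrow> process_dist P Q \<le> \<kappa> \<longrightarrow>
        smooth_violation (\<kappa>\<^sup>2) \<beta> Q - smooth_violation (\<kappa>\<^sup>2) \<beta> P \<ge> - \<sigma> - 2 * \<kappa> * process_dist P Q))"
proof -
  let ?x0 = "(xs t0, us)"
  define X where "X = {p. control (snd p) \<and> process_dist ?x0 p \<le> \<rho>}"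
  define s where "s = \<kappa>\<^sup>2"
  obtain P1 where P1: "control (snd P1)" "process_dist ?x0 P1 \<le> \<kappa>" "0 < violation s P1" "violation s P1 \<le> \<kappa>\<^sup>2"
    "\<And>Q. Q \<in> X \<Longrightarrow> violation s Q \<ge> (7/8) * violation s P1 - \<kappa> * process_dist P1 Q"
    using ekeland_violation[OF \<kappa>] unfolding X_def s_def by blast
  define c where "c = violation s P1"
  have c: "c > 0" using P1 by (simp add: c_def)
  obtain \<beta>0 where \<beta>0: "\<beta>0 > 0" "\<And>\<beta> s p. \<beta> \<ge> \<beta>0 \<Longrightarrow> control (snd p) \<Longrightarrow>
      \<bar>smooth_violation s \<beta> p - violation s p\<bar> \<le> c / 16"
    using smooth_violation_close[of "c / 16"] c by auto
  have P1X: "P1 \<in> X" using P1 \<kappa> by (simp add: X_def)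
  have "\<exists>P. control (snd P) \<and> process_dist ?x0 P \<le> 2 * \<kappa> \<and> c / 2 \<le> smooth_violation s \<beta> P \<and>
     (\<forall>Q. control (snd Q) \<longrightarrow> process_dist P Q \<le> \<kappa> \<longrightarrow>
        smooth_violation s \<beta> Q - smooth_violation s \<beta> P \<ge> - \<sigma> - 2 * \<kappa> * process_dist P Q)"
    if \<beta>: "\<beta> \<ge> \<beta>0" and \<sigma>: "\<sigma> > 0" "\<sigma> \<le> c / 16" for \<beta> \<sigma>
  proof -
    \<comment> \<open>Around \<open>P1\<close> the violation falls below 7/8 of \<open>c\<close>
      with slope at most \<kappa>; the penalty slope \<open>2 * \<kappa>\<close> exceeds this, so an
      approximate minimiser of \<open>H\<close> cannot move far from \<open>P1\<close>.\<close>
    define H where "H p = smooth_violation s \<beta> p + 2 * \<kappa> * process_dist P1 p" for p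
    have S: "\<bar>smooth_violation s \<beta> p - violation s p\<bar> \<le> c / 16" if "control (snd p)" for p
      using \<beta>0(2)[OF \<beta> that] .
    have "\<exists>P\<in>X. \<forall>Q\<in>X. H P \<le> H Q + \<sigma>"
    proof (rule sigma_minimizer[where m = "- c / 16"])
      fix p assume p: "p \<in> X"
      have "violation s p \<ge> (7/8) * c - \<kappa> * process_dist P1 p" using P1(5)[OF p] by (simp add: c_def)
      moreover have "0 \<le> \<kappa> * process_dist P1 p" using \<kappa> process_dist_nonneg[of P1 p] by simp
      moreover have "\<bar>smooth_violation s \<beta> p - violation s p\<bar> \<le> c / 16" using p by (intro S) (simp add: X_def)
      ultimately show "- c / 16 \<le> H p" using c unfolding H_def mult.assoc by linarith
    qed (use P1X \<sigma> in auto)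
    then obtain P where P: "P \<in> X" "\<And>Q. Q \<in> X \<Longrightarrow> H P \<le> H Q + \<sigma>" by blast
    have Pc: "control (snd P)" using P by (simp add: X_def)
    have k0: "0 \<le> \<kappa> * process_dist P1 P" using \<kappa> process_dist_nonneg[of P1 P] by simp
    have e1: "smooth_violation s \<beta> P + 2 * (\<kappa> * process_dist P1 P) \<le> smooth_violation s \<beta> P1 + \<sigma>"
      using P(2)[OF P1X] by (simp add: H_def)
    have e2: "violation s P \<ge> (7/8) * c - \<kappa> * process_dist P1 P" using P1(5)[OF P(1)] by (simp add: c_def)
    have "violation s P1 = c" by (simp add: c_def)
    then have e3: "smooth_violation s \<beta> P1 \<le> c + c / 16" using S[OF P1(1)] by linarith
    have e4: "smooth_violation s \<beta> P \<ge> violation s P - c / 16" using S[OF Pc] by linarith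
    \<comment> \<open>In sixteenths of \<open>c\<close>: the upper side is 16 + 1 + 1 and the lower
      side 14 - 1, which leaves 5. Then \<open>low\<close> keeps 14 - 5 - 1 = 8 sixteenths, the
      promised \<open>c / 2\<close>.\<close>
    have kd: "\<kappa> * process_dist P1 P \<le> 5 / 16 * c" using e1 e2 e3 e4 \<sigma> by linarith
    have low: "c / 2 \<le> smooth_violation s \<beta> P" using kd e2 e4 by linarith
    have "\<kappa> * process_dist P1 P \<le> \<kappa> * \<kappa>"
      using kd P1(4) c unfolding c_def[symmetric] power2_eq_square by linarith
    then have "process_dist P1 P \<le> \<kappa>" using \<kappa> by simp
    then have d0: "process_dist ?x0 P \<le> 2 * \<kappa>"
      using process_dist_triangle[of ?x0 P1 P] P1(1,2) Pc control_us by simp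
    have min: "smooth_violation s \<beta> Q - smooth_violation s \<beta> P \<ge> - \<sigma> - 2 * \<kappa> * process_dist P Q"
      if Q: "control (snd Q)" "process_dist P Q \<le> \<kappa>" for Q
    proof -
      have "process_dist ?x0 Q \<le> \<rho>"
        using process_dist_triangle[of ?x0 P Q] Pc Q d0 \<kappa> control_us by simp
      then have "H P \<le> H Q + \<sigma>" using Q by (intro P(2)) (simp add: X_def)
      moreover have "\<kappa> * process_dist P1 Q \<le> \<kappa> * (process_dist P1 P + process_dist P Q)"
        using process_dist_triangle[of P1 P Q] P1(1) Pc Q(1) \<kappa> by (intro mult_left_mono) auto
      ultimately show ?thesis unfolding H_def by (simp add: algebra_simps)
    qed
    show ?thesis using Pc d0 low min by blast
  qed
  then show ?thesis unfolding s_def using c \<beta>0(1) by blast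
qed

end

section \<open>Approximate multipliers\<close>

context constrained_system
begin

text \<open>The clause with \<open>e\<close> is approximate complementary slackness for the endpoint
  constraints without shift. One common point \<open>e\<close> serves all of them: two opposite
  constraints cannot both be positive there, so one of their weights is at most \<epsilon>.\<close>

definition approximate_multipliers ::
  "real \<Rightarrow> ('i \<Rightarrow> real) \<Rightarrow> (nat \<Rightarrow> real \<Rightarrow> real) \<Rightarrow> (real \<Rightarrow> 'a) \<Rightarrow> ('a \<times> 'a \<times> real) \<Rightarrow> bool" where
  "approximate_multipliers \<epsilon> w \<omega> p \<alpha> \<longleftrightarrow>
     (\<forall>i\<in>I. 0 \<le> w i) \<and>
     (\<forall>j\<in>{1..l}. continuous_on {t0..t1} (\<omega> j) \<and> (\<forall>t\<in>{t0..t1}. 0 \<le> \<omega> j t)) \<and>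
     (\<Sum>i\<in>I. w i) + (\<Sum>j\<in>{1..l}. integral {t0..t1} (\<omega> j)) = 1 \<and>
     \<alpha> = (\<Sum>i\<in>I. w i *\<^sub>R a i) \<and>
     bmeas t0 t1 p \<and>
     (\<forall>t\<in>{t0..t1}. p t = - fst (snd \<alpha>) + integral {t..t1} (\<lambda>s. adj s (p s, - snd (snd \<alpha>)))
          - integral {t..t1} (\<lambda>s. \<Sum>j\<in>{1..l}. \<omega> j s *\<^sub>R G j s)) \<and>
     norm (fst \<alpha> - p t0) \<le> \<epsilon> \<and>
     (\<forall>v\<in>V. \<forall>c d. t0 \<le> c \<longrightarrow> c \<le> d \<longrightarrow> d \<le> t1 \<longrightarrow>
        integral {c..d} (\<lambda>s. (p s, - snd (snd \<alpha>)) \<bullet> (\<Phi> s (xs s) v - \<Phi> s (xs s) (us s))) \<le> \<epsilon>) \<and>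
     (\<exists>e. \<forall>i\<in>I. w i \<le> \<epsilon> \<or> b i > 0 \<or> \<psi> i e > 0) \<and>
     (\<forall>j\<in>{1..l}. integral {t0..t1} (\<lambda>t. \<omega> j t * max 0 (- g j t (xs t))) \<le> \<epsilon>)"

text \<open>The constants depend on each other in a fixed order: \<eta> and \<kappa> are set by
  \<epsilon>, the violation \<open>c\<close> by \<kappa>, then \<beta> by \<open>c\<close>, the
  length \<open>h\<close> by \<beta>, the tolerance \<sigma> by \<open>h\<close>, and only then is
  the process \<open>P\<close> chosen. The variation inequality at \<open>P\<close> is tested with
  shifted starting points and with changes of control on short intervals.\<close>

theorem approximate_multipliers_exist:
  assumes \<epsilon>: "\<epsilon> > 0"
  shows "\<exists>w \<omega> p \<alpha>. approximate_multipliers \<epsilon> w \<omega> p \<alpha>"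
proof -
  define T where "T = t1 - t0"
  have T: "T > 0" using t01 by (simp add: T_def)
  \<comment> \<open>\<open>k\<close> and \<open>CP\<close> are the constants of
    \<open>adjoint_bound\<close> for \<open>c1 = c2 = c3 = B\<close>.\<close>
  define k where "k = B + B + B * B * T"
  define CP where "CP = k + B * (2 * (k * T) * exp (2 * B * T)) + B"
  have k0: "k \<ge> 0" unfolding k_def using B T by (intro add_nonneg_nonneg mult_nonneg_nonneg) auto
  have CP0: "CP > 0" unfolding CP_def using k0 B T by (intro add_nonneg_pos add_nonneg_nonneg mult_nonneg_nonneg) auto
  \<comment> \<open>\<open>K1\<close> and \<open>K2\<close> collect the coefficients of \<eta> and
    \<kappa> in the error per unit of \<open>h\<close>. In \<open>K2\<close>, the 4 is 1 from the
    quadratic remainder and 3 from the minimality slack, and 16 = 4 + 12 comes from the two residual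
    terms. \<open>K3\<close> is the cost of exchanging Ekeland's control for
    \<open>us\<close>.\<close>
  define K1 where "K1 = C2 + CP * C1 * T"
  define K2 where "K2 = 4 + 16 * CP * B * C1"
  define K3 where "K3 = 4 * CP * B"
  have K1: "K1 > 0" unfolding K1_def using C2 CP0 C1 T by (intro add_pos_nonneg) auto
  have K2: "K2 > 0" unfolding K2_def using CP0 C1 B by (intro add_pos_nonneg) auto
  have K3: "K3 > 0" unfolding K3_def using CP0 B by simp
  define \<eta> where "\<eta> = \<epsilon> / (4 * ((T + 1) * K1))"
  have \<eta>: "\<eta> > 0" unfolding \<eta>_def using \<epsilon> T K1 by simp
  obtain \<delta> where \<delta>: "\<delta> > 0" "near \<eta> \<delta>" using differentiable[OF \<eta>] unfolding near_def by blast
  \<comment> \<open>The entries provide, in order: room inside the ball of radius \<rho>, validity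
    of \<open>near\<close> for processes within \<open>3 * \<kappa>\<close>, and the three parts of
    the final error.\<close>
  define \<kappa> where "\<kappa> = Min {\<rho> / 3, \<delta> / (3 * C2), \<epsilon> / (4 * ((T + 1) * K2)), \<epsilon> / (4 * K3), \<epsilon> / (4 * (B * C1))}"
  have \<kappa>0: "\<kappa> > 0"
    unfolding \<kappa>_def using \<rho> \<delta> C2 \<epsilon> T K2 K3 B C1 by simp
  have \<kappa>: "\<kappa> \<le> \<rho> / 3" "\<kappa> \<le> \<delta> / (3 * C2)" "\<kappa> \<le> \<epsilon> / (4 * ((T + 1) * K2))" "\<kappa> \<le> \<epsilon> / (4 * K3)" "\<kappa> \<le> \<epsilon> / (4 * (B * C1))"
    unfolding \<kappa>_def by (intro Min_le; simp)+
  have \<kappa>\<rho>: "3 * \<kappa> \<le> \<rho>" using \<kappa>(1) by simp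
  have \<kappa>\<delta>: "C2 * (3 * \<kappa>) \<le> \<delta>" using \<kappa>(2) C2 by (simp add: pos_le_divide_eq algebra_simps)
  have Err: "(T + 1) * (\<eta> * K1 + \<kappa> * K2) \<le> \<epsilon> / 2" "K3 * \<kappa> \<le> \<epsilon> / 4" "B * C1 * (2 * \<kappa>) \<le> \<epsilon> / 2"
  proof -
    have "4 * ((T + 1) * K1) \<noteq> 0" using T K1 by auto
    then have "\<eta> * (4 * ((T + 1) * K1)) = \<epsilon>" unfolding \<eta>_def by (rule nonzero_eq_divide_eq[THEN iffD1, OF _ refl])
    then have "(T + 1) * (\<eta> * K1) = \<epsilon> / 4" by (simp add: algebra_simps)
    moreover have "\<kappa> * (4 * ((T + 1) * K2)) \<le> \<epsilon>" using \<kappa>(3) T K2 by (simp add: pos_le_divide_eq)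
    ultimately show "(T + 1) * (\<eta> * K1 + \<kappa> * K2) \<le> \<epsilon> / 2" by (simp add: algebra_simps)
    show "K3 * \<kappa> \<le> \<epsilon> / 4" using \<kappa>(4) K3 by (simp add: pos_le_divide_eq ac_simps)
    have "0 < 4 * (B * C1)" using B C1 by simp
    then have "\<kappa> * (4 * (B * C1)) \<le> \<epsilon>" using \<kappa>(5) by (simp only: pos_le_divide_eq)
    then show "B * C1 * (2 * \<kappa>) \<le> \<epsilon> / 2" by (simp add: algebra_simps)
  qed
  define s where "s = \<kappa>\<^sup>2"
  obtain c \<beta>0 where c: "c > 0" and \<beta>0: "\<beta>0 > 0" and min: "\<And>\<beta> \<sigma>. \<beta> \<ge> \<beta>0 \<Longrightarrow> \<sigma> > 0 \<Longrightarrow> \<sigma> \<le> c / 16 \<Longrightarrow>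
     \<exists>P. control (snd P) \<and> process_dist (xs t0, us) P \<le> 2 * \<kappa> \<and> c / 2 \<le> smooth_violation s \<beta> P \<and>
     (\<forall>Q. control (snd Q) \<longrightarrow> process_dist P Q \<le> \<kappa> \<longrightarrow>
        smooth_violation s \<beta> Q - smooth_violation s \<beta> P \<ge> - \<sigma> - 2 * \<kappa> * process_dist P Q)"
    using smooth_minimizer[OF \<kappa>0 \<kappa>\<rho>] unfolding s_def by blast
  \<comment> \<open>A bound for the weights of constraints that \<open>P\<close> satisfies;
    integrated against the bound \<open>B\<close> of the state constraints it yields at most
    \<open>\<epsilon> / 2\<close>.\<close>
  define x where "x = \<epsilon> / (2 * (T * B + 1))"
  have TB: "T * B + 1 > 0" using T B by (intro add_nonneg_pos) auto
  have x: "x > 0" using \<epsilon> TB by (simp add: x_def)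
  \<comment> \<open>The smoothed violation at \<open>P\<close> is at least \<open>c / 2\<close>, so
    the denominator of the weights is at least \<open>exp (\<beta> * (c / 2))\<close>; this \<beta>
    makes it at least \<open>1 / x\<close>.\<close>
  define \<beta> where "\<beta> = max \<beta>0 (2 / (c * x))"
  have \<beta>: "\<beta> > 0" "\<beta> \<ge> \<beta>0" using \<beta>0 by (auto simp: \<beta>_def)
  have ex: "exp (- (\<beta> * (c / 2))) \<le> x"
  proof -
    have cx: "c * x > 0" using c x by simp
    have "2 / (c * x) \<le> \<beta>" by (simp add: \<beta>_def)
    then have "2 \<le> \<beta> * (c * x)" using cx by (simp add: pos_divide_le_eq)
    then have "1 / x \<le> \<beta> * (c / 2)" using x by (simp add: pos_divide_le_eq algebra_simps)
    also have "\<dots> \<le> exp (\<beta> * (c / 2))" using exp_ge_add_one_self[of "\<beta> * (c / 2)"] by linarith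
    finally have "1 / x \<le> exp (\<beta> * (c / 2))" .
    then show ?thesis using x by (simp add: exp_minus field_simps)
  qed
  \<comment> \<open>The three entries keep changed processes within the radius of minimality, permit
    the quadratic bound for exp, and make the second-order term at most
    \<open>\<kappa> * h\<close>.\<close>
  define h0 where "h0 = Min {\<kappa>, 1 / (\<beta> * C3), \<kappa> / (\<beta> * C3\<^sup>2)}"
  have h0: "h0 > 0" unfolding h0_def using \<kappa>0 \<beta> C3 by simp
  have h0': "h0 \<le> \<kappa>" "h0 \<le> 1 / (\<beta> * C3)" "h0 \<le> \<kappa> / (\<beta> * C3\<^sup>2)"
    unfolding h0_def by (intro Min_le; simp)+
  obtain N :: nat where N: "T / h0 < N" using reals_Archimedean2 by blast
  have N0: "N > 0" using N T h0 by (metis divide_pos_pos gr0I less_asym of_nat_0)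
  define h where "h = T / N"
  have h: "h > 0" using T N0 by (simp add: h_def)
  have "h \<le> h0" using N h0 N0 by (simp add: h_def field_simps)
  then have hle: "h \<le> \<kappa>" "h \<le> 1 / (\<beta> * C3)" "h \<le> \<kappa> / (\<beta> * C3\<^sup>2)" using h0' by linarith+
  have hb: "\<beta> * (C3 * h) \<le> 1" "\<beta> * (C3\<^sup>2 * h) \<le> \<kappa>"
    using hle(2,3) \<beta> C3 by (simp_all add: pos_le_divide_eq algebra_simps)
  \<comment> \<open>The tolerance is proportional to \<open>h\<close>, so that after division by the
    size of a variation it still counts as an error of order \<kappa>.\<close>
  define \<sigma> where "\<sigma> = min (c / 16) (\<kappa> * h)"
  have \<sigma>: "\<sigma> > 0" "\<sigma> \<le> c / 16" "\<sigma> \<le> \<kappa> * h" using c \<kappa>0 h by (auto simp: \<sigma>_def)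
  obtain P where P: "control (snd P)" "process_dist (xs t0, us) P \<le> 2 * \<kappa>" "c / 2 \<le> smooth_violation s \<beta> P"
    "\<And>Q. control (snd Q) \<Longrightarrow> process_dist P Q \<le> \<kappa> \<Longrightarrow>
        smooth_violation s \<beta> Q - smooth_violation s \<beta> P \<ge> - \<sigma> - 2 * \<kappa> * process_dist P Q"
    using min[OF \<beta>(2) \<sigma>(1,2)] by blast
  define E where "E = weight_total s \<beta> P"
  have E: "E > 0" unfolding E_def by (rule weight_total_pos[OF \<beta>(1) P(1)])
  have Einv: "1 / E \<le> x"
  proof -
    have "\<beta> * (c / 2) \<le> ln E" using P(3) \<beta> unfolding smooth_violation_def E_def by (simp add: pos_le_divide_eq mult.commute)
    then have "exp (\<beta> * (c / 2)) \<le> E" by (simp only: ln_ge_iff[OF E])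
    then have "1 / E \<le> 1 / exp (\<beta> * (c / 2))" by (intro divide_left_mono) (use E in auto)
    also have "\<dots> = exp (- (\<beta> * (c / 2)))" by (simp add: exp_minus field_simps)
    finally show ?thesis using ex by linarith
  qed
  define w where "w i = exp (\<beta> * val s i P) / E" for i
  define \<omega> where "\<omega> j t = exp (\<beta> * gval j P t) / E" for j t
  define \<alpha> where "\<alpha> = (\<Sum>i\<in>I. w i *\<^sub>R a i)"
  define lam where "lam = snd (snd \<alpha>)"
  have w0: "w i \<ge> 0" for i using E by (simp add: w_def)
  have \<omega>0: "\<omega> j t \<ge> 0" for j t using E by (simp add: \<omega>_def)
  have gc: "\<And>j. j \<in> {1..l} \<Longrightarrow> continuous_on {t0..t1} (gval j P)" using gval_continuous P(1) by blast
  have \<omega>c: "continuous_on {t0..t1} (\<omega> j)" if "j \<in> {1..l}" for j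
    unfolding \<omega>_def using E by (intro continuous_intros gc that) auto
  have \<omega>b: "bmeas t0 t1 (\<omega> j)" if "j \<in> {1..l}" for j by (rule bmeas_continuous[OF \<omega>c[OF that]])
  have \<omega>i: "\<omega> j integrable_on {t0..t1}" if "j \<in> {1..l}" for j by (rule bmeas_integrable[OF \<omega>b[OF that]]) auto
  have Gb: "bmeas t0 t1 (G j)" if "j \<in> {1..l}" for j by (rule bmeas_continuous[OF G_continuous[OF that]])
  have one: "(\<Sum>i\<in>I. w i) + (\<Sum>j\<in>{1..l}. integral {t0..t1} (\<omega> j)) = 1"
    using exp_total_weights[OF I t01 \<beta>(1) gc, where y = "\<lambda>i. val s i P"]
    unfolding w_def \<omega>_def E_def weight_total_def .
  have int0: "0 \<le> integral {t0..t1} (\<omega> j)" if "j \<in> {1..l}" for j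
    using \<omega>0 by (intro integral_nonneg \<omega>i that) auto
  have int1: "integral {t0..t1} (\<omega> j) \<le> 1" if "j \<in> {1..l}" for j
  proof -
    have "integral {t0..t1} (\<omega> j) \<le> (\<Sum>j\<in>{1..l}. integral {t0..t1} (\<omega> j))"
      using that int0 by (intro member_le_sum) auto
    moreover have "0 \<le> (\<Sum>i\<in>I. w i)" by (intro sum_nonneg w0)
    ultimately show ?thesis using one by linarith
  qed
  have sums: "(\<Sum>i\<in>I. w i) \<le> 1" "(\<Sum>j\<in>{1..l}. integral {t0..t1} (\<omega> j)) \<le> 1"
    using one sum_nonneg[of I w] w0 sum_nonneg[of "{1..l}" "\<lambda>j. integral {t0..t1} (\<omega> j)"] int0 by (smt (verit))+
  have \<alpha>B: "norm \<alpha> \<le> B"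
  proof -
    have "norm \<alpha> \<le> (\<Sum>i\<in>I. w i * B)"
      unfolding \<alpha>_def
    proof (rule sum_norm_le)
      show "norm (w i *\<^sub>R a i) \<le> w i * B" if "i \<in> I" for i
        using a_bound[OF that] w0[of i] by (simp add: mult_left_mono)
    qed
    also have "\<dots> \<le> 1 * B" unfolding sum_distrib_right[symmetric] using sums B by (intro mult_right_mono) auto
    finally show ?thesis by simp
  qed
  have q1B: "norm (fst (snd \<alpha>)) \<le> B" and lamB: "\<bar>lam\<bar> \<le> B"
    using \<alpha>B norm_fst_le_norm[of "snd \<alpha>"] norm_snd_le_norm[of "snd \<alpha>"] norm_snd_le_norm[of \<alpha>]
    unfolding lam_def real_norm_def[symmetric] by linarith+
  define m where "m = (\<lambda>s. \<Sum>j\<in>{1..l}. \<omega> j s *\<^sub>R G j s)"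
  have mb: "bmeas t0 t1 m" unfolding m_def by (intro bmeas_sum bmeas_scaleR \<omega>b Gb)
  have mi: "m integrable_on {t0..t1}" by (rule bmeas_integrable[OF mb]) auto
  define M where "M t = integral {t..t1} m" for t
  have Mc: "continuous_on {t0..t1} M" unfolding M_def by (rule indefinite_integral_continuous_1'[OF mi])
  have Mb: "bmeas t0 t1 M" by (rule bmeas_continuous[OF Mc])
  have MB: "norm (M t) \<le> B" if t: "t \<in> {t0..t1}" for t
  proof -
    have sub: "{t..t1} \<subseteq> {t0..t1}" using t by auto
    have "norm (M t) \<le> integral {t..t1} (\<lambda>s. \<Sum>j\<in>{1..l}. \<omega> j s * B)"
      unfolding M_def
    proof (rule bmeas_norm_integral_le[OF mb _ sub])
      show "norm (m s) \<le> (\<Sum>j\<in>{1..l}. \<omega> j s * B)" if s: "s \<in> {t..t1}" for s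
        unfolding m_def
      proof (rule sum_norm_le)
        show "norm (\<omega> j s *\<^sub>R G j s) \<le> \<omega> j s * B" if "j \<in> {1..l}" for j
          using G_bound[OF that, of s] s t \<omega>0[of j s] by (simp add: mult_left_mono)
      qed
    qed (intro bmeas_sum bmeas_mult bmeas_const \<omega>b)
    also have "\<dots> \<le> integral {t0..t1} (\<lambda>s. \<Sum>j\<in>{1..l}. \<omega> j s * B)"
      using \<omega>0 B by (intro integral_subset_le sub bmeas_integrable[of t0 t1] bmeas_sum bmeas_mult bmeas_const \<omega>b)
        (auto intro!: sum_nonneg mult_nonneg_nonneg)
    also have "\<dots> = (\<Sum>j\<in>{1..l}. integral {t0..t1} (\<omega> j)) * B"
      by (subst Henstock_Kurzweil_Integration.integral_sum)
        (auto intro!: bmeas_integrable[of t0 t1] bmeas_mult bmeas_const \<omega>b simp: sum_distrib_right)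
    also have "\<dots> \<le> 1 * B" using sums B by (intro mult_right_mono) auto
    finally show ?thesis by simp
  qed
  obtain q where q: "continuous_on {t0..t1} q"
    "\<And>t. t \<in> {t0..t1} \<Longrightarrow> q t = - fst (snd \<alpha>) + integral {t..t1} (\<lambda>s. adj s (q s - M s, - lam))"
    using adjoint_exists[OF Mb, of "- fst (snd \<alpha>)" lam] by blast
  define p where "p t = q t - M t" for t
  have pb: "bmeas t0 t1 p" unfolding p_def by (intro bmeas_diff bmeas_continuous q Mb)
  have p: "p t = - fst (snd \<alpha>) + integral {t..t1} (\<lambda>s. adj s (p s, - lam)) - M t" if "t \<in> {t0..t1}" for t
    using q(2)[OF that] by (simp add: p_def)
  have pCP: "norm (p t, - lam) \<le> CP" if "t \<in> {t0..t1}" for t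
    using adjoint_bound[OF pb MB q1B lamB p that] unfolding CP_def k_def T_def .
  have Plam: "bmeas t0 t1 (\<lambda>s. (p s, - lam))" by (intro bmeas_pair pb bmeas_const)
  define Er where "Er = \<eta> * K1 + \<kappa> * K2"
  have Er0: "Er \<ge> 0" unfolding Er_def using \<eta> K1 \<kappa>0 K2 by simp
  \<comment> \<open>The first-order inequality at \<open>P\<close>: minimality from below against
    \<open>variation\<close> from above, for changes of size at most \<open>h\<close>.\<close>
  have star: "- h * Er \<le> (fst \<alpha> - p t0) \<bullet> (fst Q - fst P)
      - integral {t0..t1} (\<lambda>s. (p s, - lam) \<bullet> (\<Phi> s (xs s) (snd Q s) - \<Phi> s (xs s) (snd P s)))"
    if Q: "control (snd Q)" and dQ: "process_dist P Q \<le> h" for Q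
  proof -
    let ?d = "process_dist P Q"
    have d0: "?d \<ge> 0" by (rule process_dist_nonneg)
    have cd: "control_dist (snd P) us \<le> 2 * \<kappa>"
      using P(2) norm_ge_zero[of "xs t0 - fst P"]
        unfolding process_dist_def fst_conv snd_conv control_dist_commute[of us] by linarith
    have cd2: "control_dist (snd P) (snd Q) \<le> h"
      using dQ norm_ge_zero[of "fst P - fst Q"] unfolding process_dist_def by linarith
    have low: "- \<sigma> - 2 * \<kappa> * ?d \<le> smooth_violation s \<beta> Q - smooth_violation s \<beta> P"
      using P(4)[OF Q] dQ hle(1) by linarith
    have Qr: "process_dist (xs t0, us) Q \<le> 3 * \<kappa>"
      using process_dist_triangle[of "(xs t0, us)" P Q] P Q dQ hle(1) control_us by simp
    have "\<beta> * (C3 * ?d) \<le> \<beta> * (C3 * h)" using dQ \<beta> C3 by (intro mult_left_mono) auto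
    then have bd: "\<beta> * (C3 * ?d) \<le> 1" using hb by linarith
    have "smooth_violation s \<beta> Q - smooth_violation s \<beta> P
     \<le> (fst \<alpha> - p t0) \<bullet> (fst Q - fst P)
      - integral {t0..t1} (\<lambda>s. (p s, - snd (snd \<alpha>)) \<bullet> (\<Phi> s (xs s) (snd Q s) - \<Phi> s (xs s) (snd P s)))
      + \<eta> * (C2 * process_dist P Q) + \<beta> * (C3 * process_dist P Q)\<^sup>2
      + CP * (\<eta> * (C1 * process_dist P Q) * (t1 - t0)
          + 2 * B * (C1 * process_dist P Q) * control_dist (snd P) us
          + 4 * B * (C1 * (3 * \<kappa>)) * control_dist (snd P) (snd Q))"
    proof (rule variation[OF \<beta>(1) P(1) Q \<delta>(2) _ _ Qr \<kappa>\<delta> bd, where w = w and \<omega> = \<omega>])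
      show "process_dist (xs t0, us) P \<le> 3 * \<kappa>" using P(2) \<kappa>0 by simp
      show "p t = - fst (snd \<alpha>) + integral {t..t1} (\<lambda>s. adj s (p s, - snd (snd \<alpha>))) - integral {t..t1} (\<lambda>s. \<Sum>j\<in>{1..l}. \<omega> j s *\<^sub>R G j s)"
        if "t \<in> {t0..t1}" for t
        using p[OF that] unfolding M_def m_def lam_def .
    qed (use \<eta> pb pCP in \<open>simp_all add: w_def \<omega>_def E_def \<alpha>_def lam_def\<close>)
    also have "\<eta> * (C2 * ?d) \<le> \<eta> * (C2 * h)" using dQ \<eta> C2 by (intro mult_left_mono) auto
    also have "\<beta> * (C3 * ?d)\<^sup>2 \<le> \<beta> * (C3 * h)\<^sup>2"
      using dQ d0 \<beta> C3 by (intro mult_left_mono power_mono) auto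
    also have "\<beta> * (C3 * h)\<^sup>2 = (\<beta> * (C3\<^sup>2 * h)) * h" by (simp add: power2_eq_square)
    also have "\<dots> \<le> \<kappa> * h" using hb h by (intro mult_right_mono) auto
    also have "CP * (\<eta> * (C1 * ?d) * (t1 - t0) + 2 * B * (C1 * ?d) * control_dist (snd P) us + 4 * B * (C1 * (3 * \<kappa>)) * control_dist (snd P) (snd Q))
      \<le> CP * (\<eta> * (C1 * h) * (t1 - t0) + 2 * B * (C1 * h) * (2 * \<kappa>) + 4 * B * (C1 * (3 * \<kappa>)) * h)"
    proof (rule mult_left_mono[OF add_mono[OF add_mono]])
      show "\<eta> * (C1 * ?d) * (t1 - t0) \<le> \<eta> * (C1 * h) * (t1 - t0)"
        using dQ C1 \<eta> t01 by (intro mult_right_mono mult_left_mono) auto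
      show "2 * B * (C1 * ?d) * control_dist (snd P) us \<le> 2 * B * (C1 * h) * (2 * \<kappa>)"
        using dQ d0 C1 B cd h control_dist_nonneg by (intro mult_mono mult_left_mono) auto
      show "4 * B * (C1 * (3 * \<kappa>)) * control_dist (snd P) (snd Q) \<le> 4 * B * (C1 * (3 * \<kappa>)) * h"
        using cd2 C1 B \<kappa>0 by (intro mult_left_mono) auto
    qed (use CP0 in auto)
    finally have up: "smooth_violation s \<beta> Q - smooth_violation s \<beta> P
     \<le> (fst \<alpha> - p t0) \<bullet> (fst Q - fst P)
      - integral {t0..t1} (\<lambda>s. (p s, - snd (snd \<alpha>)) \<bullet> (\<Phi> s (xs s) (snd Q s) - \<Phi> s (xs s) (snd P s)))
      + \<eta> * (C2 * h) + \<kappa> * h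
      + CP * (\<eta> * (C1 * h) * (t1 - t0) + 2 * B * (C1 * h) * (2 * \<kappa>) + 4 * B * (C1 * (3 * \<kappa>)) * h)"
      by simp
    have "2 * \<kappa> * ?d \<le> 2 * \<kappa> * h" using dQ \<kappa>0 by simp
    then have low': "- 3 * \<kappa> * h \<le> smooth_violation s \<beta> Q - smooth_violation s \<beta> P"
      using low \<sigma>(3) by simp
    have "h * Er = \<eta> * (C2 * h) + \<kappa> * h
      + CP * (\<eta> * (C1 * h) * (t1 - t0) + 2 * B * (C1 * h) * (2 * \<kappa>) + 4 * B * (C1 * (3 * \<kappa>)) * h) + 3 * \<kappa> * h"
      unfolding Er_def K1_def K2_def T_def by (simp add: algebra_simps)
    then show ?thesis using up low' unfolding lam_def by linarith
  qed
  have Er\<epsilon>: "(T + 1) * Er \<le> \<epsilon> / 2" using Err(1) by (simp add: Er_def)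
  have Er1: "Er \<le> \<epsilon>" "T * Er \<le> \<epsilon> / 2"
  proof -
    have "T * Er \<ge> 0" using T Er0 by simp
    then show "Er \<le> \<epsilon>" "T * Er \<le> \<epsilon> / 2" using Er\<epsilon> Er0 \<epsilon> by (auto simp: algebra_simps)
  qed
  have start: "norm (fst \<alpha> - p t0) \<le> \<epsilon>"
  proof (cases "fst \<alpha> - p t0 = 0")
    case False
    define n where "n = fst \<alpha> - p t0"
    have n: "norm n > 0" using False by (simp add: n_def)
    \<comment> \<open>Only the starting point moves, by \<open>h\<close> against the direction
      \<open>n\<close>; the integral vanishes and \<open>star\<close> reads
      \<open>norm n \<le> Er\<close>.\<close>
    define Q where "Q = (fst P - (h / norm n) *\<^sub>R n, snd P)"
    have "process_dist P Q = h" using h n by (simp add: process_dist_def Q_def)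
    then have "- h * Er \<le> n \<bullet> (fst Q - fst P) - integral {t0..t1} (\<lambda>s. (p s, - lam) \<bullet> (\<Phi> s (xs s) (snd Q s) - \<Phi> s (xs s) (snd P s)))"
      unfolding n_def using P(1) by (intro star) (auto simp: Q_def)
    also have "\<dots> = - (h * norm n)"
      using n by (simp add: Q_def inner_diff_right dot_square_norm power2_eq_square)
    finally have "h * norm n \<le> h * Er" by simp
    then have "norm n \<le> Er" using h by simp
    then show ?thesis using Er1 by (simp add: n_def)
  qed (use \<epsilon> in auto)
  have needle: "integral {c..d} (\<lambda>s. (p s, - lam) \<bullet> (\<Phi> s (xs s) v - \<Phi> s (xs s) (snd P s))) \<le> h * Er"
    if v: "v \<in> V" and cd: "t0 \<le> c" "c \<le> d" "d \<le> t1" "d - c \<le> h" for v c d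
  proof -
    define u where "u t = (if t \<in> {c..<d} then v else snd P t)" for t
    have u: "control u" unfolding u_def by (rule control_needle[OF P(1) v])
    have du: "control_dist (snd P) u \<le> h"
      unfolding u_def using control_dist_needle[OF P(1) v cd(1-3)] cd(4) by linarith
    let ?F = "\<lambda>s. (p s, - lam) \<bullet> (\<Phi> s (xs s) (u s) - \<Phi> s (xs s) (snd P s))"
    have F: "bmeas t0 t1 ?F" by (intro bmeas_inner Plam bmeas_diff bmeas_\<Phi> xs_continuous u P)
    have "- h * Er \<le> - integral {t0..t1} ?F"
      using star[of "(fst P, u)"] u du by (simp add: process_dist_def)
    moreover have "integral {t0..t1} ?F = integral {t0..c} ?F + integral {c..d} ?F + integral {d..t1} ?F"
      using bmeas_integral_combine[OF F, of t0 c d] bmeas_integral_combine[OF F, of t0 d t1] cd by simp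
    \<comment> \<open>The changed control equals \<open>v\<close> at \<open>c\<close> but not at
      \<open>d\<close>, so each of the two integrals that are affected has one exceptional
      point.\<close>
    moreover have "integral {t0..c} ?F = integral {t0..c} (\<lambda>s. 0)"
      by (rule integral_spike[where S = "{c}"]) (auto simp: u_def)
    moreover have "integral {d..t1} ?F = integral {d..t1} (\<lambda>s. 0)"
      by (rule Henstock_Kurzweil_Integration.integral_cong) (auto simp: u_def)
    moreover have "integral {c..d} ?F = integral {c..d} (\<lambda>s. (p s, - lam) \<bullet> (\<Phi> s (xs s) v - \<Phi> s (xs s) (snd P s)))"
      by (rule integral_spike[where S = "{d}"]) (auto simp: u_def)
    ultimately show ?thesis by simp
  qed
  have vV: "control (\<lambda>_. v)" if "v \<in> V" for v using that by (simp add: control_def)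
  have maximum: "integral {c..d} (\<lambda>s. (p s, - lam) \<bullet> (\<Phi> s (xs s) v - \<Phi> s (xs s) (us s))) \<le> \<epsilon>"
    if v: "v \<in> V" and cd: "t0 \<le> c" "c \<le> d" "d \<le> t1" for v c d
  proof -
    let ?F = "\<lambda>s. (p s, - lam) \<bullet> (\<Phi> s (xs s) v - \<Phi> s (xs s) (snd P s))"
    have F: "bmeas t0 t1 ?F" by (intro bmeas_inner Plam bmeas_diff bmeas_\<Phi> xs_continuous vV v P)
    \<comment> \<open>The interval is cut into \<open>N\<close> pieces of length at most
      \<open>h\<close>. Each piece contributes an error \<open>h * Er\<close>, and
      \<open>N * h = T\<close> bounds the total by \<open>T * Er\<close>.\<close>
    define e where "e = (d - c) / N"
    have e: "0 \<le> e" "e \<le> h" "N * e = d - c" using cd N0 by (auto simp: e_def h_def T_def divide_right_mono)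
    have "integral {c..c + k * e} ?F \<le> k * (h * Er)" if "k \<le> N" for k :: nat
      using that
    proof (induction k)
      case (Suc k)
      have "Suc k * e \<le> N * e" using Suc e by (intro mult_right_mono) auto
      then have le: "c + Suc k * e \<le> d" using e by simp
      have k0: "0 \<le> k * e" using e by simp
      have ks: "c + Suc k * e = c + k * e + e" by (simp add: algebra_simps)
      have "integral {c..c + Suc k * e} ?F = integral {c..c + k * e} ?F + integral {c + k * e..c + Suc k * e} ?F"
        using e(1) k0 cd(1,3) le unfolding ks by (intro bmeas_integral_combine[OF F, symmetric]) linarith+
      also have "integral {c + k * e..c + Suc k * e} ?F \<le> h * Er"
        using e(1,2) k0 cd(1,3) le unfolding ks by (intro needle v) linarith+
      finally show ?case using Suc by (simp add: algebra_simps)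
    qed simp
    from this[of N] have 1: "integral {c..d} ?F \<le> T * Er" using e N0 by (simp add: h_def)
    \<comment> \<open>The control of \<open>P\<close> differs from \<open>us\<close> on a set of
      measure at most \<open>2 * \<kappa>\<close>; there the integrand is at most
      \<open>CP * (2 * B)\<close>.\<close>
    let ?R = "\<lambda>s. (p s, - lam) \<bullet> (\<Phi> s (xs s) (snd P s) - \<Phi> s (xs s) (us s))"
    have R: "bmeas t0 t1 ?R" by (intro bmeas_inner Plam bmeas_diff bmeas_\<Phi> xs_continuous control_us P)
    have ind: "bmeas t0 t1 (\<lambda>s. if snd P s = us s then 0 else 1 :: real)" by (intro bmeas_control_diff P control_us)
    have "integral {c..d} ?R \<le> integral {c..d} (\<lambda>s. CP * (2 * B) * (if snd P s = us s then 0 else 1))"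
    proof (rule bmeas_integral_le[OF R])
      fix s assume s: "s \<in> {c..d}"
      then have st: "s \<in> {t0..t1}" using cd by auto
      have "?R s \<le> norm (p s, - lam) * norm (\<Phi> s (xs s) (snd P s) - \<Phi> s (xs s) (us s))" by (rule norm_cauchy_schwarz)
      also have "\<dots> \<le> CP * (2 * B * (if snd P s = us s then 0 else 1))"
        using pCP[OF st] \<Phi>_diff_bound[OF P(1) control_us st, of "xs s" "xs s"] CP0 by (intro mult_mono) auto
      finally show "?R s \<le> CP * (2 * B) * (if snd P s = us s then 0 else 1)" by simp
    qed (use cd in \<open>auto intro!: bmeas_mult bmeas_const ind\<close>)
    also have "\<dots> = CP * (2 * B) * integral {c..d} (\<lambda>s. if snd P s = us s then 0 else 1)" by simp
    also have "\<dots> \<le> CP * (2 * B) * control_dist (snd P) us"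
      unfolding control_dist_def
      using CP0 B cd by (intro mult_left_mono integral_subset_le bmeas_integrable[OF ind]) auto
    also have "\<dots> \<le> CP * (2 * B) * (2 * \<kappa>)"
    proof (intro mult_left_mono)
      show "control_dist (snd P) us \<le> 2 * \<kappa>"
        using P(2) norm_ge_zero[of "xs t0 - fst P"]
        unfolding process_dist_def fst_conv snd_conv control_dist_commute[of us] by linarith
    qed (use CP0 B in auto)
    also have "\<dots> \<le> \<epsilon> / 4" using Err(2) unfolding K3_def by simp
    finally have 2: "integral {c..d} ?R \<le> \<epsilon> / 4" .
    have "integral {c..d} (\<lambda>s. (p s, - lam) \<bullet> (\<Phi> s (xs s) v - \<Phi> s (xs s) (us s))) = integral {c..d} (\<lambda>s. ?F s + ?R s)"
      by (rule Henstock_Kurzweil_Integration.integral_cong) (simp add: inner_diff_right)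
    also have "\<dots> = integral {c..d} ?F + integral {c..d} ?R"
      using cd by (intro Henstock_Kurzweil_Integration.integral_add bmeas_integrable[OF F] bmeas_integrable[OF R]) auto
    finally show ?thesis using 1 2 Er1(2) \<epsilon> by linarith
  qed
  \<comment> \<open>The witness \<open>e\<close> is the endpoint vector of \<open>P\<close>: a
    constraint with nonpositive value there has weight at most \<open>1 / E\<close>.\<close>
  have inactive: "w i \<le> \<epsilon> \<or> b i > 0 \<or> \<psi> i (endpoints (fst P) (snd P)) > 0" if i: "i \<in> I" for i
  proof (cases "val s i P > 0")
    case True
    then show ?thesis using b[OF i] by (cases "b i = 0") (auto simp: val_def)
  next
    case False
    then have "exp (\<beta> * val s i P) \<le> 1" using \<beta> by (simp add: mult_nonneg_nonpos)
    then have "w i \<le> 1 / E" unfolding w_def using E by (intro divide_right_mono) auto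
    also have "\<dots> \<le> x" by (rule Einv)
    also have "x \<le> \<epsilon>" unfolding x_def using \<epsilon> T B TB by (simp add: pos_divide_le_eq)
    finally show ?thesis by simp
  qed
  \<comment> \<open>Where the constraint value along \<open>P\<close> is nonpositive, the density is
    at most \<open>1 / E\<close>. Where it is positive, closeness of the trajectories gives
    \<open>g j t (xs t) \<ge> - B * C1 * (2 * \<kappa>)\<close>, and the density has mass at most
    1.\<close>
  have complementary: "integral {t0..t1} (\<lambda>t. \<omega> j t * max 0 (- g j t (xs t))) \<le> \<epsilon>" if j: "j \<in> {1..l}" for j
  proof -
    have gx: "continuous_on {t0..t1} (\<lambda>t. g j t (xs t))"
    proof (rule continuous_on_eq)
      show "continuous_on {t0..t1} (gval j (xs t0, us))" by (rule gval_continuous[OF j]) (simp add: control_us)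
    qed (simp add: gval_def traj_xs)
    have "integral {t0..t1} (\<lambda>t. \<omega> j t * max 0 (- g j t (xs t))) \<le> integral {t0..t1} (\<lambda>t. x * B + \<omega> j t * (B * C1 * (2 * \<kappa>)))"
    proof (rule bmeas_integral_le[of t0 t1])
      show "bmeas t0 t1 (\<lambda>t. \<omega> j t * max 0 (- g j t (xs t)))"
        by (intro bmeas_mult \<omega>b j bmeas_continuous continuous_intros gx)
      fix t assume t: "t \<in> {t0..t1}"
      have BC: "0 \<le> B * C1 * (2 * \<kappa>)" using B C1 \<kappa>0 by simp
      have xB: "0 \<le> x * B" using x B by simp
      show "\<omega> j t * max 0 (- g j t (xs t)) \<le> x * B + \<omega> j t * (B * C1 * (2 * \<kappa>))"
      proof (cases "gval j P t \<le> 0")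
        case True
        then have "exp (\<beta> * gval j P t) \<le> 1" using \<beta> by (simp add: mult_nonneg_nonpos)
        then have "\<omega> j t \<le> 1 / E" unfolding \<omega>_def using E by (intro divide_right_mono) auto
        then have "\<omega> j t \<le> x" using Einv by linarith
        moreover have "max 0 (- g j t (xs t)) \<le> B" using g_bound[OF j t] B by auto
        ultimately have "\<omega> j t * max 0 (- g j t (xs t)) \<le> x * B" using x by (intro mult_mono) auto
        moreover have "0 \<le> \<omega> j t * (B * C1 * (2 * \<kappa>))" using \<omega>0 BC by simp
        ultimately show ?thesis by linarith
      next
        case False
        have "\<bar>g j t (xs t) - gval j P t\<bar> \<le> B * norm (xs t - traj (fst P) (snd P) t)"
          unfolding gval_def by (rule g_Lipschitz[OF j t])
        also have "norm (xs t - traj (fst P) (snd P) t) \<le> C1 * process_dist (xs t0, us) P"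
          using traj_diff[OF control_us P(1) t, of "xs t0" "fst P"] traj_xs[OF t] by simp
        also have "C1 * process_dist (xs t0, us) P \<le> C1 * (2 * \<kappa>)" using P(2) C1 by (intro mult_left_mono) auto
        finally have "max 0 (- g j t (xs t)) \<le> B * C1 * (2 * \<kappa>)" using False B BC by (simp add: mult.assoc)
        then have "\<omega> j t * max 0 (- g j t (xs t)) \<le> \<omega> j t * (B * C1 * (2 * \<kappa>))" using \<omega>0 by (intro mult_left_mono) auto
        then show ?thesis using xB by linarith
      qed
    qed (intro subset_refl bmeas_add bmeas_mult bmeas_const \<omega>b j)+
    also have "\<dots> = x * B * T + integral {t0..t1} (\<omega> j) * (B * C1 * (2 * \<kappa>))"
      using T by (subst Henstock_Kurzweil_Integration.integral_add)
        (auto intro!: bmeas_integrable[of t0 t1] bmeas_mult bmeas_const \<omega>b[OF j] simp: T_def)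
    also have "\<dots> \<le> \<epsilon> / 2 + 1 * (B * C1 * (2 * \<kappa>))"
    proof (intro add_mono mult_right_mono int1 j)
      have "x * B * T \<le> x * (T * B + 1)" using x by (simp add: algebra_simps)
      also have "\<dots> = \<epsilon> / 2"
      proof -
        have "2 * (T * B + 1) \<noteq> 0" using TB by simp
        then have "x * (2 * (T * B + 1)) = \<epsilon>" unfolding x_def by (rule nonzero_eq_divide_eq[THEN iffD1, OF _ refl])
        then show ?thesis by (simp add: algebra_simps)
      qed
      finally show "x * B * T \<le> \<epsilon> / 2" .
    qed (use B C1 \<kappa>0 in auto)
    finally show ?thesis using Err(3) by simp
  qed
  have "approximate_multipliers \<epsilon> w \<omega> p \<alpha>"
    unfolding approximate_multipliers_def
  proof (intro conjI ballI allI impI)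
    show "p t = - fst (snd \<alpha>) + integral {t..t1} (\<lambda>s. adj s (p s, - snd (snd \<alpha>))) - integral {t..t1} (\<lambda>s. \<Sum>j\<in>{1..l}. \<omega> j s *\<^sub>R G j s)"
      if "t \<in> {t0..t1}" for t
      using p[OF that] unfolding M_def m_def lam_def .
    show "\<exists>e. \<forall>i\<in>I. w i \<le> \<epsilon> \<or> b i > 0 \<or> \<psi> i e > 0" using inactive by blast
    show "integral {c..d} (\<lambda>s. (p s, - snd (snd \<alpha>)) \<bullet> (\<Phi> s (xs s) v - \<Phi> s (xs s) (us s))) \<le> \<epsilon>"
      if "v \<in> V" "t0 \<le> c" "c \<le> d" "d \<le> t1" for v c d
      using maximum[OF that] unfolding lam_def .
  qed (use w0 \<omega>c \<omega>0 one \<alpha>_def pb start complementary in auto)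
  then show ?thesis by blast
qed

end

section \<open>Weak limits of densities on an interval\<close>

definition subprob_density :: "real \<Rightarrow> real \<Rightarrow> (real \<Rightarrow> real) \<Rightarrow> bool" where
  "subprob_density a b w \<longleftrightarrow> continuous_on {a..b} w \<and> (\<forall>t\<in>{a..b}. 0 \<le> w t) \<and> integral {a..b} w \<le> 1"

text \<open>Helly's theorem is available for probability measures, so the missing mass is put, uniformly
  distributed, on the interval \<open>{a - 2..a - 1}\<close>.\<close>

definition pad_density :: "real \<Rightarrow> real \<Rightarrow> (real \<Rightarrow> real) \<Rightarrow> real \<Rightarrow> real" where
  "pad_density a b w s = indicator {a..b} s *\<^sub>R w s + indicator {a - 2..a - 1} s *\<^sub>R (1 - integral {a..b} w)"

definition padded :: "real \<Rightarrow> real \<Rightarrow> (real \<Rightarrow> real) \<Rightarrow> real measure" where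
  "padded a b w = density lborel (\<lambda>s. ennreal (pad_density a b w s))"

lemma pad_density_measurable: "subprob_density a b w \<Longrightarrow> pad_density a b w \<in> borel_measurable borel"
  unfolding pad_density_def subprob_density_def
  by (intro borel_measurable_add borel_measurable_continuous_on_indicator) auto

lemma pad_density_nonneg: "subprob_density a b w \<Longrightarrow> 0 \<le> pad_density a b w s"
  unfolding pad_density_def subprob_density_def by (auto simp: indicator_def)

lemma set_integral_continuous_lborel:
  fixes f :: "real \<Rightarrow> 'a::euclidean_space"
  assumes "continuous_on {c..d} f"
  shows "integrable lborel (\<lambda>s. indicator {c..d} s *\<^sub>R f s)"
    "integral\<^sup>L lborel (\<lambda>s. indicator {c..d} s *\<^sub>R f s) = integral {c..d} f"
proof -
  have "set_integrable lborel {c..d} f"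
    unfolding set_integrable_def using assms by (intro borel_integrable_compact) auto
  then show "integrable lborel (\<lambda>s. indicator {c..d} s *\<^sub>R f s)"
    "integral\<^sup>L lborel (\<lambda>s. indicator {c..d} s *\<^sub>R f s) = integral {c..d} f"
    using set_borel_integral_eq_integral(2)[of "{c..d}" f]
    by (auto simp: set_integrable_def set_lebesgue_integral_def)
qed

lemma sets_padded [simp]: "sets (padded a b w) = sets borel" and space_padded [simp]: "space (padded a b w) = UNIV"
  by (simp_all add: padded_def)

lemma padded_real_distribution:
  assumes "subprob_density a b w"
  shows "real_distribution (padded a b w)"
proof -
  have w: "continuous_on {a..b} w" using assms by (simp add: subprob_density_def)
  have i: "integrable lborel (pad_density a b w)" "integral\<^sup>L lborel (pad_density a b w) = 1"
    unfolding pad_density_def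
    using set_integral_continuous_lborel[OF w]
      set_integral_continuous_lborel[of "a - 2" "a - 1" "\<lambda>_. 1 - integral {a..b} w"] by auto
  have "emeasure (padded a b w) UNIV = (\<integral>\<^sup>+ s. ennreal (pad_density a b w s) \<partial>lborel)"
    unfolding padded_def using pad_density_measurable[OF assms] by (subst emeasure_density) auto
  also have "\<dots> = 1"
    using nn_integral_eq_integral[OF i(1)] pad_density_nonneg[OF assms] i(2) by simp
  finally have "prob_space (padded a b w)" by (intro prob_spaceI) simp
  then show ?thesis by (simp add: real_distribution_def real_distribution_axioms_def)
qed

lemma AE_padded:
  assumes "subprob_density a b w"
  shows "AE s in padded a b w. s \<in> {a - 2..a - 1} \<union> {a..b}"
  unfolding padded_def
proof (subst AE_density)
  show "(\<lambda>s. ennreal (pad_density a b w s)) \<in> borel_measurable lborel"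
    using pad_density_measurable[OF assms] by simp
qed (auto simp: pad_density_def indicator_def)

text \<open>Test functions that vanish up to \<open>a - 1\<close> do not see the padding, so padded
  integrals are integrals of the original density.\<close>

lemma padded_integral:
  fixes F :: "real \<Rightarrow> 'a::euclidean_space"
  assumes w: "subprob_density a b w" and F: "F \<in> borel_measurable borel" "\<And>s. s \<le> a - 1 \<Longrightarrow> F s = 0"
    and cd: "{c..b} \<subseteq> {a..b}" "\<And>s. s \<in> {a..b} \<Longrightarrow> F s = indicator {c..b} s *\<^sub>R h s"
    and h: "continuous_on {a..b} h"
  shows "integral\<^sup>L (padded a b w) F = integral {c..b} (\<lambda>s. w s *\<^sub>R h s)"
proof -
  have "integral\<^sup>L (padded a b w) F = integral\<^sup>L lborel (\<lambda>s. pad_density a b w s *\<^sub>R F s)"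
    unfolding padded_def using F pad_density_measurable[OF w] pad_density_nonneg[OF w]
    by (intro integral_density) auto
  also have "(\<lambda>s. pad_density a b w s *\<^sub>R F s) = (\<lambda>s. indicator {c..b} s *\<^sub>R (w s *\<^sub>R h s))"
  proof
    fix s
    show "pad_density a b w s *\<^sub>R F s = indicator {c..b} s *\<^sub>R (w s *\<^sub>R h s)"
      using F(2)[of s] cd(2)[of s] cd(1) by (auto simp: pad_density_def indicator_def)
  qed
  also have "integral\<^sup>L lborel \<dots> = integral {c..b} (\<lambda>s. w s *\<^sub>R h s)"
    using w h cd(1) unfolding subprob_density_def
    by (intro set_integral_continuous_lborel continuous_intros) (auto intro: continuous_on_subset)
  finally show ?thesis .
qed

text \<open>All padded measures live on one bounded interval and are therefore tight. The left end
  \<open>a - 3\<close> keeps the padding inside a half-open interval.\<close>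

lemma padded_convergent_subsequence:
  fixes w :: "nat \<Rightarrow> real \<Rightarrow> real"
  assumes "\<And>k. subprob_density a b (w k)" "a < b" "strict_mono s"
  shows "\<exists>r \<nu>. strict_mono (r :: nat \<Rightarrow> nat) \<and> real_distribution \<nu> \<and> weak_conv_m (\<lambda>k. padded a b (w ((s \<circ> r) k))) \<nu>"
proof -
  have "tight (\<lambda>k. padded a b (w k))"
    unfolding tight_def
  proof (intro conjI allI impI)
    show rd: "real_distribution (padded a b (w n))" for n by (rule padded_real_distribution[OF assms(1)])
    fix \<epsilon> :: real assume "\<epsilon> > 0"
    have "measure (padded a b (w n)) {a - 3<..b} = 1" for n
    proof -
      interpret real_distribution "padded a b (w n)" by (rule rd)
      have "AE s in padded a b (w n). s \<in> {a - 3<..b}"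
        using AE_padded[OF assms(1)[of n]] by eventually_elim (use \<open>a < b\<close> in auto)
      then show ?thesis by (intro prob_eq_1[THEN iffD2]) auto
    qed
    then show "\<exists>c d. c < d \<and> (\<forall>n. 1 - \<epsilon> < measure (padded a b (w n)) {c<..d})"
      using \<open>\<epsilon> > 0\<close> \<open>a < b\<close> by (intro exI[of _ "a - 3"] exI[of _ b]) auto
  qed
  from tight_imp_convergent_subsubsequence[OF this assms(3)]
  show ?thesis by (simp add: o_def)
qed

text \<open>The truncated distance to the closed support is a bounded continuous test function with
  integral 0 along the sequence, hence also in the limit.\<close>

lemma padded_limit_AE:
  assumes w: "\<And>k. subprob_density a b (w k)" and ab: "a < b" and \<nu>: "real_distribution \<nu>"
    and weak: "weak_conv_m (\<lambda>k. padded a b (w k)) \<nu>"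
  shows "AE s in \<nu>. s \<in> {a - 2..a - 1} \<union> {a..b}"
proof -
  interpret \<nu>: real_distribution \<nu> by (rule \<nu>)
  define K where "K = {a - 2..a - 1} \<union> {a..b}"
  define \<zeta> where "\<zeta> s = min 1 (infdist s K)" for s :: real
  have K: "closed K" "K \<noteq> {}" using ab by (auto simp: K_def)
  have \<zeta>c: "continuous_on UNIV \<zeta>" unfolding \<zeta>_def by (intro continuous_intros)
  have \<zeta>m: "\<zeta> \<in> borel_measurable borel" by (rule borel_measurable_continuous_onI[OF \<zeta>c])
  have \<zeta>0: "0 \<le> \<zeta> s" "\<zeta> s \<le> 1" for s by (auto simp: \<zeta>_def infdist_nonneg)
  have "(\<lambda>k. integral\<^sup>L (padded a b (w k)) \<zeta>) \<longlonglongrightarrow> integral\<^sup>L \<nu> \<zeta>"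
    using \<zeta>c \<zeta>0 by (intro weak_conv_imp_integral_bdd_continuous_conv[OF padded_real_distribution[OF w] \<nu> weak, where B = 1])
      (auto simp: continuous_on_eq_continuous_at)
  moreover have "integral\<^sup>L (padded a b (w k)) \<zeta> = 0" for k
  proof (rule integral_eq_zero_AE)
    show "AE s in padded a b (w k). \<zeta> s = 0"
      using AE_padded[OF w[of k]] by eventually_elim (auto simp: \<zeta>_def K_def)
  qed
  ultimately have "integral\<^sup>L \<nu> \<zeta> = 0" using LIMSEQ_unique[of "\<lambda>_. 0 :: real"] by simp
  moreover have "integrable \<nu> \<zeta>"
    using \<zeta>m \<zeta>0 by (intro \<nu>.integrable_const_bound[where B = 1]) auto
  ultimately have "AE s in \<nu>. \<zeta> s = 0"
    using integral_nonneg_eq_0_iff_AE[of \<nu> \<zeta>] \<zeta>0 by auto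
  then show ?thesis
  proof eventually_elim
    case (elim s)
    then have "infdist s K = 0" by (auto simp: \<zeta>_def min_def split: if_splits)
    then show ?case using in_closed_iff_infdist_zero[OF K, of s] by (simp add: K_def)
  qed
qed

text \<open>Weak convergence extends to bounded functions whose discontinuities are null for the
  limit, so a tail integral converges unless \<nu> has an atom at \<open>t\<close>. At
  \<open>t = a\<close> an atom does no harm: the empty gap between padding and interval has room for
  a continuous cutoff. This exception later saves the transversality condition at
  \<open>t0\<close>.\<close>

lemma padded_limit_integral:
  fixes h :: "real \<Rightarrow> 'a::euclidean_space"
  assumes w: "\<And>k. subprob_density a b (w k)" and ab: "a < b" and \<nu>: "real_distribution \<nu>"
    and weak: "weak_conv_m (\<lambda>k. padded a b (w k)) \<nu>"
    and h: "continuous_on {a..b} h" and t: "t \<in> {a..b}" and atom: "t = a \<or> measure \<nu> {t} = 0"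
  shows "(\<lambda>k. integral {t..b} (\<lambda>s. w k s *\<^sub>R h s)) \<longlonglongrightarrow> (LINT s:{t..b}|\<nu>. h s)"
proof -
  interpret \<nu>: real_distribution \<nu> by (rule \<nu>)
  define cl where "cl s = max a (min b s)" for s
  \<comment> \<open>\<open>h\<close> is extended by clamping and multiplied by a ramp that rises
    from 0 at \<open>a - 1\<close> to 1 at \<open>a\<close>.\<close>
  define H where "H s = max 0 (min 1 (s - a + 1)) *\<^sub>R h (cl s)" for s
  have cl: "cl s \<in> {a..b}" "s \<in> {a..b} \<Longrightarrow> cl s = s" for s using ab by (auto simp: cl_def)
  have clc: "continuous_on UNIV cl" unfolding cl_def by (intro continuous_intros)
  have Hc: "continuous_on UNIV H"
    unfolding H_def using cl by (intro continuous_intros continuous_on_compose2[OF h clc]) auto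
  obtain C where C: "C > 0" "\<And>s. s \<in> {a..b} \<Longrightarrow> norm (h s) \<le> C"
    using bmeas_bound[OF bmeas_continuous[OF h]] by blast
  have HB: "norm (H s) \<le> C" for s
  proof -
    have "norm (H s) \<le> 1 * norm (h (cl s))" unfolding H_def norm_scaleR by (intro mult_right_mono) auto
    then show ?thesis using C(2)[OF cl(1)[of s]] by simp
  qed
  have H0: "H s = 0" if "s \<le> a - 1" for s using that by (simp add: H_def)
  have Hh: "H s = h s" if "s \<in> {a..b}" for s using that cl(2) by (simp add: H_def)
  \<comment> \<open>For \<open>t = a\<close> nothing is cut off and \<open>F\<close> is continuous;
    otherwise the only possible jump is at \<open>t\<close>.\<close>
  define F where "F s = (if t = a \<or> t \<le> s then H s else 0)" for s
  have Fm: "F \<in> borel_measurable borel"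
    unfolding F_def using borel_measurable_continuous_onI[OF Hc] by measurable
  have FB: "norm (F s) \<le> C" for s using HB C by (auto simp: F_def)
  have "\<nu> {s. \<not> isCont F s} = 0"
  proof (cases "t = a")
    case True
    then have "F = H" by (auto simp: F_def)
    then show ?thesis using Hc by (simp add: continuous_on_eq_continuous_at)
  next
    case False
    have "isCont F s" if "s \<noteq> t" for s
    proof (cases "s < t")
      case True
      have "\<forall>\<^sub>F x in nhds s. F x = 0"
        using True False by (intro eventually_nhds[THEN iffD2] exI[of _ "{..<t}"]) (auto simp: F_def)
      then show ?thesis by (simp add: isCont_cong)
    next
      case False
      then have "s > t" using that by simp
      have "\<forall>\<^sub>F x in nhds s. F x = H x"
        using \<open>s > t\<close> by (intro eventually_nhds[THEN iffD2] exI[of _ "{t<..}"]) (auto simp: F_def)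
      moreover have "isCont H s" using Hc by (simp add: continuous_on_eq_continuous_at)
      ultimately show ?thesis by (simp add: isCont_cong)
    qed
    then have "{s. \<not> isCont F s} \<subseteq> {t}" by auto
    moreover have "emeasure \<nu> {t} = 0" using atom False by (simp add: \<nu>.emeasure_eq_measure)
    ultimately show ?thesis by (metis emeasure_mono le_zero_eq \<nu>.events_eq_borel borel_singleton sets.empty_sets)
  qed
  then have "(\<lambda>k. integral\<^sup>L (padded a b (w k)) F) \<longlonglongrightarrow> integral\<^sup>L \<nu> F"
    by (intro weak_conv_imp_bdd_ae_continuous_conv[OF padded_real_distribution[OF w] \<nu> weak _ FB Fm])
  moreover have "integral\<^sup>L (padded a b (w k)) F = integral {t..b} (\<lambda>s. w k s *\<^sub>R h s)" for k
    using t by (intro padded_integral w Fm h) (auto simp: F_def H0 Hh)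
  moreover have "integral\<^sup>L \<nu> F = (LINT s:{t..b}|\<nu>. h s)"
    unfolding set_lebesgue_integral_def
  proof (rule integral_cong_AE)
    show "F \<in> borel_measurable \<nu>" using Fm by simp
    have "(\<lambda>s. indicator {t..b} s *\<^sub>R h s) \<in> borel_measurable borel"
      using t by (intro borel_measurable_continuous_on_indicator continuous_on_subset[OF h]) auto
    then show "(\<lambda>s. indicator {t..b} s *\<^sub>R h s) \<in> borel_measurable \<nu>" by simp
    show "AE s in \<nu>. F s = indicator {t..b} s *\<^sub>R h s"
      using padded_limit_AE[OF w ab \<nu> weak]
      by eventually_elim (use t in \<open>auto simp: F_def H0 Hh\<close>)
  qed
  ultimately show ?thesis by simp
qed

lemma common_subsequence:
  assumes "finite J"
    and ex: "\<And>j s. j \<in> J \<Longrightarrow> strict_mono s \<Longrightarrow> \<exists>r. strict_mono (r :: nat \<Rightarrow> nat) \<and> Q j (s \<circ> r)"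
    and sub: "\<And>j s r. j \<in> J \<Longrightarrow> Q j s \<Longrightarrow> strict_mono (r :: nat \<Rightarrow> nat) \<Longrightarrow> Q j (s \<circ> r)"
    and s: "strict_mono (s :: nat \<Rightarrow> nat)"
  shows "\<exists>r. strict_mono (r :: nat \<Rightarrow> nat) \<and> (\<forall>j\<in>J. Q j (s \<circ> r))"
  using assms(1-3)
proof (induction J rule: finite_induct)
  case empty
  then show ?case by (intro exI[of _ id]) (auto simp: strict_mono_def)
next
  case (insert j J)
  have "\<exists>r. strict_mono r \<and> (\<forall>j\<in>J. Q j (s \<circ> r))"
    by (rule insert.IH) (use insert.prems in blast)+
  then obtain r where r: "strict_mono r" "\<forall>j\<in>J. Q j (s \<circ> r)" by blast
  obtain r' where r': "strict_mono r'" "Q j (s \<circ> r \<circ> r')"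
    using insert.prems(1)[of j "s \<circ> r"] s r strict_mono_o by blast
  have "\<forall>i\<in>J. Q i (s \<circ> r \<circ> r')" using r r' insert.prems(2) by blast
  then have "\<forall>i\<in>insert j J. Q i (s \<circ> (r \<circ> r'))" using r'(2) unfolding comp_assoc by blast
  then show ?case using strict_mono_o[OF r(1) r'(1)] by blast
qed

text \<open>Measurability in \<open>t\<close> is that of a parameter integral with a jointly
  measurable integrand, as in Fubini's theorem.\<close>

lemma interval_integral_tail_measurable:
  fixes h :: "real \<Rightarrow> 'a::euclidean_space"
  assumes \<nu>: "real_distribution \<nu>" and h: "continuous_on {a..b} h" and B: "\<And>t. t \<in> {a..b} \<Longrightarrow> norm (h t) \<le> B"
  shows "bmeas a b (\<lambda>t. LINT s:{t..b}|\<nu>. h s)" "\<And>t. t \<in> {a..b} \<Longrightarrow> norm (LINT s:{t..b}|\<nu>. h s) \<le> B"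
proof -
  interpret \<nu>: real_distribution \<nu> by (rule \<nu>)
  define H where "H s = indicator {a..b} s *\<^sub>R h s" for s
  have Hm: "H \<in> borel_measurable borel"
    unfolding H_def by (intro borel_measurable_continuous_on_indicator h) auto
  have eq: "(LINT s:{t..b}|\<nu>. h s) = (\<integral>s. (if t \<le> s then H s else 0) \<partial>\<nu>)" if "t \<in> {a..b}" for t
    unfolding set_lebesgue_integral_def using that
    by (intro Bochner_Integration.integral_cong) (auto simp: H_def indicator_def)
  have "(\<lambda>(t, s). if t \<le> s then H s else 0) \<in> borel_measurable (borel \<Otimes>\<^sub>M borel)"
    using Hm by measurable
  then have "(\<lambda>(t, s). if t \<le> s then H s else 0) \<in> borel_measurable (borel \<Otimes>\<^sub>M \<nu>)"
    by (simp cong: measurable_cong_sets sets_pair_measure_cong)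
  then have "(\<lambda>t. \<integral>s. (if t \<le> s then H s else 0) \<partial>\<nu>) \<in> borel_measurable borel"
    by (rule \<nu>.borel_measurable_lebesgue_integral)
  then have m: "(\<lambda>t. \<integral>s. (if t \<le> s then H s else 0) \<partial>\<nu>) \<in> borel_measurable (lebesgue_on {a..b})"
    by (intro measurable_restrict_space1 measurable_completion) simp
  show nb: "norm (LINT s:{t..b}|\<nu>. h s) \<le> B" if t: "t \<in> {a..b}" for t
  proof -
    have B0: "B \<ge> 0" using B[OF t] norm_ge_zero order_trans by blast
    have n: "norm (if t \<le> s then H s else 0) \<le> B" for s
      using B[of s] B0 by (auto simp: H_def indicator_def)
    have "(\<lambda>s. if t \<le> s then H s else 0) \<in> borel_measurable borel" using Hm by measurable
    then have i: "integrable \<nu> (\<lambda>s. if t \<le> s then H s else 0)"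
      using n by (intro \<nu>.integrable_const_bound[where B = B]) auto
    have "norm (LINT s:{t..b}|\<nu>. h s) \<le> (\<integral>s. norm (if t \<le> s then H s else 0) \<partial>\<nu>)"
      unfolding eq[OF t] by (rule integral_norm_bound)
    also have "\<dots> \<le> B" using i n by (intro \<nu>.integral_le_const integrable_norm) auto
    finally show ?thesis .
  qed
  show "bmeas a b (\<lambda>t. LINT s:{t..b}|\<nu>. h s)"
  proof (rule bmeas_cong)
    show "bmeas a b (\<lambda>t. \<integral>s. (if t \<le> s then H s else 0) \<partial>\<nu>)"
      using nb eq by (intro bmeasI[OF m, of B]) auto
  qed (simp add: eq)
qed

text \<open>Compactness of \<open>{0..1}\<close> and Helly's theorem, one index after another; both
  kinds of convergence survive further thinning.\<close>

lemma subprob_densities_convergent_subsequence: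
  fixes w :: "nat \<Rightarrow> 'i \<Rightarrow> real" and \<omega> :: "nat \<Rightarrow> nat \<Rightarrow> real \<Rightarrow> real"
  assumes "a < b" "finite I" "finite J" and w: "\<And>k i. i \<in> I \<Longrightarrow> w k i \<in> {0..1}"
    and \<omega>: "\<And>k j. j \<in> J \<Longrightarrow> subprob_density a b (\<omega> k j)"
  shows "\<exists>r w' \<nu>. strict_mono (r :: nat \<Rightarrow> nat) \<and> (\<forall>i\<in>I. (\<lambda>k. w (r k) i) \<longlonglongrightarrow> w' i) \<and>
    (\<forall>j\<in>J. real_distribution (\<nu> j) \<and> weak_conv_m (\<lambda>k. padded a b (\<omega> (r k) j)) (\<nu> j))"
proof -
  have id: "strict_mono (id :: nat \<Rightarrow> nat)" by (simp add: strict_mono_def)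
  have "\<exists>r. strict_mono (r :: nat \<Rightarrow> nat) \<and> (\<forall>i\<in>I. \<exists>x. (\<lambda>k. w ((id \<circ> r) k) i) \<longlonglongrightarrow> x)"
  proof (rule common_subsequence[OF \<open>finite I\<close> _ _ id])
    fix i and s :: "nat \<Rightarrow> nat" assume i: "i \<in> I"
    have "\<forall>k. w (s k) i \<in> {0..1}" using w[OF i] by blast
    then obtain x r where "strict_mono (r :: nat \<Rightarrow> nat)" "((\<lambda>k. w (s k) i) \<circ> r) \<longlonglongrightarrow> x"
      using compact_Icc[of "0 :: real" 1] unfolding compact_def by metis
    then show "\<exists>r. strict_mono r \<and> (\<exists>x. (\<lambda>k. w ((s \<circ> r) k) i) \<longlonglongrightarrow> x)" by (auto simp: o_def)
  next
    fix i and s r :: "nat \<Rightarrow> nat"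
    assume "\<exists>x. (\<lambda>k. w (s k) i) \<longlonglongrightarrow> x" "strict_mono r"
    then show "\<exists>x. (\<lambda>k. w ((s \<circ> r) k) i) \<longlonglongrightarrow> x"
      using LIMSEQ_subseq_LIMSEQ by (fastforce simp: o_def)
  qed
  then obtain r1 where r1: "strict_mono r1" "\<And>i. i \<in> I \<Longrightarrow> \<exists>x. (\<lambda>k. w (r1 k) i) \<longlonglongrightarrow> x" by auto
  have "\<exists>r. strict_mono (r :: nat \<Rightarrow> nat) \<and> (\<forall>j\<in>J. \<exists>\<nu>. real_distribution \<nu> \<and> weak_conv_m (\<lambda>k. padded a b (\<omega> ((r1 \<circ> r) k) j)) \<nu>)"
  proof (rule common_subsequence[OF \<open>finite J\<close> _ _ r1(1)])
    fix j and s :: "nat \<Rightarrow> nat" assume j: "j \<in> J" and s: "strict_mono s"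
    show "\<exists>r. strict_mono r \<and> (\<exists>\<nu>. real_distribution \<nu> \<and> weak_conv_m (\<lambda>k. padded a b (\<omega> ((s \<circ> r) k) j)) \<nu>)"
      using padded_convergent_subsequence[of a b "\<lambda>k. \<omega> k j", OF \<omega>[OF j] \<open>a < b\<close> s] by blast
  next
    fix j and s r :: "nat \<Rightarrow> nat"
    assume *: "\<exists>\<nu>. real_distribution \<nu> \<and> weak_conv_m (\<lambda>k. padded a b (\<omega> (s k) j)) \<nu>" "strict_mono r"
    then obtain \<nu> where \<nu>: "real_distribution \<nu>" "weak_conv_m (\<lambda>k. padded a b (\<omega> (s k) j)) \<nu>" by blast
    have "weak_conv_m (\<lambda>k. padded a b (\<omega> ((s \<circ> r) k) j)) \<nu>"
      unfolding weak_conv_m_def weak_conv_def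
    proof (intro allI impI)
      fix x assume "isCont (cdf \<nu>) x"
      then have "(\<lambda>k. cdf (padded a b (\<omega> (s k) j)) x) \<longlonglongrightarrow> cdf \<nu> x"
        using \<nu>(2) by (simp add: weak_conv_m_def weak_conv_def)
      from LIMSEQ_subseq_LIMSEQ[OF this *(2)]
      show "(\<lambda>k. cdf (padded a b (\<omega> ((s \<circ> r) k) j)) x) \<longlonglongrightarrow> cdf \<nu> x" by (simp add: o_def)
    qed
    then show "\<exists>\<nu>. real_distribution \<nu> \<and> weak_conv_m (\<lambda>k. padded a b (\<omega> ((s \<circ> r) k) j)) \<nu>" using \<nu> by blast
  qed
  then obtain r2 where r2: "strict_mono r2" "\<And>j. j \<in> J \<Longrightarrow> \<exists>\<nu>. real_distribution \<nu> \<and> weak_conv_m (\<lambda>k. padded a b (\<omega> (r1 (r2 k)) j)) \<nu>"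
    by auto
  define r where "r = r1 \<circ> r2"
  have "strict_mono r" unfolding r_def by (rule strict_mono_o[OF r1(1) r2(1)])
  moreover have "\<exists>x. (\<lambda>k. w (r k) i) \<longlonglongrightarrow> x" if "i \<in> I" for i
    using r1(2)[OF that] LIMSEQ_subseq_LIMSEQ[OF _ r2(1)] unfolding r_def by (fastforce simp: o_def)
  then obtain w' where "\<forall>i\<in>I. (\<lambda>k. w (r k) i) \<longlonglongrightarrow> w' i" by metis
  moreover obtain \<nu> where "\<forall>j\<in>J. real_distribution (\<nu> j) \<and> weak_conv_m (\<lambda>k. padded a b (\<omega> (r k) j)) (\<nu> j)"
    using r2(2) unfolding r_def o_def by metis
  ultimately show ?thesis by blast
qed

section \<open>Passage to the limit in the adjoint equation\<close>

context control_system
begin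

text \<open>The difference of two solutions satisfies a backward Gronwall inequality whose
  inhomogeneity \<open>r\<close> is bounded and tends to 0 outside \<open>N\<close>. Its integral
  tends to 0, so at any \<open>t\<close> only the convergence of \<open>M k t\<close> itself
  matters.\<close>

lemma adjoint_limit:
  assumes pb: "\<And>k. bmeas t0 t1 (p k)" and M: "\<And>k. bmeas t0 t1 (M k)" "bmeas t0 t1 M'"
    and MB: "\<And>k t. t \<in> {t0..t1} \<Longrightarrow> norm (M k t - M' t) \<le> C"
    and p: "\<And>k t. t \<in> {t0..t1} \<Longrightarrow> p k t = - q1 k + integral {t..t1} (\<lambda>s. adj s (p k s, - lam k)) - M k t"
    and qb: "bmeas t0 t1 q"
    and q: "\<And>t. t \<in> {t0..t1} \<Longrightarrow> q t = - q1' + integral {t..t1} (\<lambda>s. adj s (q s, - lam')) - M' t"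
    and lims: "q1 \<longlonglongrightarrow> q1'" "lam \<longlonglongrightarrow> lam'" and N: "negligible N"
    and Ml: "\<And>t. t \<in> {t0..t1} - N \<Longrightarrow> (\<lambda>k. M k t) \<longlonglongrightarrow> M' t"
    and t: "t \<in> {t0..t1}" "(\<lambda>k. M k t) \<longlonglongrightarrow> M' t"
  shows "(\<lambda>k. p k t) \<longlonglongrightarrow> q t"
proof -
  define A where "A = (\<lambda>k. norm (q1 k - q1') + B * \<bar>lam k - lam'\<bar> * (t1 - t0))"
  define r where "r k t = A k + norm (M k t - M' t)" for k t
  have "(\<lambda>k. norm (q1 k - q1') + B * \<bar>lam k - lam'\<bar> * (t1 - t0)) \<longlonglongrightarrow> norm (q1' - q1') + B * \<bar>lam' - lam'\<bar> * (t1 - t0)"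
    by (intro tendsto_intros lims)
  then have A: "A \<longlonglongrightarrow> 0" by (simp add: A_def)
  have A0: "A k \<ge> 0" for k unfolding A_def using B t01 by (intro add_nonneg_nonneg mult_nonneg_nonneg) auto
  have rb: "bmeas t0 t1 (r k)" for k unfolding r_def by (intro bmeas_intros M)
  have r0: "r k t \<ge> 0" for k t unfolding r_def using A0 by (intro add_nonneg_nonneg) auto
  have rl: "(\<lambda>k. r k t) \<longlonglongrightarrow> 0" if "(\<lambda>k. M k t) \<longlonglongrightarrow> M' t" for t
  proof -
    have "(\<lambda>k. A k + norm (M k t - M' t)) \<longlonglongrightarrow> 0 + norm (M' t - M' t)" by (intro tendsto_intros A that)
    then show ?thesis by (simp add: r_def)
  qed
  obtain CA where CA: "\<And>k. norm (A k) \<le> CA" using convergent_imp_Bseq[of A] A unfolding convergent_def Bseq_def by blast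
  have "(\<lambda>k. integral {t0..t1} (r k)) \<longlonglongrightarrow> integral {t0..t1} (\<lambda>_. 0 :: real)"
  proof (rule bmeas_dominated_convergence[OF rb bmeas_const _ N])
    show "norm (r k t) \<le> CA + C" if "t \<in> {t0..t1}" for k t
      using MB[OF that, of k] CA[of k] A0[of k] by (simp add: r_def)
  qed (use rl Ml in auto)
  then have ri: "(\<lambda>k. integral {t0..t1} (r k)) \<longlonglongrightarrow> 0" by simp
  have le: "norm (p k t - q t) \<le> r k t + B * (2 * integral {t0..t1} (r k) * exp (2 * B * (t1 - t0)))" for k
  proof (rule gronwall_bmeas[where e = "\<lambda>t. norm (p k t - q t)", OF _ rb])
    fix t assume t: "t \<in> {t0..t1}"
    have sub: "{t..t1} \<subseteq> {t0..t1}" using t by auto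
    have e: "bmeas t0 t1 (\<lambda>s. norm (p k s - q s))" by (intro bmeas_intros pb qb)
    have b1: "bmeas t0 t1 (\<lambda>s. adj s (p k s, - lam k))" "bmeas t0 t1 (\<lambda>s. adj s (q s, - lam'))"
      by (intro bmeas_adj bmeas_intros pb qb)+
    let ?I = "integral {t..t1} (\<lambda>s. adj s (p k s, - lam k) - adj s (q s, - lam'))"
    have "p k t - q t = (q1' - q1 k) + ?I - (M k t - M' t)"
      using p[OF t, of k] q[OF t]
      by (simp add: Henstock_Kurzweil_Integration.integral_diff bmeas_integrable[OF b1(1) sub] bmeas_integrable[OF b1(2) sub])
    then have "norm (p k t - q t) \<le> norm (q1 k - q1') + norm ?I + norm (M k t - M' t)"
      using norm_triangle_ineq4[of "(q1' - q1 k) + ?I" "M k t - M' t"] norm_triangle_ineq[of "q1' - q1 k" ?I]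
      by (simp add: norm_minus_commute)
    also have "norm ?I \<le> integral {t..t1} (\<lambda>s. B * norm (p k s - q s) + B * \<bar>lam k - lam'\<bar>)"
    proof (rule bmeas_norm_integral_le[OF bmeas_diff[OF b1] _ sub])
      fix s assume "s \<in> {t..t1}"
      then have s: "s \<in> {t0..t1}" using t by auto
      have "norm (adj s (p k s, - lam k) - adj s (q s, - lam')) \<le> B * norm (p k s - q s, - lam k - - lam')"
        unfolding adj_diff diff_Pair using adj_bound[OF s] by blast
      also have "\<dots> \<le> B * (norm (p k s - q s) + norm (- lam k - - lam'))"
        using B by (intro mult_left_mono norm_Pair_le) auto
      finally show "norm (adj s (p k s, - lam k) - adj s (q s, - lam')) \<le> B * norm (p k s - q s) + B * \<bar>lam k - lam'\<bar>"
        by (simp add: distrib_left abs_minus_commute)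
    qed (intro bmeas_intros e)
    also have "\<dots> = B * integral {t..t1} (\<lambda>s. norm (p k s - q s)) + B * \<bar>lam k - lam'\<bar> * (t1 - t)"
    proof (subst Henstock_Kurzweil_Integration.integral_add)
      show "(\<lambda>s. B * norm (p k s - q s)) integrable_on {t..t1}"
        by (rule bmeas_integrable[OF _ sub]) (intro bmeas_intros e pb qb)
    qed (use t in auto)
    also have "B * \<bar>lam k - lam'\<bar> * (t1 - t) \<le> B * \<bar>lam k - lam'\<bar> * (t1 - t0)"
      using t B by (intro mult_left_mono) auto
    finally show "norm (p k t - q t) \<le> r k t + B * integral {t..t1} (\<lambda>s. norm (p k s - q s))"
      by (simp add: r_def A_def)
  qed (use B t r0 in \<open>auto intro!: bmeas_intros pb qb\<close>)
  have "(\<lambda>k. r k t + B * (2 * integral {t0..t1} (r k) * exp (2 * B * (t1 - t0)))) \<longlonglongrightarrow> 0 + B * (2 * 0 * exp (2 * B * (t1 - t0)))"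
    by (intro tendsto_intros rl ri t)
  then have "(\<lambda>k. r k t + B * (2 * integral {t0..t1} (r k) * exp (2 * B * (t1 - t0)))) \<longlonglongrightarrow> 0" by simp
  then have "(\<lambda>k. p k t - q t) \<longlonglongrightarrow> 0"
    by (rule Lim_null_comparison[rotated]) (use le in auto)
  then show ?thesis by (rule LIM_zero_cancel)
qed

theorem multiplier_limit:
  fixes w :: "nat \<Rightarrow> 'i \<Rightarrow> real" and \<omega> :: "nat \<Rightarrow> nat \<Rightarrow> real \<Rightarrow> real" and p :: "nat \<Rightarrow> real \<Rightarrow> 'a"
    and \<alpha> :: "nat \<Rightarrow> 'a \<times> 'a \<times> real" and \<Delta> :: "'v \<Rightarrow> real \<Rightarrow> 'a \<times> real"
  assumes I: "finite I" and w0: "\<And>k i. i \<in> I \<Longrightarrow> 0 \<le> w k i"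
    and \<omega>: "\<And>k j. j \<in> {1..l} \<Longrightarrow> continuous_on {t0..t1} (\<omega> k j)" "\<And>k j t. j \<in> {1..l} \<Longrightarrow> t \<in> {t0..t1} \<Longrightarrow> 0 \<le> \<omega> k j t"
    and one: "\<And>k. (\<Sum>i\<in>I. w k i) + (\<Sum>j\<in>{1..l}. integral {t0..t1} (\<omega> k j)) = 1"
    and \<alpha>: "\<And>k. \<alpha> k = (\<Sum>i\<in>I. w k i *\<^sub>R a i)"
    and pb: "\<And>k. bmeas t0 t1 (p k)"
    and p: "\<And>k t. t \<in> {t0..t1} \<Longrightarrow> p k t = - fst (snd (\<alpha> k)) + integral {t..t1} (\<lambda>s. adj s (p k s, - snd (snd (\<alpha> k))))
        - integral {t..t1} (\<lambda>s. \<Sum>j\<in>{1..l}. \<omega> k j s *\<^sub>R G j s)"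
    and start: "\<And>k. norm (fst (\<alpha> k) - p k t0) \<le> \<epsilon> k"
    and max: "\<And>v c d. v \<in> W \<Longrightarrow> t0 \<le> c \<Longrightarrow> c \<le> d \<Longrightarrow> d \<le> t1 \<Longrightarrow>
        \<forall>\<^sub>F k in sequentially. integral {c..d} (\<lambda>s. (p k s, - snd (snd (\<alpha> k))) \<bullet> \<Delta> v s) \<le> \<epsilon> k"
    and \<Delta>: "\<And>v. v \<in> W \<Longrightarrow> bmeas t0 t1 (\<Delta> v)"
    and compl: "\<And>k j. j \<in> {1..l} \<Longrightarrow> integral {t0..t1} (\<lambda>t. \<omega> k j t * max 0 (- \<gamma> j t)) \<le> \<epsilon> k"
    and \<epsilon>: "\<epsilon> \<longlonglongrightarrow> 0" and G: "\<And>j. j \<in> {1..l} \<Longrightarrow> continuous_on {t0..t1} (G j)"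
    and \<gamma>: "\<And>j. j \<in> {1..l} \<Longrightarrow> continuous_on {t0..t1} (\<gamma> j)"
  shows "\<exists>r w' \<nu> q. strict_mono (r :: nat \<Rightarrow> nat) \<and> (\<forall>i\<in>I. 0 \<le> w' i \<and> (\<lambda>k. w (r k) i) \<longlonglongrightarrow> w' i) \<and>
     (\<forall>j\<in>{1..l}. real_distribution (\<nu> j) \<and> measure (\<nu> j) {t \<in> {t0..t1}. \<gamma> j t < 0} = 0) \<and>
     (\<Sum>i\<in>I. w' i) + (\<Sum>j\<in>{1..l}. measure (\<nu> j) {t0..t1}) = 1 \<and> bmeas t0 t1 q \<and>
     (\<forall>t\<in>{t0..t1}. q t = - fst (snd (\<Sum>i\<in>I. w' i *\<^sub>R a i))
        + integral {t..t1} (\<lambda>s. adj s (q s, - snd (snd (\<Sum>i\<in>I. w' i *\<^sub>R a i))))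
        - (\<Sum>j\<in>{1..l}. LINT s:{t..t1}|\<nu> j. G j s)) \<and>
     q t0 = fst (\<Sum>i\<in>I. w' i *\<^sub>R a i) \<and>
     (\<forall>v\<in>W. \<forall>c d. t0 \<le> c \<longrightarrow> c \<le> d \<longrightarrow> d \<le> t1 \<longrightarrow>
        integral {c..d} (\<lambda>s. (q s, - snd (snd (\<Sum>i\<in>I. w' i *\<^sub>R a i))) \<bullet> \<Delta> v s) \<le> 0)"
proof -
  have int0: "0 \<le> integral {t0..t1} (\<omega> k j)" if "j \<in> {1..l}" for k j
    using \<omega> that by (intro integral_nonneg integrable_continuous_interval) auto
  have sums0: "0 \<le> (\<Sum>i\<in>I. w k i)" "0 \<le> (\<Sum>j\<in>{1..l}. integral {t0..t1} (\<omega> k j))" for k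
    by (intro sum_nonneg w0 int0; assumption)+
  have w1: "w k i \<in> {0..1}" if "i \<in> I" for k i
    using member_le_sum[of i I "w k"] w0 I that sums0(2)[of k] one[of k] by fastforce
  have int1: "integral {t0..t1} (\<omega> k j) \<le> 1" if "j \<in> {1..l}" for k j
    using member_le_sum[of j "{1..l}" "\<lambda>j. integral {t0..t1} (\<omega> k j)"] int0[of _ k] that sums0(1)[of k] one[of k] by fastforce
  have sp: "subprob_density t0 t1 (\<omega> k j)" if "j \<in> {1..l}" for k j
    using \<omega> int1 that by (simp add: subprob_density_def)
  obtain r w' \<nu> where r: "strict_mono r" and w': "\<And>i. i \<in> I \<Longrightarrow> (\<lambda>k. w (r k) i) \<longlonglongrightarrow> w' i"
    and \<nu>: "\<And>j. j \<in> {1..l} \<Longrightarrow> real_distribution (\<nu> j)"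
      "\<And>j. j \<in> {1..l} \<Longrightarrow> weak_conv_m (\<lambda>k. padded t0 t1 (\<omega> (r k) j)) (\<nu> j)"
    using subprob_densities_convergent_subsequence[of t0 t1 I "{1..l}" w \<omega>, OF t01 I finite_atLeastAtMost w1 sp] by blast
  have conv: "(\<lambda>k. integral {t..t1} (\<lambda>s. \<omega> (r k) j s *\<^sub>R h s)) \<longlonglongrightarrow> (LINT s:{t..t1}|\<nu> j. h s)"
    if "j \<in> {1..l}" "continuous_on {t0..t1} h" "t \<in> {t0..t1}" "t = t0 \<or> measure (\<nu> j) {t} = 0"
    for j t and h :: "real \<Rightarrow> 'b::euclidean_space"
    using that by (intro padded_limit_integral[where a = t0 and w = "\<lambda>k. \<omega> (r k) j"] sp t01 \<nu>)
  define \<alpha>' where "\<alpha>' = (\<Sum>i\<in>I. w' i *\<^sub>R a i)"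
  define lam where "lam = snd (snd \<alpha>')"
  have \<alpha>l: "(\<lambda>k. \<alpha> (r k)) \<longlonglongrightarrow> \<alpha>'"
    unfolding \<alpha> \<alpha>'_def by (intro tendsto_intros w')
  have \<epsilon>r: "(\<lambda>k. \<epsilon> (r k)) \<longlonglongrightarrow> 0" using LIMSEQ_subseq_LIMSEQ[OF \<epsilon> r] by (simp add: o_def)
  have w'0: "0 \<le> w' i" if "i \<in> I" for i
    using w'[OF that] w0[OF that] by (intro LIMSEQ_le_const) auto
  have mass: "(\<lambda>k. integral {t0..t1} (\<omega> (r k) j)) \<longlonglongrightarrow> measure (\<nu> j) {t0..t1}" if j: "j \<in> {1..l}" for j
  proof -
    interpret \<nu>: real_distribution "\<nu> j" by (rule \<nu>(1)[OF j])
    show ?thesis using conv[OF j, of "\<lambda>_. 1 :: real" t0] t01 by (simp add: set_lebesgue_integral_def)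
  qed
  have "(\<lambda>k. (\<Sum>i\<in>I. w (r k) i) + (\<Sum>j\<in>{1..l}. integral {t0..t1} (\<omega> (r k) j)))
     \<longlonglongrightarrow> (\<Sum>i\<in>I. w' i) + (\<Sum>j\<in>{1..l}. measure (\<nu> j) {t0..t1})"
    by (intro tendsto_intros w' mass)
  then have one': "(\<Sum>i\<in>I. w' i) + (\<Sum>j\<in>{1..l}. measure (\<nu> j) {t0..t1}) = 1"
    unfolding one using LIMSEQ_unique tendsto_const by blast
  have null: "measure (\<nu> j) {t \<in> {t0..t1}. \<gamma> j t < 0} = 0" if j: "j \<in> {1..l}" for j
  proof -
    interpret \<nu>: real_distribution "\<nu> j" by (rule \<nu>(1)[OF j])
    \<comment> \<open>\<open>h\<close> is positive exactly where the constraint is inactive, and its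
      integral against the limit measure is the limit of the slackness errors.\<close>
    define h where "h t = max 0 (- \<gamma> j t)" for t
    have hc: "continuous_on {t0..t1} h" unfolding h_def by (intro continuous_intros \<gamma> j)
    have "(\<lambda>k. integral {t0..t1} (\<lambda>s. \<omega> (r k) j s *\<^sub>R h s)) \<longlonglongrightarrow> (LINT s:{t0..t1}|\<nu> j. h s)"
      using t01 by (intro conv j hc) auto
    moreover have "integral {t0..t1} (\<lambda>s. \<omega> (r k) j s *\<^sub>R h s) \<le> \<epsilon> (r k)" for k
      using compl[OF j, of "r k"] by (simp add: h_def)
    ultimately have le0: "(LINT s:{t0..t1}|\<nu> j. h s) \<le> 0"
      using \<epsilon>r by (intro LIMSEQ_le[of "\<lambda>k. integral {t0..t1} (\<lambda>s. \<omega> (r k) j s *\<^sub>R h s)" _ "\<lambda>k. \<epsilon> (r k)"]) auto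
    define H where "H s = indicator {t0..t1} s *\<^sub>R h s" for s
    have Hm: "H \<in> borel_measurable borel"
      unfolding H_def by (intro borel_measurable_continuous_on_indicator hc) auto
    obtain C where C: "C > 0" "\<And>t. t \<in> {t0..t1} \<Longrightarrow> norm (h t) \<le> C"
      using bmeas_bound[OF bmeas_continuous[OF hc]] by blast
    have H0: "0 \<le> H s" for s by (simp add: H_def h_def)
    have Hi: "integrable (\<nu> j) H"
      using C Hm by (intro \<nu>.integrable_const_bound[where B = C]) (auto simp: H_def indicator_def)
    have "0 \<le> integral\<^sup>L (\<nu> j) H" by (intro Bochner_Integration.integral_nonneg H0)
    then have "integral\<^sup>L (\<nu> j) H = 0"
      using le0 unfolding set_lebesgue_integral_def H_def[symmetric] by linarith
    then have AE: "AE s in \<nu> j. H s = 0" using integral_nonneg_eq_0_iff_AE[OF Hi] H0 by auto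
    have eq: "{t \<in> {t0..t1}. \<gamma> j t < 0} = {s. H s \<noteq> 0}"
      by (auto simp: H_def h_def indicator_def max_def)
    have "{s. H s \<noteq> 0} \<in> sets (\<nu> j)"
    proof -
      have "{s \<in> space borel. H s \<noteq> 0} \<in> sets borel" using Hm by measurable
      then show ?thesis by simp
    qed
    then have "emeasure (\<nu> j) {s. H s \<noteq> 0} = 0"
      using AE AE_iff_measurable[of "{s. H s \<noteq> 0}" "\<nu> j" "\<lambda>s. H s = 0"] by auto
    then show ?thesis unfolding eq by (simp add: measure_def)
  qed
  have "\<exists>C. \<forall>t\<in>{t0..t1}. norm (G j t) \<le> C" if "j \<in> {1..l}" for j
    using bmeas_bound[OF bmeas_continuous[OF G[OF that]]] by metis
  then obtain BG where BG: "\<And>j t. j \<in> {1..l} \<Longrightarrow> t \<in> {t0..t1} \<Longrightarrow> norm (G j t) \<le> BG j" by metis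
  define M where "M k t = (\<Sum>j\<in>{1..l}. integral {t..t1} (\<lambda>s. \<omega> (r k) j s *\<^sub>R G j s))" for k t
  define M' where "M' t = (\<Sum>j\<in>{1..l}. LINT s:{t..t1}|\<nu> j. G j s)" for t
  have \<omega>G: "bmeas t0 t1 (\<lambda>s. \<omega> k j s *\<^sub>R G j s)" if "j \<in> {1..l}" for k j
    by (intro bmeas_continuous continuous_intros \<omega> G that)
  have Mb: "bmeas t0 t1 (M k)" for k
    unfolding M_def
    by (intro bmeas_sum bmeas_continuous indefinite_integral_continuous_1' bmeas_integrable[OF \<omega>G]) auto
  have M'b: "bmeas t0 t1 M'"
    unfolding M'_def by (intro bmeas_sum interval_integral_tail_measurable(1)[OF \<nu>(1) G BG])
  have MB: "norm (M k t) \<le> (\<Sum>j\<in>{1..l}. BG j)" if t: "t \<in> {t0..t1}" for k t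
    unfolding M_def
  proof (rule sum_norm_le)
    fix j assume j: "j \<in> {1..l}"
    have sub: "{t..t1} \<subseteq> {t0..t1}" using t by auto
    have \<omega>b: "bmeas t0 t1 (\<omega> (r k) j)" by (intro bmeas_continuous \<omega> j)
    have BG0: "0 \<le> BG j" using BG[OF j t] norm_ge_zero order_trans by blast
    have "norm (integral {t..t1} (\<lambda>s. \<omega> (r k) j s *\<^sub>R G j s)) \<le> integral {t..t1} (\<lambda>s. \<omega> (r k) j s * BG j)"
    proof (rule bmeas_norm_integral_le[OF \<omega>G[OF j] _ sub])
      show "norm (\<omega> (r k) j s *\<^sub>R G j s) \<le> \<omega> (r k) j s * BG j" if "s \<in> {t..t1}" for s
        using BG[OF j, of s] \<omega>(2)[OF j, of s "r k"] that t by (simp add: mult_left_mono)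
    qed (intro bmeas_mult bmeas_const \<omega>b)
    also have "\<dots> = integral {t..t1} (\<omega> (r k) j) * BG j" by simp
    also have "\<dots> \<le> integral {t0..t1} (\<omega> (r k) j) * BG j"
      using sub BG0 \<omega>(2)[OF j] by (intro mult_right_mono integral_subset_le bmeas_integrable[OF \<omega>b]) auto
    also have "\<dots> \<le> 1 * BG j" using int1[OF j] BG0 by (intro mult_right_mono) auto
    finally show "norm (integral {t..t1} (\<lambda>s. \<omega> (r k) j s *\<^sub>R G j s)) \<le> BG j" by simp
  qed
  have M'B: "norm (M' t) \<le> (\<Sum>j\<in>{1..l}. BG j)" if t: "t \<in> {t0..t1}" for t
    unfolding M'_def
  proof (rule sum_norm_le)
    show "norm (LINT s:{t..t1}|\<nu> j. G j s) \<le> BG j" if j: "j \<in> {1..l}" for j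
      by (rule interval_integral_tail_measurable(2)[OF \<nu>(1)[OF j] G[OF j] BG[OF j] t])
  qed
  \<comment> \<open>The atoms of the limit measures, a countable set; off it and at
    \<open>t0\<close> the tails converge.\<close>
  define N where "N = (\<Union>j\<in>{1..l}. {t. measure (\<nu> j) {t} \<noteq> 0})"
  have N: "negligible N"
    unfolding negligible_iff_null_sets
  proof (intro null_sets_completionI countable_imp_null_set_lborel)
    have "countable {t. measure (\<nu> j) {t} \<noteq> 0}" if "j \<in> {1..l}" for j
    proof -
      interpret \<nu>: real_distribution "\<nu> j" by (rule \<nu>(1)[OF that])
      show ?thesis by (rule \<nu>.countable_support)
    qed
    then show "countable N" unfolding N_def by (intro countable_UN) auto
  qed
  have Ml: "(\<lambda>k. M k t) \<longlonglongrightarrow> M' t" if "t \<in> {t0..t1}" "t = t0 \<or> t \<notin> N" for t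
    unfolding M_def M'_def using that by (intro tendsto_sum conv G) (auto simp: N_def)
  obtain q0 where q0: "continuous_on {t0..t1} q0"
    "\<And>t. t \<in> {t0..t1} \<Longrightarrow> q0 t = - fst (snd \<alpha>') + integral {t..t1} (\<lambda>s. adj s (q0 s - M' s, - lam))"
    using adjoint_exists[OF M'b, of "- fst (snd \<alpha>')" lam] by blast
  define q where "q t = q0 t - M' t" for t
  have qb: "bmeas t0 t1 q" unfolding q_def by (intro bmeas_diff bmeas_continuous q0 M'b)
  have q: "q t = - fst (snd \<alpha>') + integral {t..t1} (\<lambda>s. adj s (q s, - lam)) - M' t" if "t \<in> {t0..t1}" for t
    using q0(2)[OF that] by (simp add: q_def)
  have pk: "p (r k) t = - fst (snd (\<alpha> (r k))) + integral {t..t1} (\<lambda>s. adj s (p (r k) s, - snd (snd (\<alpha> (r k))))) - M k t"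
    if t: "t \<in> {t0..t1}" for k t
  proof -
    have "integral {t..t1} (\<lambda>s. \<Sum>j\<in>{1..l}. \<omega> (r k) j s *\<^sub>R G j s) = M k t"
      unfolding M_def using t by (intro Henstock_Kurzweil_Integration.integral_sum bmeas_integrable[OF \<omega>G]) auto
    then show ?thesis using p[OF t, of "r k"] by simp
  qed
  have pl: "(\<lambda>k. p (r k) t) \<longlonglongrightarrow> q t" if "t \<in> {t0..t1}" "t = t0 \<or> t \<notin> N" for t
  proof (rule adjoint_limit[OF pb Mb M'b _ pk qb q _ _ N Ml that(1) Ml[OF that]])
    show "norm (M k t - M' t) \<le> (\<Sum>j\<in>{1..l}. BG j) + (\<Sum>j\<in>{1..l}. BG j)" if "t \<in> {t0..t1}" for k t
      using MB[OF that, of k] M'B[OF that] norm_triangle_ineq4[of "M k t" "M' t"] by linarith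
    show "(\<lambda>k. fst (snd (\<alpha> (r k)))) \<longlonglongrightarrow> fst (snd \<alpha>')" by (intro tendsto_intros \<alpha>l)
    show "(\<lambda>k. snd (snd (\<alpha> (r k)))) \<longlonglongrightarrow> lam" unfolding lam_def by (intro tendsto_intros \<alpha>l)
  qed auto
  have q0eq: "q t0 = fst \<alpha>'"
  proof -
    have "(\<lambda>k. norm (fst (\<alpha> (r k)) - p (r k) t0)) \<longlonglongrightarrow> norm (fst \<alpha>' - q t0)"
      using t01 by (intro tendsto_intros \<alpha>l pl) auto
    then have "norm (fst \<alpha>' - q t0) \<le> 0"
      using start \<epsilon>r by (intro LIMSEQ_le[of "\<lambda>k. norm (fst (\<alpha> (r k)) - p (r k) t0)" _ "\<lambda>k. \<epsilon> (r k)"]) auto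
    then show ?thesis by simp
  qed
  obtain CA where CA: "\<And>k. norm (\<alpha> (r k)) \<le> CA"
    using convergent_imp_Bseq[of "\<lambda>k. \<alpha> (r k)"] \<alpha>l unfolding convergent_def Bseq_def by blast
  \<comment> \<open>A bound independent of \<open>k\<close>, because the coefficient of the adjoint
    equation is the same for all \<open>k\<close>; it serves as dominating constant below.\<close>
  have "\<exists>CP. \<forall>k. \<forall>t\<in>{t0..t1}. norm (p (r k) t, - snd (snd (\<alpha> (r k)))) \<le> CP"
  proof -
    have "norm (fst (snd (\<alpha> (r k)))) \<le> CA" "\<bar>snd (snd (\<alpha> (r k)))\<bar> \<le> CA" for k
      using CA[of k] norm_fst_le_norm[of "snd (\<alpha> (r k))"] norm_snd_le_norm[of "snd (\<alpha> (r k))"] norm_snd_le_norm[of "\<alpha> (r k)"]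
      unfolding real_norm_def[symmetric] by linarith+
    then show ?thesis using adjoint_bound[OF pb MB _ _ pk] by blast
  qed
  then obtain CP where CP: "\<And>k t. t \<in> {t0..t1} \<Longrightarrow> norm (p (r k) t, - snd (snd (\<alpha> (r k)))) \<le> CP" by blast
  have max': "integral {c..d} (\<lambda>s. (q s, - lam) \<bullet> \<Delta> v s) \<le> 0"
    if v: "v \<in> W" and cd: "t0 \<le> c" "c \<le> d" "d \<le> t1" for v c d
  proof -
    have sub: "{c..d} \<subseteq> {t0..t1}" using cd by auto
    obtain CD where CD: "CD > 0" "\<And>t. t \<in> {t0..t1} \<Longrightarrow> norm (\<Delta> v t) \<le> CD" using bmeas_bound[OF \<Delta>[OF v]] by blast
    have "(\<lambda>k. integral {c..d} (\<lambda>s. (p (r k) s, - snd (snd (\<alpha> (r k)))) \<bullet> \<Delta> v s)) \<longlonglongrightarrow> integral {c..d} (\<lambda>s. (q s, - lam) \<bullet> \<Delta> v s)"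
    proof (rule bmeas_dominated_convergence[OF _ _ _ N])
      show "bmeas c d (\<lambda>s. (p (r k) s, - snd (snd (\<alpha> (r k)))) \<bullet> \<Delta> v s)" for k
        by (rule bmeas_subinterval[OF _ sub]) (intro bmeas_inner bmeas_pair bmeas_const pb \<Delta> v)
      show "bmeas c d (\<lambda>s. (q s, - lam) \<bullet> \<Delta> v s)"
        by (rule bmeas_subinterval[OF _ sub]) (intro bmeas_inner bmeas_pair bmeas_const qb \<Delta> v)
      show "norm ((p (r k) t, - snd (snd (\<alpha> (r k)))) \<bullet> \<Delta> v t) \<le> CP * CD" if "t \<in> {c..d}" for k t
      proof -
        have t: "t \<in> {t0..t1}" using that sub by auto
        have "norm ((p (r k) t, - snd (snd (\<alpha> (r k)))) \<bullet> \<Delta> v t) \<le> norm (p (r k) t, - snd (snd (\<alpha> (r k)))) * norm (\<Delta> v t)"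
          unfolding real_norm_def by (rule Cauchy_Schwarz_ineq2)
        also have "\<dots> \<le> CP * CD"
          using CP[OF t, of k] CD(2)[OF t] by (intro mult_mono order_trans[OF norm_ge_zero CP[OF t]]) auto
        finally show ?thesis .
      qed
      show "(\<lambda>k. (p (r k) t, - snd (snd (\<alpha> (r k)))) \<bullet> \<Delta> v t) \<longlonglongrightarrow> (q t, - lam) \<bullet> \<Delta> v t" if "t \<in> {c..d} - N" for t
        unfolding lam_def using that sub by (intro tendsto_intros pl \<alpha>l) auto
    qed
    moreover have "\<forall>\<^sub>F k in sequentially. integral {c..d} (\<lambda>s. (p (r k) s, - snd (snd (\<alpha> (r k)))) \<bullet> \<Delta> v s) \<le> \<epsilon> (r k)"
      using max[OF v cd] r by (rule eventually_subseq[rotated])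
    ultimately show ?thesis using \<epsilon>r by (intro tendsto_le[OF sequentially_bot \<epsilon>r])
  qed
  have "\<forall>t\<in>{t0..t1}. q t = - fst (snd \<alpha>') + integral {t..t1} (\<lambda>s. adj s (q s, - snd (snd \<alpha>')))
        - (\<Sum>j\<in>{1..l}. LINT s:{t..t1}|\<nu> j. G j s)"
    using q unfolding M'_def lam_def by blast
  then show ?thesis
    using r w' w'0 \<nu>(1) null one' qb q0eq max' unfolding \<alpha>'_def lam_def
    by (intro exI[of _ r] exI[of _ w'] exI[of _ \<nu>] exI[of _ q]) blast
qed

end

section \<open>Smooth data on a tube\<close>

lemma tubeI: "t \<in> {t0..t1} \<Longrightarrow> norm (x - xs t) \<le> \<gamma> \<Longrightarrow> u \<in> U1 \<Longrightarrow> ((t, u), x) \<in> tube t0 t1 xs \<gamma> U1"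
  by (auto simp: tube_def)

lemma bounded_tube:
  assumes "continuous_on {t0..t1} xs" "compact U1"
  shows "bounded (tube t0 t1 xs \<gamma> U1)"
proof -
  have "bounded (xs ` {t0..t1})" using assms by (intro compact_imp_bounded compact_continuous_image) auto
  then obtain C where C: "\<And>t. t \<in> {t0..t1} \<Longrightarrow> norm (xs t) \<le> C" unfolding bounded_iff by blast
  have "norm x \<le> C + \<gamma>" if "t \<in> {t0..t1}" "norm (x - xs t) \<le> \<gamma>" for t x
    using C[OF that(1)] that(2) norm_triangle_ineq[of "x - xs t" "xs t"] by simp
  then have "tube t0 t1 xs \<gamma> U1 \<subseteq> ({t0..t1} \<times> U1) \<times> cball 0 (C + \<gamma>)" by (auto simp: tube_def)
  moreover have "bounded (({t0..t1} \<times> U1) \<times> cball 0 (C + \<gamma>))"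
    using compact_imp_bounded[OF assms(2)] by (intro bounded_Times) auto
  ultimately show ?thesis by (rule bounded_subset[rotated])
qed

text \<open>Everything extracted from \<open>uniformly_C1_on\<close> with one constant. The last
  clause is strict differentiability at the centre \<open>xs t\<close>, uniform in time and control:
  two nearby points are compared through the derivative at the centre alone.\<close>

definition tube_C1 :: "real \<Rightarrow> real \<Rightarrow> (real \<Rightarrow> real^'n) \<Rightarrow> real \<Rightarrow> (real^'m) set \<Rightarrow>
    (real \<times> (real^'m) \<Rightarrow> real^'n \<Rightarrow> 'b::euclidean_space) \<Rightarrow>
    ((real \<times> (real^'m)) \<times> (real^'n) \<Rightarrow> (real^'n) \<Rightarrow>\<^sub>L 'b) \<Rightarrow> real \<Rightarrow> bool" where
  "tube_C1 t0 t1 xs \<gamma> U1 F F' B \<longleftrightarrow>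
    uniformly_continuous_on (tube t0 t1 xs \<gamma> U1) (\<lambda>(s, x). F s x) \<and>
    uniformly_continuous_on (tube t0 t1 xs \<gamma> U1) F' \<and>
    (\<forall>t\<in>{t0..t1}. \<forall>u\<in>U1. \<forall>x. norm (x - xs t) \<le> \<gamma> \<longrightarrow>
      (F (t, u) has_derivative blinfun_apply (F' ((t, u), x))) (at x) \<and> norm (F (t, u) x) \<le> B \<and> norm (F' ((t, u), x)) \<le> B) \<and>
    (\<forall>t\<in>{t0..t1}. \<forall>u\<in>U1. \<forall>x y. norm (x - xs t) \<le> \<gamma> \<longrightarrow> norm (y - xs t) \<le> \<gamma> \<longrightarrow>
      norm (F (t, u) x - F (t, u) y) \<le> B * norm (x - y)) \<and>
    (\<forall>\<eta>>0. \<exists>\<delta>>0. \<forall>t\<in>{t0..t1}. \<forall>u\<in>U1. \<forall>x y. norm (x - xs t) \<le> min \<delta> \<gamma> \<longrightarrow> norm (y - xs t) \<le> min \<delta> \<gamma> \<longrightarrow>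
      norm (F (t, u) x - F (t, u) y - blinfun_apply (F' ((t, u), xs t)) (x - y)) \<le> \<eta> * norm (x - y))"

text \<open>Uniform continuity on a bounded set gives the bounds, and the mean value inequality on
  the convex ball around \<open>xs t\<close> gives the Lipschitz estimate.\<close>

lemma tube_C1_exists:
  fixes F :: "real \<times> (real^'m) \<Rightarrow> real^'n \<Rightarrow> 'b::euclidean_space"
  assumes F: "uniformly_C1_on (tube t0 t1 xs \<gamma> U1) F" and xs: "continuous_on {t0..t1} xs" and U1: "compact U1"
  shows "\<exists>F' B. tube_C1 t0 t1 xs \<gamma> U1 F F' B"
proof -
  let ?S = "tube t0 t1 xs \<gamma> U1"
  obtain F' :: "(real \<times> (real^'m)) \<times> (real^'n) \<Rightarrow> (real^'n) \<Rightarrow>\<^sub>L 'b" where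
    uF: "uniformly_continuous_on ?S (\<lambda>(s, x). F s x)" and uF': "uniformly_continuous_on ?S F'"
    and dF: "\<forall>(s, x)\<in>?S. (F s has_derivative blinfun_apply (F' (s, x))) (at x)"
    using F unfolding uniformly_C1_on_def by blast
  have der: "(F (t, u) has_derivative blinfun_apply (F' ((t, u), x))) (at x)"
    if "t \<in> {t0..t1}" "u \<in> U1" "norm (x - xs t) \<le> \<gamma>" for t u x
    using dF tubeI[where xs = xs, OF that(1,3,2)] by fastforce
  have bS: "bounded ?S" by (rule bounded_tube[OF xs U1])
  obtain B1 where B1: "\<And>q. q \<in> ?S \<Longrightarrow> norm ((\<lambda>(s, x). F s x) q) \<le> B1"
    using bounded_uniformly_continuous_image[OF uF bS] unfolding bounded_iff by blast
  obtain B2 where B2: "\<And>q. q \<in> ?S \<Longrightarrow> norm (F' q) \<le> B2"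
    using bounded_uniformly_continuous_image[OF uF' bS] unfolding bounded_iff by blast
  define B where "B = max 1 (max B1 B2)"
  have F_bound: "norm (F (t, u) x) \<le> B" if "t \<in> {t0..t1}" "u \<in> U1" "norm (x - xs t) \<le> \<gamma>" for t u x
    using B1[OF tubeI[where xs = xs, OF that(1,3,2)]] by (simp add: B_def)
  have F'_bound: "norm (F' ((t, u), x)) \<le> B" if "t \<in> {t0..t1}" "u \<in> U1" "norm (x - xs t) \<le> \<gamma>" for t u x
    using B2[OF tubeI[where xs = xs, OF that(1,3,2)]] by (simp add: B_def)
  have lip: "norm (F (t, u) x - F (t, u) y) \<le> B * norm (x - y)"
    if t: "t \<in> {t0..t1}" "u \<in> U1" and x: "norm (x - xs t) \<le> \<gamma>" "norm (y - xs t) \<le> \<gamma>" for t u x y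
  proof (rule differentiable_bound[where S = "cball (xs t) \<gamma>"])
    fix z assume "z \<in> cball (xs t) \<gamma>"
    then have z: "norm (z - xs t) \<le> \<gamma>" by (simp add: dist_norm norm_minus_commute)
    show "(F (t, u) has_derivative blinfun_apply (F' ((t, u), z))) (at z within cball (xs t) \<gamma>)"
      using der[OF t z] has_derivative_at_withinI by blast
    show "onorm (blinfun_apply (F' ((t, u), z))) \<le> B"
      using F'_bound[OF t z] by (simp add: norm_blinfun.rep_eq)
  qed (use x in \<open>auto simp: dist_norm norm_minus_commute\<close>)
  have unif: "\<exists>\<delta>>0. \<forall>t\<in>{t0..t1}. \<forall>u\<in>U1. \<forall>x y. norm (x - xs t) \<le> min \<delta> \<gamma> \<longrightarrow> norm (y - xs t) \<le> min \<delta> \<gamma> \<longrightarrow>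
      norm (F (t, u) x - F (t, u) y - blinfun_apply (F' ((t, u), xs t)) (x - y)) \<le> \<eta> * norm (x - y)"
    if \<eta>: "\<eta> > 0" for \<eta>
  proof -
    obtain \<delta> where \<delta>: "\<delta> > 0" "\<And>q q'. q \<in> ?S \<Longrightarrow> q' \<in> ?S \<Longrightarrow> dist q' q < \<delta> \<Longrightarrow> dist (F' q') (F' q) < \<eta>"
      using uF' \<eta> unfolding uniformly_continuous_on_def by metis
    have "norm (F (t, u) x - F (t, u) y - blinfun_apply (F' ((t, u), xs t)) (x - y)) \<le> \<eta> * norm (x - y)"
      if t: "t \<in> {t0..t1}" "u \<in> U1" and x: "norm (x - xs t) \<le> min (\<delta> / 2) \<gamma>" "norm (y - xs t) \<le> min (\<delta> / 2) \<gamma>" for t u x y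
    proof -
      let ?L = "F' ((t, u), xs t)"
      have g0: "0 \<le> \<gamma>" using x(1) norm_ge_zero[of "x - xs t"] by linarith
      \<comment> \<open>The mean value inequality for \<open>F\<close> minus its linearisation at
        the centre, whose derivative is at most \<eta> by uniform continuity of
        \<open>F'\<close>.\<close>
      have "norm ((F (t, u) x - blinfun_apply ?L x) - (F (t, u) y - blinfun_apply ?L y)) \<le> \<eta> * norm (x - y)"
      proof (rule differentiable_bound[where S = "cball (xs t) (min (\<delta> / 2) \<gamma>)"])
        fix z assume "z \<in> cball (xs t) (min (\<delta> / 2) \<gamma>)"
        then have z: "norm (z - xs t) \<le> \<gamma>" "norm (z - xs t) \<le> \<delta> / 2" by (auto simp: dist_norm norm_minus_commute)
        have "((\<lambda>x. F (t, u) x - blinfun_apply ?L x) has_derivative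
            (\<lambda>h. blinfun_apply (F' ((t, u), z)) h - blinfun_apply ?L h)) (at z)"
          by (intro derivative_intros der t z) (auto intro!: derivative_eq_intros)
        then have "((\<lambda>x. F (t, u) x - blinfun_apply ?L x) has_derivative
            blinfun_apply (F' ((t, u), z) - ?L)) (at z)"
          by (simp add: minus_blinfun.rep_eq[abs_def])
        then show "((\<lambda>x. F (t, u) x - blinfun_apply ?L x) has_derivative
            blinfun_apply (F' ((t, u), z) - ?L)) (at z within cball (xs t) (min (\<delta> / 2) \<gamma>))"
          by (rule has_derivative_at_withinI)
        have "dist (F' ((t, u), z)) ?L < \<eta>"
          using z \<delta>(1) g0 t by (intro \<delta>(2) tubeI) (auto simp: dist_Pair_Pair dist_norm)
        then show "onorm (blinfun_apply (F' ((t, u), z) - ?L)) \<le> \<eta>"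
          by (simp add: dist_norm norm_blinfun.rep_eq)
      qed (use x in \<open>auto simp: dist_norm norm_minus_commute\<close>)
      then show ?thesis by (simp add: blinfun.diff_right algebra_simps)
    qed
    then show ?thesis using \<delta>(1) by (intro exI[of _ "\<delta> / 2"]) auto
  qed
  have "tube_C1 t0 t1 xs \<gamma> U1 F F' B"
    unfolding tube_C1_def using uF uF' der F_bound F'_bound lip unif by blast
  then show ?thesis by blast
qed

lemma measurable_on_tube:
  fixes H :: "(real \<times> (real^'m)) \<times> (real^'n) \<Rightarrow> 'b::topological_space"
  assumes H: "continuous_on (tube t0 t1 xs \<gamma> U1) H"
    and u: "u \<in> borel_measurable (lebesgue_on {t0..t1})" "\<And>t. t \<in> {t0..t1} \<Longrightarrow> u t \<in> U1"
    and x: "continuous_on {t0..t1} x" "\<And>t. t \<in> {t0..t1} \<Longrightarrow> norm (x t - xs t) \<le> \<gamma>"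
  shows "(\<lambda>t. H ((t, u t), x t)) \<in> borel_measurable (lebesgue_on {t0..t1})"
proof -
  have "(\<lambda>t. ((t, u t), x t)) \<in> borel_measurable (lebesgue_on {t0..t1})"
  proof (intro borel_measurable_Pair)
    show "(\<lambda>t. t) \<in> borel_measurable (lebesgue_on {t0..t1})"
      by (intro measurable_restrict_space1 measurable_completion) simp
    show "x \<in> borel_measurable (lebesgue_on {t0..t1})"
      using bmeas_measurable[OF bmeas_continuous[OF x(1)]] .
  qed (rule u)
  then have "(\<lambda>t. ((t, u t), x t)) \<in> measurable (lebesgue_on {t0..t1}) (restrict_space borel (tube t0 t1 xs \<gamma> U1))"
    by (intro measurable_restrict_space2) (auto intro!: tubeI u(2) x(2))
  from measurable_compose[OF this borel_measurable_continuous_on_restrict[OF H]] show ?thesis .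
qed

text \<open>Coordinates produce a vector that represents the derivative, and uniqueness of the
  derivative lets the definite description in \<open>grad\<close> select it.\<close>

lemma grad_eqI:
  fixes F :: "'a::euclidean_space \<Rightarrow> real"
  assumes "(F has_derivative L) (at x)"
  shows "grad F x = (\<Sum>i\<in>Basis. L i *\<^sub>R i)" "L h = grad F x \<bullet> h"
proof -
  define D where "D = (\<Sum>i\<in>Basis. L i *\<^sub>R i)"
  have lin: "linear L" using assms has_derivative_linear by blast
  have L: "L h = D \<bullet> h" for h
  proof -
    have "L h = L (\<Sum>i\<in>Basis. (h \<bullet> i) *\<^sub>R i)" by (simp add: euclidean_representation)
    also have "\<dots> = (\<Sum>i\<in>Basis. (h \<bullet> i) * L i)" using lin by (simp add: linear_sum linear_cmul)
    also have "\<dots> = D \<bullet> h"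
      unfolding D_def inner_sum_left inner_scaleR_left by (simp only: inner_commute[of h] mult.commute)
    finally show ?thesis .
  qed
  have "(\<lambda>h. h \<bullet> D) = L"
  proof
    show "h \<bullet> D = L h" for h using L[of h] by (simp only: inner_commute)
  qed
  then have "GDERIV F x :> D"
    unfolding gderiv_def using assms by simp
  moreover have "D' = D" if "GDERIV F x :> D'" for D'
  proof -
    have "(\<lambda>h. h \<bullet> D') = L" using that assms unfolding gderiv_def by (rule has_derivative_unique)
    then have "h \<bullet> D' = L h" for h by (rule fun_cong)
    then have "\<forall>h. h \<bullet> D' = h \<bullet> D" using L by (metis inner_commute)
    then show ?thesis using vector_eq_ldot by blast
  qed
  ultimately have "grad F x = D" unfolding grad_def by (rule the_equality)
  then show "grad F x = (\<Sum>i\<in>Basis. L i *\<^sub>R i)" "L h = grad F x \<bullet> h"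
    using L[of h] unfolding D_def by simp_all
qed

text \<open>Nearest-point projection onto the ball of radius \<gamma> around \<open>xs t\<close>.
  Data composed with it are bounded and Lipschitz in the state globally and unchanged near
  \<open>xs\<close>.\<close>

definition tube_proj :: "(real \<Rightarrow> 'a::euclidean_space) \<Rightarrow> real \<Rightarrow> real \<Rightarrow> 'a \<Rightarrow> 'a" where
  "tube_proj xs \<gamma> t x = xs t + closest_point (cball 0 \<gamma>) (x - xs t)"

lemma tube_proj_in: "\<gamma> > 0 \<Longrightarrow> norm (tube_proj xs \<gamma> t x - xs t) \<le> \<gamma>"
  using closest_point_in_set[of "cball 0 \<gamma>" "x - xs t"] by (simp add: tube_proj_def)

lemma tube_proj_id: "norm (x - xs t) \<le> \<gamma> \<Longrightarrow> tube_proj xs \<gamma> t x = x"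
  by (simp add: tube_proj_def closest_point_self)

lemma closest_point_cball_Lipschitz:
  fixes x :: "'a::euclidean_space"
  assumes "\<gamma> > 0"
  shows "norm (closest_point (cball 0 \<gamma>) x - closest_point (cball 0 \<gamma>) y) \<le> norm (x - y)"
  using closest_point_lipschitz[of "cball 0 \<gamma>" x y] assms by (simp add: dist_norm)

lemma tube_proj_Lipschitz: "\<gamma> > 0 \<Longrightarrow> norm (tube_proj xs \<gamma> t x - tube_proj xs \<gamma> t y) \<le> norm (x - y)"
  using closest_point_cball_Lipschitz[of \<gamma> "x - xs t" "y - xs t"] by (simp add: tube_proj_def)

text \<open>The centre enters twice, as translation and inside the nonexpansive projection.\<close>

lemma tube_proj_time: "\<gamma> > 0 \<Longrightarrow> norm (tube_proj xs \<gamma> s x - tube_proj xs \<gamma> t x) \<le> 2 * norm (xs s - xs t)"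
proof -
  assume \<gamma>: "\<gamma> > 0"
  have "norm (closest_point (cball 0 \<gamma>) (x - xs s) - closest_point (cball 0 \<gamma>) (x - xs t)) \<le> norm (xs s - xs t)"
    using closest_point_cball_Lipschitz[OF \<gamma>, of "x - xs s" "x - xs t"] by (simp add: norm_minus_commute)
  then show ?thesis
    using norm_triangle_ineq[of "xs s - xs t" "closest_point (cball 0 \<gamma>) (x - xs s) - closest_point (cball 0 \<gamma>) (x - xs t)"]
    by (simp add: tube_proj_def algebra_simps)
qed

lemma tube_proj_continuous:
  fixes xs :: "real \<Rightarrow> 'a::euclidean_space"
  assumes "continuous_on {t0..t1} xs" "continuous_on {t0..t1} x" "\<gamma> > 0"
  shows "continuous_on {t0..t1} (\<lambda>t. tube_proj xs \<gamma> t (x t))"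
proof -
  have "continuous_on UNIV (closest_point (cball 0 \<gamma>) :: 'a \<Rightarrow> 'a)"
    by (rule continuous_on_closest_point) (use assms(3) in \<open>simp_all add: less_imp_le not_less\<close>)
  then have "continuous_on {t0..t1} (\<lambda>t. closest_point (cball 0 \<gamma>) (x t - xs t))"
    by (rule continuous_on_compose2) (use assms in \<open>auto intro!: continuous_intros\<close>)
  then show ?thesis
    unfolding tube_proj_def by (intro continuous_on_add assms(1))
qed

lemma finite_common_delta:
  assumes "finite J" "\<And>j. j \<in> J \<Longrightarrow> \<exists>\<delta>>0. P j (\<delta> :: real)"
    and mono: "\<And>j \<delta> \<delta>'. j \<in> J \<Longrightarrow> P j \<delta> \<Longrightarrow> 0 < \<delta>' \<Longrightarrow> \<delta>' \<le> \<delta> \<Longrightarrow> P j \<delta>'"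
  shows "\<exists>\<delta>>0. \<forall>j\<in>J. P j \<delta>"
proof (cases "J = {}")
  case True
  then show ?thesis by (auto intro: exI[of _ 1])
next
  case False
  obtain \<delta> where \<delta>: "\<And>j. j \<in> J \<Longrightarrow> \<delta> j > 0 \<and> P j (\<delta> j)"
    using bchoice[of J "\<lambda>j \<delta>. \<delta> > 0 \<and> P j \<delta>"] assms(2) by metis
  have "Min (\<delta> ` J) > 0" using assms(1) False \<delta> by simp
  moreover have "P j (Min (\<delta> ` J))" if "j \<in> J" for j
    by (rule mono[OF that, of "\<delta> j"]) (use \<delta>[OF that] \<open>Min (\<delta> ` J) > 0\<close> assms(1) that in auto)
  ultimately show ?thesis by blast
qed

lemma finite_common_bound:
  assumes "finite J" "\<And>j. j \<in> J \<Longrightarrow> \<exists>B. P j (B :: real)"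
    and mono: "\<And>j B B'. j \<in> J \<Longrightarrow> P j B \<Longrightarrow> B \<le> B' \<Longrightarrow> P j B'"
  shows "\<exists>B. \<forall>j\<in>J. P j B"
proof -
  obtain f where f: "\<And>j. j \<in> J \<Longrightarrow> P j (f j)" using bchoice[of J P] assms(2) by blast
  have "P j (Max (insert 0 (f ` J)))" if "j \<in> J" for j
    by (rule mono[OF that f[OF that]], rule Max_ge) (use assms(1) that in auto)
  then show ?thesis by blast
qed

text \<open>The indefinite integral is nonincreasing, and almost everywhere \<open>f\<close> is its
  derivative.\<close>

lemma nonpositive_integrals_AE:
  assumes f: "bmeas a b f" and "a < b"
    and le: "\<And>c d. a \<le> c \<Longrightarrow> c \<le> d \<Longrightarrow> d \<le> b \<Longrightarrow> integral {c..d} f \<le> (0 :: real)"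
  shows "\<exists>N. negligible N \<and> (\<forall>t\<in>{a..b} - N. f t \<le> 0)"
proof -
  obtain N where N: "negligible N" "\<And>t. t \<in> {a..b} - N \<Longrightarrow>
      ((\<lambda>s. integral {a..s} f) has_vector_derivative f t) (at t within {a..b})"
    using integral_has_vector_derivative_AE[OF f] by blast
  have "f t \<le> 0" if t: "t \<in> {a..b} - N" for t
  proof (rule ccontr)
    assume "\<not> f t \<le> 0"
    then have pos: "f t > 0" by simp
    obtain d where d: "d > 0" "\<And>s. s \<in> {a..b} \<Longrightarrow> norm (s - t) < d \<Longrightarrow>
        norm (integral {a..s} f - integral {a..t} f - (s - t) *\<^sub>R f t) \<le> f t / 2 * norm (s - t)"
      using N(2)[OF t] pos unfolding has_vector_derivative_def has_derivative_within_alt by (meson half_gt_zero)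
    have comb: "integral {a..s'} f - integral {a..s} f \<le> 0" if "s \<in> {a..b}" "s' \<in> {a..b}" "s \<le> s'" for s s'
      using bmeas_integral_combine[OF f, of a s s'] le[of s s'] that by auto
    show False
    \<comment> \<open>The contradiction comes from a difference quotient to the right, and at the
      endpoint \<open>b\<close> from one to the left.\<close>
    proof (cases "t < b")
      case True
      define s where "s = min b (t + d / 2)"
      have s: "s \<in> {a..b}" "norm (s - t) < d" "t < s" using True t d(1) by (auto simp: s_def)
      then have "norm (integral {a..s} f - integral {a..t} f - (s - t) * f t) \<le> f t / 2 * (s - t)" using d(2)[OF s(1,2)] by simp
      moreover have "integral {a..s} f - integral {a..t} f \<le> 0" using comb[of t s] s t by auto
      ultimately have "(s - t) * f t \<le> f t / 2 * (s - t)" unfolding real_norm_def by linarith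
      moreover have "0 < f t * (s - t)" using pos s by simp
      ultimately show False by (simp add: mult.commute)
    next
      case False
      define s where "s = max a (t - d / 2)"
      have s: "s \<in> {a..b}" "norm (s - t) < d" "s < t" using False t d(1) \<open>a < b\<close> by (auto simp: s_def)
      then have "norm (integral {a..s} f - integral {a..t} f - (s - t) * f t) \<le> f t / 2 * (t - s)" using d(2)[OF s(1,2)] by simp
      moreover have "integral {a..t} f - integral {a..s} f \<le> 0" using comb[of s t] s t by auto
      ultimately have "- ((s - t) * f t) \<le> f t / 2 * (t - s)" unfolding real_norm_def by linarith
      moreover have "0 < f t * (t - s)" using pos s by simp
      ultimately show False by (simp add: algebra_simps)
    qed
  qed
  then show ?thesis using N(1) by blast
qed

section \<open>Regularity of the multipliers\<close>

text \<open>Intervals of a division may share endpoints, where the measure may have atoms. Their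
  half-open versions are disjoint, so every atom counts at most once.\<close>

lemma sum_measure_division_le:
  assumes "finite_measure M" "sets M = sets borel" "d division_of A" "A \<subseteq> {a..b :: real}"
  shows "(\<Sum>k\<in>d. measure M {Inf k..<Sup k}) \<le> measure M (space M)"
proof -
  interpret finite_measure M by fact
  have "disjoint_family_on (\<lambda>k. {Inf k..<Sup k}) d"
    unfolding disjoint_family_on_def
  proof (intro ballI impI)
    fix k k' assume k: "k \<in> d" "k' \<in> d" "k \<noteq> k'"
    obtain u v u' v' where uv: "k = {u..v}" "u \<le> v" "k' = {u'..v'}" "u' \<le> v'"
      using division_ofD(3,4)[OF assms(3)] k by (metis atLeastatMost_empty_iff box_real(2))
    have "interior k \<inter> interior k' = {}" using division_ofD(5)[OF assms(3) k] .
    then have "{max u u'<..<min v v'} = {}" using uv by (auto simp: interior_atLeastAtMost_real)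
    then have "min v v' \<le> max u u'" by (simp add: greaterThanLessThan_empty_iff2)
    then show "{Inf k..<Sup k} \<inter> {Inf k'..<Sup k'} = {}" using uv by auto
  qed
  with division_ofD(1)[OF assms(3)] have "measure M (\<Union>k\<in>d. {Inf k..<Sup k}) = (\<Sum>k\<in>d. measure M {Inf k..<Sup k})"
    by (intro finite_measure_finite_Union) (auto simp: assms(2))
  then have "(\<Sum>k\<in>d. measure M {Inf k..<Sup k}) = measure M (\<Union>k\<in>d. {Inf k..<Sup k})" ..
  also have "\<dots> \<le> measure M (space M)" by (rule bounded_measure)
  finally show ?thesis .
qed

text \<open>Inherited from regularity on the whole space: compact subsets of \<open>B\<close> are
  the same, and an open superset \<open>T\<close> is replaced by \<open>S \<inter> T\<close>, which
  is relatively open and has no larger measure.\<close>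

lemma finite_regular_borel_measure_on_restrict:
  fixes S :: "'a::{second_countable_topology, complete_space} set"
  assumes M: "finite_measure M" "sets M = sets borel" and S: "S \<in> sets borel"
  shows "finite_regular_borel_measure_on S (restrict_space M S)"
  unfolding finite_regular_borel_measure_on_def
proof (intro conjI ballI)
  interpret finite_measure M by fact
  have sp: "space M = UNIV" using sets_eq_imp_space_eq[OF M(2)] by simp
  show "sets (restrict_space M S) = sets (restrict_space borel S)"
    using M(2) by (simp add: sets_restrict_space)
  show "finite_measure (restrict_space M S)"
    using M S by (intro finite_measure_restrict_space) auto
  have em: "emeasure (restrict_space M S) K = emeasure M K" if "K \<subseteq> S" for K
    using S M that by (intro emeasure_restrict_space) (auto simp: sp)
  have fin: "emeasure M (space M) \<noteq> \<infinity>" using emeasure_finite[of "space M"] by simp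
  fix B assume "B \<in> sets (restrict_space M S)"
  then have B: "B \<in> sets borel" "B \<subseteq> S" using S M by (auto simp: sets_restrict_space_iff sp)
  show "emeasure (restrict_space M S) B = (SUP K\<in>{K. compact K \<and> K \<subseteq> B}. emeasure (restrict_space M S) K)"
  proof -
    have "emeasure M B = (SUP K\<in>{K. K \<subseteq> B \<and> compact K}. emeasure M K)"
      by (rule inner_regular[OF M(2) fin B(1)])
    also have "\<dots> = (SUP K\<in>{K. compact K \<and> K \<subseteq> B}. emeasure (restrict_space M S) K)"
      using B em by (intro SUP_cong) auto
    finally show ?thesis using em[OF B(2)] by simp
  qed
  show "emeasure (restrict_space M S) B = (INF W\<in>{W. openin (top_of_set S) W \<and> B \<subseteq> W}. emeasure (restrict_space M S) W)"
  proof (rule antisym)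
    show "emeasure (restrict_space M S) B \<le> (INF W\<in>{W. openin (top_of_set S) W \<and> B \<subseteq> W}. emeasure (restrict_space M S) W)"
    proof (rule INF_greatest)
      fix W assume "W \<in> {W. openin (top_of_set S) W \<and> B \<subseteq> W}"
      then obtain T where T: "open T" "W = S \<inter> T" "B \<subseteq> W" by (auto simp: openin_open)
      then have "W \<in> sets M" using S M by auto
      then show "emeasure (restrict_space M S) B \<le> emeasure (restrict_space M S) W"
        using em[OF B(2)] em[of W] T emeasure_mono[of B W M] by auto
    qed
    have "emeasure M B = (INF W\<in>{W. B \<subseteq> W \<and> open W}. emeasure M W)"
      by (rule outer_regular[OF M(2) fin B(1)])
    moreover have "(INF W\<in>{W. openin (top_of_set S) W \<and> B \<subseteq> W}. emeasure (restrict_space M S) W) \<le> (INF W\<in>{W. B \<subseteq> W \<and> open W}. emeasure M W)"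
    proof (rule INF_mono)
      fix T assume T: "T \<in> {W. B \<subseteq> W \<and> open W}"
      have "emeasure M (S \<inter> T) \<le> emeasure M T" using T M S by (intro emeasure_mono) auto
      then have "emeasure (restrict_space M S) (S \<inter> T) \<le> emeasure M T" using em[of "S \<inter> T"] by simp
      moreover have "S \<inter> T \<in> {W. openin (top_of_set S) W \<and> B \<subseteq> W}" using T B by (auto simp: openin_open)
      ultimately show "\<exists>W\<in>{W. openin (top_of_set S) W \<and> B \<subseteq> W}. emeasure (restrict_space M S) W \<le> emeasure M T" by blast
    qed
    ultimately show "(INF W\<in>{W. openin (top_of_set S) W \<and> B \<subseteq> W}. emeasure (restrict_space M S) W) \<le> emeasure (restrict_space M S) B"
      using em[OF B(2)] by simp
  qed
qed

lemma tube_C1_mono: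
  assumes "tube_C1 t0 t1 xs \<gamma> U1 F F' B" "B \<le> B'"
  shows "tube_C1 t0 t1 xs \<gamma> U1 F F' B'"
proof -
  have "B * norm z \<le> B' * norm z" for z :: "real^'a" using assms(2) by (intro mult_right_mono) auto
  then show ?thesis using assms unfolding tube_C1_def by (meson order_trans)
qed

section \<open>Data composed with the projection onto the tube\<close>

context
  fixes t0 t1 :: real and xs :: "real \<Rightarrow> real^'n" and \<gamma> B :: real and U1 :: "(real^'m) set"
    and F :: "real \<times> (real^'m) \<Rightarrow> real^'n \<Rightarrow> 'b::euclidean_space"
    and F' :: "(real \<times> (real^'m)) \<times> (real^'n) \<Rightarrow> (real^'n) \<Rightarrow>\<^sub>L 'b"
  assumes C1: "tube_C1 t0 t1 xs \<gamma> U1 F F' B" and xs: "continuous_on {t0..t1} xs" and \<gamma>: "\<gamma> > 0"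
begin

lemma tube_C1_derivative:
  "t \<in> {t0..t1} \<Longrightarrow> u \<in> U1 \<Longrightarrow> norm (x - xs t) \<le> \<gamma> \<Longrightarrow> (F (t, u) has_derivative blinfun_apply (F' ((t, u), x))) (at x)"
  using C1 unfolding tube_C1_def by blast

lemma tube_C1_derivative_bound:
  assumes "t \<in> {t0..t1}" "u \<in> U1"
  shows "norm (blinfun_apply (F' ((t, u), xs t)) v) \<le> B * norm v"
proof -
  have "norm (F' ((t, u), xs t)) \<le> B" using C1 assms \<gamma> unfolding tube_C1_def by simp
  then show ?thesis using norm_blinfun[of "F' ((t, u), xs t)" v] by (meson mult_right_mono norm_ge_zero order_trans)
qed

lemma tube_C1_proj_bound: "t \<in> {t0..t1} \<Longrightarrow> u \<in> U1 \<Longrightarrow> norm (F (t, u) (tube_proj xs \<gamma> t x)) \<le> B"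
  using C1 tube_proj_in[OF \<gamma>, of xs t x] unfolding tube_C1_def by blast

lemma tube_C1_proj_Lipschitz:
  assumes "t \<in> {t0..t1}" "u \<in> U1"
  shows "norm (F (t, u) (tube_proj xs \<gamma> t x) - F (t, u) (tube_proj xs \<gamma> t y)) \<le> B * norm (x - y)"
proof -
  have "0 \<le> B" using tube_C1_proj_bound[OF assms] norm_ge_zero order_trans by blast
  then have "B * norm (tube_proj xs \<gamma> t x - tube_proj xs \<gamma> t y) \<le> B * norm (x - y)"
    using tube_proj_Lipschitz[OF \<gamma>] by (intro mult_left_mono)
  moreover have "norm (F (t, u) (tube_proj xs \<gamma> t x) - F (t, u) (tube_proj xs \<gamma> t y)) \<le> B * norm (tube_proj xs \<gamma> t x - tube_proj xs \<gamma> t y)"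
    using C1 assms tube_proj_in[OF \<gamma>] unfolding tube_C1_def by blast
  ultimately show ?thesis by linarith
qed

lemma tube_C1_proj_near:
  assumes "\<eta> > 0"
  shows "\<exists>\<delta>>0. \<forall>t\<in>{t0..t1}. \<forall>u\<in>U1. \<forall>x y. norm (x - xs t) \<le> \<delta> \<longrightarrow> norm (y - xs t) \<le> \<delta> \<longrightarrow>
      norm (F (t, u) (tube_proj xs \<gamma> t x) - F (t, u) (tube_proj xs \<gamma> t y) - blinfun_apply (F' ((t, u), xs t)) (x - y)) \<le> \<eta> * norm (x - y)"
proof -
  obtain \<delta> where \<delta>: "\<delta> > 0" "\<And>t u x y. t \<in> {t0..t1} \<Longrightarrow> u \<in> U1 \<Longrightarrow> norm (x - xs t) \<le> min \<delta> \<gamma> \<Longrightarrow> norm (y - xs t) \<le> min \<delta> \<gamma> \<Longrightarrow>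
      norm (F (t, u) x - F (t, u) y - blinfun_apply (F' ((t, u), xs t)) (x - y)) \<le> \<eta> * norm (x - y)"
    using C1 assms unfolding tube_C1_def by meson
  show ?thesis
  proof (intro exI[of _ "min \<delta> \<gamma>"] conjI ballI allI impI)
    fix t u x y assume *: "t \<in> {t0..t1}" "u \<in> U1" "norm (x - xs t) \<le> min \<delta> \<gamma>" "norm (y - xs t) \<le> min \<delta> \<gamma>"
    have "tube_proj xs \<gamma> t x = x" "tube_proj xs \<gamma> t y = y" using * by (auto intro: tube_proj_id)
    then show "norm (F (t, u) (tube_proj xs \<gamma> t x) - F (t, u) (tube_proj xs \<gamma> t y) - blinfun_apply (F' ((t, u), xs t)) (x - y)) \<le> \<eta> * norm (x - y)"
      using \<delta>(2)[OF *] by simp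
  qed (use \<delta> \<gamma> in auto)
qed

lemma tube_C1_proj_measurable:
  assumes "continuous_on {t0..t1} x" "u \<in> borel_measurable (lebesgue_on {t0..t1})" "\<And>t. t \<in> {t0..t1} \<Longrightarrow> u t \<in> U1"
  shows "(\<lambda>t. F (t, u t) (tube_proj xs \<gamma> t (x t))) \<in> borel_measurable (lebesgue_on {t0..t1})"
proof -
  have "continuous_on (tube t0 t1 xs \<gamma> U1) (\<lambda>(s, x). F s x)"
    using C1 unfolding tube_C1_def by (intro uniformly_continuous_imp_continuous) blast
  from measurable_on_tube[OF this assms(2,3) tube_proj_continuous[OF xs assms(1) \<gamma>] tube_proj_in[OF \<gamma>]]
  show ?thesis by simp
qed

lemma tube_C1_derivative_measurable:
  assumes "u \<in> borel_measurable (lebesgue_on {t0..t1})" "\<And>t. t \<in> {t0..t1} \<Longrightarrow> u t \<in> U1"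
  shows "(\<lambda>t. blinfun_apply (F' ((t, u t), xs t)) v) \<in> borel_measurable (lebesgue_on {t0..t1})"
proof -
  have "continuous_on (tube t0 t1 xs \<gamma> U1) F'"
    using C1 unfolding tube_C1_def by (intro uniformly_continuous_imp_continuous) blast
  then have "continuous_on (tube t0 t1 xs \<gamma> U1) (\<lambda>q. blinfun_apply (F' q) v)" by (intro continuous_intros)
  from measurable_on_tube[OF this assms xs] show ?thesis using \<gamma> by simp
qed

text \<open>Changing the time moves the centre of the ball as well; uniform continuity of
  \<open>xs\<close> bounds that motion by \<open>\<delta> / 4\<close>, hence the motion of the
  projection by \<open>\<delta> / 2\<close>.\<close>

lemma tube_C1_proj_uniform:
  assumes u: "u \<in> U1" and \<eta>: "\<eta> > 0"
  shows "\<exists>\<delta>>0. \<forall>s\<in>{t0..t1}. \<forall>t\<in>{t0..t1}. \<forall>x. \<bar>s - t\<bar> \<le> \<delta> \<longrightarrow>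
     norm (F (s, u) (tube_proj xs \<gamma> s x) - F (t, u) (tube_proj xs \<gamma> t x)) \<le> \<eta>"
proof -
  let ?S = "tube t0 t1 xs \<gamma> U1"
  obtain \<delta> where \<delta>: "\<delta> > 0" "\<And>q q'. q \<in> ?S \<Longrightarrow> q' \<in> ?S \<Longrightarrow> dist q' q < \<delta> \<Longrightarrow>
      dist ((\<lambda>(s, x). F s x) q') ((\<lambda>(s, x). F s x) q) < \<eta>"
    using C1 \<eta> unfolding tube_C1_def uniformly_continuous_on_def by metis
  have "uniformly_continuous_on {t0..t1} xs" by (rule compact_uniformly_continuous[OF xs]) auto
  then obtain d where d: "d > 0" "\<And>s t. s \<in> {t0..t1} \<Longrightarrow> t \<in> {t0..t1} \<Longrightarrow> dist t s < d \<Longrightarrow> dist (xs t) (xs s) < \<delta> / 4"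
    unfolding uniformly_continuous_on_def using \<delta>(1) by (metis divide_pos_pos zero_less_numeral)
  have mem: "((t, u), tube_proj xs \<gamma> t x) \<in> ?S" if "t \<in> {t0..t1}" for t x
    by (rule tubeI[OF that _ u]) (rule tube_proj_in[OF \<gamma>])
  define e where "e = min (d / 2) (\<delta> / 4)"
  have "norm (F (s, u) (tube_proj xs \<gamma> s x) - F (t, u) (tube_proj xs \<gamma> t x)) \<le> \<eta>"
    if st: "s \<in> {t0..t1}" "t \<in> {t0..t1}" "\<bar>s - t\<bar> \<le> e" for s t x
  proof -
    have "dist s t < d" using st d(1) by (auto simp: e_def dist_real_def)
    then have "norm (xs s - xs t) < \<delta> / 4" using d(2)[OF st(2,1)] by (simp add: dist_norm)
    then have "norm (tube_proj xs \<gamma> s x - tube_proj xs \<gamma> t x) < \<delta> / 2" using tube_proj_time[OF \<gamma>, of xs s x t] by linarith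
    moreover have "dist ((s, u), tube_proj xs \<gamma> s x) ((t, u), tube_proj xs \<gamma> t x)
       \<le> \<bar>s - t\<bar> + norm (tube_proj xs \<gamma> s x - tube_proj xs \<gamma> t x)"
      unfolding dist_Pair_Pair using sqrt_sum_squares_le_sum_abs[of "dist (s, u) (t, u)" "dist (tube_proj xs \<gamma> s x) (tube_proj xs \<gamma> t x)"]
      by (simp add: dist_Pair_Pair dist_norm)
    ultimately have "dist ((s, u), tube_proj xs \<gamma> s x) ((t, u), tube_proj xs \<gamma> t x) < \<delta>"
      using st \<delta>(1) by (simp add: e_def)
    then have "dist (F (s, u) (tube_proj xs \<gamma> s x)) (F (t, u) (tube_proj xs \<gamma> t x)) < \<eta>"
      using \<delta>(2)[OF mem[OF st(2)] mem[OF st(1)]] by simp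
    then show ?thesis by (simp add: dist_norm)
  qed
  moreover have "e > 0" using \<delta>(1) d(1) by (simp add: e_def)
  ultimately show ?thesis by blast
qed

end

context
  fixes t0 t1 :: real and xs :: "real \<Rightarrow> real^'n" and \<gamma> B :: real and U1 :: "(real^'m) set"
    and F :: "real \<times> (real^'m) \<Rightarrow> real^'n \<Rightarrow> real" and F' :: "(real \<times> (real^'m)) \<times> (real^'n) \<Rightarrow> (real^'n) \<Rightarrow>\<^sub>L real"
  assumes C1: "tube_C1 t0 t1 xs \<gamma> U1 F F' B" and xs: "continuous_on {t0..t1} xs" and \<gamma>: "\<gamma> > 0"
begin

lemma tube_C1_grad:
  assumes "t \<in> {t0..t1}" "u \<in> U1"
  shows "grad (F (t, u)) (xs t) = (\<Sum>i\<in>Basis. blinfun_apply (F' ((t, u), xs t)) i *\<^sub>R i)"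
    "blinfun_apply (F' ((t, u), xs t)) v = grad (F (t, u)) (xs t) \<bullet> v"
  using grad_eqI[OF tube_C1_derivative[OF C1 xs \<gamma> assms]] \<gamma> by auto

lemma tube_C1_grad_bound:
  assumes "t \<in> {t0..t1}" "u \<in> U1"
  shows "norm (grad (F (t, u)) (xs t)) \<le> B"
proof (cases "grad (F (t, u)) (xs t) = 0")
  case True
  have "0 \<le> B" using tube_C1_proj_bound[OF C1 xs \<gamma> assms] norm_ge_zero order_trans by blast
  then show ?thesis using True by simp
next
  case False
  let ?g = "grad (F (t, u)) (xs t)"
  have "norm ?g * norm ?g = blinfun_apply (F' ((t, u), xs t)) ?g"
    by (simp add: tube_C1_grad(2)[OF assms] dot_square_norm power2_eq_square)
  also have "\<dots> \<le> B * norm ?g" using tube_C1_derivative_bound[OF C1 xs \<gamma> assms, of ?g] by simp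
  finally show ?thesis using False by simp
qed

lemma tube_C1_grad_continuous:
  assumes u: "u \<in> U1"
  shows "continuous_on {t0..t1} (\<lambda>t. grad (F (t, u)) (xs t))"
proof (rule continuous_on_eq)
  have "continuous_on (tube t0 t1 xs \<gamma> U1) F'"
    using C1 unfolding tube_C1_def by (intro uniformly_continuous_imp_continuous) blast
  then have "continuous_on {t0..t1} (\<lambda>t. F' ((t, u), xs t))"
    by (rule continuous_on_compose2) (use u \<gamma> in \<open>auto intro!: continuous_intros xs tubeI\<close>)
  then show "continuous_on {t0..t1} (\<lambda>t. \<Sum>i\<in>Basis. blinfun_apply (F' ((t, u), xs t)) i *\<^sub>R i)"
    by (intro continuous_intros)
qed (simp add: tube_C1_grad(1) u)

end

lemma absolutely_continuous_imp_continuous: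
  fixes x :: "real \<Rightarrow> 'a::real_normed_vector"
  assumes "absolutely_continuous_on {a..b} x"
  shows "continuous_on {a..b} x"
  unfolding continuous_on_iff
proof (intro ballI allI impI)
  fix t e :: real assume t: "t \<in> {a..b}" and "e > 0"
  obtain \<delta> where \<delta>: "\<delta> > 0" "\<And>D A. D division_of A \<Longrightarrow> A \<subseteq> {a..b} \<Longrightarrow> (\<Sum>k\<in>D. Sup k - Inf k) < \<delta> \<Longrightarrow>
        (\<Sum>k\<in>D. norm (x (Sup k) - x (Inf k))) < e"
    using assms \<open>e > 0\<close> unfolding absolutely_continuous_on_def by meson
  have *: "norm (x s' - x s) < e" if "s \<in> {a..b}" "s' \<in> {a..b}" "s \<le> s'" "s' - s < \<delta>" for s s'
    using \<delta>(2)[of "{{s..s'}}" "{s..s'}"] that division_of_self[of s s'] by auto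
  have "dist (x s) (x t) < e" if "s \<in> {a..b}" "dist s t < \<delta>" for s
    using *[of s t] *[of t s] that t by (cases "s \<le> t") (auto simp: dist_norm norm_minus_commute dist_real_def)
  then show "\<exists>d>0. \<forall>s\<in>{a..b}. dist s t < d \<longrightarrow> dist (x s) (x t) < e" using \<delta>(1) by blast
qed

lemma absolutely_continuous_on_subset:
  "absolutely_continuous_on S x \<Longrightarrow> T \<subseteq> S \<Longrightarrow> absolutely_continuous_on T x"
  unfolding absolutely_continuous_on_def by (meson order_trans)

section \<open>Application to the optimal control problem\<close>

text \<open>The constraints at the endpoints are indexed by pairs: \<open>(0, 0)\<close> stands for the decrease of the cost,
  \<open>(1, i)\<close> and \<open>(2, i)\<close> for \<open>h0 i \<le> 0\<close> and \<open>- h0 i \<le> 0\<close>, and \<open>(3, i)\<close> and \<open>(4, i)\<close> likewise for \<open>h1\<close>.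
  The control \<open>uu\<close> is a representative of \<open>us\<close> with values in a bounded part of \<open>U\<close> everywhere.\<close>

locale minimal_process =
  fixes t0 t1 :: real
    and f :: "real \<Rightarrow> real^'n \<Rightarrow> real^'m \<Rightarrow> real"
    and \<phi> :: "real \<Rightarrow> real^'n \<Rightarrow> real^'m \<Rightarrow> real^'n"
    and s0 s1 l :: nat
    and h0 h1 :: "nat \<Rightarrow> real^'n \<Rightarrow> real"
    and U :: "(real^'m) set"
    and g :: "nat \<Rightarrow> real \<Rightarrow> real^'n \<Rightarrow> real"
    and xs :: "real \<Rightarrow> real^'n"
    and us uu :: "real \<Rightarrow> real^'m" and R0 :: real and N :: "real set"
  assumes t01: "t0 < t1"
    and regular: "regular_data t0 t1 f \<phi> s0 h0 s1 h1 l g xs"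
    and minimum: "strong_local_min t0 t1 f \<phi> s0 h0 s1 h1 U l g xs us"
    and uu_measurable: "uu \<in> borel_measurable (lebesgue_on {t0..t1})"
    and uu_U: "\<And>t. t \<in> {t0..t1} \<Longrightarrow> uu t \<in> U \<inter> cball 0 R0"
    and N: "negligible N" and uu_us: "\<And>t. t \<in> {t0..t1} - N \<Longrightarrow> uu t = us t"
begin

text \<open>Defined through \<open>frechet_derivative\<close> rather than the derivative fields
  supplied by regularity, because those depend on the truncation radius. Thus all truncated problems
  have literally the same adjoint equation.\<close>

definition D :: "real \<Rightarrow> real^'n \<Rightarrow> (real^'n) \<times> real" where
  "D t v = (frechet_derivative (\<lambda>x. \<phi> t x (uu t)) (at (xs t)) v, frechet_derivative (\<lambda>x. f t x (uu t)) (at (xs t)) v)"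

definition \<Delta> :: "real^'m \<Rightarrow> real \<Rightarrow> (real^'n) \<times> real" where
  "\<Delta> v s = (\<phi> s (xs s) v - \<phi> s (xs s) (uu s), f s (xs s) v - f s (xs s) (uu s))"

definition index :: "(nat \<times> nat) set" where
  "index = insert (0, 0) ({1, 2} \<times> {1..s0} \<union> {3, 4} \<times> {1..s1})"

text \<open>Gradients with respect to starting point, final point and cost, in the order of
  \<open>endpoints\<close>; opposite constraints have opposite gradients.\<close>

definition endpoint_grad :: "nat \<times> nat \<Rightarrow> (real^'n) \<times> (real^'n) \<times> real" where
  "endpoint_grad = (\<lambda>(k, i). if k = 0 then (0, 0, 1)
     else if k = 1 then (grad (h0 i) (xs t0), 0, 0) else if k = 2 then (- grad (h0 i) (xs t0), 0, 0)
     else if k = 3 then (0, grad (h1 i) (xs t1), 0) else (0, - grad (h1 i) (xs t1), 0))"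

lemma admissible_xs: "admissible t0 t1 f \<phi> s0 h0 s1 h1 U l g xs us"
  using minimum by (simp add: strong_local_min_def)

lemma xs_absolutely_continuous: "absolutely_continuous_on {t0..t1} xs"
  using admissible_xs by (simp add: admissible_def W1_inf_def)

lemma xs_continuous: "continuous_on {t0..t1} xs"
  by (rule absolutely_continuous_imp_continuous[OF xs_absolutely_continuous])

lemma xs_eq:
  assumes t: "t \<in> {t0..t1}"
  shows "xs t = xs t0 + integral {t0..t} (\<lambda>s. \<phi> s (xs s) (uu s))"
proof -
  have "AE t in lebesgue_on {t0..t1}. (xs has_vector_derivative \<phi> t (xs t) (us t)) (at t within {t0..t1})"
    using admissible_xs by (simp add: admissible_def)
  then obtain N' where N': "negligible N'" "\<And>t. t \<in> {t0..t1} - N' \<Longrightarrow> (xs has_vector_derivative \<phi> t (xs t) (us t)) (at t within {t0..t1})"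
    by (subst (asm) AE_lebesgue_on_iff_negligible) auto
  have "((\<lambda>s. \<phi> s (xs s) (uu s)) has_integral (xs t - xs t0)) {t0..t}"
  proof (rule absolutely_continuous_has_integral[where N = "N \<union> N'"])
    show "absolutely_continuous_on {t0..t} xs"
      using t by (intro absolutely_continuous_on_subset[OF xs_absolutely_continuous]) auto
    show "(xs has_vector_derivative \<phi> s (xs s) (uu s)) (at s within {t0..t})" if "s \<in> {t0..t} - (N \<union> N')" for s
      using N'(2)[of s] uu_us[of s] that t by (auto intro: has_vector_derivative_within_subset[of _ _ _ "{t0..t1}"])
  qed (use t N N' in auto)
  then show ?thesis by (simp add: integral_unique)
qed

definition regular_at :: "real \<Rightarrow> real \<Rightarrow> real \<Rightarrow>
    ((real \<times> (real^'m)) \<times> (real^'n) \<Rightarrow> (real^'n) \<Rightarrow>\<^sub>L (real^'n)) \<Rightarrow> ((real \<times> (real^'m)) \<times> (real^'n) \<Rightarrow> (real^'n) \<Rightarrow>\<^sub>L real) \<Rightarrow>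
    (nat \<Rightarrow> (real \<times> (real^'m)) \<times> (real^'n) \<Rightarrow> (real^'n) \<Rightarrow>\<^sub>L real) \<Rightarrow>
    (nat \<Rightarrow> (real \<times> (real^'m)) \<times> (real^'n) \<Rightarrow> (real^'n) \<Rightarrow>\<^sub>L real) \<Rightarrow>
    (nat \<Rightarrow> (real \<times> (real^'m)) \<times> (real^'n) \<Rightarrow> (real^'n) \<Rightarrow>\<^sub>L real) \<Rightarrow> bool" where
  "regular_at R \<gamma> B \<phi>' f' g' h0' h1' \<longleftrightarrow> \<gamma> > 0 \<and> B \<ge> 1 \<and>
     tube_C1 t0 t1 xs \<gamma> (cball 0 R) (\<lambda>(t, u) x. \<phi> t x u) \<phi>' B \<and>
     tube_C1 t0 t1 xs \<gamma> (cball 0 R) (\<lambda>(t, u) x. f t x u) f' B \<and>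
     (\<forall>j\<in>{1..l}. tube_C1 t0 t1 xs \<gamma> (cball 0 R) (\<lambda>(t, u) x. g j t x) (g' j) B) \<and>
     (\<forall>i\<in>{1..s0}. tube_C1 t0 t1 xs \<gamma> (cball 0 R) (\<lambda>(t, u) x. h0 i x) (h0' i) B) \<and>
     (\<forall>i\<in>{1..s1}. tube_C1 t0 t1 xs \<gamma> (cball 0 R) (\<lambda>(t, u) x. h1 i x) (h1' i) B)"

text \<open>Finitely many functions share the tube radius from the regularity assumption, so their
  bounds can be replaced by the largest.\<close>

lemma regular_at_exists: "\<exists>\<gamma> B \<phi>' f' g' h0' h1'. regular_at R \<gamma> B \<phi>' f' g' h0' h1'"
proof -
  let ?U = "cball 0 R :: (real^'m) set"
  have U: "compact ?U" by simp
  obtain \<gamma> where \<gamma>: "\<gamma> > 0"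
    and C: "uniformly_C1_on (tube t0 t1 xs \<gamma> ?U) (\<lambda>(t, u) x. \<phi> t x u)" "uniformly_C1_on (tube t0 t1 xs \<gamma> ?U) (\<lambda>(t, u) x. f t x u)"
    "\<And>j. j \<in> {1..l} \<Longrightarrow> uniformly_C1_on (tube t0 t1 xs \<gamma> ?U) (\<lambda>(t, u) x. g j t x)"
    "\<And>i. i \<in> {1..s0} \<Longrightarrow> uniformly_C1_on (tube t0 t1 xs \<gamma> ?U) (\<lambda>(t, u) x. h0 i x)"
    "\<And>i. i \<in> {1..s1} \<Longrightarrow> uniformly_C1_on (tube t0 t1 xs \<gamma> ?U) (\<lambda>(t, u) x. h1 i x)"
    using regular U unfolding regular_data_def by meson
  have fam: "\<exists>F' B. \<forall>j\<in>J. tube_C1 t0 t1 xs \<gamma> ?U (F j) (F' j) B"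
    if J: "finite J" and "\<And>j. j \<in> J \<Longrightarrow> uniformly_C1_on (tube t0 t1 xs \<gamma> ?U) (F j)"
    for J :: "nat set" and F :: "nat \<Rightarrow> real \<times> (real^'m) \<Rightarrow> real^'n \<Rightarrow> real"
  proof -
    have "\<forall>j\<in>J. \<exists>F'. \<exists>B. tube_C1 t0 t1 xs \<gamma> ?U (F j) F' B"
      using tube_C1_exists[OF that(2) xs_continuous U] by blast
    then obtain F' where F': "\<forall>j\<in>J. \<exists>B. tube_C1 t0 t1 xs \<gamma> ?U (F j) (F' j) B" using bchoice by metis
    have "\<exists>B. \<forall>j\<in>J. tube_C1 t0 t1 xs \<gamma> ?U (F j) (F' j) B"
      by (rule finite_common_bound[OF J]) (use F' tube_C1_mono in blast)+
    then show ?thesis by blast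
  qed
  obtain \<phi>' B1 where 1: "tube_C1 t0 t1 xs \<gamma> ?U (\<lambda>(t, u) x. \<phi> t x u) \<phi>' B1" using tube_C1_exists[OF C(1) xs_continuous U] by blast
  obtain f' B2 where 2: "tube_C1 t0 t1 xs \<gamma> ?U (\<lambda>(t, u) x. f t x u) f' B2" using tube_C1_exists[OF C(2) xs_continuous U] by blast
  obtain g' B3 where 3: "\<forall>j\<in>{1..l}. tube_C1 t0 t1 xs \<gamma> ?U (\<lambda>(t, u) x. g j t x) (g' j) B3"
    using fam[of "{1..l}" "\<lambda>j (t, u) x. g j t x"] C(3) by blast
  obtain h0' B4 where 4: "\<forall>i\<in>{1..s0}. tube_C1 t0 t1 xs \<gamma> ?U (\<lambda>(t, u) x. h0 i x) (h0' i) B4"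
    using fam[of "{1..s0}" "\<lambda>i (t, u) x. h0 i x"] C(4) by blast
  obtain h1' B5 where 5: "\<forall>i\<in>{1..s1}. tube_C1 t0 t1 xs \<gamma> ?U (\<lambda>(t, u) x. h1 i x) (h1' i) B5"
    using fam[of "{1..s1}" "\<lambda>i (t, u) x. h1 i x"] C(5) by blast
  define B where "B = Max {1, B1, B2, B3, B4, B5}"
  have B: "1 \<le> B" "B1 \<le> B" "B2 \<le> B" "B3 \<le> B" "B4 \<le> B" "B5 \<le> B" unfolding B_def by (intro Max_ge; simp)+
  have "regular_at R \<gamma> B \<phi>' f' g' h0' h1'"
    unfolding regular_at_def
    by (intro conjI ballI \<gamma> B(1) tube_C1_mono[OF 1 B(2)] tube_C1_mono[OF 2 B(3)]
        tube_C1_mono[OF bspec[OF 3] B(4)] tube_C1_mono[OF bspec[OF 4] B(5)] tube_C1_mono[OF bspec[OF 5] B(6)])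
  then show ?thesis by blast
qed

end

section \<open>The problem with controls in a ball\<close>

text \<open>Everything that depends on the radius \<open>R\<close> (tube radius, bound, derivative
  fields) is fixed here, so that \<open>minimal_process\<close> retains only objects common to all
  radii.\<close>

locale truncated_process = minimal_process t0 t1 f \<phi> s0 s1 l h0 h1 U g xs us uu R0 N
  for t0 t1 :: real
    and f :: "real \<Rightarrow> real^'n \<Rightarrow> real^'m \<Rightarrow> real"
    and \<phi> :: "real \<Rightarrow> real^'n \<Rightarrow> real^'m \<Rightarrow> real^'n"
    and s0 s1 l :: nat
    and h0 h1 :: "nat \<Rightarrow> real^'n \<Rightarrow> real"
    and U :: "(real^'m) set"
    and g :: "nat \<Rightarrow> real \<Rightarrow> real^'n \<Rightarrow> real"
    and xs :: "real \<Rightarrow> real^'n"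
    and us uu :: "real \<Rightarrow> real^'m" and R0 :: real and N :: "real set" +
  fixes R \<gamma> B :: real
    and \<phi>' :: "(real \<times> (real^'m)) \<times> (real^'n) \<Rightarrow> (real^'n) \<Rightarrow>\<^sub>L (real^'n)"
    and f' :: "(real \<times> (real^'m)) \<times> (real^'n) \<Rightarrow> (real^'n) \<Rightarrow>\<^sub>L real"
    and g' h0' h1' :: "nat \<Rightarrow> (real \<times> (real^'m)) \<times> (real^'n) \<Rightarrow> (real^'n) \<Rightarrow>\<^sub>L real"
  assumes R: "R \<ge> R0" and data: "regular_at R \<gamma> B \<phi>' f' g' h0' h1'"
begin

abbreviation \<pi> :: "real \<Rightarrow> real^'n \<Rightarrow> real^'n" where "\<pi> \<equiv> tube_proj xs \<gamma>"

abbreviation W :: "(real^'m) set" where "W \<equiv> U \<inter> cball 0 R"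

definition \<Phi> :: "real \<Rightarrow> real^'n \<Rightarrow> real^'m \<Rightarrow> (real^'n) \<times> real" where
  "\<Phi> t x u = (\<phi> t (\<pi> t x) u, f t (\<pi> t x) u)"

lemma \<gamma>: "\<gamma> > 0" and B: "B \<ge> 1"
  and \<phi>_C1: "tube_C1 t0 t1 xs \<gamma> (cball 0 R) (\<lambda>(t, u) x. \<phi> t x u) \<phi>' B"
  and f_C1: "tube_C1 t0 t1 xs \<gamma> (cball 0 R) (\<lambda>(t, u) x. f t x u) f' B"
  and g_C1: "\<And>j. j \<in> {1..l} \<Longrightarrow> tube_C1 t0 t1 xs \<gamma> (cball 0 R) (\<lambda>(t, u) x. g j t x) (g' j) B"
  and h0_C1: "\<And>i. i \<in> {1..s0} \<Longrightarrow> tube_C1 t0 t1 xs \<gamma> (cball 0 R) (\<lambda>(t, u) x. h0 i x) (h0' i) B"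
  and h1_C1: "\<And>i. i \<in> {1..s1} \<Longrightarrow> tube_C1 t0 t1 xs \<gamma> (cball 0 R) (\<lambda>(t, u) x. h1 i x) (h1' i) B"
  using data unfolding regular_at_def by blast+

lemma uu_W: "t \<in> {t0..t1} \<Longrightarrow> uu t \<in> W"
  using uu_U[of t] R by auto

lemma \<pi>_xs [simp]: "\<pi> t (xs t) = xs t"
  using \<gamma> by (intro tube_proj_id) auto

lemma \<phi>_derivative:
  assumes "t \<in> {t0..t1}" "u \<in> cball 0 R"
  shows "((\<lambda>x. \<phi> t x u) has_derivative blinfun_apply (\<phi>' ((t, u), xs t))) (at (xs t))"
  using tube_C1_derivative[OF \<phi>_C1 xs_continuous \<gamma> assms, of "xs t"] \<gamma> by simp

lemma f_derivative:
  assumes "t \<in> {t0..t1}" "u \<in> cball 0 R"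
  shows "((\<lambda>x. f t x u) has_derivative blinfun_apply (f' ((t, u), xs t))) (at (xs t))"
  using tube_C1_derivative[OF f_C1 xs_continuous \<gamma> assms, of "xs t"] \<gamma> by simp

lemma D_eq:
  assumes "t \<in> {t0..t1}"
  shows "D t v = (blinfun_apply (\<phi>' ((t, uu t), xs t)) v, blinfun_apply (f' ((t, uu t), xs t)) v)"
proof -
  have u: "uu t \<in> cball 0 R" using uu_W[OF assms] by blast
  show ?thesis
    unfolding D_def frechet_derivative_at[OF \<phi>_derivative[OF assms u], symmetric]
      frechet_derivative_at[OF f_derivative[OF assms u], symmetric] ..
qed

text \<open>The factor 2 in \<open>2 * B\<close> arises because dynamics and cost are bounded
  separately by \<open>B\<close> and paired.\<close>

lemma control_system_truncated: "control_system t0 t1 xs uu W \<Phi> D (2 * B)"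
proof (rule control_system.intro)
  show "t0 < t1" "uu \<in> borel_measurable (lebesgue_on {t0..t1})" "continuous_on {t0..t1} xs"
    by (rule t01 uu_measurable xs_continuous)+
  show "1 \<le> 2 * B" using B by simp
  show "uu t \<in> W" if "t \<in> {t0..t1}" for t using uu_W[OF that] .
  show "xs t = xs t0 + integral {t0..t} (\<lambda>s. fst (\<Phi> s (xs s) (uu s)))" if "t \<in> {t0..t1}" for t
    using xs_eq[OF that] by (simp add: \<Phi>_def)
  fix t assume t: "t \<in> {t0..t1}"
  show "norm (\<Phi> t x u) \<le> 2 * B" if "u \<in> W" for x u
  proof -
    have u: "u \<in> cball 0 R" using that by blast
    show ?thesis
      using tube_C1_proj_bound[OF \<phi>_C1 xs_continuous \<gamma> t u, of x] tube_C1_proj_bound[OF f_C1 xs_continuous \<gamma> t u, of x]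
        norm_Pair_le[of "\<phi> t (\<pi> t x) u" "f t (\<pi> t x) u"]
      unfolding \<Phi>_def by simp
  qed
  show "norm (\<Phi> t x u - \<Phi> t y u) \<le> 2 * B * norm (x - y)" if "u \<in> W" for x y u
  proof -
    have u: "u \<in> cball 0 R" using that by blast
    show ?thesis
      using tube_C1_proj_Lipschitz[OF \<phi>_C1 xs_continuous \<gamma> t u, of x y] tube_C1_proj_Lipschitz[OF f_C1 xs_continuous \<gamma> t u, of x y]
        norm_Pair_le[of "\<phi> t (\<pi> t x) u - \<phi> t (\<pi> t y) u" "f t (\<pi> t x) u - f t (\<pi> t y) u"]
      unfolding \<Phi>_def by simp
  qed
  show "linear (D t)"
    by (rule linearI) (simp_all add: D_eq[OF t] blinfun.add_right blinfun.scaleR_right)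
  have u: "uu t \<in> cball 0 R" using uu_W[OF t] by blast
  show "norm (D t v) \<le> 2 * B * norm v" for v
    using tube_C1_derivative_bound[OF \<phi>_C1 xs_continuous \<gamma> t u, of v] tube_C1_derivative_bound[OF f_C1 xs_continuous \<gamma> t u, of v]
      norm_Pair_le[of "blinfun_apply (\<phi>' ((t, uu t), xs t)) v" "blinfun_apply (f' ((t, uu t), xs t)) v"]
    unfolding D_eq[OF t] by simp
next
  show "(\<lambda>t. \<Phi> t (x t) (u t)) \<in> borel_measurable (lebesgue_on {t0..t1})"
    if "continuous_on {t0..t1} x" "u \<in> borel_measurable (lebesgue_on {t0..t1})" "\<And>t. t \<in> {t0..t1} \<Longrightarrow> u t \<in> W" for x u
    unfolding \<Phi>_def
    using tube_C1_proj_measurable[OF \<phi>_C1 xs_continuous \<gamma> that(1,2)] tube_C1_proj_measurable[OF f_C1 xs_continuous \<gamma> that(1,2)] that(3)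
    by (intro borel_measurable_Pair) auto
  show "(\<lambda>t. D t v) \<in> borel_measurable (lebesgue_on {t0..t1})" for v
  proof (rule measurable_cong[THEN iffD1])
    show "(\<lambda>t. (blinfun_apply (\<phi>' ((t, uu t), xs t)) v, blinfun_apply (f' ((t, uu t), xs t)) v)) \<in> borel_measurable (lebesgue_on {t0..t1})"
      using tube_C1_derivative_measurable[OF \<phi>_C1 xs_continuous \<gamma> uu_measurable] tube_C1_derivative_measurable[OF f_C1 xs_continuous \<gamma> uu_measurable] uu_W
      by (intro borel_measurable_Pair) auto
  qed (simp add: D_eq)
qed

sublocale cs: control_system t0 t1 xs uu W \<Phi> D "2 * B"
  by (rule control_system_truncated)

definition \<psi> :: "nat \<times> nat \<Rightarrow> (real^'n) \<times> (real^'n) \<times> real \<Rightarrow> real" where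
  "\<psi> = (\<lambda>(k, i) e. if k = 0 then snd (snd e) - snd (snd (cs.endpoints (xs t0) uu))
     else if k = 1 then h0 i (\<pi> t0 (fst e)) else if k = 2 then - h0 i (\<pi> t0 (fst e))
     else if k = 3 then h1 i (\<pi> t1 (fst (snd e))) else - h1 i (\<pi> t1 (fst (snd e))))"

lemma endpoints_xs: "cs.endpoints (xs t0) uu = (xs t0, xs t1, cost t0 t1 f xs us)"
proof -
  have "integral {t0..t1} (\<lambda>s. snd (\<Phi> s (cs.traj (xs t0) uu s) (uu s))) = integral {t0..t1} (\<lambda>s. f s (xs s) (uu s))"
    by (intro Henstock_Kurzweil_Integration.integral_cong) (simp add: \<Phi>_def cs.traj_xs)
  also have "\<dots> = integral {t0..t1} (\<lambda>s. f s (xs s) (us s))"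
    by (rule integral_spike[OF N]) (simp add: uu_us)
  also have "\<dots> = cost t0 t1 f xs us"
    using admissible_xs unfolding cost_def admissible_def by (simp add: set_lebesgue_integral_eq_integral(2))
  finally show ?thesis using t01 by (simp add: cs.endpoints_def cs.traj_xs)
qed

text \<open>Inside the tube the projection is the identity, so trajectories of the truncated system
  are admissible processes of the original problem with the same cost.\<close>

lemma truncated_admissible:
  assumes u: "cs.control u" and near: "\<And>t. t \<in> {t0..t1} \<Longrightarrow> norm (cs.traj \<xi> u t - xs t) \<le> \<gamma>"
    and h: "\<And>i. i \<in> {1..s0} \<Longrightarrow> h0 i \<xi> = 0" "\<And>i. i \<in> {1..s1} \<Longrightarrow> h1 i (cs.traj \<xi> u t1) = 0"
    and g: "\<And>j t. j \<in> {1..l} \<Longrightarrow> t \<in> {t0..t1} \<Longrightarrow> g j t (cs.traj \<xi> u t) \<le> 0"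
  shows "admissible t0 t1 f \<phi> s0 h0 s1 h1 U l g (cs.traj \<xi> u) u"
    "cost t0 t1 f (cs.traj \<xi> u) u = snd (snd (cs.endpoints \<xi> u))"
proof -
  let ?x = "cs.traj \<xi> u"
  have \<Phi>eq: "\<Phi> t (?x t) (u t) = (\<phi> t (?x t) (u t), f t (?x t) (u t))" if "t \<in> {t0..t1}" for t
    using near[OF that] by (simp add: \<Phi>_def tube_proj_id)
  have sol: "cs.solution \<xi> u ?x" by (rule cs.solution_traj[OF u])
  have b: "bmeas t0 t1 (\<lambda>t. fst (\<Phi> t (?x t) (u t)))" by (intro bmeas_fst cs.bmeas_\<Phi>_traj u)
  obtain N' where N': "negligible N'" "\<And>t. t \<in> {t0..t1} - N' \<Longrightarrow>
      ((\<lambda>s. integral {t0..s} (\<lambda>t. fst (\<Phi> t (?x t) (u t)))) has_vector_derivative fst (\<Phi> t (?x t) (u t))) (at t within {t0..t1})"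
    using integral_has_vector_derivative_AE[OF b] by blast
  have d: "(?x has_vector_derivative \<phi> t (?x t) (u t)) (at t within {t0..t1})" if t: "t \<in> {t0..t1} - N'" for t
  proof -
    have "((\<lambda>s. \<xi> + integral {t0..s} (\<lambda>t. fst (\<Phi> t (?x t) (u t)))) has_vector_derivative fst (\<Phi> t (?x t) (u t))) (at t within {t0..t1})"
      using has_vector_derivative_add[OF has_vector_derivative_const N'(2)[OF t], of \<xi>] by simp
    then have "(?x has_vector_derivative fst (\<Phi> t (?x t) (u t))) (at t within {t0..t1})"
      by (rule has_vector_derivative_transform[rotated 2]) (use t sol in \<open>auto simp: cs.solution_def\<close>)
    then show ?thesis using \<Phi>eq[of t] t by simp
  qed
  have "norm (\<phi> t (?x t) (u t)) \<le> 2 * B" if "t \<in> {t0..t1}" for t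
    using cs.\<Phi>_bound[OF that, of "u t" "?x t"] u that \<Phi>eq[OF that] norm_fst_le[of "\<phi> t (?x t) (u t)" "f t (?x t) (u t)"]
    by (simp add: cs.control_def)
  then have "\<exists>N. negligible N \<and> (\<forall>t\<in>{t0..t1} - N. \<exists>v. (?x has_vector_derivative v) (at t within {t0..t1}) \<and> norm v \<le> 2 * B)"
    using N'(1) d by (intro exI[of _ N'] conjI ballI exI[of _ "\<phi> t (?x t) (u t)" for t]) auto
  then have "AE t in lebesgue_on {t0..t1}. \<exists>v. (?x has_vector_derivative v) (at t within {t0..t1}) \<and> norm v \<le> 2 * B"
    by (subst AE_lebesgue_on_iff_negligible) auto
  moreover have "absolutely_continuous_on {t0..t1} ?x"
    using cs.solution_Lipschitz[OF sol u] by (intro Lipschitz_absolutely_continuous_on) blast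
  ultimately have W: "W1_inf t0 t1 ?x" unfolding W1_inf_def by blast
  have L: "L_inf t0 t1 U u"
    unfolding L_inf_def
  proof (intro conjI exI)
    show "u \<in> borel_measurable (lebesgue_on {t0..t1})" using u by (simp add: cs.control_def)
    show "AE t in lebesgue_on {t0..t1}. u t \<in> U" using u by (intro AE_I2) (auto simp: cs.control_def)
    show "AE t in lebesgue_on {t0..t1}. norm (u t) \<le> R" using u by (intro AE_I2) (auto simp: cs.control_def)
  qed
  have fb: "bmeas t0 t1 (\<lambda>t. f t (?x t) (u t))"
    by (rule bmeas_cong[OF bmeas_snd[OF cs.bmeas_\<Phi>_traj[OF u, of \<xi>]]]) (simp add: \<Phi>eq)
  have fi: "set_integrable lebesgue {t0..t1} (\<lambda>t. f t (?x t) (u t))"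
    by (rule bmeas_absolutely_integrable[OF fb]) auto
  have "AE t in lebesgue_on {t0..t1}. (?x has_vector_derivative \<phi> t (?x t) (u t)) (at t within {t0..t1})"
    using N'(1) d by (subst AE_lebesgue_on_iff_negligible) auto
  then show "admissible t0 t1 f \<phi> s0 h0 s1 h1 U l g ?x u"
    unfolding admissible_def using W L h g fi cs.traj_start[OF u] by simp
  have "cost t0 t1 f ?x u = integral {t0..t1} (\<lambda>t. f t (?x t) (u t))"
    unfolding cost_def by (rule set_lebesgue_integral_eq_integral(2)[OF fi])
  also have "\<dots> = snd (snd (cs.endpoints \<xi> u))"
    unfolding cs.endpoints_def snd_conv by (intro Henstock_Kurzweil_Integration.integral_cong) (simp add: \<Phi>eq)
  finally show "cost t0 t1 f ?x u = snd (snd (cs.endpoints \<xi> u))" .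
qed

text \<open>If no value were positive, each pair of opposite constraints would give an equality, the
  process would be admissible, and its cost would be lower than the minimal one by at least
  \<open>s\<close>. The bound on the distance keeps its trajectory both in the tube and in the
  neighbourhood of the strong minimum.\<close>

lemma infeasible:
  assumes \<epsilon>0: "\<epsilon>0 > 0"
    and min: "\<And>x u. admissible t0 t1 f \<phi> s0 h0 s1 h1 U l g x u \<Longrightarrow> (\<And>t. t \<in> {t0..t1} \<Longrightarrow> norm (x t - xs t) \<le> \<epsilon>0) \<Longrightarrow>
      cost t0 t1 f xs us \<le> cost t0 t1 f x u"
    and s: "s > 0" and u: "cs.control u"
    and dist: "cs.process_dist (xs t0, uu) (\<xi>, u) \<le> min \<gamma> \<epsilon>0 / cs.C1"
  shows "(\<exists>i\<in>index. \<psi> i (cs.endpoints \<xi> u) + s * (if fst i = 0 then 1 else 0) > 0)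
    \<or> (\<exists>j\<in>{1..l}. \<exists>t\<in>{t0..t1}. g j t (\<pi> t (cs.traj \<xi> u t)) > 0)"
proof (rule ccontr)
  assume neg: "\<not> ?thesis"
  let ?x = "cs.traj \<xi> u"
  have near: "norm (?x t - xs t) \<le> min \<gamma> \<epsilon>0" if t: "t \<in> {t0..t1}" for t
  proof -
    have "norm (?x t - xs t) \<le> cs.C1 * cs.process_dist (\<xi>, u) (xs t0, uu)"
      using cs.traj_diff[OF u cs.control_us t, of \<xi> "xs t0"] cs.traj_xs[OF t] by simp
    also have "\<dots> \<le> cs.C1 * (min \<gamma> \<epsilon>0 / cs.C1)"
      using dist cs.C1 by (intro mult_left_mono) (auto simp: cs.process_dist_commute)
    also have "\<dots> = min \<gamma> \<epsilon>0" using cs.C1 by simp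
    finally show ?thesis .
  qed
  have pi: "\<pi> t (?x t) = ?x t" if "t \<in> {t0..t1}" for t using near[OF that] by (intro tube_proj_id) simp
  have t: "t0 \<in> {t0..t1}" "t1 \<in> {t0..t1}" using t01 by auto
  have \<psi>: "\<psi> i (cs.endpoints \<xi> u) + s * (if fst i = 0 then 1 else 0) \<le> 0" if "i \<in> index" for i
    using neg that by (auto simp: not_less)
  have "h0 i \<xi> = 0" if "i \<in> {1..s0}" for i
    using \<psi>[of "(1, i)"] \<psi>[of "(2, i)"] that pi[OF t(1)] cs.traj_start[OF u, of \<xi>]
    by (auto simp: index_def \<psi>_def cs.endpoints_def)
  moreover have "h1 i (?x t1) = 0" if "i \<in> {1..s1}" for i
    using \<psi>[of "(3, i)"] \<psi>[of "(4, i)"] that pi[OF t(2)]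
    by (auto simp: index_def \<psi>_def cs.endpoints_def)
  moreover have "g j t (?x t) \<le> 0" if "j \<in> {1..l}" "t \<in> {t0..t1}" for j t
    using neg that pi[OF that(2)] by (metis not_less)
  ultimately have adm: "admissible t0 t1 f \<phi> s0 h0 s1 h1 U l g ?x u"
    and c: "cost t0 t1 f ?x u = snd (snd (cs.endpoints \<xi> u))"
    using near by (intro truncated_admissible u; auto)+
  have "cost t0 t1 f xs us \<le> cost t0 t1 f ?x u" using near by (intro min adm) auto
  moreover have "cost t0 t1 f ?x u - cost t0 t1 f xs us + s \<le> 0"
    using \<psi>[of "(0, 0)"] unfolding c by (simp add: index_def \<psi>_def endpoints_xs)
  ultimately show False using s by linarith
qed

lemma uu_cball: "t \<in> {t0..t1} \<Longrightarrow> uu t \<in> cball 0 R" using uu_W by blast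

lemma real_tube_C1_near:
  fixes F :: "real \<times> (real^'m) \<Rightarrow> real^'n \<Rightarrow> real"
  assumes C1: "tube_C1 t0 t1 xs \<gamma> (cball 0 R) F F' B" and \<eta>: "\<eta> > 0"
  shows "\<exists>\<delta>>0. \<forall>t\<in>{t0..t1}. \<forall>x y. norm (x - xs t) \<le> \<delta> \<longrightarrow> norm (y - xs t) \<le> \<delta> \<longrightarrow>
     \<bar>F (t, uu t) (\<pi> t x) - F (t, uu t) (\<pi> t y) - grad (F (t, uu t)) (xs t) \<bullet> (x - y)\<bar> \<le> \<eta> * norm (x - y)"
proof -
  obtain \<delta> where \<delta>: "\<delta> > 0" "\<And>t u x y. t \<in> {t0..t1} \<Longrightarrow> u \<in> cball 0 R \<Longrightarrow> norm (x - xs t) \<le> \<delta> \<Longrightarrow> norm (y - xs t) \<le> \<delta> \<Longrightarrow>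
      norm (F (t, u) (\<pi> t x) - F (t, u) (\<pi> t y) - blinfun_apply (F' ((t, u), xs t)) (x - y)) \<le> \<eta> * norm (x - y)"
    using tube_C1_proj_near[OF C1 xs_continuous \<gamma> \<eta>] by blast
  show ?thesis
  proof (intro exI[of _ \<delta>] conjI ballI allI impI)
    fix t x y assume *: "t \<in> {t0..t1}" "norm (x - xs t) \<le> \<delta>" "norm (y - xs t) \<le> \<delta>"
    show "\<bar>F (t, uu t) (\<pi> t x) - F (t, uu t) (\<pi> t y) - grad (F (t, uu t)) (xs t) \<bullet> (x - y)\<bar> \<le> \<eta> * norm (x - y)"
      using \<delta>(2)[OF *(1) uu_cball[OF *(1)] *(2,3)] tube_C1_grad(2)[OF C1 xs_continuous \<gamma> *(1) uu_cball[OF *(1)]] by simp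
  qed (rule \<delta>)
qed

lemma index_cases:
  assumes "i \<in> index"
  obtains "i = (0, 0)" | k where "i = (1, k)" "k \<in> {1..s0}" | k where "i = (2, k)" "k \<in> {1..s0}"
    | k where "i = (3, k)" "k \<in> {1..s1}" | k where "i = (4, k)" "k \<in> {1..s1}"
  using assms unfolding index_def by blast

lemma \<psi>_simps:
  "\<psi> (0, k) e = snd (snd e) - snd (snd (cs.endpoints (xs t0) uu))"
  "\<psi> (1, k) e = h0 k (\<pi> t0 (fst e))" "\<psi> (Suc 0, k) e = h0 k (\<pi> t0 (fst e))" "\<psi> (2, k) e = - h0 k (\<pi> t0 (fst e))"
  "\<psi> (3, k) e = h1 k (\<pi> t1 (fst (snd e)))" "\<psi> (4, k) e = - h1 k (\<pi> t1 (fst (snd e)))"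
  by (simp_all add: \<psi>_def)

lemma endpoint_grad_simps:
  "endpoint_grad (0, k) = (0, 0, 1)"
  "endpoint_grad (1, k) = (grad (h0 k) (xs t0), 0, 0)" "endpoint_grad (Suc 0, k) = (grad (h0 k) (xs t0), 0, 0)" "endpoint_grad (2, k) = (- grad (h0 k) (xs t0), 0, 0)"
  "endpoint_grad (3, k) = (0, grad (h1 k) (xs t1), 0)" "endpoint_grad (4, k) = (0, - grad (h1 k) (xs t1), 0)"
  by (simp_all add: endpoint_grad_def)

lemma t0_in: "t0 \<in> {t0..t1}" and t1_in: "t1 \<in> {t0..t1}" using t01 by auto

lemma norm_fst_snd_diff: "norm (fst e - fst e') \<le> norm (e - e')" "norm (fst (snd e) - fst (snd e')) \<le> norm (e - e')"
  "\<bar>snd (snd e) - snd (snd e')\<bar> \<le> norm (e - e')" for e e' :: "(real^'n) \<times> (real^'n) \<times> real"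
  using norm_fst_le_norm[of "e - e'"] norm_snd_le_norm[of "e - e'"] norm_fst_le_norm[of "snd (e - e')"] norm_snd_le_norm[of "snd (e - e')"]
  unfolding real_norm_def[symmetric] fst_diff snd_diff by linarith+

lemma \<psi>_Lipschitz:
  assumes "i \<in> index"
  shows "\<bar>\<psi> i e - \<psi> i e'\<bar> \<le> 2 * B * norm (e - e')"
proof -
  have B1: "B * norm z \<le> 2 * B * norm (e - e')" if "norm z \<le> norm (e - e')" for z :: "real^'n"
    using that B mult_left_mono[OF that, of B] norm_ge_zero[of "e - e'"] mult_nonneg_nonneg[of B "norm (e - e')"] by linarith
  have h0L: "\<bar>h0 k (\<pi> t0 (fst e)) - h0 k (\<pi> t0 (fst e'))\<bar> \<le> 2 * B * norm (e - e')" if "k \<in> {1..s0}" for k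
    using tube_C1_proj_Lipschitz[OF h0_C1[OF that] xs_continuous \<gamma> t0_in uu_cball[OF t0_in], of "fst e" "fst e'"] B1[OF norm_fst_snd_diff(1)]
    by simp
  have h1L: "\<bar>h1 k (\<pi> t1 (fst (snd e))) - h1 k (\<pi> t1 (fst (snd e')))\<bar> \<le> 2 * B * norm (e - e')" if "k \<in> {1..s1}" for k
    using tube_C1_proj_Lipschitz[OF h1_C1[OF that] xs_continuous \<gamma> t1_in uu_cball[OF t1_in], of "fst (snd e)" "fst (snd e')"] B1[OF norm_fst_snd_diff(2)]
    by simp
  have J: "\<bar>snd (snd e) - snd (snd e')\<bar> \<le> 2 * B * norm (e - e')"
    using norm_fst_snd_diff(3)[of e e'] B mult_right_mono[of 1 "2 * B" "norm (e - e')"] by simp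
  from assms show ?thesis
  proof (cases rule: index_cases)
    case (3 k)
    then show ?thesis using h0L[OF 3(2)] by (simp add: \<psi>_simps abs_minus_commute)
  next
    case (5 k)
    then show ?thesis using h1L[OF 5(2)] by (simp add: \<psi>_simps abs_minus_commute)
  qed (use J h0L h1L in \<open>simp_all add: \<psi>_simps\<close>)
qed

lemma endpoint_grad_bound:
  assumes "i \<in> index"
  shows "norm (endpoint_grad i) \<le> 2 * B"
proof -
  have h0B: "norm (grad (h0 k) (xs t0)) \<le> B" if "k \<in> {1..s0}" for k
    using tube_C1_grad_bound[OF h0_C1[OF that] xs_continuous \<gamma> t0_in uu_cball[OF t0_in]] by simp
  have h1B: "norm (grad (h1 k) (xs t1)) \<le> B" if "k \<in> {1..s1}" for k
    using tube_C1_grad_bound[OF h1_C1[OF that] xs_continuous \<gamma> t1_in uu_cball[OF t1_in]] by simp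
  from assms show ?thesis
  proof (cases rule: index_cases)
    case (2 k)
    then show ?thesis using h0B[OF 2(2)] B by (simp add: endpoint_grad_simps norm_Pair)
  next
    case (3 k)
    then show ?thesis using h0B[OF 3(2)] B by (simp add: endpoint_grad_simps norm_Pair)
  next
    case (4 k)
    then show ?thesis using h1B[OF 4(2)] B by (simp add: endpoint_grad_simps norm_Pair)
  next
    case (5 k)
    then show ?thesis using h1B[OF 5(2)] B by (simp add: endpoint_grad_simps norm_Pair)
  qed (use B in \<open>simp add: endpoint_grad_simps norm_Pair\<close>)
qed

text \<open>The halves of \<eta> are spent on dynamics and cost; the finitely many remaining
  functions are treated one by one, and the least radius is taken.\<close>

lemma differentiable_data:
  assumes \<eta>: "\<eta> > 0"
  shows "\<exists>\<delta>>0.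
        (\<forall>t\<in>{t0..t1}. \<forall>x y. norm (x - xs t) \<le> \<delta> \<longrightarrow> norm (y - xs t) \<le> \<delta> \<longrightarrow>
            norm (\<Phi> t x (uu t) - \<Phi> t y (uu t) - D t (x - y)) \<le> \<eta> * norm (x - y)) \<and>
        (\<forall>i\<in>index. \<forall>e e'. norm (e - cs.endpoints (xs t0) uu) \<le> \<delta> \<longrightarrow> norm (e' - cs.endpoints (xs t0) uu) \<le> \<delta> \<longrightarrow>
            \<bar>\<psi> i e - \<psi> i e' - endpoint_grad i \<bullet> (e - e')\<bar> \<le> \<eta> * norm (e - e')) \<and>
        (\<forall>j\<in>{1..l}. \<forall>t\<in>{t0..t1}. \<forall>x y. norm (x - xs t) \<le> \<delta> \<longrightarrow> norm (y - xs t) \<le> \<delta> \<longrightarrow>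
            \<bar>g j t (\<pi> t x) - g j t (\<pi> t y) - grad (g j t) (xs t) \<bullet> (x - y)\<bar> \<le> \<eta> * norm (x - y))"
proof -
  have \<eta>2: "\<eta> / 2 > 0" using \<eta> by simp
  obtain \<delta>1 where \<delta>1: "\<delta>1 > 0" "\<And>t u x y. t \<in> {t0..t1} \<Longrightarrow> u \<in> cball 0 R \<Longrightarrow> norm (x - xs t) \<le> \<delta>1 \<Longrightarrow> norm (y - xs t) \<le> \<delta>1 \<Longrightarrow>
      norm (\<phi> t (\<pi> t x) u - \<phi> t (\<pi> t y) u - blinfun_apply (\<phi>' ((t, u), xs t)) (x - y)) \<le> \<eta> / 2 * norm (x - y)"
    using tube_C1_proj_near[OF \<phi>_C1 xs_continuous \<gamma> \<eta>2] by auto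
  obtain \<delta>2 where \<delta>2: "\<delta>2 > 0" "\<And>t u x y. t \<in> {t0..t1} \<Longrightarrow> u \<in> cball 0 R \<Longrightarrow> norm (x - xs t) \<le> \<delta>2 \<Longrightarrow> norm (y - xs t) \<le> \<delta>2 \<Longrightarrow>
      norm (f t (\<pi> t x) u - f t (\<pi> t y) u - blinfun_apply (f' ((t, u), xs t)) (x - y)) \<le> \<eta> / 2 * norm (x - y)"
    using tube_C1_proj_near[OF f_C1 xs_continuous \<gamma> \<eta>2] by auto
  define Pg where "Pg j \<delta> \<longleftrightarrow> (\<forall>t\<in>{t0..t1}. \<forall>x y. norm (x - xs t) \<le> \<delta> \<longrightarrow> norm (y - xs t) \<le> \<delta> \<longrightarrow>
            \<bar>g j t (\<pi> t x) - g j t (\<pi> t y) - grad (g j t) (xs t) \<bullet> (x - y)\<bar> \<le> \<eta> * norm (x - y))" for j \<delta>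
  have "\<exists>\<delta>>0. \<forall>j\<in>{1..l}. Pg j \<delta>"
  proof (rule finite_common_delta)
    show "\<exists>\<delta>>0. Pg j \<delta>" if "j \<in> {1..l}" for j
      using real_tube_C1_near[OF g_C1[OF that] \<eta>]  unfolding Pg_def by auto
    show "Pg j \<delta>'" if "Pg j \<delta>" "\<delta>' \<le> \<delta>" for j \<delta> \<delta>'
      using that unfolding Pg_def by (meson order_trans)
  qed auto
  then obtain \<delta>3 where \<delta>3: "\<delta>3 > 0" "\<And>j. j \<in> {1..l} \<Longrightarrow> Pg j \<delta>3" by blast
  define P0 where "P0 i \<delta> \<longleftrightarrow> (\<forall>x y. norm (x - xs t0) \<le> \<delta> \<longrightarrow> norm (y - xs t0) \<le> \<delta> \<longrightarrow>
            \<bar>h0 i (\<pi> t0 x) - h0 i (\<pi> t0 y) - grad (h0 i) (xs t0) \<bullet> (x - y)\<bar> \<le> \<eta> * norm (x - y))" for i \<delta>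
  have "\<exists>\<delta>>0. \<forall>i\<in>{1..s0}. P0 i \<delta>"
  proof (rule finite_common_delta)
    show "\<exists>\<delta>>0. P0 i \<delta>" if "i \<in> {1..s0}" for i
      using real_tube_C1_near[OF h0_C1[OF that] \<eta>] t0_in unfolding P0_def by auto
    show "P0 i \<delta>'" if "P0 i \<delta>" "\<delta>' \<le> \<delta>" for i \<delta> \<delta>'
      using that unfolding P0_def by (meson order_trans)
  qed auto
  then obtain \<delta>4 where \<delta>4: "\<delta>4 > 0" "\<And>i. i \<in> {1..s0} \<Longrightarrow> P0 i \<delta>4" by blast
  define P1 where "P1 i \<delta> \<longleftrightarrow> (\<forall>x y. norm (x - xs t1) \<le> \<delta> \<longrightarrow> norm (y - xs t1) \<le> \<delta> \<longrightarrow>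
            \<bar>h1 i (\<pi> t1 x) - h1 i (\<pi> t1 y) - grad (h1 i) (xs t1) \<bullet> (x - y)\<bar> \<le> \<eta> * norm (x - y))" for i \<delta>
  have "\<exists>\<delta>>0. \<forall>i\<in>{1..s1}. P1 i \<delta>"
  proof (rule finite_common_delta)
    show "\<exists>\<delta>>0. P1 i \<delta>" if "i \<in> {1..s1}" for i
      using real_tube_C1_near[OF h1_C1[OF that] \<eta>] t1_in unfolding P1_def by auto
    show "P1 i \<delta>'" if "P1 i \<delta>" "\<delta>' \<le> \<delta>" for i \<delta> \<delta>'
      using that unfolding P1_def by (meson order_trans)
  qed auto
  then obtain \<delta>5 where \<delta>5: "\<delta>5 > 0" "\<And>i. i \<in> {1..s1} \<Longrightarrow> P1 i \<delta>5" by blast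
  define \<delta> where "\<delta> = Min {\<delta>1, \<delta>2, \<delta>3, \<delta>4, \<delta>5}"
  have \<delta>: "\<delta> > 0" unfolding \<delta>_def using \<delta>1 \<delta>2 \<delta>3 \<delta>4 \<delta>5 by simp
  have le: "\<delta> \<le> \<delta>1" "\<delta> \<le> \<delta>2" "\<delta> \<le> \<delta>3" "\<delta> \<le> \<delta>4" "\<delta> \<le> \<delta>5" unfolding \<delta>_def by (intro Min_le; simp)+
  show ?thesis
  proof (intro exI[of _ \<delta>] conjI ballI allI impI)
    fix t x y assume t: "t \<in> {t0..t1}" and xy: "norm (x - xs t) \<le> \<delta>" "norm (y - xs t) \<le> \<delta>"
    have "norm (\<Phi> t x (uu t) - \<Phi> t y (uu t) - D t (x - y))
      \<le> norm (\<phi> t (\<pi> t x) (uu t) - \<phi> t (\<pi> t y) (uu t) - blinfun_apply (\<phi>' ((t, uu t), xs t)) (x - y))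
       + norm (f t (\<pi> t x) (uu t) - f t (\<pi> t y) (uu t) - blinfun_apply (f' ((t, uu t), xs t)) (x - y))"
      unfolding \<Phi>_def D_eq[OF t] diff_Pair by (rule norm_Pair_le)
    also have "\<dots> \<le> \<eta> / 2 * norm (x - y) + \<eta> / 2 * norm (x - y)"
      using xy le by (intro add_mono \<delta>1 \<delta>2 t uu_cball) auto
    finally show "norm (\<Phi> t x (uu t) - \<Phi> t y (uu t) - D t (x - y)) \<le> \<eta> * norm (x - y)" by simp
  next
    fix i and e e' :: "(real^'n) \<times> (real^'n) \<times> real"
    assume i: "i \<in> index" and e: "norm (e - cs.endpoints (xs t0) uu) \<le> \<delta>" "norm (e' - cs.endpoints (xs t0) uu) \<le> \<delta>"
    have n: "\<eta> * norm (fst e - fst e') \<le> \<eta> * norm (e - e')" "\<eta> * norm (fst (snd e) - fst (snd e')) \<le> \<eta> * norm (e - e')"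
      using \<eta> norm_fst_snd_diff by (intro mult_left_mono; simp)+
    have e0: "norm (fst e - xs t0) \<le> \<delta>4" "norm (fst e' - xs t0) \<le> \<delta>4" "norm (fst (snd e) - xs t1) \<le> \<delta>5" "norm (fst (snd e') - xs t1) \<le> \<delta>5"
      using norm_fst_snd_diff[of e "cs.endpoints (xs t0) uu"] norm_fst_snd_diff[of e' "cs.endpoints (xs t0) uu"] e le
      by (auto simp: endpoints_xs)
    have h0D: "\<bar>h0 k (\<pi> t0 (fst e)) - h0 k (\<pi> t0 (fst e')) - grad (h0 k) (xs t0) \<bullet> (fst e - fst e')\<bar> \<le> \<eta> * norm (e - e')"
      if "k \<in> {1..s0}" for k
      using \<delta>4(2)[OF that] e0(1,2) n(1) unfolding P0_def by (meson order_trans)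
    have h1D: "\<bar>h1 k (\<pi> t1 (fst (snd e))) - h1 k (\<pi> t1 (fst (snd e'))) - grad (h1 k) (xs t1) \<bullet> (fst (snd e) - fst (snd e'))\<bar> \<le> \<eta> * norm (e - e')"
      if "k \<in> {1..s1}" for k
      using \<delta>5(2)[OF that] e0(3,4) n(2) unfolding P1_def by (meson order_trans)
    from i show "\<bar>\<psi> i e - \<psi> i e' - endpoint_grad i \<bullet> (e - e')\<bar> \<le> \<eta> * norm (e - e')"
    proof (cases rule: index_cases)
      case 1
      then show ?thesis using \<eta> by (simp add: \<psi>_simps endpoint_grad_simps inner_prod_def)
    next
      case (2 k)
      then show ?thesis using h0D[OF 2(2)] by (simp only: \<psi>_simps endpoint_grad_simps inner_prod_def fst_conv snd_conv fst_diff snd_diff inner_zero_left add_0_right)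
    next
      case (3 k)
      have eq: "- a - - b - (- c + (0 + 0)) = - (a - b - c)" for a b c :: real by simp
      show ?thesis using h0D[OF 3(2)] unfolding 3(1) \<psi>_simps endpoint_grad_simps inner_prod_def fst_conv snd_conv fst_diff snd_diff inner_zero_left inner_minus_left eq abs_minus_cancel .
    next
      case (4 k)
      then show ?thesis using h1D[OF 4(2)] by (simp only: \<psi>_simps endpoint_grad_simps inner_prod_def fst_conv snd_conv fst_diff snd_diff inner_zero_left add_0_right add_0_left)
    next
      case (5 k)
      have eq: "- a - - b - (0 + (- c + 0)) = - (a - b - c)" for a b c :: real by simp
      show ?thesis using h1D[OF 5(2)] unfolding 5(1) \<psi>_simps endpoint_grad_simps inner_prod_def fst_conv snd_conv fst_diff snd_diff inner_zero_left inner_minus_left eq abs_minus_cancel .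
    qed
  next
    fix j t x y assume j: "j \<in> {1..l}" and t: "t \<in> {t0..t1}" and xy: "norm (x - xs t) \<le> \<delta>" "norm (y - xs t) \<le> \<delta>"
    show "\<bar>g j t (\<pi> t x) - g j t (\<pi> t y) - grad (g j t) (xs t) \<bullet> (x - y)\<bar> \<le> \<eta> * norm (x - y)"
      using \<delta>3(2)[OF j] t xy le(3) unfolding Pg_def by (meson order_trans)
  qed (rule \<delta>)
qed

lemma constrained_system_truncated:
  "\<exists>\<rho>. constrained_system t0 t1 xs uu W \<Phi> D (2 * B) index \<psi> endpoint_grad (\<lambda>i. if fst i = 0 then 1 else 0) l
     (\<lambda>j t x. g j t (\<pi> t x)) (\<lambda>j t. grad (g j t) (xs t)) \<rho>"
proof -
  obtain \<epsilon>0 where \<epsilon>0: "\<epsilon>0 > 0" "\<And>x u. admissible t0 t1 f \<phi> s0 h0 s1 h1 U l g x u \<Longrightarrow> (\<And>t. t \<in> {t0..t1} \<Longrightarrow> norm (x t - xs t) \<le> \<epsilon>0) \<Longrightarrow>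
      cost t0 t1 f xs us \<le> cost t0 t1 f x u"
    using minimum unfolding strong_local_min_def by blast
  have start: "h0 i (xs t0) = 0" if "i \<in> {1..s0}" for i using admissible_xs that by (simp add: admissible_def)
  have finish: "h1 i (xs t1) = 0" if "i \<in> {1..s1}" for i using admissible_xs that by (simp add: admissible_def)
  have "constrained_system t0 t1 xs uu W \<Phi> D (2 * B) index \<psi> endpoint_grad (\<lambda>i. if fst i = 0 then 1 else 0) l
     (\<lambda>j t x. g j t (\<pi> t x)) (\<lambda>j t. grad (g j t) (xs t)) (min \<gamma> \<epsilon>0 / cs.C1)"
  proof (intro constrained_system.intro constrained_system_axioms.intro)
    show "control_system t0 t1 xs uu W \<Phi> D (2 * B)" by (rule control_system_truncated)
    show "finite index" "index \<noteq> {}" by (auto simp: index_def)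
    show "\<psi> i (cs.endpoints (xs t0) uu) \<le> 0" if "i \<in> index" for i
      using that by (cases rule: index_cases) (simp_all add: \<psi>_simps endpoints_xs start finish)
    show "\<bar>g j t (\<pi> t x) - g j t (\<pi> t y)\<bar> \<le> 2 * B * norm (x - y)" if "j \<in> {1..l}" "t \<in> {t0..t1}" for j t x y
    proof -
      have "\<bar>g j t (\<pi> t x) - g j t (\<pi> t y)\<bar> \<le> B * norm (x - y)"
        using tube_C1_proj_Lipschitz[OF g_C1[OF that(1)] xs_continuous \<gamma> that(2) uu_cball[OF that(2)], of x y] by simp
      also have "\<dots> \<le> 2 * B * norm (x - y)" using B by (intro mult_right_mono) auto
      finally show ?thesis .
    qed
    show "\<exists>\<delta>>0. \<forall>j\<in>{1..l}. \<forall>s\<in>{t0..t1}. \<forall>t\<in>{t0..t1}. \<forall>x. \<bar>s - t\<bar> \<le> \<delta> \<longrightarrow> \<bar>g j s (\<pi> s x) - g j t (\<pi> t x)\<bar> \<le> \<eta>"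
      if \<eta>: "\<eta> > 0" for \<eta>
    proof (rule finite_common_delta)
      show "\<exists>\<delta>>0. \<forall>s\<in>{t0..t1}. \<forall>t\<in>{t0..t1}. \<forall>x. \<bar>s - t\<bar> \<le> \<delta> \<longrightarrow> \<bar>g j s (\<pi> s x) - g j t (\<pi> t x)\<bar> \<le> \<eta>" if "j \<in> {1..l}" for j
        using tube_C1_proj_uniform[OF g_C1[OF that] xs_continuous \<gamma> uu_cball[OF t0_in] \<eta>] by simp
    qed (meson order_trans | simp)+
    show "g j t (\<pi> t (xs t)) \<le> 0" if "j \<in> {1..l}" "t \<in> {t0..t1}" for j t
      using admissible_xs that by (simp add: admissible_def)
    show "\<bar>g j t (\<pi> t (xs t))\<bar> \<le> 2 * B" if "j \<in> {1..l}" "t \<in> {t0..t1}" for j t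
      using tube_C1_proj_bound[OF g_C1[OF that(1)] xs_continuous \<gamma> that(2) uu_cball[OF that(2)], of "xs t"] B by simp
    show "continuous_on {t0..t1} (\<lambda>t. grad (g j t) (xs t))" if "j \<in> {1..l}" for j
      using tube_C1_grad_continuous[OF g_C1[OF that] xs_continuous \<gamma> uu_cball[OF t0_in]] by simp
    show "norm (grad (g j t) (xs t)) \<le> 2 * B" if "j \<in> {1..l}" "t \<in> {t0..t1}" for j t
      using tube_C1_grad_bound[OF g_C1[OF that(1)] xs_continuous \<gamma> that(2) uu_cball[OF that(2)]] B by simp
    show "min \<gamma> \<epsilon>0 / cs.C1 > 0" using \<gamma> \<epsilon>0 cs.C1 by simp
    show "(\<exists>i\<in>index. \<psi> i (cs.endpoints \<xi> u) + s * (if fst i = 0 then 1 else 0) > 0)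
      \<or> (\<exists>j\<in>{1..l}. \<exists>t\<in>{t0..t1}. g j t (\<pi> t (cs.traj \<xi> u t)) > 0)"
      if "s > 0" "cs.control u" "cs.process_dist (xs t0, uu) (\<xi>, u) \<le> min \<gamma> \<epsilon>0 / cs.C1" for s \<xi> u
      by (rule infeasible[OF \<epsilon>0 that])
  qed (use \<psi>_Lipschitz endpoint_grad_bound differentiable_data in auto)
  then show ?thesis by blast
qed

end

lemma tube_C1_continuous:
  assumes "tube_C1 t0 t1 xs \<gamma> U1 F F' B"
  shows "continuous_on (tube t0 t1 xs \<gamma> U1) (\<lambda>q. F (fst q) (snd q))"
  using assms uniformly_continuous_imp_continuous unfolding tube_C1_def case_prod_unfold by blast

section \<open>Multipliers for growing truncation radii\<close>

context minimal_process
begin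

definition combination :: "(nat \<times> nat \<Rightarrow> real) \<Rightarrow> (real^'n) \<times> (real^'n) \<times> real" where
  "combination w = (\<Sum>i\<in>index. w i *\<^sub>R endpoint_grad i)"

abbreviation adj :: "real \<Rightarrow> (real^'n) \<times> real \<Rightarrow> real^'n" where
  "adj \<equiv> control_system.adj D"

text \<open>\<open>approximate_multipliers\<close> freed of the projection and of the constants
  belonging to a radius; \<open>R\<close> remains only in the set of competing control values. Hence
  sequences with growing \<open>R\<close> can be compared.\<close>

definition weak_multipliers ::
  "real \<Rightarrow> real \<Rightarrow> (nat \<times> nat \<Rightarrow> real) \<Rightarrow> (nat \<Rightarrow> real \<Rightarrow> real) \<Rightarrow> (real \<Rightarrow> real^'n) \<Rightarrow> bool" where
  "weak_multipliers R \<epsilon> w \<omega> p \<longleftrightarrow>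
     (\<forall>i\<in>index. 0 \<le> w i) \<and>
     (\<forall>j\<in>{1..l}. continuous_on {t0..t1} (\<omega> j) \<and> (\<forall>t\<in>{t0..t1}. 0 \<le> \<omega> j t)) \<and>
     (\<Sum>i\<in>index. w i) + (\<Sum>j\<in>{1..l}. integral {t0..t1} (\<omega> j)) = 1 \<and>
     bmeas t0 t1 p \<and>
     (\<forall>t\<in>{t0..t1}. p t = - fst (snd (combination w)) + integral {t..t1} (\<lambda>s. adj s (p s, - snd (snd (combination w))))
          - integral {t..t1} (\<lambda>s. \<Sum>j\<in>{1..l}. \<omega> j s *\<^sub>R grad (g j s) (xs s))) \<and>
     norm (fst (combination w) - p t0) \<le> \<epsilon> \<and>
     (\<forall>v\<in>U \<inter> cball 0 R. \<forall>c d. t0 \<le> c \<longrightarrow> c \<le> d \<longrightarrow> d \<le> t1 \<longrightarrow>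
        integral {c..d} (\<lambda>s. (p s, - snd (snd (combination w))) \<bullet> \<Delta> v s) \<le> \<epsilon>) \<and>
     (\<forall>k\<in>{1..s0}. min (w (1, k)) (w (2, k)) \<le> \<epsilon>) \<and> (\<forall>k\<in>{1..s1}. min (w (3, k)) (w (4, k)) \<le> \<epsilon>) \<and>
     (\<forall>j\<in>{1..l}. integral {t0..t1} (\<lambda>t. \<omega> j t * max 0 (- g j t (xs t))) \<le> \<epsilon>)"

end

context truncated_process
begin

lemma \<Delta>_eq: "\<Delta> v s = \<Phi> s (xs s) v - \<Phi> s (xs s) (uu s)"
  by (simp add: \<Delta>_def \<Phi>_def)

lemma bmeas_\<Delta>:
  assumes v: "v \<in> W"
  shows "bmeas t0 t1 (\<Delta> v)"
  unfolding \<Delta>_eq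
proof (intro bmeas_diff)
  show "bmeas t0 t1 (\<lambda>s. \<Phi> s (xs s) v)"
    using v by (intro bmeasI[of _ _ _ "2 * B"] cs.\<Phi>_measurable cs.\<Phi>_bound xs_continuous) auto
  show "bmeas t0 t1 (\<lambda>s. \<Phi> s (xs s) (uu s))"
    using uu_W by (intro bmeasI[of _ _ _ "2 * B"] cs.\<Phi>_measurable cs.\<Phi>_bound xs_continuous uu_measurable) auto
qed

text \<open>The bounds on the minima hold because \<open>\<psi> (1, k) e\<close> and
  \<open>\<psi> (2, k) e\<close> are opposite numbers, and likewise for 3 and 4; one of them is not
  positive, so its weight is at most \<epsilon>.\<close>

lemma weak_multipliers_exist_truncated:
  assumes \<epsilon>: "\<epsilon> > 0"
  shows "\<exists>w \<omega> p. weak_multipliers R \<epsilon> w \<omega> p"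
proof -
  obtain \<rho> where "constrained_system t0 t1 xs uu W \<Phi> D (2 * B) index \<psi> endpoint_grad (\<lambda>i. if fst i = 0 then 1 else 0) l
     (\<lambda>j t x. g j t (\<pi> t x)) (\<lambda>j t. grad (g j t) (xs t)) \<rho>"
    using constrained_system_truncated by blast
  then interpret cn: constrained_system t0 t1 xs uu W \<Phi> D "2 * B" index \<psi> endpoint_grad "\<lambda>i. if fst i = 0 then 1 else 0" l
     "\<lambda>j t x. g j t (\<pi> t x)" "\<lambda>j t. grad (g j t) (xs t)" \<rho> .
  obtain w \<omega> p \<alpha> where *: "cn.approximate_multipliers \<epsilon> w \<omega> p \<alpha>"
    using cn.approximate_multipliers_exist[OF \<epsilon>] by blast
  then have \<alpha>: "\<alpha> = combination w" unfolding cn.approximate_multipliers_def combination_def by blast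
  have "\<exists>e. \<forall>i\<in>index. w i \<le> \<epsilon> \<or> (if fst i = 0 then 1 else 0 :: real) > 0 \<or> \<psi> i e > 0"
    using * unfolding cn.approximate_multipliers_def by blast
  then obtain e where e: "\<And>i. i \<in> index \<Longrightarrow> fst i \<noteq> 0 \<Longrightarrow> w i \<le> \<epsilon> \<or> \<psi> i e > 0" by force
  have "min (w (1, k)) (w (2, k)) \<le> \<epsilon>" if "k \<in> {1..s0}" for k
    using e[of "(1, k)"] e[of "(2, k)"] that unfolding \<psi>_simps by (auto simp: index_def)
  moreover have "min (w (3, k)) (w (4, k)) \<le> \<epsilon>" if "k \<in> {1..s1}" for k
    using e[of "(3, k)"] e[of "(4, k)"] that unfolding \<psi>_simps by (auto simp: index_def)
  ultimately show ?thesis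
    using * unfolding cn.approximate_multipliers_def \<alpha> weak_multipliers_def \<Delta>_eq \<pi>_xs
    by (intro exI[of _ w] exI[of _ \<omega>] exI[of _ p]) blast
qed

lemma continuous_constraints:
  assumes "j \<in> {1..l}"
  shows "continuous_on {t0..t1} (\<lambda>t. g j t (xs t))" "continuous_on {t0..t1} (\<lambda>t. grad (g j t) (xs t))"
proof -
  show "continuous_on {t0..t1} (\<lambda>t. grad (g j t) (xs t))"
    using tube_C1_grad_continuous[OF g_C1[OF assms] xs_continuous \<gamma> uu_cball[OF t0_in]] by simp
  have "continuous_on {t0..t1} (\<lambda>t. ((t, uu t0), xs t))" by (intro continuous_intros xs_continuous)
  moreover have "(\<lambda>t. ((t, uu t0), xs t)) ` {t0..t1} \<subseteq> tube t0 t1 xs \<gamma> (cball 0 R)"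
    using uu_cball[OF t0_in] \<gamma> by (auto intro!: tubeI)
  ultimately have "continuous_on {t0..t1} (\<lambda>t. (\<lambda>(t, u) x. g j t x) (fst ((t, uu t0), xs t)) (snd ((t, uu t0), xs t)))"
    by (rule continuous_on_compose2[OF tube_C1_continuous[OF g_C1[OF assms]]])
  then show "continuous_on {t0..t1} (\<lambda>t. g j t (xs t))" by simp
qed

end

context minimal_process
begin

lemma R0: "R0 \<ge> 0"
  using uu_U[of t0] t01 norm_ge_zero[of "uu t0"] by (simp del: norm_ge_zero)

lemma truncated_process_exists:
  assumes "R \<ge> R0"
  shows "\<exists>\<gamma> B \<phi>' f' g' h0' h1'. truncated_process t0 t1 f \<phi> s0 s1 l h0 h1 U g xs us uu R0 N R \<gamma> B \<phi>' f' g' h0' h1'"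
  using regular_at_exists[of R] minimal_process_axioms assms
  unfolding truncated_process_def truncated_process_axioms_def by blast

lemma weak_multipliers_exist:
  assumes "R \<ge> R0" "\<epsilon> > 0"
  shows "\<exists>w \<omega> p. weak_multipliers R \<epsilon> w \<omega> p"
proof -
  obtain \<gamma> B \<phi>' f' g' h0' h1' where "truncated_process t0 t1 f \<phi> s0 s1 l h0 h1 U g xs us uu R0 N R \<gamma> B \<phi>' f' g' h0' h1'"
    using truncated_process_exists[OF assms(1)] by blast
  from truncated_process.weak_multipliers_exist_truncated[OF this assms(2)] show ?thesis .
qed

text \<open>The radius \<open>R0 + real k\<close> grows while the error
  \<open>1 / real (Suc k)\<close> tends to 0. That one weight of each opposite pair vanishes is
  recorded because only the differences of weights enter the theorem.\<close>

lemma multipliers_exist: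
  obtains w \<nu> q where "\<forall>i\<in>index. 0 \<le> w i"
    and "\<forall>k\<in>{1..s0}. w (1, k) = 0 \<or> w (2, k) = 0" "\<forall>k\<in>{1..s1}. w (3, k) = 0 \<or> w (4, k) = 0"
    and "\<forall>j\<in>{1..l}. real_distribution (\<nu> j)"
    and "\<forall>j\<in>{1..l}. measure (\<nu> j) {t \<in> {t0..t1}. g j t (xs t) < 0} = 0"
    and "(\<Sum>i\<in>index. w i) + (\<Sum>j\<in>{1..l}. measure (\<nu> j) {t0..t1}) = 1" and "bmeas t0 t1 q"
    and "\<forall>t\<in>{t0..t1}. q t = - fst (snd (combination w)) + integral {t..t1} (\<lambda>s. adj s (q s, - snd (snd (combination w))))
        - (\<Sum>j\<in>{1..l}. LINT s:{t..t1}|\<nu> j. grad (g j s) (xs s))"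
    and "q t0 = fst (combination w)"
    and "\<forall>v\<in>U. \<forall>c d. t0 \<le> c \<longrightarrow> c \<le> d \<longrightarrow> d \<le> t1 \<longrightarrow>
        integral {c..d} (\<lambda>s. (q s, - snd (snd (combination w))) \<bullet> \<Delta> v s) \<le> 0"
proof -
  obtain \<gamma> B \<phi>' f' g' h0' h1' where "truncated_process t0 t1 f \<phi> s0 s1 l h0 h1 U g xs us uu R0 N R0 \<gamma> B \<phi>' f' g' h0' h1'"
    using truncated_process_exists[of R0] by blast
  then interpret tp: truncated_process t0 t1 f \<phi> s0 s1 l h0 h1 U g xs us uu R0 N R0 \<gamma> B \<phi>' f' g' h0' h1' .
  have "\<forall>k. \<exists>w \<omega> p. weak_multipliers (R0 + real k) (1 / real (Suc k)) w \<omega> p"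
    by (intro allI weak_multipliers_exist) auto
  then obtain w \<omega> p where *: "\<And>k. weak_multipliers (R0 + real k) (1 / real (Suc k)) (w k) (\<omega> k) (p k)" by metis
  have fin: "finite index" by (simp add: index_def)
  have lim: "\<exists>r w' \<nu> q. strict_mono (r :: nat \<Rightarrow> nat) \<and> (\<forall>i\<in>index. 0 \<le> w' i \<and> (\<lambda>k. w (r k) i) \<longlonglongrightarrow> w' i) \<and>
     (\<forall>j\<in>{1..l}. real_distribution (\<nu> j) \<and> measure (\<nu> j) {t \<in> {t0..t1}. g j t (xs t) < 0} = 0) \<and>
     (\<Sum>i\<in>index. w' i) + (\<Sum>j\<in>{1..l}. measure (\<nu> j) {t0..t1}) = 1 \<and> bmeas t0 t1 q \<and>
     (\<forall>t\<in>{t0..t1}. q t = - fst (snd (\<Sum>i\<in>index. w' i *\<^sub>R endpoint_grad i))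
        + integral {t..t1} (\<lambda>s. adj s (q s, - snd (snd (\<Sum>i\<in>index. w' i *\<^sub>R endpoint_grad i))))
        - (\<Sum>j\<in>{1..l}. LINT s:{t..t1}|\<nu> j. grad (g j s) (xs s))) \<and>
     q t0 = fst (\<Sum>i\<in>index. w' i *\<^sub>R endpoint_grad i) \<and>
     (\<forall>v\<in>U. \<forall>c d. t0 \<le> c \<longrightarrow> c \<le> d \<longrightarrow> d \<le> t1 \<longrightarrow>
        integral {c..d} (\<lambda>s. (q s, - snd (snd (\<Sum>i\<in>index. w' i *\<^sub>R endpoint_grad i))) \<bullet> \<Delta> v s) \<le> 0)"
  \<comment> \<open>The limit is taken in the system of radius \<open>R0\<close>: the adjoint
    equations involve only \<open>D\<close>, hence only the optimal control, and the bounds of that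
    fixed system apply to all \<open>k\<close>.\<close>
  proof (rule tp.cs.multiplier_limit[where \<epsilon> = "\<lambda>k. 1 / real (Suc k)" and \<alpha> = "\<lambda>k. combination (w k)" and \<omega> = \<omega> and p = p])
    show "(\<lambda>k. 1 / real (Suc k)) \<longlonglongrightarrow> 0" using LIMSEQ_inverse_real_of_nat by (simp add: inverse_eq_divide)
    show "\<forall>\<^sub>F k in sequentially. integral {c..d} (\<lambda>s. (p k s, - snd (snd (combination (w k)))) \<bullet> \<Delta> v s) \<le> 1 / real (Suc k)"
      if v: "v \<in> U" and cd: "t0 \<le> c" "c \<le> d" "d \<le> t1" for v c d
    proof (rule eventually_sequentiallyI[of "nat \<lceil>norm v\<rceil>"])
      fix k assume k: "nat \<lceil>norm v\<rceil> \<le> k"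
      have "norm v \<le> real (nat \<lceil>norm v\<rceil>)" by (rule real_nat_ceiling_ge)
      with k have "norm v \<le> R0 + real k" using R0 by linarith
      then have "v \<in> U \<inter> cball 0 (R0 + real k)" using v by simp
      then show "integral {c..d} (\<lambda>s. (p k s, - snd (snd (combination (w k)))) \<bullet> \<Delta> v s) \<le> 1 / real (Suc k)"
        using *[of k] cd unfolding weak_multipliers_def by blast
    qed
    \<comment> \<open>\<open>v\<close> may lie outside the ball of radius \<open>R0\<close>, so its
      measurability is taken from a truncation that contains it.\<close>
    show "bmeas t0 t1 (\<Delta> v)" if "v \<in> U" for v
    proof -
      obtain \<gamma> B \<phi>' f' g' h0' h1' where "truncated_process t0 t1 f \<phi> s0 s1 l h0 h1 U g xs us uu R0 N (max R0 (norm v)) \<gamma> B \<phi>' f' g' h0' h1'"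
        using truncated_process_exists[of "max R0 (norm v)"] by auto
      from truncated_process.bmeas_\<Delta>[OF this] show ?thesis using that by simp
    qed
    show "continuous_on {t0..t1} (\<lambda>t. g j t (xs t))" "continuous_on {t0..t1} (\<lambda>t. grad (g j t) (xs t))" if "j \<in> {1..l}" for j
      by (rule tp.continuous_constraints[OF that])+
    show "integral {t0..t1} (\<lambda>t. \<omega> k j t * max 0 (- g j t (xs t))) \<le> 1 / real (Suc k)" if "j \<in> {1..l}" for k j
      using *[of k] that unfolding weak_multipliers_def by blast
    show "(\<Sum>i\<in>index. w k i) + (\<Sum>j\<in>{1..l}. integral {t0..t1} (\<omega> k j)) = 1" for k
      using *[of k] unfolding weak_multipliers_def by blast
    show "p k t = - fst (snd (combination (w k))) + integral {t..t1} (\<lambda>s. adj s (p k s, - snd (snd (combination (w k)))))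
        - integral {t..t1} (\<lambda>s. \<Sum>j\<in>{1..l}. \<omega> k j s *\<^sub>R grad (g j s) (xs s))" if "t \<in> {t0..t1}" for k t
      using *[of k] that unfolding weak_multipliers_def by blast
    show "norm (fst (combination (w k)) - p k t0) \<le> 1 / real (Suc k)" for k
      using *[of k] unfolding weak_multipliers_def by blast
    show "bmeas t0 t1 (p k)" for k using *[of k] unfolding weak_multipliers_def by blast
    show "0 \<le> w k i" if "i \<in> index" for k i using *[of k] that unfolding weak_multipliers_def by blast
    show "continuous_on {t0..t1} (\<omega> k j)" if "j \<in> {1..l}" for k j using *[of k] that unfolding weak_multipliers_def by blast
    show "0 \<le> \<omega> k j t" if "j \<in> {1..l}" "t \<in> {t0..t1}" for k j t using *[of k] that unfolding weak_multipliers_def by blast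
  qed (simp_all add: fin combination_def)
  then obtain r w' \<nu> q where r: "strict_mono (r :: nat \<Rightarrow> nat)"
    and w': "\<And>i. i \<in> index \<Longrightarrow> 0 \<le> w' i" "\<And>i. i \<in> index \<Longrightarrow> (\<lambda>k. w (r k) i) \<longlonglongrightarrow> w' i"
    and rest: "(\<forall>j\<in>{1..l}. real_distribution (\<nu> j) \<and> measure (\<nu> j) {t \<in> {t0..t1}. g j t (xs t) < 0} = 0) \<and>
     (\<Sum>i\<in>index. w' i) + (\<Sum>j\<in>{1..l}. measure (\<nu> j) {t0..t1}) = 1 \<and> bmeas t0 t1 q \<and>
     (\<forall>t\<in>{t0..t1}. q t = - fst (snd (combination w'))
        + integral {t..t1} (\<lambda>s. adj s (q s, - snd (snd (combination w'))))
        - (\<Sum>j\<in>{1..l}. LINT s:{t..t1}|\<nu> j. grad (g j s) (xs s))) \<and>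
     q t0 = fst (combination w') \<and>
     (\<forall>v\<in>U. \<forall>c d. t0 \<le> c \<longrightarrow> c \<le> d \<longrightarrow> d \<le> t1 \<longrightarrow>
        integral {c..d} (\<lambda>s. (q s, - snd (snd (combination w'))) \<bullet> \<Delta> v s) \<le> 0)"
    unfolding combination_def[symmetric] by blast
  \<comment> \<open>The smaller weight of a pair tends to 0 along the whole sequence, and the
    minimum is continuous.\<close>
  have inactive: "w' i = 0 \<or> w' i' = 0"
    if i: "i \<in> index" "i' \<in> index" and le: "\<And>k. min (w k i) (w k i') \<le> 1 / real (Suc k)" for i i'
  proof -
    have "min (w' i) (w' i') \<le> 0"
    proof (rule LIMSEQ_le)
      show "(\<lambda>k. min (w (r k) i) (w (r k) i')) \<longlonglongrightarrow> min (w' i) (w' i')" by (intro tendsto_min w' i)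
      show "(\<lambda>k. 1 / real (Suc (r k))) \<longlonglongrightarrow> 0"
        using LIMSEQ_subseq_LIMSEQ[OF LIMSEQ_inverse_real_of_nat r] by (simp add: comp_def inverse_eq_divide)
    qed (use le in auto)
    then show ?thesis using w'(1)[OF i(1)] w'(1)[OF i(2)] by linarith
  qed
  have "w' (1, k) = 0 \<or> w' (2, k) = 0" if "k \<in> {1..s0}" for k
    using * that unfolding weak_multipliers_def by (intro inactive) (auto simp: index_def)
  moreover have "w' (3, k) = 0 \<or> w' (4, k) = 0" if "k \<in> {1..s1}" for k
    using * that unfolding weak_multipliers_def by (intro inactive) (auto simp: index_def)
  ultimately show ?thesis by (intro that[of w' \<nu> q]) (use w'(1) rest in blast)+
qed

end

section \<open>Bounded variation of the adjoint function\<close>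

text \<open>The two tails differ exactly by the half-open interval from \<open>s\<close> to
  \<open>t\<close>, the form that \<open>sum_measure_division_le\<close> can sum over a division
  without counting atoms twice.\<close>

lemma interval_integral_tail_diff:
  fixes h :: "real \<Rightarrow> 'a::euclidean_space"
  assumes \<nu>: "real_distribution \<nu>" and h: "continuous_on {a..b} h" and B: "\<And>t. t \<in> {a..b} \<Longrightarrow> norm (h t) \<le> B"
    and st: "a \<le> s" "s \<le> t" "t \<le> b"
  shows "norm ((LINT x:{t..b}|\<nu>. h x) - (LINT x:{s..b}|\<nu>. h x)) \<le> B * measure \<nu> {s..<t}"
proof -
  interpret \<nu>: real_distribution \<nu> by (rule \<nu>)
  have m: "(\<lambda>x. indicator {a..b} x *\<^sub>R h x) \<in> borel_measurable borel"
    by (intro borel_measurable_continuous_on_indicator h) auto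
  have B0: "B \<ge> 0" using B[of a] st norm_ge_zero[of "h a"] by (simp del: norm_ge_zero)
  have "integrable \<nu> (\<lambda>x. indicator {a..b} x *\<^sub>R h x)"
    using m B B0 by (intro \<nu>.integrable_const_bound[where B = B]) (auto simp: indicator_def)
  then have i: "set_integrable \<nu> {a..b} h" unfolding set_integrable_def .
  have i1: "set_integrable \<nu> {s..<t} h" and i2: "set_integrable \<nu> {t..b} h"
    using st by (auto intro!: set_integrable_subset[OF i])
  have "{s..b} = {s..<t} \<union> {t..b}" using st by auto
  then have "(LINT x:{s..b}|\<nu>. h x) = (LINT x:{s..<t}|\<nu>. h x) + (LINT x:{t..b}|\<nu>. h x)"
    by (simp only:) (intro set_integral_Un i1 i2, auto)
  then have "norm ((LINT x:{t..b}|\<nu>. h x) - (LINT x:{s..b}|\<nu>. h x)) = norm (LINT x:{s..<t}|\<nu>. h x)" by simp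
  also have "\<dots> \<le> (\<integral>x. B * indicator {s..<t} x \<partial>\<nu>)"
    unfolding set_lebesgue_integral_def
  proof (rule Bochner_Integration.integral_norm_bound_integral)
    show "integrable \<nu> (\<lambda>x. indicator {s..<t} x *\<^sub>R h x)" using i1 unfolding set_integrable_def .
    show "integrable \<nu> (\<lambda>x. B * indicator {s..<t} x)"
      by (intro integrable_mult_right integrable_real_indicator) (auto simp: \<nu>.emeasure_eq_measure)
  qed (use B st in \<open>auto simp: indicator_def\<close>)
  finally show ?thesis by simp
qed

lemma bounded_variation_onI:
  fixes q :: "real \<Rightarrow> 'a::real_normed_vector"
  assumes "a \<le> b" and K: "K \<ge> 0" and M: "\<And>j. j \<in> J \<Longrightarrow> finite_measure (M j) \<and> sets (M j) = sets borel"
    and C: "\<And>j. j \<in> J \<Longrightarrow> 0 \<le> C j"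
    and le: "\<And>s t. a \<le> s \<Longrightarrow> s \<le> t \<Longrightarrow> t \<le> b \<Longrightarrow> norm (q t - q s) \<le> K * (t - s) + (\<Sum>j\<in>J. C j * measure (M j) {s..<t})"
  shows "bounded_variation_on {a..b} q"
  unfolding bounded_variation_on_def
proof (intro exI allI impI)
  fix d A assume d: "d division_of A \<and> A \<subseteq> {a..b}"
  have iv: "\<exists>u v. k = {u..v} \<and> a \<le> u \<and> u \<le> v \<and> v \<le> b" if "k \<in> d" for k
  proof -
    obtain u v where k: "k = {u..v}" "u \<le> v"
      using division_ofD(3,4)[of d A k] d \<open>k \<in> d\<close> by (metis atLeastatMost_empty_iff box_real(2))
    moreover have "k \<subseteq> {a..b}" using division_ofD(2)[of d A k] d \<open>k \<in> d\<close> by blast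
    ultimately show ?thesis by auto
  qed
  have "(\<Sum>k\<in>d. norm (q (Sup k) - q (Inf k))) \<le> (\<Sum>k\<in>d. K * measure lborel k + (\<Sum>j\<in>J. C j * measure (M j) {Inf k..<Sup k}))"
  proof (rule sum_mono)
    fix k assume "k \<in> d"
    then obtain u v where k: "k = {u..v}" "a \<le> u" "u \<le> v" "v \<le> b" using iv by blast
    show "norm (q (Sup k) - q (Inf k)) \<le> K * measure lborel k + (\<Sum>j\<in>J. C j * measure (M j) {Inf k..<Sup k})"
      using le[OF k(2-4)] k by simp
  qed
  also have "\<dots> = K * (\<Sum>k\<in>d. measure lborel k) + (\<Sum>j\<in>J. C j * (\<Sum>k\<in>d. measure (M j) {Inf k..<Sup k}))"
    by (subst sum.distrib, subst sum.swap) (simp add: sum_distrib_left)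
  also have "\<dots> \<le> K * (b - a) + (\<Sum>j\<in>J. C j * measure (M j) (space (M j)))"
  proof (intro add_mono sum_mono mult_left_mono K C)
    show "(\<Sum>k\<in>d. measure lborel k) \<le> b - a"
      using subadditive_content_division[of d A a b] d \<open>a \<le> b\<close> by simp
    show "(\<Sum>k\<in>d. measure (M j) {Inf k..<Sup k}) \<le> measure (M j) (space (M j))" if "j \<in> J" for j
      using d M[OF that] by (intro sum_measure_division_le[of _ _ A a b]) auto
  qed
  finally show "(\<Sum>k\<in>d. norm (q (Sup k) - q (Inf k))) \<le> K * (b - a) + (\<Sum>j\<in>J. C j * measure (M j) (space (M j)))" .
qed

lemma set_integral_restrict_space:
  fixes h :: "'a \<Rightarrow> 'b::{banach, second_countable_topology}"
  assumes "S \<in> sets M" "A \<subseteq> S"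
  shows "(LINT x:A|restrict_space M S. h x) = (LINT x:A|M. h x)"
proof -
  have "indicator S x *\<^sub>R indicator A x *\<^sub>R h x = indicator A x *\<^sub>R h x" for x
    using assms(2) by (auto simp: indicator_def)
  then show ?thesis
    unfolding set_lebesgue_integral_def using assms(1)
    by (subst integral_restrict_space) (auto intro!: Bochner_Integration.integral_cong simp del: scaleR_scaleR)
qed

context truncated_process
begin

text \<open>The Pontryagin function is the pairing of \<open>(p, - lam)\<close> with the pair of
  dynamics and cost, so its state gradient is the transpose of \<open>D\<close> applied to that
  vector.\<close>

lemma pontryagin_x_eq:
  assumes t: "t \<in> {t0..t1}"
  shows "pontryagin_x f \<phi> t (xs t) (uu t) p lam = adj t (p, - lam)"
proof -
  have u: "uu t \<in> cball 0 R" using uu_cball[OF t] .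
  have "((\<lambda>y. pontryagin f \<phi> t y (uu t) p lam) has_derivative
      (\<lambda>v. p \<bullet> blinfun_apply (\<phi>' ((t, uu t), xs t)) v - lam * blinfun_apply (f' ((t, uu t), xs t)) v)) (at (xs t))"
    unfolding pontryagin_def by (intro derivative_intros \<phi>_derivative f_derivative t u)
  from grad_eqI(1)[OF this] show ?thesis
    unfolding pontryagin_x_def cs.adj_def D_eq[OF t] inner_prod_def by (simp add: inner_commute mult.commute)
qed

lemma pontryagin_continuous:
  assumes t: "t \<in> {t0..t1}"
  shows "continuous_on (cball 0 R) (\<lambda>u. pontryagin f \<phi> t (xs t) u p lam)"
proof -
  have c: "continuous_on (cball 0 R) (\<lambda>u. ((t, u), xs t))" by (intro continuous_intros)
  have s: "(\<lambda>u. ((t, u), xs t)) ` cball 0 R \<subseteq> tube t0 t1 xs \<gamma> (cball 0 R)"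
    using t \<gamma> by (auto intro!: tubeI)
  show ?thesis
    unfolding pontryagin_def
    using continuous_on_compose2[OF tube_C1_continuous[OF \<phi>_C1] c s] continuous_on_compose2[OF tube_C1_continuous[OF f_C1] c s]
    by (auto intro!: continuous_intros)
qed

end

section \<open>The limit in terms of the Pontryagin function\<close>

context minimal_process
begin

lemma sum_index:
  fixes F :: "nat \<times> nat \<Rightarrow> 'a::comm_monoid_add"
  shows "sum F index = F (0, 0) + ((\<Sum>k=1..s0. F (1, k) + F (2, k)) + (\<Sum>k=1..s1. F (3, k) + F (4, k)))"
proof -
  have "sum F ({1, 2} \<times> {1..s0}) = (\<Sum>i\<in>{1, 2}. \<Sum>k=1..s0. F (i, k))"
    "sum F ({3, 4} \<times> {1..s1}) = (\<Sum>i\<in>{3, 4}. \<Sum>k=1..s1. F (i, k))"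
    by (simp_all only: sum.cartesian_product case_prod_eta)
  moreover have "sum F index = F (0, 0) + (sum F ({1, 2} \<times> {1..s0}) + sum F ({3, 4} \<times> {1..s1}))"
    unfolding index_def by (subst sum.insert, force, force, subst sum.union_disjoint) auto
  ultimately show ?thesis by (simp add: sum.distrib)
qed

lemma combination_eq:
  "combination w = (jacobian_transpose_mult s0 h0 (xs t0) (\<lambda>k. w (1, k) - w (2, k)),
     jacobian_transpose_mult s1 h1 (xs t1) (\<lambda>k. w (3, k) - w (4, k)), w (0, 0))"
  unfolding combination_def sum_index
  by (intro prod_eqI) (simp_all add: endpoint_grad_def fst_sum snd_sum jacobian_transpose_mult_def scaleR_diff_left)

text \<open>The exceptional null set depends on \<open>v\<close>, so the inequality is first
  obtained for a countable dense subset of \<open>U\<close> and then, at each remaining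
  \<open>t\<close>, extended to \<open>U\<close> by continuity in the control, which is available on
  balls.\<close>

lemma maximum_condition:
  assumes q: "bmeas t0 t1 q"
    and max: "\<And>v c d. v \<in> U \<Longrightarrow> t0 \<le> c \<Longrightarrow> c \<le> d \<Longrightarrow> d \<le> t1 \<Longrightarrow> integral {c..d} (\<lambda>s. (q s, - lam) \<bullet> \<Delta> v s) \<le> 0"
  shows "\<exists>N'. negligible N' \<and> (\<forall>t\<in>{t0..t1} - N'. \<forall>u\<in>U. pontryagin f \<phi> t (xs t) u (q t) lam \<le> pontryagin f \<phi> t (xs t) (uu t) (q t) lam)"
proof -
  obtain T where T: "countable T" "T \<subseteq> U" "U \<subseteq> closure T" by (rule separable)
  have "\<exists>N. negligible N \<and> (\<forall>t\<in>{t0..t1} - N. (q t, - lam) \<bullet> \<Delta> v t \<le> 0)" if v: "v \<in> T" for v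
  proof (rule nonpositive_integrals_AE[OF _ t01])
    obtain \<gamma> B \<phi>' f' g' h0' h1' where "truncated_process t0 t1 f \<phi> s0 s1 l h0 h1 U g xs us uu R0 N (max R0 (norm v)) \<gamma> B \<phi>' f' g' h0' h1'"
      using truncated_process_exists[of "max R0 (norm v)"] by auto
    from truncated_process.bmeas_\<Delta>[OF this] have "bmeas t0 t1 (\<Delta> v)" using v T by auto
    then show "bmeas t0 t1 (\<lambda>t. (q t, - lam) \<bullet> \<Delta> v t)" by (intro bmeas_inner bmeas_pair q bmeas_const)
  qed (use max v T in auto)
  then obtain NT where NT: "\<And>v. v \<in> T \<Longrightarrow> negligible (NT v)" "\<And>v t. v \<in> T \<Longrightarrow> t \<in> {t0..t1} - NT v \<Longrightarrow> (q t, - lam) \<bullet> \<Delta> v t \<le> 0"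
    by metis
  have "negligible (\<Union>(NT ` T))" using T(1) NT(1) by (intro negligible_countable_Union) auto
  moreover have "pontryagin f \<phi> t (xs t) u (q t) lam \<le> pontryagin f \<phi> t (xs t) (uu t) (q t) lam"
    if t: "t \<in> {t0..t1} - \<Union>(NT ` T)" and u: "u \<in> U" for t u
  proof -
    obtain x where x: "\<And>n. x n \<in> T" "x \<longlonglongrightarrow> u" using T(3) u closure_sequential by blast
    obtain \<gamma> B \<phi>' f' g' h0' h1' where "truncated_process t0 t1 f \<phi> s0 s1 l h0 h1 U g xs us uu R0 N (max R0 (norm u + 1)) \<gamma> B \<phi>' f' g' h0' h1'"
      using truncated_process_exists[of "max R0 (norm u + 1)"] by auto
    from truncated_process.pontryagin_continuous[OF this]
    have c: "continuous_on (cball 0 (max R0 (norm u + 1))) (\<lambda>u. pontryagin f \<phi> t (xs t) u (q t) lam)" using t by blast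
    have "\<forall>\<^sub>F n in sequentially. norm (x n) < norm u + 1"
      by (rule order_tendstoD(2)[OF tendsto_norm[OF x(2)]]) simp
    then have ev: "\<forall>\<^sub>F n in sequentially. x n \<in> cball 0 (max R0 (norm u + 1))" by (rule eventually_mono) auto
    have "(\<lambda>n. pontryagin f \<phi> t (xs t) (x n) (q t) lam) \<longlonglongrightarrow> pontryagin f \<phi> t (xs t) u (q t) lam"
      by (rule continuous_on_tendsto_compose[OF c x(2) _ ev]) simp
    then show ?thesis
    proof (rule tendsto_upperbound)
      have "pontryagin f \<phi> t (xs t) (x n) (q t) lam \<le> pontryagin f \<phi> t (xs t) (uu t) (q t) lam" for n
        using NT(2)[OF x(1)[of n], of t] t x(1)[of n]
        by (auto simp: pontryagin_def \<Delta>_def inner_diff_right algebra_simps)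
      then show "\<forall>\<^sub>F n in sequentially. pontryagin f \<phi> t (xs t) (x n) (q t) lam \<le> pontryagin f \<phi> t (xs t) (uu t) (q t) lam"
        by simp
    qed simp
  qed
  ultimately show ?thesis by blast
qed

lemma pontryagin_x_integral:
  assumes "t \<in> {t0..t1}" "bmeas t0 t1 q"
  shows "bmeas t0 t1 (\<lambda>s. adj s (q s, - lam))"
    "(LINT s:{t..t1}|lebesgue. pontryagin_x f \<phi> s (xs s) (us s) (q s) lam) = integral {t..t1} (\<lambda>s. adj s (q s, - lam))"
proof -
  obtain \<gamma> B \<phi>' f' g' h0' h1' where "truncated_process t0 t1 f \<phi> s0 s1 l h0 h1 U g xs us uu R0 N R0 \<gamma> B \<phi>' f' g' h0' h1'"
    using truncated_process_exists[of R0] by blast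
  then interpret tp: truncated_process t0 t1 f \<phi> s0 s1 l h0 h1 U g xs us uu R0 N R0 \<gamma> B \<phi>' f' g' h0' h1' .
  show b: "bmeas t0 t1 (\<lambda>s. adj s (q s, - lam))" by (intro tp.cs.bmeas_adj bmeas_pair assms bmeas_const)
  have eq: "pontryagin_x f \<phi> s (xs s) (us s) (q s) lam = adj s (q s, - lam)" if "s \<in> {t..t1} - N" for s
    using tp.pontryagin_x_eq[of s] uu_us[of s] that assms(1) by auto
  have "(\<lambda>s. adj s (q s, - lam)) absolutely_integrable_on {t..t1}"
    using assms(1) by (intro bmeas_absolutely_integrable[OF b]) auto
  then have "(\<lambda>s. pontryagin_x f \<phi> s (xs s) (us s) (q s) lam) absolutely_integrable_on {t..t1}"
    by (rule absolutely_integrable_spike[OF _ N eq])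
  then have "(LINT s:{t..t1}|lebesgue. pontryagin_x f \<phi> s (xs s) (us s) (q s) lam) = integral {t..t1} (\<lambda>s. pontryagin_x f \<phi> s (xs s) (us s) (q s) lam)"
    by (rule set_lebesgue_integral_eq_integral(2))
  also have "\<dots> = integral {t..t1} (\<lambda>s. adj s (q s, - lam))"
    by (rule integral_spike[OF N]) (simp add: eq)
  finally show "(LINT s:{t..t1}|lebesgue. pontryagin_x f \<phi> s (xs s) (us s) (q s) lam) = integral {t..t1} (\<lambda>s. adj s (q s, - lam))" .
qed

lemma adjoint_bounded_variation:
  assumes q: "bmeas t0 t1 q" and \<nu>: "\<And>j. j \<in> {1..l} \<Longrightarrow> real_distribution (\<nu> j)"
    and eq: "\<And>t. t \<in> {t0..t1} \<Longrightarrow> q t = c + integral {t..t1} (\<lambda>s. adj s (q s, - lam))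
        - (\<Sum>j\<in>{1..l}. LINT s:{t..t1}|\<nu> j. grad (g j s) (xs s))"
  shows "bounded_variation_on {t0..t1} q"
proof -
  obtain \<gamma> B \<phi>' f' g' h0' h1' where "truncated_process t0 t1 f \<phi> s0 s1 l h0 h1 U g xs us uu R0 N R0 \<gamma> B \<phi>' f' g' h0' h1'"
    using truncated_process_exists[of R0] by blast
  then interpret tp: truncated_process t0 t1 f \<phi> s0 s1 l h0 h1 U g xs us uu R0 N R0 \<gamma> B \<phi>' f' g' h0' h1' .
  have b: "bmeas t0 t1 (\<lambda>s. adj s (q s, - lam))"
    using t01 by (intro pontryagin_x_integral(1)[of t0] q) auto
  obtain K where K: "K > 0" "\<And>t. t \<in> {t0..t1} \<Longrightarrow> norm (adj t (q t, - lam)) \<le> K" using bmeas_bound[OF b] by metis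
  show ?thesis
  proof (rule bounded_variation_onI)
    show "t0 \<le> t1" "0 \<le> K" using t01 K by simp_all
    show "finite_measure (\<nu> j) \<and> sets (\<nu> j) = sets borel" if "j \<in> {1..l}" for j
    proof -
      interpret \<nu>: real_distribution "\<nu> j" by (rule \<nu>[OF that])
      show ?thesis by (simp add: \<nu>.finite_measure_axioms)
    qed
    show "0 \<le> B" using tp.B by simp
    fix s t assume st: "t0 \<le> s" "s \<le> t" "t \<le> t1"
    let ?L = "\<lambda>t. \<Sum>j\<in>{1..l}. LINT s:{t..t1}|\<nu> j. grad (g j s) (xs s)"
    have L: "norm (?L t - ?L s) \<le> (\<Sum>j\<in>{1..l}. B * measure (\<nu> j) {s..<t})"
      unfolding sum_subtractf[symmetric]
    proof (intro sum_norm_le interval_integral_tail_diff[where a = t0] \<nu> tp.continuous_constraints(2) st)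
      show "norm (grad (g j t) (xs t)) \<le> B" if "j \<in> {1..l}" "t \<in> {t0..t1}" for j t
        using tube_C1_grad_bound[OF tp.g_C1[OF that(1)] xs_continuous tp.\<gamma> that(2) tp.uu_cball[OF that(2)]] by simp
    qed
    have "q t - q s = - integral {s..t} (\<lambda>s. adj s (q s, - lam)) - (?L t - ?L s)"
      using eq[of s] eq[of t] st bmeas_integral_combine[OF b st(1) st(2) st(3), symmetric] by (simp add: algebra_simps)
    then have "norm (q t - q s) \<le> norm (integral {s..t} (\<lambda>s. adj s (q s, - lam))) + norm (?L t - ?L s)"
      using norm_triangle_ineq4[of "- integral {s..t} (\<lambda>s. adj s (q s, - lam))" "?L t - ?L s"] by simp
    also have "\<dots> \<le> K * (t - s) + (\<Sum>j\<in>{1..l}. B * measure (\<nu> j) {s..<t})"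
      using st K by (intro add_mono L bmeas_norm_integral_le_const[OF b]) auto
    finally show "norm (q t - q s) \<le> K * (t - s) + (\<Sum>j\<in>{1..l}. B * measure (\<nu> j) {s..<t})" .
  qed
qed

end

text \<open>On the null set where \<open>u\<close> leaves \<open>U\<close> or exceeds its essential
  bound it is replaced by a fixed element of \<open>U\<close>, so that the constraint and the bound
  hold at every time.\<close>

lemma L_inf_representative:
  assumes "L_inf t0 t1 U u" "U \<noteq> {}"
  shows "\<exists>v R N. v \<in> borel_measurable (lebesgue_on {t0..t1}) \<and> (\<forall>t\<in>{t0..t1}. v t \<in> U \<inter> cball 0 R) \<and>
    negligible N \<and> (\<forall>t\<in>{t0..t1} - N. v t = u t)"
proof -
  obtain C where m: "u \<in> borel_measurable (lebesgue_on {t0..t1})" and "AE t in lebesgue_on {t0..t1}. u t \<in> U"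
    "AE t in lebesgue_on {t0..t1}. norm (u t) \<le> C"
    using assms(1) unfolding L_inf_def by blast
  then obtain N1 N2 where N: "negligible N1" "negligible N2" "\<And>t. t \<in> {t0..t1} - N1 \<Longrightarrow> u t \<in> U" "\<And>t. t \<in> {t0..t1} - N2 \<Longrightarrow> norm (u t) \<le> C"
    using AE_lebesgue_on_iff_negligible[of "{t0..t1}"] by auto
  obtain u0 where u0: "u0 \<in> U" using assms(2) by blast
  define v where "v t = (if t \<in> N1 \<union> N2 then u0 else u t)" for t
  have "negligible (N1 \<union> N2)" using N(1,2) by (rule negligible_Un)
  then have "{t0..t1} \<inter> (N1 \<union> N2) \<in> sets lebesgue" by (intro negligible_imp_sets negligible_Int) auto
  then have "v \<in> borel_measurable (lebesgue_on {t0..t1})"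
    unfolding v_def by (intro measurable_If_set m) (auto simp: sets_restrict_space Int_commute)
  moreover have "v t \<in> U \<inter> cball 0 (max C (norm u0))" if "t \<in> {t0..t1}" for t
    using N(3,4)[of t] u0 that by (auto simp: v_def le_max_iff_disj)
  moreover have "v t = u t" if "t \<in> {t0..t1} - (N1 \<union> N2)" for t using that by (auto simp: v_def)
  ultimately show ?thesis using \<open>negligible (N1 \<union> N2)\<close> by blast
qed

theorem theorem5p6:
  fixes t0 t1 :: real
    and f :: "real \<Rightarrow> real^'n \<Rightarrow> real^'m \<Rightarrow> real"
    and \<phi> :: "real \<Rightarrow> real^'n \<Rightarrow> real^'m \<Rightarrow> real^'n"
    and s0 s1 l :: nat
    and h0 h1 :: "nat \<Rightarrow> real^'n \<Rightarrow> real"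
    and U :: "(real^'m) set"
    and g :: "nat \<Rightarrow> real \<Rightarrow> real^'n \<Rightarrow> real"
    and xs :: "real \<Rightarrow> real^'n"
    and us :: "real \<Rightarrow> real^'m"
  assumes "t0 < t1" and "U \<noteq> {}"
    and "regular_data t0 t1 f \<phi> s0 h0 s1 h1 l g xs"
    and "strong_local_min t0 t1 f \<phi> s0 h0 s1 h1 U l g xs us"
  shows "\<exists>(lam0::real) (p :: real \<Rightarrow> real^'n) (l0 :: nat \<Rightarrow> real) (l1 :: nat \<Rightarrow> real)
            (\<mu> :: nat \<Rightarrow> real measure).
      lam0 \<ge> 0 \<and>
      (\<forall>j\<in>{1..l}. finite_regular_borel_measure_on {t0..t1} (\<mu> j) \<and>
         {t0..t1} - {t\<in>{t0..t1}. g j t (xs t) = 0} \<in> null_sets (\<mu> j)) \<and>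
      (lam0 \<noteq> 0 \<or> (\<exists>t\<in>{t0..t1}. p t \<noteq> 0) \<or> (\<exists>i\<in>{1..s0}. l0 i \<noteq> 0) \<or> (\<exists>i\<in>{1..s1}. l1 i \<noteq> 0) \<or>
         (\<exists>j\<in>{1..l}. emeasure (\<mu> j) {t0..t1} \<noteq> 0)) \<and>
      bounded_variation_on {t0..t1} p \<and>
      (\<forall>t\<in>{t0..t1}.
         p t = - jacobian_transpose_mult s1 h1 (xs t1) l1
               + (LINT s:{t..t1}|lebesgue. pontryagin_x f \<phi> s (xs s) (us s) (p s) lam0)
               - (\<Sum>j\<in>{1..l}. LINT s:{t..t1}|\<mu> j. grad (g j s) (xs s))) \<and>
      p t0 = jacobian_transpose_mult s0 h0 (xs t0) l0 \<and>
      (AE t in lebesgue_on {t0..t1}.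
         us t \<in> U \<and>
         (\<forall>u\<in>U. pontryagin f \<phi> t (xs t) u (p t) lam0 \<le> pontryagin f \<phi> t (xs t) (us t) (p t) lam0))"
proof -
  obtain uu R0 N where uu: "uu \<in> borel_measurable (lebesgue_on {t0..t1})" "\<forall>t\<in>{t0..t1}. uu t \<in> U \<inter> cball 0 R0"
    "negligible N" "\<forall>t\<in>{t0..t1} - N. uu t = us t"
    using L_inf_representative[of t0 t1 U us] assms(2,4) unfolding strong_local_min_def admissible_def by blast
  interpret minimal_process t0 t1 f \<phi> s0 s1 l h0 h1 U g xs us uu R0 N
    by unfold_locales (use assms uu in auto)
  obtain w \<nu> q where w: "\<forall>i\<in>index. 0 \<le> w i"
    and inactive: "\<forall>k\<in>{1..s0}. w (1, k) = 0 \<or> w (2, k) = 0" "\<forall>k\<in>{1..s1}. w (3, k) = 0 \<or> w (4, k) = 0"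
    and \<nu>: "\<forall>j\<in>{1..l}. real_distribution (\<nu> j)"
    and \<nu>0: "\<forall>j\<in>{1..l}. measure (\<nu> j) {t \<in> {t0..t1}. g j t (xs t) < 0} = 0"
    and one: "(\<Sum>i\<in>index. w i) + (\<Sum>j\<in>{1..l}. measure (\<nu> j) {t0..t1}) = 1" and q: "bmeas t0 t1 q"
    and q_eq: "\<forall>t\<in>{t0..t1}. q t = - fst (snd (combination w)) + integral {t..t1} (\<lambda>s. adj s (q s, - snd (snd (combination w))))
        - (\<Sum>j\<in>{1..l}. LINT s:{t..t1}|\<nu> j. grad (g j s) (xs s))"
    and q_start: "q t0 = fst (combination w)"
    and max: "\<forall>v\<in>U. \<forall>c d. t0 \<le> c \<longrightarrow> c \<le> d \<longrightarrow> d \<le> t1 \<longrightarrow>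
        integral {c..d} (\<lambda>s. (q s, - snd (snd (combination w))) \<bullet> \<Delta> v s) \<le> 0"
    by (rule multipliers_exist)
  note w = w[rule_format] and inactive = inactive[rule_format] and \<nu> = bspec[OF \<nu>] and \<nu>0 = bspec[OF \<nu>0]
    and q_eq = bspec[OF q_eq] and max = max[rule_format]
  obtain \<gamma> B \<phi>' f' g' h0' h1' where "truncated_process t0 t1 f \<phi> s0 s1 l h0 h1 U g xs us uu R0 N R0 \<gamma> B \<phi>' f' g' h0' h1'"
    using truncated_process_exists[of R0] by blast
  then interpret tp: truncated_process t0 t1 f \<phi> s0 s1 l h0 h1 U g xs us uu R0 N R0 \<gamma> B \<phi>' f' g' h0' h1' .
  define lam where "lam = w (0, 0)"
  have lam: "snd (snd (combination w)) = lam" by (simp add: combination_eq lam_def)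
  \<comment> \<open>The restriction discards the mass of the limit distribution on the padding
    interval.\<close>
  define \<mu> where "\<mu> j = restrict_space (\<nu> j) {t0..t1}" for j
  have sets_\<nu>: "sets (\<nu> j) = sets borel" if "j \<in> {1..l}" for j
    using \<nu>[OF that] by (simp add: real_distribution.events_eq_borel)
  show ?thesis
  proof (rule exI[of _ lam], rule exI[of _ q], rule exI[of _ "\<lambda>k. w (1, k) - w (2, k)"],
      rule exI[of _ "\<lambda>k. w (3, k) - w (4, k)"], rule exI[of _ \<mu>], intro conjI ballI)
    show "0 \<le> lam" unfolding lam_def by (rule w) (simp add: index_def)
    fix j assume j: "j \<in> {1..l}"
    interpret \<nu>: real_distribution "\<nu> j" by (rule \<nu>[OF j])
    show "finite_regular_borel_measure_on {t0..t1} (\<mu> j)"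
      unfolding \<mu>_def by (intro finite_regular_borel_measure_on_restrict) (auto simp: \<nu>.finite_measure_axioms)
    let ?A = "{t \<in> {t0..t1}. g j t (xs t) < 0}"
    have "closed ({t0..t1} \<inter> (\<lambda>t. g j t (xs t)) -` {0..})"
      by (intro continuous_closed_preimage tp.continuous_constraints j) auto
    then have "{t0..t1} - ({t0..t1} \<inter> (\<lambda>t. g j t (xs t)) -` {0..}) \<in> sets borel" by (intro sets.Diff) auto
    also have "{t0..t1} - ({t0..t1} \<inter> (\<lambda>t. g j t (xs t)) -` {0..}) = ?A" by auto
    finally have "?A \<in> sets (\<nu> j)" unfolding sets_\<nu>[OF j] .
    moreover have "emeasure (\<nu> j) ?A = 0"
      unfolding \<nu>.emeasure_eq_measure \<nu>0[OF j] by simp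
    ultimately have "?A \<in> null_sets (\<nu> j)" by (intro null_setsI)
    moreover have "g j t (xs t) \<le> 0" if "t \<in> {t0..t1}" for t
      using admissible_xs j that unfolding admissible_def by blast
    then have "{t0..t1} - {t \<in> {t0..t1}. g j t (xs t) = 0} = ?A" by (auto simp: less_le)
    ultimately have "{t0..t1} - {t \<in> {t0..t1}. g j t (xs t) = 0} \<in> null_sets (\<nu> j)" by (simp only:)
    then show "{t0..t1} - {t \<in> {t0..t1}. g j t (xs t) = 0} \<in> null_sets (\<mu> j)"
      unfolding \<mu>_def by (intro null_sets_restrict_space[THEN iffD2] conjI Diff_subset) simp
  next
    show "lam \<noteq> 0 \<or> (\<exists>t\<in>{t0..t1}. q t \<noteq> 0) \<or> (\<exists>i\<in>{1..s0}. w (1, i) - w (2, i) \<noteq> 0) \<or> (\<exists>i\<in>{1..s1}. w (3, i) - w (4, i) \<noteq> 0) \<or>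
         (\<exists>j\<in>{1..l}. emeasure (\<mu> j) {t0..t1} \<noteq> 0)"
    proof (rule ccontr)
      assume neg: "\<not> ?thesis"
      \<comment> \<open>Since one weight of each pair is zero, a vanishing difference forces both to
        vanish; then the total mass 1 would be 0.\<close>
      have "w (1, k) = 0 \<and> w (2, k) = 0" if "k \<in> {1..s0}" for k using neg inactive(1)[OF that] that by force
      moreover have "w (3, k) = 0 \<and> w (4, k) = 0" if "k \<in> {1..s1}" for k using neg inactive(2)[OF that] that by force
      ultimately have "(\<Sum>i\<in>index. w i) = 0" using neg unfolding sum_index lam_def by simp
      moreover have "measure (\<nu> j) {t0..t1} = 0" if j: "j \<in> {1..l}" for j
      proof -
        have "emeasure (\<mu> j) {t0..t1} = 0" using neg j by blast
        then show ?thesis unfolding \<mu>_def using sets_\<nu>[OF j] by (simp add: emeasure_restrict_space measure_def)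
      qed
      ultimately show False using one by simp
    qed
    show "bounded_variation_on {t0..t1} q"
      using q_eq unfolding lam by (intro adjoint_bounded_variation[OF q \<nu>])
    show "q t0 = jacobian_transpose_mult s0 h0 (xs t0) (\<lambda>k. w (1, k) - w (2, k))"
      using q_start by (simp add: combination_eq)
  next
    fix t assume t: "t \<in> {t0..t1}"
    have "(LINT s:{t..t1}|\<mu> j. grad (g j s) (xs s)) = (LINT s:{t..t1}|\<nu> j. grad (g j s) (xs s))" if "j \<in> {1..l}" for j
      unfolding \<mu>_def using t sets_\<nu>[OF that] by (intro set_integral_restrict_space) auto
    then show "q t = - jacobian_transpose_mult s1 h1 (xs t1) (\<lambda>k. w (3, k) - w (4, k))
               + (LINT s:{t..t1}|lebesgue. pontryagin_x f \<phi> s (xs s) (us s) (q s) lam)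
               - (\<Sum>j\<in>{1..l}. LINT s:{t..t1}|\<mu> j. grad (g j s) (xs s))"
      using q_eq[OF t] unfolding lam pontryagin_x_integral(2)[OF t q] by (simp add: combination_eq)
  next
    obtain N' where N': "negligible N'" "\<And>t u. t \<in> {t0..t1} - N' \<Longrightarrow> u \<in> U \<Longrightarrow>
        pontryagin f \<phi> t (xs t) u (q t) lam \<le> pontryagin f \<phi> t (xs t) (uu t) (q t) lam"
      using maximum_condition[OF q, of lam] max unfolding lam by blast
    have "us t \<in> U \<and> (\<forall>u\<in>U. pontryagin f \<phi> t (xs t) u (q t) lam \<le> pontryagin f \<phi> t (xs t) (us t) (q t) lam)"
      if "t \<in> {t0..t1} - (N \<union> N')" for t
      using N'(2)[of t] uu_us[of t] uu_U[of t] that by auto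
    moreover have "negligible (N \<union> N')" using N N'(1) by (rule negligible_Un)
    ultimately show "AE t in lebesgue_on {t0..t1}. us t \<in> U \<and>
        (\<forall>u\<in>U. pontryagin f \<phi> t (xs t) u (q t) lam \<le> pontryagin f \<phi> t (xs t) (us t) (q t) lam)"
      by (subst AE_lebesgue_on_iff_negligible) (simp, blast)
  qed
qed

end
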